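(* Let $\mathbb{G}$ be a discrete quantum group with associated rigid C*-tensor category $\mathcal{C}=\mathsf{Rep}(\mathbb{G})$ and forgetful dagger tensor functor $(\mathbf{F},\eta):\mathcal{C}\to\mathsf{Hilb}_{\mathrm{f.d.}}$, and let $\mathbf{G}\in\mathsf{Vec}(\mathcal{C})$ be the corresponding connected W*-algebra object. Then $\mathbb{G}$ is amenable (respectively has the Haagerup property, respectively has property (T)) if and only if $\mathbf{G}$ is amenable (respectively has the Haagerup property, respectively has property (T)).
   Context: **Category.** $\mathcal{C}$ is a rigid C*-tensor category with simple unit $1_{\mathcal{C}}$, admitting finite direct sums and subobjects (associators suppressed); $\mathrm{Irr}(\mathcal{C})$ is a set of representatives of simple objects. Each $a$ has a conjugate $\overline a$ and standard duality maps $\mathrm{ev}_a:\overline a\otimes a\to1_{\mathcal{C}}$, $\mathrm{ev}_{\overline a}:a\otimes\overline a\to1_{\mathcal{C}}$ (identifying $\overline{\overline a}=a$), with $\mathrm{coev}_a=\mathrm{ev}_{\overline a}^*$; $d_a$ is the quantum dimension. $\mathrm{ONB}(a\otimes b,c)$ is an orthonormal basis of $\mathcal{C}(a\otimes b,c)$ for $\langle\psi|\phi\rangle=$ categorical trace of $\psi^*\phi$. By Tannaka–Krein–Woronowicz reconstruction a discrete quantum group $\mathbb{G}$ is encoded by such a $\mathcal{C}$ together with a dagger tensor functor $(\mathbf{F},\eta):\mathcal{C}\to\mathsf{Hilb}_{\mathrm{f.d.}}$ (finite dimensional Hilbert spaces); $\mathbf{F}(1_{\mathcal{C}})=\mathbb{C}$.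 **Algebras of $\mathbb{G}$.** $H_c=\mathrm{Hom}(\mathbb{C},\mathbf{F}(c))\cong\mathbf{F}(c)$, $H_c^*=\mathrm{Hom}(\mathbf{F}(c),\mathbb{C})$, and $\hat\alpha=\mathbf{F}(\alpha)\circ\eta_{a,b}$ for $\alpha\in\mathcal{C}(a\otimes b,c)$. $\mathbb{C}[\mathbb{G}]=\bigoplus_{a\in\mathrm{Irr}(\mathcal{C})}H_a^*\otimes H_a$ (algebraic), with product, for $x_{(1)}\otimes x_{(2)}\in H_a^*\otimes H_a$, $y_{(1)}\otimes y_{(2)}\in H_b^*\otimes H_b$, $$xy=\sum_{c\in\mathrm{Irr}(\mathcal{C})}\sum_{\alpha\in\mathrm{ONB}(a\otimes b,c)}d_c\,\big((x_{(1)}\otimes y_{(1)})\circ\hat\alpha^*\big)\otimes\big(\hat\alpha\circ(x_{(2)}\otimes y_{(2)})\big),$$ antipode $S(x_{(1)}\otimes x_{(2)})=\big(\widehat{\mathrm{ev}}_a\circ(\mathrm{id}_{\mathbf{F}(\overline a)}\otimes x_{(2)})\big)\otimes\big((x_{(1)}\otimes\mathrm{id}_{\mathbf{F}(\overline a)})\circ\widehat{\mathrm{ev}}_{\overline a}^*\big)$, and involution $x^{\#}=S(x_{(2)}^*\otimes x_{(1)}^* )$. A state on $\mathbb{G}$ is a linear functional $\phi$ on $\mathbb{C}[\mathbb{G}]$ with $\phi(1)=1$ and $\phi(x^{\#}x)\ge0$ for all $x$. Write $\phi(x_{(1)}\otimes x_{(2)})=x_{(1)}(\Phi_a(x_{(2)}))$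 on $H_a^*\otimes H_a$ with $\Phi_a\in B(\mathbf{F}(a))$, and $m_\phi=(\Phi_a)_{a\in\mathrm{Irr}(\mathcal{C})}$. For a state, $m_\phi\in\ell^\infty(\mathbb{G}):=\bigoplus_{a\in\mathrm{Irr}(\mathcal{C})}B(\mathbf{F}(a))$ (von Neumann direct sum), viewed in $B(H)$ with $H=\bigoplus_{a\in\mathrm{Irr}(\mathcal{C})}H_a$; such elements are called (u)cp-multipliers on $\mathbb{G}$. Pointwise convergence means strong operator convergence in $B(H)$. $\mathbb{G}$ is *amenable* if there is a net of finite rank ucp-multipliers converging pointwise to the identity; has the *Haagerup property* if there is a net of compact ucp-multipliers converging pointwise to the identity; has *property (T)* if every net of ucp-multipliers converging pointwise to the identity converges uniformly (in operator norm) to the identity. **The algebra object $\mathbf{G}$.** $\mathsf{Vec}(\mathcal{C})$ is the category of linear functors $\mathcal{C}^{\rm op}\to\mathsf{Vec}$. $\mathbf{G}(a)=\mathrm{Hom}(\mathbf{F}(a),\mathbb{C})=H_a^*$, multiplication $\mu_{a,b}(f\otimes g)=(f\otimes g)\circ\eta_{a,b}^{-1}$, unit $1\in\mathbf{G}(1_{\mathcal{C}})=\mathbb{C}$, $*$-structure $j_a(f)=\widehat{\mathrm{ev}}_a\circ(\mathrm{id}_{\mathbf{F}(\overline a)}\otimes f^* )\in\mathbf{G}(\overline a)$. For $c\in\mathcal{C}$, $\mathbf{G}(\overline c\otimes c)\cong B(\mathbf{F}(c))$ as C*-algebras via $f\mapsto\widehat{\mathrm{ev}}_c\circ(\mathrm{id}\otimes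 f)\circ\eta_{\overline c,c}^{-1}$. A ucp map $\Psi:\mathbf{G}\Rightarrow\mathbf{G}$ is a natural transformation commuting with the $j_a$, fixing the unit, with each $\Psi_{\overline c\otimes c}$ mapping positive elements to positive elements. **Analytic properties of $\mathbf{G}$.** Let $L^2(\mathbf{G})(a)$ be $\mathbf{G}(a)$ with inner product $\langle f|g\rangle=\mathbf{G}(\mathrm{ev}_a^* )(\mu_{\overline a,a}(j_a(f)\otimes g))\in\mathbf{G}(1_{\mathcal{C}})=\mathbb{C}$, $H_\tau=\bigoplus_{a\in\mathrm{Irr}(\mathcal{C})}L^2(\mathbf{G})(a)$, and $\ell^\infty(\mathbf{G})=\bigoplus_{a\in\mathrm{Irr}(\mathcal{C})}B(L^2(\mathbf{G})(a))\subseteq B(H_\tau)$. A ucp map $\Psi$ gives the ucp multiplier $m_\Psi=\bigoplus_a\Psi_a\in\ell^\infty(\mathbf{G})$; pointwise convergence means strong operator convergence in $B(H_\tau)$. $\mathbf{G}$ is *amenable* if there is a net of finite rank ucp multipliers converging pointwise to the identity; has the *Haagerup property* if there is a net of compact ucp multipliers converging pointwise to the identity; has *property (T)* if every net of ucp multipliers converging pointwise to the identity converges in operator norm. *)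

theory Defs
  imports "HOL-Analysis.Analysis" "HOL-Library.Function_Algebras"
begin

section \<open>Complex vector spaces and finite dimensional Hilbert spaces\<close>

class complex_vector = ab_group_add +
  fixes scaleC :: "complex \<Rightarrow> 'a \<Rightarrow> 'a" (infixr "*\<^sub>C" 75)
  assumes scaleC_add_right: "z *\<^sub>C (x + y) = z *\<^sub>C x + z *\<^sub>C y"
    and scaleC_add_left: "(z + w) *\<^sub>C x = z *\<^sub>C x + w *\<^sub>C x"
    and scaleC_scaleC: "z *\<^sub>C (w *\<^sub>C x) = (z * w) *\<^sub>C x"
    and scaleC_one: "1 *\<^sub>C x = x"

global_interpretation complex_vector: vector_space "scaleC :: complex \<Rightarrow> 'a \<Rightarrow> 'a::complex_vector"
  by unfold_locales (rule scaleC_add_right scaleC_add_left scaleC_scaleC scaleC_one)+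

instantiation complex :: complex_vector
begin
definition scaleC_complex :: "complex \<Rightarrow> complex \<Rightarrow> complex" where
  "scaleC_complex z x = z * x"
instance
  by standard (simp_all add: scaleC_complex_def algebra_simps)
end

instantiation "fun" :: (type, complex_vector) complex_vector
begin
definition scaleC_fun :: "complex \<Rightarrow> ('a \<Rightarrow> 'b) \<Rightarrow> 'a \<Rightarrow> 'b" where
  "scaleC_fun z f = (\<lambda>x. z *\<^sub>C f x)"
instance
  by standard
    (simp_all add: scaleC_fun_def fun_eq_iff scaleC_add_right scaleC_add_left scaleC_scaleC scaleC_one)
end

definition clinear_on :: "'v::complex_vector set \<Rightarrow> 'w::complex_vector set \<Rightarrow> ('v \<Rightarrow> 'w) \<Rightarrow> bool" where
  "clinear_on V W T \<longleftrightarrow>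
     (\<forall>x\<in>V. T x \<in> W) \<and>
     (\<forall>x\<in>V. \<forall>y\<in>V. T (x + y) = T x + T y) \<and>
     (\<forall>x\<in>V. \<forall>z. T (z *\<^sub>C x) = z *\<^sub>C T x)"

text \<open>A Hilbert space is carried by a subspace of an ambient vector space; its inner product
  (linear in the second variable) need not be related to any other structure of the ambient space.\<close>

record 'v hilb =
  vecs :: "'v set"
  ip :: "'v \<Rightarrow> 'v \<Rightarrow> complex"

definition fd_hilbert :: "'v::complex_vector hilb \<Rightarrow> bool" where
  "fd_hilbert H \<longleftrightarrow>
     (\<exists>B. finite B \<and> vecs H = complex_vector.span B) \<and>
     (\<forall>x\<in>vecs H. clinear_on (vecs H) UNIV (ip H x)) \<and>
     (\<forall>x\<in>vecs H. \<forall>y\<in>vecs H. ip H y x = cnj (ip H x y)) \<and>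
     (\<forall>x\<in>vecs H. ip H x x \<in> \<real>\<^sub>\<ge>\<^sub>0 \<and> (ip H x x = 0 \<longrightarrow> x = 0))"

text \<open>Functionals on \<open>H\<close> are extended by \<open>0\<close> outside the carrier, so that equality of
  functionals is equality of functions.\<close>

definition dual :: "'v::complex_vector hilb \<Rightarrow> ('v \<Rightarrow> complex) set" where
  "dual H = {f. clinear_on (vecs H) UNIV f \<and> (\<forall>x. x \<notin> vecs H \<longrightarrow> f x = 0)}"

text \<open>The adjoints \<open>v\<^sup>*\<close> of \<open>v \<in> H = Hom(\<complex>, H)\<close> and \<open>f\<^sup>*\<close> of \<open>f \<in> Hom(H, \<complex>)\<close>.\<close>

definition bra :: "'v::complex_vector hilb \<Rightarrow> 'v \<Rightarrow> 'v \<Rightarrow> complex" where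
  "bra H v = (\<lambda>x. if x \<in> vecs H then ip H v x else 0)"

definition ket :: "'v::complex_vector hilb \<Rightarrow> ('v \<Rightarrow> complex) \<Rightarrow> 'v" where
  "ket H f = (THE v. v \<in> vecs H \<and> bra H v = f)"

definition positive_op :: "'v::complex_vector hilb \<Rightarrow> ('v \<Rightarrow> 'v) \<Rightarrow> bool" where
  "positive_op H T \<longleftrightarrow> clinear_on (vecs H) (vecs H) T \<and> (\<forall>x\<in>vecs H. ip H x (T x) \<in> \<real>\<^sub>\<ge>\<^sub>0)"

text \<open>A unitary from the Hilbert space tensor product of \<open>H\<close> and \<open>K\<close> onto \<open>T\<close>, given by the
  corresponding bilinear map \<open>t\<close>, i.e. \<open>t x y\<close> is the image of \<open>x \<otimes> y\<close>.\<close>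

definition tensor_unitary ::
  "'u::complex_vector hilb \<Rightarrow> 'v::complex_vector hilb \<Rightarrow> 'w::complex_vector hilb \<Rightarrow> ('u \<Rightarrow> 'v \<Rightarrow> 'w) \<Rightarrow> bool"
  where
  "tensor_unitary H K T t \<longleftrightarrow>
     (\<forall>x\<in>vecs H. clinear_on (vecs K) (vecs T) (t x)) \<and>
     (\<forall>y\<in>vecs K. clinear_on (vecs H) (vecs T) (\<lambda>x. t x y)) \<and>
     (\<forall>x\<in>vecs H. \<forall>x'\<in>vecs H. \<forall>y\<in>vecs K. \<forall>y'\<in>vecs K.
        ip T (t x y) (t x' y') = ip H x x' * ip K y y') \<and>
     vecs T = complex_vector.span {t x y |x y. x \<in> vecs H \<and> y \<in> vecs K}"

text \<open>The algebraic tensor product \<open>H\<^sup>* \<otimes> H\<close> is realised as the span of the rank one maps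
  \<open>x \<mapsto> f(x) v\<close>, and \<open>bilin_ext H \<beta>\<close> is the extension to \<open>H\<^sup>* \<otimes> H\<close> of a map \<open>\<beta>\<close> prescribed on
  elementary tensors.  It is used for \<open>\<beta>\<close> linear in both arguments and for \<open>\<beta>\<close> antilinear in both
  arguments; in either case the value does not depend on the chosen decomposition.\<close>

definition elt :: "('v \<Rightarrow> complex) \<Rightarrow> 'v \<Rightarrow> 'v \<Rightarrow> 'v::complex_vector" where
  "elt f v = (\<lambda>x. f x *\<^sub>C v)"

definition dual_tensor :: "'v::complex_vector hilb \<Rightarrow> ('v \<Rightarrow> 'v) set" where
  "dual_tensor H = complex_vector.span {elt f v |f v. f \<in> dual H \<and> v \<in> vecs H}"

definition bilin_ext ::
  "'v::complex_vector hilb \<Rightarrow> (('v \<Rightarrow> complex) \<Rightarrow> 'v \<Rightarrow> 'w::complex_vector) \<Rightarrow> ('v \<Rightarrow> 'v) \<Rightarrow> 'w" where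
  "bilin_ext H \<beta> t = (THE s. \<exists>ps. set ps \<subseteq> dual H \<times> vecs H \<and>
     t = (\<Sum>(f, v)\<leftarrow>ps. elt f v) \<and> s = (\<Sum>(f, v)\<leftarrow>ps. \<beta> f v))"


section \<open>Rigid C*-tensor categories\<close>

text \<open>The objects are the elements of the type \<open>'o\<close>.  All morphism spaces are subspaces of one
  ambient complex vector space \<open>'m\<close> (for instance their algebraic direct sum), so that a single
  composition, tensor product and involution on \<open>'m\<close> suffices; the operations are only
  constrained on (composable) morphisms.\<close>

record ('o, 'm) tensor_category =
  Hom :: "'o \<Rightarrow> 'o \<Rightarrow> 'm set"
  ident :: "'o \<Rightarrow> 'm" ("\<one>\<index>")
  comp :: "'m \<Rightarrow> 'm \<Rightarrow> 'm" (infixl "\<cdot>\<index>" 70)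
  dag :: "'m \<Rightarrow> 'm" ("_\<^bold>*\<index>" [1000] 999)
  mnorm :: "'m \<Rightarrow> real"
  unit :: 'o ("\<I>\<index>")
  tens_obj :: "'o \<Rightarrow> 'o \<Rightarrow> 'o" (infixr "\<boxtimes>\<index>" 75)
  tens :: "'m \<Rightarrow> 'm \<Rightarrow> 'm" (infixr "\<otimes>\<index>" 75)
  assoc :: "'o \<Rightarrow> 'o \<Rightarrow> 'o \<Rightarrow> 'm"
  lunit :: "'o \<Rightarrow> 'm"
  runit :: "'o \<Rightarrow> 'm"
  conj_obj :: "'o \<Rightarrow> 'o"
  ev :: "'o \<Rightarrow> 'm"
  coev :: "'o \<Rightarrow> 'm"

definition unitary_mor :: "('o, 'm) tensor_category \<Rightarrow> 'o \<Rightarrow> 'o \<Rightarrow> 'm \<Rightarrow> bool" where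
  "unitary_mor C a b u \<longleftrightarrow> u \<in> Hom C a b \<and> dag C u \<cdot>\<^bsub>C\<^esub> u = \<one>\<^bsub>C\<^esub> a \<and> u \<cdot>\<^bsub>C\<^esub> dag C u = \<one>\<^bsub>C\<^esub> b"

definition isomorphic :: "('o, 'm) tensor_category \<Rightarrow> 'o \<Rightarrow> 'o \<Rightarrow> bool" where
  "isomorphic C a b \<longleftrightarrow>
     (\<exists>f\<in>Hom C a b. \<exists>g\<in>Hom C b a. g \<cdot>\<^bsub>C\<^esub> f = \<one>\<^bsub>C\<^esub> a \<and> f \<cdot>\<^bsub>C\<^esub> g = \<one>\<^bsub>C\<^esub> b)"

definition simple :: "('o, 'm::complex_vector) tensor_category \<Rightarrow> 'o \<Rightarrow> bool" where
  "simple C a \<longleftrightarrow> \<one>\<^bsub>C\<^esub> a \<noteq> 0 \<and> Hom C a a = {z *\<^sub>C \<one>\<^bsub>C\<^esub> a |z. True}"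

locale cstar_category =
  fixes C :: "('o, 'm::complex_vector) tensor_category" (structure)
  assumes Hom_subspace: "complex_vector.subspace (Hom C a b)"
    and ident_in: "\<one> a \<in> Hom C a a"
    and comp_in: "\<lbrakk>g \<in> Hom C b c; f \<in> Hom C a b\<rbrakk> \<Longrightarrow> g \<cdot> f \<in> Hom C a c"
    and comp_assoc: "\<lbrakk>h \<in> Hom C c d; g \<in> Hom C b c; f \<in> Hom C a b\<rbrakk> \<Longrightarrow> (h \<cdot> g) \<cdot> f = h \<cdot> (g \<cdot> f)"
    and ident_left: "f \<in> Hom C a b \<Longrightarrow> \<one> b \<cdot> f = f"
    and ident_right: "f \<in> Hom C a b \<Longrightarrow> f \<cdot> \<one> a = f"
    and comp_linear_right: "g \<in> Hom C b c \<Longrightarrow> clinear_on (Hom C a b) (Hom C a c) (\<lambda>f. g \<cdot> f)"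
    and comp_linear_left: "f \<in> Hom C a b \<Longrightarrow> clinear_on (Hom C b c) (Hom C a c) (\<lambda>g. g \<cdot> f)"
    and dag_in: "f \<in> Hom C a b \<Longrightarrow> f\<^bold>* \<in> Hom C b a"
    and dag_dag: "f \<in> Hom C a b \<Longrightarrow> (f\<^bold>*)\<^bold>* = f"
    and dag_add: "\<lbrakk>f \<in> Hom C a b; g \<in> Hom C a b\<rbrakk> \<Longrightarrow> (f + g)\<^bold>* = f\<^bold>* + g\<^bold>*"
    and dag_scale: "f \<in> Hom C a b \<Longrightarrow> (z *\<^sub>C f)\<^bold>* = cnj z *\<^sub>C f\<^bold>*"
    and dag_comp: "\<lbrakk>g \<in> Hom C b c; f \<in> Hom C a b\<rbrakk> \<Longrightarrow> (g \<cdot> f)\<^bold>* = f\<^bold>* \<cdot> g\<^bold>*"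
    and norm_ge_0: "f \<in> Hom C a b \<Longrightarrow> mnorm C f \<ge> 0"
    and norm_eq_0: "f \<in> Hom C a b \<Longrightarrow> mnorm C f = 0 \<longleftrightarrow> f = 0"
    and norm_scale: "f \<in> Hom C a b \<Longrightarrow> mnorm C (z *\<^sub>C f) = cmod z * mnorm C f"
    and norm_triangle: "\<lbrakk>f \<in> Hom C a b; g \<in> Hom C a b\<rbrakk> \<Longrightarrow> mnorm C (f + g) \<le> mnorm C f + mnorm C g"
    and norm_complete: "\<lbrakk>\<And>n::nat. X n \<in> Hom C a b;
          \<And>e. e > 0 \<Longrightarrow> \<exists>N. \<forall>i\<ge>N. \<forall>k\<ge>N. mnorm C (X i - X k) < e\<rbrakk>
        \<Longrightarrow> \<exists>f\<in>Hom C a b. (\<lambda>n. mnorm C (X n - f)) \<longlonglongrightarrow> 0"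
    and norm_comp: "\<lbrakk>g \<in> Hom C b c; f \<in> Hom C a b\<rbrakk> \<Longrightarrow> mnorm C (g \<cdot> f) \<le> mnorm C g * mnorm C f"
    and norm_cstar: "f \<in> Hom C a b \<Longrightarrow> mnorm C (f\<^bold>* \<cdot> f) = (mnorm C f)\<^sup>2"
    and positive: "f \<in> Hom C a b \<Longrightarrow> \<exists>g\<in>Hom C a a. f\<^bold>* \<cdot> f = g\<^bold>* \<cdot> g"

text \<open>Associativity and unit constraints are kept explicit.\<close>

locale cstar_tensor_category = cstar_category +
  assumes tens_in: "\<lbrakk>f \<in> Hom C a b; g \<in> Hom C c d\<rbrakk> \<Longrightarrow> f \<otimes> g \<in> Hom C (a \<boxtimes> c) (b \<boxtimes> d)"
    and tens_ident: "\<one> a \<otimes> \<one> b = \<one> (a \<boxtimes> b)"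
    and tens_comp: "\<lbrakk>g \<in> Hom C b c; f \<in> Hom C a b; g' \<in> Hom C b' c'; f' \<in> Hom C a' b'\<rbrakk>
        \<Longrightarrow> (g \<cdot> f) \<otimes> (g' \<cdot> f') = (g \<otimes> g') \<cdot> (f \<otimes> f')"
    and tens_linear_right:
      "f \<in> Hom C a b \<Longrightarrow> clinear_on (Hom C c d) (Hom C (a \<boxtimes> c) (b \<boxtimes> d)) (\<lambda>g. f \<otimes> g)"
    and tens_linear_left:
      "g \<in> Hom C c d \<Longrightarrow> clinear_on (Hom C a b) (Hom C (a \<boxtimes> c) (b \<boxtimes> d)) (\<lambda>f. f \<otimes> g)"
    and tens_dag: "\<lbrakk>f \<in> Hom C a b; g \<in> Hom C c d\<rbrakk> \<Longrightarrow> (f \<otimes> g)\<^bold>* = f\<^bold>* \<otimes> g\<^bold>*"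
    and assoc_unitary: "unitary_mor C ((a \<boxtimes> b) \<boxtimes> c) (a \<boxtimes> (b \<boxtimes> c)) (assoc C a b c)"
    and assoc_natural: "\<lbrakk>f \<in> Hom C a a'; g \<in> Hom C b b'; h \<in> Hom C c c'\<rbrakk>
        \<Longrightarrow> assoc C a' b' c' \<cdot> ((f \<otimes> g) \<otimes> h) = (f \<otimes> (g \<otimes> h)) \<cdot> assoc C a b c"
    and lunit_unitary: "unitary_mor C (\<I> \<boxtimes> a) a (lunit C a)"
    and lunit_natural: "f \<in> Hom C a b \<Longrightarrow> lunit C b \<cdot> (\<one> \<I> \<otimes> f) = f \<cdot> lunit C a"
    and runit_unitary: "unitary_mor C (a \<boxtimes> \<I>) a (runit C a)"
    and runit_natural: "f \<in> Hom C a b \<Longrightarrow> runit C b \<cdot> (f \<otimes> \<one> \<I>) = f \<cdot> runit C a"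
    and pentagon: "assoc C a b (c \<boxtimes> d) \<cdot> assoc C (a \<boxtimes> b) c d =
        (\<one> a \<otimes> assoc C b c d) \<cdot> (assoc C a (b \<boxtimes> c) d \<cdot> (assoc C a b c \<otimes> \<one> d))"
    and triangle: "(\<one> a \<otimes> lunit C b) \<cdot> assoc C a \<I> b = runit C a \<otimes> \<one> b"
    and unit_simple: "simple C \<I>"
    and direct_sums: "\<exists>s. \<exists>v\<in>Hom C a s. \<exists>w\<in>Hom C b s.
        v\<^bold>* \<cdot> v = \<one> a \<and> w\<^bold>* \<cdot> w = \<one> b \<and> v \<cdot> v\<^bold>* + w \<cdot> w\<^bold>* = \<one> s"
    and zero_object: "\<exists>o0. \<one> o0 = 0"
    and subobjects: "\<lbrakk>p \<in> Hom C a a; p \<cdot> p = p; p\<^bold>* = p\<rbrakk>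
        \<Longrightarrow> \<exists>b. \<exists>v\<in>Hom C b a. v\<^bold>* \<cdot> v = \<one> b \<and> v \<cdot> v\<^bold>* = p"

text \<open>The maps \<open>ev a : conj a \<otimes> a \<rightarrow> 1\<close> and \<open>coev a : 1 \<rightarrow> a \<otimes> conj a\<close> are a standard solution of
  the conjugate equations, standardness being expressed by the equality of the left and right
  trace on \<open>End(a)\<close>.  The adjoint of \<open>coev a\<close> is the map written \<open>ev\<close> of the conjugate of \<open>a\<close> under
  the identification of \<open>a\<close> with its double conjugate; no strict equality
  \<open>conj (conj a) = a\<close> is required.\<close>

locale rigid_cstar_tensor_category = cstar_tensor_category +
  assumes ev_in: "ev C a \<in> Hom C (conj_obj C a \<boxtimes> a) \<I>"
    and coev_in: "coev C a \<in> Hom C \<I> (a \<boxtimes> conj_obj C a)"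
    and conjugate_eq:
      "runit C a \<cdot> (\<one> a \<otimes> ev C a) \<cdot> assoc C a (conj_obj C a) a \<cdot> (coev C a \<otimes> \<one> a) \<cdot> (lunit C a)\<^bold>* = \<one> a"
    and conjugate_eq':
      "lunit C (conj_obj C a) \<cdot> (ev C a \<otimes> \<one> (conj_obj C a)) \<cdot> (assoc C (conj_obj C a) a (conj_obj C a))\<^bold>*
         \<cdot> (\<one> (conj_obj C a) \<otimes> coev C a) \<cdot> (runit C (conj_obj C a))\<^bold>* = \<one> (conj_obj C a)"
    and standard: "f \<in> Hom C a a \<Longrightarrow>
        ev C a \<cdot> (\<one> (conj_obj C a) \<otimes> f) \<cdot> (ev C a)\<^bold>* = (coev C a)\<^bold>* \<cdot> (f \<otimes> \<one> (conj_obj C a)) \<cdot> coev C a"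

definition cat_trace :: "('o, 'm::complex_vector) tensor_category \<Rightarrow> 'o \<Rightarrow> 'm \<Rightarrow> complex" where
  "cat_trace C a f = (THE z.
     ev C a \<cdot>\<^bsub>C\<^esub> (\<one>\<^bsub>C\<^esub> (conj_obj C a) \<otimes>\<^bsub>C\<^esub> f) \<cdot>\<^bsub>C\<^esub> dag C (ev C a) = z *\<^sub>C \<one>\<^bsub>C\<^esub> \<I>\<^bsub>C\<^esub>)"

definition qdim :: "('o, 'm::complex_vector) tensor_category \<Rightarrow> 'o \<Rightarrow> complex" where
  "qdim C a = cat_trace C a (\<one>\<^bsub>C\<^esub> a)"

definition is_ONB :: "('o, 'm::complex_vector) tensor_category \<Rightarrow> 'o \<Rightarrow> 'o \<Rightarrow> 'm set \<Rightarrow> bool" where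
  "is_ONB C a b B \<longleftrightarrow> finite B \<and> complex_vector.span B = Hom C a b \<and>
     (\<forall>\<psi>\<in>B. \<forall>\<phi>\<in>B. cat_trace C a (dag C \<psi> \<cdot>\<^bsub>C\<^esub> \<phi>) = (if \<psi> = \<phi> then 1 else 0))"

definition ONB :: "('o, 'm::complex_vector) tensor_category \<Rightarrow> 'o \<Rightarrow> 'o \<Rightarrow> 'm set" where
  "ONB C a b = (SOME B. is_ONB C a b B)"

definition irr_representatives :: "('o, 'm::complex_vector) tensor_category \<Rightarrow> 'o set \<Rightarrow> bool" where
  "irr_representatives C Irr \<longleftrightarrow>
     (\<forall>a\<in>Irr. simple C a) \<and> (\<forall>c. simple C c \<longrightarrow> (\<exists>!a. a \<in> Irr \<and> isomorphic C c a))"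


section \<open>Dagger tensor functors to finite dimensional Hilbert spaces\<close>

text \<open>\<open>lax F a b x y\<close> is the value of \<open>\<eta>\<close> at \<open>x \<otimes> y\<close>.  The identification of \<open>F(1)\<close> with \<open>\<complex>\<close> is
  given by the unit vector \<open>vac F\<close>, the image of \<open>1 \<in> \<complex>\<close>.\<close>

record ('o, 'm, 'h) fibre_functor =
  obj :: "'o \<Rightarrow> 'h hilb"
  mor :: "'m \<Rightarrow> 'h \<Rightarrow> 'h"
  lax :: "'o \<Rightarrow> 'o \<Rightarrow> 'h \<Rightarrow> 'h \<Rightarrow> 'h"
  vac :: 'h

locale dagger_tensor_functor =
  fixes C :: "('o, 'm::complex_vector) tensor_category" (structure)
    and F :: "('o, 'm, 'h::complex_vector) fibre_functor"
  assumes obj_hilbert: "fd_hilbert (obj F a)"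
    and mor_linear: "f \<in> Hom C a b \<Longrightarrow> clinear_on (vecs (obj F a)) (vecs (obj F b)) (mor F f)"
    and mor_ident: "x \<in> vecs (obj F a) \<Longrightarrow> mor F (\<one> a) x = x"
    and mor_comp: "\<lbrakk>g \<in> Hom C b c; f \<in> Hom C a b; x \<in> vecs (obj F a)\<rbrakk>
        \<Longrightarrow> mor F (g \<cdot> f) x = mor F g (mor F f x)"
    and mor_add: "\<lbrakk>f \<in> Hom C a b; g \<in> Hom C a b; x \<in> vecs (obj F a)\<rbrakk>
        \<Longrightarrow> mor F (f + g) x = mor F f x + mor F g x"
    and mor_scale: "\<lbrakk>f \<in> Hom C a b; x \<in> vecs (obj F a)\<rbrakk> \<Longrightarrow> mor F (z *\<^sub>C f) x = z *\<^sub>C mor F f x"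
    and mor_dag: "\<lbrakk>f \<in> Hom C a b; x \<in> vecs (obj F a); y \<in> vecs (obj F b)\<rbrakk>
        \<Longrightarrow> ip (obj F a) (mor F (f\<^bold>*) y) x = ip (obj F b) y (mor F f x)"
    and lax_unitary: "tensor_unitary (obj F a) (obj F b) (obj F (a \<boxtimes> b)) (lax F a b)"
    and lax_natural:
      "\<lbrakk>f \<in> Hom C a a'; g \<in> Hom C b b'; x \<in> vecs (obj F a); y \<in> vecs (obj F b)\<rbrakk>
        \<Longrightarrow> mor F (f \<otimes> g) (lax F a b x y) = lax F a' b' (mor F f x) (mor F g y)"
    and lax_assoc:
      "\<lbrakk>x \<in> vecs (obj F a); y \<in> vecs (obj F b); w \<in> vecs (obj F c)\<rbrakk>
        \<Longrightarrow> mor F (assoc C a b c) (lax F (a \<boxtimes> b) c (lax F a b x y) w)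
            = lax F a (b \<boxtimes> c) x (lax F b c y w)"
    and vac_unit: "vac F \<in> vecs (obj F \<I>)" "ip (obj F \<I>) (vac F) (vac F) = 1"
      "vecs (obj F \<I>) = complex_vector.span {vac F}"
    and lax_lunit: "x \<in> vecs (obj F a) \<Longrightarrow> mor F (lunit C a) (lax F \<I> a (vac F) x) = x"
    and lax_runit: "x \<in> vecs (obj F a) \<Longrightarrow> mor F (runit C a) (lax F a \<I> x (vac F)) = x"

text \<open>A discrete quantum group in Tannaka--Krein--Woronowicz form, together with a choice of
  representatives of the simple objects.\<close>

locale discrete_quantum_group =
  rigid_cstar_tensor_category C + dagger_tensor_functor C F
  for C :: "('o, 'm::complex_vector) tensor_category" (structure)
    and F :: "('o, 'm, 'h::complex_vector) fibre_functor"
    and Irr :: "'o set" +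
  assumes Irr: "irr_representatives C Irr"

text \<open>\<open>hat_ev C F a \<xi> x\<close> is the number \<open>(F(ev a) \<circ> \<eta>)(\<xi> \<otimes> x)\<close>.\<close>

definition hat_ev ::
  "('o, 'm) tensor_category \<Rightarrow> ('o, 'm, 'h) fibre_functor \<Rightarrow> 'o \<Rightarrow> 'h \<Rightarrow> 'h \<Rightarrow> complex" where
  "hat_ev C F a \<xi> x = ip (obj F \<I>\<^bsub>C\<^esub>) (vac F) (mor F (ev C a) (lax F (conj_obj C a) a \<xi> x))"

text \<open>\<open>\<mu>(f \<otimes> g) = (f \<otimes> g) \<circ> \<eta>\<inverse>\<close>, and the slice map \<open>(f \<otimes> id) \<circ> \<eta>\<inverse>\<close>.\<close>

definition tens_fun ::
  "('o, 'm) tensor_category \<Rightarrow> ('o, 'm, 'h::complex_vector) fibre_functor \<Rightarrow> 'o \<Rightarrow> 'o \<Rightarrow>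
     ('h \<Rightarrow> complex) \<Rightarrow> ('h \<Rightarrow> complex) \<Rightarrow> 'h \<Rightarrow> complex" where
  "tens_fun C F a b f g = (THE h. h \<in> dual (obj F (a \<boxtimes>\<^bsub>C\<^esub> b)) \<and>
     (\<forall>x\<in>vecs (obj F a). \<forall>y\<in>vecs (obj F b). h (lax F a b x y) = f x * g y))"

definition slice ::
  "('o, 'm) tensor_category \<Rightarrow> ('o, 'm, 'h::complex_vector) fibre_functor \<Rightarrow> 'o \<Rightarrow> 'o \<Rightarrow>
     ('h \<Rightarrow> complex) \<Rightarrow> 'h \<Rightarrow> 'h" where
  "slice C F a b f = (THE L. clinear_on (vecs (obj F (a \<boxtimes>\<^bsub>C\<^esub> b))) (vecs (obj F b)) L \<and>
     (\<forall>w. w \<notin> vecs (obj F (a \<boxtimes>\<^bsub>C\<^esub> b)) \<longrightarrow> L w = 0) \<and>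
     (\<forall>x\<in>vecs (obj F a). \<forall>y\<in>vecs (obj F b). L (lax F a b x y) = f x *\<^sub>C y))"


section \<open>The *-algebra of a discrete quantum group and its states\<close>

definition qg_alg :: "('o, 'm, 'h::complex_vector) fibre_functor \<Rightarrow> 'o set \<Rightarrow> ('o \<Rightarrow> 'h \<Rightarrow> 'h) set" where
  "qg_alg F Irr = {x. finite {a. x a \<noteq> 0} \<and> (\<forall>a\<in>Irr. x a \<in> dual_tensor (obj F a)) \<and>
     (\<forall>a. a \<notin> Irr \<longrightarrow> x a = 0)}"

text \<open>The elementary tensor \<open>f \<otimes> v \<in> F(c)\<^sup>* \<otimes> F(c)\<close> for an arbitrary simple object \<open>c\<close>, transported
  to the representative \<open>r\<close> of \<open>c\<close> along a unitary \<open>u : c \<rightarrow> r\<close>.  As \<open>u\<close> is unique up to a phase,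
  the result does not depend on it.  This is needed because the conjugate of a member of \<open>Irr\<close>
  need not belong to \<open>Irr\<close>.\<close>

definition place ::
  "('o, 'm) tensor_category \<Rightarrow> ('o, 'm, 'h::complex_vector) fibre_functor \<Rightarrow> 'o set \<Rightarrow>
     'o \<Rightarrow> ('h \<Rightarrow> complex) \<Rightarrow> 'h \<Rightarrow> 'o \<Rightarrow> 'h \<Rightarrow> 'h" where
  "place C F Irr c f v = (\<lambda>r. if r \<in> Irr \<and> (\<exists>u. unitary_mor C c r u)
     then let u = (SOME u. unitary_mor C c r u)
          in elt (\<lambda>x. if x \<in> vecs (obj F r) then f (mor F (dag C u) x) else 0) (mor F u v)
     else 0)"

definition qg_one ::
  "('o, 'm) tensor_category \<Rightarrow> ('o, 'm, 'h::complex_vector) fibre_functor \<Rightarrow> 'o set \<Rightarrow> 'o \<Rightarrow> 'h \<Rightarrow> 'h"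
  where
  "qg_one C F Irr = place C F Irr \<I>\<^bsub>C\<^esub> (bra (obj F \<I>\<^bsub>C\<^esub>) (vac F)) (vac F)"

definition qg_mult_elt ::
  "('o, 'm::complex_vector) tensor_category \<Rightarrow> ('o, 'm, 'h::complex_vector) fibre_functor \<Rightarrow> 'o set \<Rightarrow>
     'o \<Rightarrow> 'o \<Rightarrow> ('h \<Rightarrow> complex) \<Rightarrow> 'h \<Rightarrow> ('h \<Rightarrow> complex) \<Rightarrow> 'h \<Rightarrow> 'o \<Rightarrow> 'h \<Rightarrow> 'h" where
  "qg_mult_elt C F Irr a b x1 x2 y1 y2 = (\<lambda>c. if c \<in> Irr
     then \<Sum>\<alpha>\<in>ONB C (a \<boxtimes>\<^bsub>C\<^esub> b) c. qdim C c *\<^sub>C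
            elt (\<lambda>w. if w \<in> vecs (obj F c) then tens_fun C F a b x1 y1 (mor F (dag C \<alpha>) w) else 0)
                (mor F \<alpha> (lax F a b x2 y2))
     else 0)"

definition qg_mult ::
  "('o, 'm::complex_vector) tensor_category \<Rightarrow> ('o, 'm, 'h::complex_vector) fibre_functor \<Rightarrow> 'o set \<Rightarrow>
     ('o \<Rightarrow> 'h \<Rightarrow> 'h) \<Rightarrow> ('o \<Rightarrow> 'h \<Rightarrow> 'h) \<Rightarrow> 'o \<Rightarrow> 'h \<Rightarrow> 'h" where
  "qg_mult C F Irr x y = (\<Sum>a\<in>{a. x a \<noteq> 0}. \<Sum>b\<in>{b. y b \<noteq> 0}.
     bilin_ext (obj F a) (\<lambda>x1 x2.
       bilin_ext (obj F b) (\<lambda>y1 y2. qg_mult_elt C F Irr a b x1 x2 y1 y2) (y b)) (x a))"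

definition qg_antipode_elt ::
  "('o, 'm) tensor_category \<Rightarrow> ('o, 'm, 'h::complex_vector) fibre_functor \<Rightarrow> 'o set \<Rightarrow>
     'o \<Rightarrow> ('h \<Rightarrow> complex) \<Rightarrow> 'h \<Rightarrow> 'o \<Rightarrow> 'h \<Rightarrow> 'h" where
  "qg_antipode_elt C F Irr a x1 x2 = place C F Irr (conj_obj C a)
     (\<lambda>\<xi>. if \<xi> \<in> vecs (obj F (conj_obj C a)) then hat_ev C F a \<xi> x2 else 0)
     (slice C F a (conj_obj C a) x1 (mor F (coev C a) (vac F)))"

definition qg_antipode ::
  "('o, 'm) tensor_category \<Rightarrow> ('o, 'm, 'h::complex_vector) fibre_functor \<Rightarrow> 'o set \<Rightarrow>
     ('o \<Rightarrow> 'h \<Rightarrow> 'h) \<Rightarrow> 'o \<Rightarrow> 'h \<Rightarrow> 'h" where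
  "qg_antipode C F Irr x = (\<Sum>a\<in>{a. x a \<noteq> 0}. bilin_ext (obj F a) (qg_antipode_elt C F Irr a) (x a))"

definition qg_star ::
  "('o, 'm) tensor_category \<Rightarrow> ('o, 'm, 'h::complex_vector) fibre_functor \<Rightarrow> 'o set \<Rightarrow>
     ('o \<Rightarrow> 'h \<Rightarrow> 'h) \<Rightarrow> 'o \<Rightarrow> 'h \<Rightarrow> 'h" where
  "qg_star C F Irr x = qg_antipode C F Irr
     (\<lambda>a. bilin_ext (obj F a) (\<lambda>x1 x2. elt (bra (obj F a) x2) (ket (obj F a) x1)) (x a))"

definition qg_state ::
  "('o, 'm::complex_vector) tensor_category \<Rightarrow> ('o, 'm, 'h::complex_vector) fibre_functor \<Rightarrow> 'o set \<Rightarrow>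
     (('o \<Rightarrow> 'h \<Rightarrow> 'h) \<Rightarrow> complex) \<Rightarrow> bool" where
  "qg_state C F Irr \<phi> \<longleftrightarrow> clinear_on (qg_alg F Irr) UNIV \<phi> \<and> \<phi> (qg_one C F Irr) = 1 \<and>
     (\<forall>x\<in>qg_alg F Irr. \<phi> (qg_mult C F Irr (qg_star C F Irr x) x) \<in> \<real>\<^sub>\<ge>\<^sub>0)"

text \<open>\<open>m\<^sub>\<phi> = (\<Phi>\<^sub>a)\<close> with \<open>\<phi>(x\<^sub>1 \<otimes> x\<^sub>2) = x\<^sub>1(\<Phi>\<^sub>a(x\<^sub>2))\<close> on the summand of \<open>a\<close>.\<close>

definition state_multiplier ::
  "('o, 'm, 'h::complex_vector) fibre_functor \<Rightarrow> 'o set \<Rightarrow>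
     (('o \<Rightarrow> 'h \<Rightarrow> 'h) \<Rightarrow> complex) \<Rightarrow> 'o \<Rightarrow> 'h \<Rightarrow> 'h" where
  "state_multiplier F Irr \<phi> = (\<lambda>a v. if a \<in> Irr \<and> v \<in> vecs (obj F a)
     then THE w. w \<in> vecs (obj F a) \<and> (\<forall>f\<in>dual (obj F a). \<phi> ((\<lambda>_. 0)(a := elt f v)) = f w)
     else 0)"

definition qg_ucp_multipliers ::
  "('o, 'm::complex_vector) tensor_category \<Rightarrow> ('o, 'm, 'h::complex_vector) fibre_functor \<Rightarrow> 'o set \<Rightarrow>
     ('o \<Rightarrow> 'h \<Rightarrow> 'h) set" where
  "qg_ucp_multipliers C F Irr = {state_multiplier F Irr \<phi> |\<phi>. qg_state C F Irr \<phi>}"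


section \<open>The algebra object and its ucp maps\<close>

text \<open>The algebra object is the functor \<open>a \<mapsto> dual (obj F a)\<close>, with multiplication \<open>tens_fun\<close> and
  unit \<open>bra (obj F \<I>) (vac F)\<close>.\<close>

definition alg_map ::
  "('o, 'm, 'h::complex_vector) fibre_functor \<Rightarrow> 'o \<Rightarrow> 'm \<Rightarrow> ('h \<Rightarrow> complex) \<Rightarrow> 'h \<Rightarrow> complex" where
  "alg_map F a f g = (\<lambda>x. if x \<in> vecs (obj F a) then g (mor F f x) else 0)"

definition alg_star ::
  "('o, 'm) tensor_category \<Rightarrow> ('o, 'm, 'h::complex_vector) fibre_functor \<Rightarrow> 'o \<Rightarrow>
     ('h \<Rightarrow> complex) \<Rightarrow> 'h \<Rightarrow> complex" where
  "alg_star C F a f =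
     (\<lambda>\<xi>. if \<xi> \<in> vecs (obj F (conj_obj C a)) then hat_ev C F a \<xi> (ket (obj F a) f) else 0)"

text \<open>The isomorphism from \<open>B(F(c))\<close> onto the C*-algebra of the algebra object at \<open>conj c \<otimes> c\<close>.\<close>

definition op_to_alg ::
  "('o, 'm) tensor_category \<Rightarrow> ('o, 'm, 'h::complex_vector) fibre_functor \<Rightarrow> 'o \<Rightarrow>
     ('h \<Rightarrow> 'h) \<Rightarrow> 'h \<Rightarrow> complex" where
  "op_to_alg C F c T = (THE h. h \<in> dual (obj F (conj_obj C c \<boxtimes>\<^bsub>C\<^esub> c)) \<and>
     (\<forall>\<xi>\<in>vecs (obj F (conj_obj C c)). \<forall>v\<in>vecs (obj F c).
        h (lax F (conj_obj C c) c \<xi> v) = hat_ev C F c \<xi> (T v)))"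

definition alg_positive ::
  "('o, 'm) tensor_category \<Rightarrow> ('o, 'm, 'h::complex_vector) fibre_functor \<Rightarrow> 'o \<Rightarrow> ('h \<Rightarrow> complex) set" where
  "alg_positive C F c = {op_to_alg C F c T |T. positive_op (obj F c) T}"

definition ucp_map ::
  "('o, 'm) tensor_category \<Rightarrow> ('o, 'm, 'h::complex_vector) fibre_functor \<Rightarrow>
     ('o \<Rightarrow> ('h \<Rightarrow> complex) \<Rightarrow> 'h \<Rightarrow> complex) \<Rightarrow> bool" where
  "ucp_map C F \<Psi> \<longleftrightarrow>
     (\<forall>a. clinear_on (dual (obj F a)) (dual (obj F a)) (\<Psi> a)) \<and>
     (\<forall>a b. \<forall>f\<in>Hom C a b. \<forall>g\<in>dual (obj F b). \<Psi> a (alg_map F a f g) = alg_map F a f (\<Psi> b g)) \<and>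
     (\<forall>a. \<forall>f\<in>dual (obj F a). \<Psi> (conj_obj C a) (alg_star C F a f) = alg_star C F a (\<Psi> a f)) \<and>
     \<Psi> \<I>\<^bsub>C\<^esub> (bra (obj F \<I>\<^bsub>C\<^esub>) (vac F)) = bra (obj F \<I>\<^bsub>C\<^esub>) (vac F) \<and>
     (\<forall>c. \<forall>h\<in>alg_positive C F c. \<Psi> (conj_obj C c \<boxtimes>\<^bsub>C\<^esub> c) h \<in> alg_positive C F c)"

text \<open>In the inner product, \<open>dual (obj F \<I>)\<close> is identified with \<open>\<complex>\<close> by evaluation at \<open>vac F\<close>.\<close>

definition L2 ::
  "('o, 'm) tensor_category \<Rightarrow> ('o, 'm, 'h::complex_vector) fibre_functor \<Rightarrow> 'o \<Rightarrow> ('h \<Rightarrow> complex) hilb"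
  where
  "L2 C F a = \<lparr> vecs = dual (obj F a),
     ip = (\<lambda>f g. alg_map F \<I>\<^bsub>C\<^esub> (dag C (ev C a))
                   (tens_fun C F (conj_obj C a) a (alg_star C F a f) g) (vac F)) \<rparr>"

definition alg_ucp_multipliers ::
  "('o, 'm) tensor_category \<Rightarrow> ('o, 'm, 'h::complex_vector) fibre_functor \<Rightarrow> 'o set \<Rightarrow>
     ('o \<Rightarrow> ('h \<Rightarrow> complex) \<Rightarrow> 'h \<Rightarrow> complex) set" where
  "alg_ucp_multipliers C F Irr =
     {(\<lambda>a f. if a \<in> Irr \<and> f \<in> dual (obj F a) then \<Psi> a f else 0) |\<Psi>. ucp_map C F \<Psi>}"


section \<open>Multipliers on a Hilbert space direct sum\<close>

text \<open>A multiplier is a family of operators \<open>m a\<close> on the Hilbert spaces \<open>V a\<close>, \<open>a \<in> I\<close>, acting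
  diagonally on the (completed) direct sum.\<close>

definition l2sum :: "'o set \<Rightarrow> ('o \<Rightarrow> 'v::complex_vector hilb) \<Rightarrow> ('o \<Rightarrow> 'v) set" where
  "l2sum I V = {v. (\<forall>a\<in>I. v a \<in> vecs (V a)) \<and> (\<forall>a. a \<notin> I \<longrightarrow> v a = 0) \<and>
     (\<lambda>a. Re (ip (V a) (v a) (v a))) summable_on I}"

definition l2norm :: "'o set \<Rightarrow> ('o \<Rightarrow> 'v::complex_vector hilb) \<Rightarrow> ('o \<Rightarrow> 'v) \<Rightarrow> real" where
  "l2norm I V v = sqrt (\<Sum>\<^sub>\<infinity>a\<in>I. Re (ip (V a) (v a) (v a)))"

definition diag_op :: "'o set \<Rightarrow> ('o \<Rightarrow> 'v \<Rightarrow> 'v) \<Rightarrow> ('o \<Rightarrow> 'v) \<Rightarrow> 'o \<Rightarrow> 'v::complex_vector" where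
  "diag_op I m v = (\<lambda>a. if a \<in> I then m a (v a) else 0)"

definition finite_rank :: "'o set \<Rightarrow> ('o \<Rightarrow> 'v::complex_vector hilb) \<Rightarrow> ('o \<Rightarrow> 'v \<Rightarrow> 'v) \<Rightarrow> bool" where
  "finite_rank I V m \<longleftrightarrow> (\<exists>B. finite B \<and> diag_op I m ` l2sum I V \<subseteq> complex_vector.span B)"

definition compact_mult :: "'o set \<Rightarrow> ('o \<Rightarrow> 'v::complex_vector hilb) \<Rightarrow> ('o \<Rightarrow> 'v \<Rightarrow> 'v) \<Rightarrow> bool" where
  "compact_mult I V m \<longleftrightarrow>
     (\<forall>X :: nat \<Rightarrow> 'o \<Rightarrow> 'v. (\<forall>n. X n \<in> l2sum I V \<and> l2norm I V (X n) \<le> 1) \<longrightarrow>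
        (\<exists>r. strict_mono r \<and>
           (\<exists>w\<in>l2sum I V. (\<lambda>n. l2norm I V (diag_op I m (X (r n)) - w)) \<longlonglongrightarrow> 0)))"

text \<open>Nets of multipliers are rendered by proper filters on the set of multipliers: a net
  \<open>(m\<^sub>i)\<close> in \<open>S\<close> gives the filter generated by its tails \<open>{m\<^sub>i | i \<ge> j}\<close>, every proper filter
  containing \<open>S\<close> arises in this way, and the net converges iff its filter does.  In contrast to
  nets, filters need no auxiliary index type.\<close>

definition net_in :: "'x set \<Rightarrow> 'x filter \<Rightarrow> bool" where
  "net_in S N \<longleftrightarrow> N \<noteq> bot \<and> (\<forall>\<^sub>F m in N. m \<in> S)"

definition converges_pointwise ::
  "'o set \<Rightarrow> ('o \<Rightarrow> 'v::complex_vector hilb) \<Rightarrow> ('o \<Rightarrow> 'v \<Rightarrow> 'v) filter \<Rightarrow> bool" where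
  "converges_pointwise I V N \<longleftrightarrow>
     (\<forall>v\<in>l2sum I V. ((\<lambda>m. l2norm I V (diag_op I m v - v)) \<longlongrightarrow> 0) N)"

definition converges_uniformly ::
  "'o set \<Rightarrow> ('o \<Rightarrow> 'v::complex_vector hilb) \<Rightarrow> ('o \<Rightarrow> 'v \<Rightarrow> 'v) filter \<Rightarrow> bool" where
  "converges_uniformly I V N \<longleftrightarrow>
     (\<forall>e>0. \<forall>\<^sub>F m in N. \<forall>v\<in>l2sum I V. l2norm I V (diag_op I m v - v) \<le> e * l2norm I V v)"

definition mult_amenable ::
  "'o set \<Rightarrow> ('o \<Rightarrow> 'v::complex_vector hilb) \<Rightarrow> ('o \<Rightarrow> 'v \<Rightarrow> 'v) set \<Rightarrow> bool" where
  "mult_amenable I V S \<longleftrightarrow>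
     (\<exists>N. net_in {m \<in> S. finite_rank I V m} N \<and> converges_pointwise I V N)"

definition mult_haagerup ::
  "'o set \<Rightarrow> ('o \<Rightarrow> 'v::complex_vector hilb) \<Rightarrow> ('o \<Rightarrow> 'v \<Rightarrow> 'v) set \<Rightarrow> bool" where
  "mult_haagerup I V S \<longleftrightarrow>
     (\<exists>N. net_in {m \<in> S. compact_mult I V m} N \<and> converges_pointwise I V N)"

definition mult_property_T ::
  "'o set \<Rightarrow> ('o \<Rightarrow> 'v::complex_vector hilb) \<Rightarrow> ('o \<Rightarrow> 'v \<Rightarrow> 'v) set \<Rightarrow> bool" where
  "mult_property_T I V S \<longleftrightarrow>
     (\<forall>N. net_in S N \<and> converges_pointwise I V N \<longrightarrow> converges_uniformly I V N)"

definition qg_amenable where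
  "qg_amenable C F Irr \<longleftrightarrow> mult_amenable Irr (obj F) (qg_ucp_multipliers C F Irr)"
definition qg_haagerup where
  "qg_haagerup C F Irr \<longleftrightarrow> mult_haagerup Irr (obj F) (qg_ucp_multipliers C F Irr)"
definition qg_property_T where
  "qg_property_T C F Irr \<longleftrightarrow> mult_property_T Irr (obj F) (qg_ucp_multipliers C F Irr)"

definition alg_amenable where
  "alg_amenable C F Irr \<longleftrightarrow> mult_amenable Irr (L2 C F) (alg_ucp_multipliers C F Irr)"
definition alg_haagerup where
  "alg_haagerup C F Irr \<longleftrightarrow> mult_haagerup Irr (L2 C F) (alg_ucp_multipliers C F Irr)"
definition alg_property_T where
  "alg_property_T C F Irr \<longleftrightarrow> mult_property_T Irr (L2 C F) (alg_ucp_multipliers C F Irr)"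

end

theory Submission
  imports Defs "HOL-Library.Diagonal_Subsequence" "HOL-Computational_Algebra.Fundamental_Theorem_Algebra"
begin

text \<open>
  Write \<open>coef c f v\<close> for the matrix coefficient of an arbitrary object \<open>c\<close> given by a functional \<open>f\<close>
  and a vector \<open>v\<close>, as an element of the algebra of the quantum group.  A state \<open>\<phi>\<close> and a ucp map
  \<open>\<Psi>\<close> of the algebra object determine each other by \<open>(\<Psi>\<^sub>c f)(v) = \<phi>(coef c f v)\<close>, and the
  theorem rests on three facts.

  First, coefficients are natural in the object (\<open>coef_natural\<close>), the product of two coefficients is the
  coefficient of the tensor product (\<open>mult_coef\<close>), the involution moves a coefficient to the conjugate
  object (\<open>star_coef\<close>), and by direct sums every element is a single coefficient (\<open>qg_alg_coef\<close>).  For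
  \<open>x = coef c f v\<close> the number \<open>\<phi>(x\<^sup># x)\<close> is therefore the value of \<open>\<Psi>(f\<^sup>* f)\<close> at the
  vector \<open>v\<^sup>\<sharp> \<otimes> v\<close>.  These vectors detect the positive elements of the algebra object (\<open>alg_positiveI\<close>),
  and positive elements are sums of squares \<open>f\<^sup>* f\<close> (\<open>alg_positive_sum_squares\<close>); so \<open>\<phi>\<close> is positive iff
  \<open>\<Psi>\<close> is (\<open>state_map_ucp\<close>, \<open>ucp_state_state\<close>).  On simple objects the multiplier of \<open>\<Psi>\<close> is the
  transpose of that of \<open>\<phi>\<close>, whence a bijection of the ucp multipliers (\<open>transpose_bij\<close>).

  Second, the Hilbert space of the algebra object at \<open>a\<close> is a copy of the one of the conjugate of \<open>a\<close>.
  As \<open>\<Psi>\<close> commutes with the involution, the block of its multiplier at \<open>a\<close> is unitarily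
  equivalent to the transpose of the block of the multiplier of \<open>\<phi>\<close> at the conjugate of \<open>a\<close>
  (\<open>transpose_form\<close>).  The norms of the blocks of \<open>m\<close> and of \<open>m - 1\<close> thus agree up to the permutation of
  the simple objects given by conjugation (\<open>transpose_bounds\<close>).

  Third, multipliers of states are contractions, and for contractive multipliers finite rank,
  compactness, pointwise and uniform convergence can be read off from these norms, because the blocks
  are finite dimensional.  Hence the three approximation properties coincide (\<open>multiplier_transfer\<close>).

  The first fact requires some structure theory: faithfulness of \<open>F\<close>, semisimplicity, and
  the existence of the orthonormal bases that occur in the product.  The last point is where standardness
  of the duality is used, through the trace property (\<open>cat_trace_comp\<close>); completeness of these bases
  (\<open>completeness\<close>) then drives all computations with coefficients.
\<close>

section \<open>Linear maps on subspaces\<close>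

lemma scaleC_complex [simp]: "z *\<^sub>C (w::complex) = z * w"
  by (simp add: scaleC_complex_def)

lemma scaleC_fun_apply: "(z *\<^sub>C f) x = z *\<^sub>C f x"
  by (simp add: scaleC_fun_def)

lemma sum_fun_apply: "(\<Sum>i\<in>I. f i) x = (\<Sum>i\<in>I. f i x)" for f :: "'i \<Rightarrow> 'x \<Rightarrow> 'y::comm_monoid_add"
  by (induction I rule: infinite_finite_induct) auto

lemmas scaleC_simps [simp] = scaleC_one scaleC_scaleC

lemma clinear_onI:
  assumes "\<And>x. x \<in> V \<Longrightarrow> T x \<in> W"
    and "\<And>x y. x \<in> V \<Longrightarrow> y \<in> V \<Longrightarrow> T (x + y) = T x + T y"
    and "\<And>x z. x \<in> V \<Longrightarrow> T (z *\<^sub>C x) = z *\<^sub>C T x"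
  shows "clinear_on V W T"
  using assms by (auto simp: clinear_on_def)

lemma clinear_onD:
  assumes "clinear_on V W T"
  shows clinear_on_in: "\<And>x. x \<in> V \<Longrightarrow> T x \<in> W"
    and clinear_on_add: "\<And>x y. x \<in> V \<Longrightarrow> y \<in> V \<Longrightarrow> T (x + y) = T x + T y"
    and clinear_on_scale: "\<And>x z. x \<in> V \<Longrightarrow> T (z *\<^sub>C x) = z *\<^sub>C T x"
  using assms by (auto simp: clinear_on_def)

lemma clinear_on_zero:
  assumes "clinear_on V W T" "complex_vector.subspace V"
  shows "T 0 = 0"
  using clinear_on_scale[OF assms(1) complex_vector.subspace_0[OF assms(2)], of 0] by simp

lemma clinear_on_diff:
  assumes "clinear_on V W T" "complex_vector.subspace V" "x \<in> V" "y \<in> V"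
  shows "T (x - y) = T x - T y"
proof -
  have "T (x - y) + T y = T x"
    using clinear_on_add[OF assms(1) complex_vector.subspace_diff[OF assms(2-4)] assms(4)] by simp
  thus ?thesis by (simp add: algebra_simps)
qed

lemma clinear_on_sum:
  assumes "clinear_on V W T" "complex_vector.subspace V" "\<And>i. i \<in> I \<Longrightarrow> x i \<in> V"
  shows "T (\<Sum>i\<in>I. x i) = (\<Sum>i\<in>I. T (x i))"
  using assms(3)
proof (induction I rule: infinite_finite_induct)
  case (insert i I)
  have "(\<Sum>i\<in>I. x i) \<in> V"
    using insert.prems by (intro complex_vector.subspace_sum assms(2)) auto
  then show ?case
    using insert clinear_on_add[OF assms(1)] by auto
qed (auto simp: clinear_on_zero[OF assms(1,2)])

lemma clinear_on_span_eq:
  assumes "clinear_on (complex_vector.span S) W T" "clinear_on (complex_vector.span S) W' T'"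
    and "\<And>x. x \<in> S \<Longrightarrow> T x = T' x" and "x \<in> complex_vector.span S"
  shows "T x = T' x"
proof -
  let ?M = "{x \<in> complex_vector.span S. T x = T' x}"
  have "complex_vector.subspace ?M"
    using assms(1,2)
    by (intro complex_vector.subspaceI)
      (auto simp: clinear_on_zero[OF _ complex_vector.subspace_span] complex_vector.span_add complex_vector.span_scale complex_vector.span_zero
        clinear_on_add[OF assms(1)] clinear_on_add[OF assms(2)]
        clinear_on_scale[OF assms(1)] clinear_on_scale[OF assms(2)])
  moreover have "S \<subseteq> ?M"
    using assms(3) by (auto intro: complex_vector.span_base)
  ultimately have "complex_vector.span S \<subseteq> ?M"
    by (intro complex_vector.span_minimal)
  thus ?thesis using assms(4) by auto
qed

lemma finite_span_if_embedded:
  fixes G :: "'v::complex_vector \<Rightarrow> 'w::complex_vector"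
  assumes V: "complex_vector.subspace V" and G: "clinear_on V UNIV G"
    and inj: "\<And>x. x \<in> V \<Longrightarrow> G x = 0 \<Longrightarrow> x = 0"
    and S: "finite S" "G ` V \<subseteq> complex_vector.span S"
  shows "\<exists>B. finite B \<and> V = complex_vector.span B"
proof -
  obtain B where B: "B \<subseteq> V" "complex_vector.independent B" "V \<subseteq> complex_vector.span B"
    using complex_vector.maximal_independent_subset[of V] by blast
  have span: "V = complex_vector.span B"
    using B V by (simp add: complex_vector.span_minimal order_antisym)
  have injG: "inj_on G V"
  proof (rule inj_onI)
    fix x y assume xy: "x \<in> V" "y \<in> V" "G x = G y"
    hence "G (x - y) = 0" using clinear_on_diff[OF G V] by simp
    thus "x = y" using inj[of "x - y"] complex_vector.subspace_diff[OF V] xy by simp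
  qed
  have "complex_vector.independent (G ` B)"
    unfolding complex_vector.dependent_explicit
  proof clarsimp
    fix t u v assume t: "finite t" "t \<subseteq> G ` B" "(\<Sum>v\<in>t. u v *\<^sub>C v) = 0" and v: "v \<in> t"
    obtain s where s: "s \<subseteq> B" "finite s" "t = G ` s"
      using finite_subset_image[OF t(1,2)] by blast
    have sV: "x \<in> V" if "x \<in> s" for x using that s B by auto
    have "inj_on G s" using injG sV by (auto intro: inj_on_subset)
    have "G (\<Sum>x\<in>s. u (G x) *\<^sub>C x) = (\<Sum>x\<in>s. G (u (G x) *\<^sub>C x))"
      by (rule clinear_on_sum[OF G V]) (simp add: complex_vector.subspace_scale[OF V] sV)
    also have "\<dots> = (\<Sum>x\<in>s. u (G x) *\<^sub>C G x)"
      by (intro sum.cong refl clinear_on_scale[OF G] sV)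
    also have "\<dots> = 0"
      using t(3) \<open>inj_on G s\<close> by (simp add: s(3) sum.reindex)
    finally have "(\<Sum>x\<in>s. u (G x) *\<^sub>C x) = 0"
      by (intro inj complex_vector.subspace_sum[OF V] complex_vector.subspace_scale[OF V] sV)
    moreover obtain x where "x \<in> s" "v = G x" using v s by auto
    ultimately show "u v = 0" using complex_vector.independentD[OF B(2) s(2,1), of "\<lambda>x. u (G x)"] by simp
  qed
  hence "finite (G ` B)"
    using complex_vector.independent_span_bound[OF S(1)] S(2) B(1) by blast
  hence "finite B" using inj_on_subset[OF injG B(1)] finite_imageD by blast
  thus ?thesis using span by blast
qed

text \<open>The relation is between positions of the sequence, so that a repeated vector counts as one.\<close>

lemma finite_span_sequence_dependent:
  fixes x :: "nat \<Rightarrow> 'v::complex_vector"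
  assumes "finite B" "\<And>i. x i \<in> complex_vector.span B"
  shows "\<exists>T u. finite T \<and> (\<Sum>i\<in>T. u i *\<^sub>C x i) = 0 \<and> (\<exists>i\<in>T. u i \<noteq> 0)"
proof (cases "inj x")
  case False
  then obtain i j where ij: "i \<noteq> j" "x i = x j" by (auto simp: inj_def)
  let ?u = "\<lambda>k. if k = i then 1 else (-1 :: complex)"
  have "(\<Sum>k\<in>{i, j}. ?u k *\<^sub>C x k) = 0"
    using ij by (simp add: complex_vector.scale_minus_left)
  thus ?thesis by (intro exI[of _ "{i, j}"] exI[of _ ?u]) auto
next
  case True
  have "\<not> complex_vector.independent (range x)"
  proof
    assume "complex_vector.independent (range x)"
    hence "finite (range x)"
      using complex_vector.independent_span_bound[OF assms(1)] assms(2) by blast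
    thus False using True finite_imageD by blast
  qed
  then obtain t u v where t: "finite t" "t \<subseteq> range x" "(\<Sum>v\<in>t. u v *\<^sub>C v) = 0" "v \<in> t" "u v \<noteq> 0"
    unfolding complex_vector.dependent_explicit by blast
  obtain T where T: "finite T" "t = x ` T" using finite_subset_image[OF t(1,2)] by blast
  have "(\<Sum>i\<in>T. u (x i) *\<^sub>C x i) = 0"
    using t(3) inj_on_subset[OF True, of T] by (simp add: T(2) sum.reindex)
  thus ?thesis using t T by (intro exI[of _ T] exI[of _ "\<lambda>i. u (x i)"]) auto
qed

lemma sum_mem:
  assumes "0 \<in> K" "\<And>x y. x \<in> K \<Longrightarrow> y \<in> K \<Longrightarrow> x + y \<in> K" "\<And>i. i \<in> I \<Longrightarrow> g i \<in> K"
  shows "(\<Sum>i\<in>I. g i) \<in> K"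
  using assms(3) by (induction I rule: infinite_finite_induct) (auto simp: assms(1,2))

section \<open>Finite dimensional Hilbert spaces\<close>

definition hnorm :: "'v hilb \<Rightarrow> 'v \<Rightarrow> real" where
  "hnorm H x = sqrt (Re (ip H x x))"

definition onb :: "'v::complex_vector hilb \<Rightarrow> 'v set \<Rightarrow> bool" where
  "onb H E \<longleftrightarrow> finite E \<and> E \<subseteq> vecs H \<and>
     (\<forall>e\<in>E. \<forall>e'\<in>E. ip H e e' = (if e = e' then 1 else 0)) \<and> complex_vector.span E = vecs H"

definition basis :: "'v::complex_vector hilb \<Rightarrow> 'v set" where
  "basis H = (SOME E. onb H E)"

locale fd_hilbert_space =
  fixes H :: "'v::complex_vector hilb"
  assumes fd_hilbert: "fd_hilbert H"
begin

lemma subspace: "complex_vector.subspace (vecs H)"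
  using conjunct1[OF fd_hilbert[unfolded fd_hilbert_def]] by (auto simp: complex_vector.subspace_span)

lemmas zero_in [simp] = complex_vector.subspace_0[OF subspace]
lemmas add_in [simp] = complex_vector.subspace_add[OF subspace]
lemmas diff_in [simp] = complex_vector.subspace_diff[OF subspace]
lemmas scale_in [simp] = complex_vector.subspace_scale[OF subspace]
lemmas sum_in = complex_vector.subspace_sum[OF subspace]

lemma ip_linear: "x \<in> vecs H \<Longrightarrow> clinear_on (vecs H) UNIV (ip H x)"
  using fd_hilbert by (simp only: fd_hilbert_def)

lemma ip_cnj: "x \<in> vecs H \<Longrightarrow> y \<in> vecs H \<Longrightarrow> ip H y x = cnj (ip H x y)"
  using fd_hilbert unfolding fd_hilbert_def by (elim conjE) (drule (1) bspec)+

lemma ip_add_right: "x \<in> vecs H \<Longrightarrow> y \<in> vecs H \<Longrightarrow> y' \<in> vecs H \<Longrightarrow> ip H x (y + y') = ip H x y + ip H x y'"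
  using clinear_on_add[OF ip_linear] by blast

lemma ip_scale_right: "x \<in> vecs H \<Longrightarrow> y \<in> vecs H \<Longrightarrow> ip H x (z *\<^sub>C y) = z * ip H x y"
  using clinear_on_scale[OF ip_linear] by simp

lemma ip_diff_right: "x \<in> vecs H \<Longrightarrow> y \<in> vecs H \<Longrightarrow> y' \<in> vecs H \<Longrightarrow> ip H x (y - y') = ip H x y - ip H x y'"
  using clinear_on_diff[OF ip_linear subspace] by blast

lemma ip_zero_right [simp]: "x \<in> vecs H \<Longrightarrow> ip H x 0 = 0"
  using clinear_on_zero[OF ip_linear subspace] by blast

lemma ip_sum_right: "x \<in> vecs H \<Longrightarrow> (\<And>i. i \<in> I \<Longrightarrow> y i \<in> vecs H) \<Longrightarrow> ip H x (\<Sum>i\<in>I. y i) = (\<Sum>i\<in>I. ip H x (y i))"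
  using clinear_on_sum[OF ip_linear subspace] by blast

lemma ip_add_left: "x \<in> vecs H \<Longrightarrow> y \<in> vecs H \<Longrightarrow> y' \<in> vecs H \<Longrightarrow> ip H (y + y') x = ip H y x + ip H y' x"
  using ip_cnj[of x "y + y'"] ip_cnj[of x y] ip_cnj[of x y'] by (simp add: ip_add_right)

lemma ip_diff_left: "x \<in> vecs H \<Longrightarrow> y \<in> vecs H \<Longrightarrow> y' \<in> vecs H \<Longrightarrow> ip H (y - y') x = ip H y x - ip H y' x"
  using ip_cnj[of x "y - y'"] ip_cnj[of x y] ip_cnj[of x y'] by (simp add: ip_diff_right)

lemma ip_scale_left: "x \<in> vecs H \<Longrightarrow> y \<in> vecs H \<Longrightarrow> ip H (z *\<^sub>C y) x = cnj z * ip H y x"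
  using ip_cnj[of x "z *\<^sub>C y"] ip_cnj[of x y] by (simp add: ip_scale_right)

lemma ip_zero_left [simp]: "x \<in> vecs H \<Longrightarrow> ip H 0 x = 0"
  using ip_cnj[of x 0] by simp

lemma ip_sum_left:
  assumes "x \<in> vecs H" "\<And>i. i \<in> I \<Longrightarrow> y i \<in> vecs H"
  shows "ip H (\<Sum>i\<in>I. y i) x = (\<Sum>i\<in>I. ip H (y i) x)"
proof -
  have "ip H (\<Sum>i\<in>I. y i) x = cnj (\<Sum>i\<in>I. ip H x (y i))"
    using assms ip_cnj[of x "\<Sum>i\<in>I. y i"] by (simp add: ip_sum_right sum_in)
  also have "\<dots> = (\<Sum>i\<in>I. ip H (y i) x)"
    using assms by (auto intro!: sum.cong simp: ip_cnj[of x])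
  finally show ?thesis .
qed

lemma ip_self_nonneg: "x \<in> vecs H \<Longrightarrow> ip H x x \<in> \<real>\<^sub>\<ge>\<^sub>0"
  using conjunct2[OF conjunct2[OF conjunct2[OF fd_hilbert[unfolded fd_hilbert_def]]]] by blast

lemma ip_self: "x \<in> vecs H \<Longrightarrow> ip H x x = of_real ((hnorm H x)\<^sup>2)"
  using ip_self_nonneg[of x] by (simp add: hnorm_def complex_nonneg_Reals_iff complex_eq_iff)

lemma hnorm_sq: "x \<in> vecs H \<Longrightarrow> (hnorm H x)\<^sup>2 = Re (ip H x x)"
  by (simp add: ip_self)

lemma hnorm_nonneg [simp]: "x \<in> vecs H \<Longrightarrow> hnorm H x \<ge> 0"
  using ip_self_nonneg[of x] by (simp add: hnorm_def complex_nonneg_Reals_iff)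

lemma ip_self_eq_0: "x \<in> vecs H \<Longrightarrow> ip H x x = 0 \<Longrightarrow> x = 0"
  using conjunct2[OF conjunct2[OF conjunct2[OF fd_hilbert[unfolded fd_hilbert_def]]]] by blast

lemma hnorm_zero [simp]: "hnorm H 0 = 0"
  by (simp add: hnorm_def)

lemma hnorm_eq_0: "x \<in> vecs H \<Longrightarrow> hnorm H x = 0 \<longleftrightarrow> x = 0"
  using ip_self[of x] ip_self_eq_0[of x] by auto

lemma hnorm_scale: "x \<in> vecs H \<Longrightarrow> hnorm H (z *\<^sub>C x) = cmod z * hnorm H x"
proof -
  assume x: "x \<in> vecs H"
  have "ip H (z *\<^sub>C x) (z *\<^sub>C x) = of_real ((cmod z)\<^sup>2) * ip H x x"
    using x by (simp add: ip_scale_left ip_scale_right complex_norm_square mult_ac del: of_real_power)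
  thus ?thesis
    by (simp add: hnorm_def real_sqrt_mult)
qed

lemma eq_if_ip_eq:
  assumes "x \<in> vecs H" "y \<in> vecs H" "\<And>w. w \<in> vecs H \<Longrightarrow> ip H w x = ip H w y"
  shows "x = y"
proof -
  have "ip H (x - y) (x - y) = 0"
    using assms by (simp add: ip_diff_right)
  thus ?thesis
    using assms ip_self_eq_0[of "x - y"] by simp
qed

text \<open>Gram--Schmidt: one new basis vector is obtained for each spanning vector outside the span
  reached so far.\<close>

lemma orthonormal_span:
  assumes "finite B" "B \<subseteq> vecs H"
  shows "\<exists>E. finite E \<and> E \<subseteq> vecs H \<and>
    (\<forall>e\<in>E. \<forall>e'\<in>E. ip H e e' = (if e = e' then 1 else 0)) \<and> complex_vector.span E = complex_vector.span B"
  using assms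
proof (induction B rule: finite_induct)
  case empty
  show ?case by (intro exI[of _ "{}"]) auto
next
  case (insert b B)
  have "B \<subseteq> vecs H" using insert.prems by simp
  from insert.IH[OF this] obtain E where E0: "finite E" "E \<subseteq> vecs H"
    "\<forall>e\<in>E. \<forall>e'\<in>E. ip H e e' = (if e = e' then 1 else 0)"
    "complex_vector.span E = complex_vector.span B"
    by (elim exE conjE) (rule that)
  note E = E0(1,2) E0(3)[rule_format] E0(4)
  have b: "b \<in> vecs H" using insert.prems by auto
  have Ein: "e \<in> vecs H" if "e \<in> E" for e using E(2) that by auto
  define s where "s = (\<Sum>e\<in>E. ip H e b *\<^sub>C e)"
  define r where "r = b - s"
  have s_in: "s \<in> vecs H" unfolding s_def using E by (intro sum_in) auto
  have s_span: "s \<in> complex_vector.span E"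
    unfolding s_def by (auto intro: complex_vector.span_sum complex_vector.span_scale complex_vector.span_base)
  have r_in: "r \<in> vecs H" using b s_in by (simp add: r_def)
  have orth: "ip H e r = 0" if e: "e \<in> E" for e
  proof -
    have "ip H e s = (\<Sum>e'\<in>E. ip H e (ip H e' b *\<^sub>C e'))"
      unfolding s_def by (rule ip_sum_right) (simp_all add: Ein e)
    also have "\<dots> = (\<Sum>e'\<in>E. if e = e' then ip H e' b else 0)"
    proof (rule sum.cong[OF refl])
      fix e' assume e': "e' \<in> E"
      show "ip H e (ip H e' b *\<^sub>C e') = (if e = e' then ip H e' b else 0)"
        using ip_scale_right[OF Ein[OF e] Ein[OF e']] E(3)[OF e e'] by simp
    qed
    also have "\<dots> = ip H e b" using E(1) e by simp
    finally show ?thesis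
      unfolding r_def using ip_diff_right[OF Ein[OF e] b s_in] by simp
  qed
  have span_b: "complex_vector.span (insert b B) = complex_vector.span (insert r E)"
  proof -
    have "complex_vector.span (insert b B) = complex_vector.span (insert b E)"
      using E(4) by (metis complex_vector.span_insert)
    also have "\<dots> = complex_vector.span (insert r E)"
    proof -
      have "b = r + s" by (simp add: r_def)
      have "s \<in> complex_vector.span (insert r E)" "s \<in> complex_vector.span (insert b E)"
        using s_span complex_vector.span_mono[of E "insert r E"] complex_vector.span_mono[of E "insert b E"] by auto
      moreover have "r \<in> complex_vector.span (insert r E)" "b \<in> complex_vector.span (insert b E)"
        by (auto intro: complex_vector.span_base)
      ultimately have b_span: "b \<in> complex_vector.span (insert r E)" and r_span: "r \<in> complex_vector.span (insert b E)"
        using complex_vector.span_add[of r "insert r E" s] complex_vector.span_diff[of b "insert b E" s]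
        by (simp_all add: r_def)
      have "E \<subseteq> complex_vector.span (insert r E)" "E \<subseteq> complex_vector.span (insert b E)"
        by (auto intro: complex_vector.span_base)
      thus ?thesis using b_span r_span
        by (intro complex_vector.span_eq[THEN iffD2]) auto
    qed
    finally show ?thesis .
  qed
  show ?case
  proof (cases "r = 0")
    case True
    have "complex_vector.span (insert b B) = complex_vector.span E"
      using span_b True by simp
    thus ?thesis using E by (intro exI[of _ E]) auto
  next
    case False
    define n where "n = complex_of_real (1 / hnorm H r)"
    have hr: "hnorm H r > 0" using False r_in hnorm_eq_0[of r] hnorm_nonneg[of r] by linarith
    have n0: "n \<noteq> 0" using hr by (simp add: n_def)
    define e0 where "e0 = n *\<^sub>C r"
    have e0_in: "e0 \<in> vecs H" using r_in by (simp add: e0_def)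
    have "hnorm H e0 = 1" using hr r_in by (simp add: e0_def hnorm_scale n_def norm_divide)
    hence e0_1: "ip H e0 e0 = 1" using ip_self[OF e0_in] by simp
    have orth0: "ip H e e0 = 0" "ip H e0 e = 0" if "e \<in> E" for e
    proof -
      show "ip H e e0 = 0" unfolding e0_def using orth[OF that] r_in by (simp add: ip_scale_right Ein that)
      thus "ip H e0 e = 0" using ip_cnj[of e e0] e0_in by (simp add: Ein that)
    qed
    have "e0 \<notin> E" using orth0 e0_1 by force
    have "complex_vector.span (insert r E) = complex_vector.span (insert e0 E)"
    proof (intro complex_vector.span_eq[THEN iffD2] conjI)
      have "r = (1/n) *\<^sub>C e0" using n0 by (simp add: e0_def)
      hence "r \<in> complex_vector.span (insert e0 E)"
        by (metis complex_vector.span_base complex_vector.span_scale insertI1)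
      thus "insert r E \<subseteq> complex_vector.span (insert e0 E)"
        by (auto intro: complex_vector.span_base)
      show "insert e0 E \<subseteq> complex_vector.span (insert r E)"
        unfolding e0_def by (auto intro: complex_vector.span_base complex_vector.span_scale)
    qed
    thus ?thesis
      using span_b E e0_in e0_1 orth0 \<open>e0 \<notin> E\<close>
      by (intro exI[of _ "insert e0 E"]) auto
  qed
qed

lemma basis: "onb H (basis H)"
proof -
  obtain B where B: "finite B" "vecs H = complex_vector.span B"
    using conjunct1[OF fd_hilbert[unfolded fd_hilbert_def]] by blast
  hence "B \<subseteq> vecs H" by (auto intro: complex_vector.span_base)
  from orthonormal_span[OF B(1) this] have "\<exists>E. onb H E"
    using B unfolding onb_def by metis
  thus ?thesis unfolding basis_def by (rule someI_ex)
qed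

lemma finite_basis [simp]: "finite (basis H)"
  and basis_in: "e \<in> basis H \<Longrightarrow> e \<in> vecs H"
  and basis_ip: "e \<in> basis H \<Longrightarrow> e' \<in> basis H \<Longrightarrow> ip H e e' = (if e = e' then 1 else 0)"
  and span_basis: "complex_vector.span (basis H) = vecs H"
  using basis by (auto simp: onb_def)

lemma onb_expand:
  assumes E: "onb H E" and x: "x \<in> vecs H"
  shows "x = (\<Sum>e\<in>E. ip H e x *\<^sub>C e)"
proof -
  note E' = E[unfolded onb_def]
  have Ein: "e \<in> vecs H" if "e \<in> E" for e using E' that by auto
  have span: "complex_vector.span E = vecs H" using E' by auto
  have lin: "clinear_on (complex_vector.span E) (vecs H) (\<lambda>x. \<Sum>e\<in>E. ip H e x *\<^sub>C e)"
    by (intro clinear_onI)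
      (auto intro!: sum_in sum.cong scale_in
        simp: Ein span ip_add_right ip_scale_right scaleC_add_left sum.distrib complex_vector.scale_sum_right)
  have "(\<Sum>e\<in>E. ip H e x *\<^sub>C e) = (\<lambda>x. x) x"
  proof (rule clinear_on_span_eq[OF lin, of UNIV])
    fix e assume e: "e \<in> E"
    have "(\<Sum>e'\<in>E. ip H e' e *\<^sub>C e') = (\<Sum>e'\<in>E. if e' = e then e' else 0)"
      using E' e by (intro sum.cong) auto
    thus "(\<Sum>e'\<in>E. ip H e' e *\<^sub>C e') = e" using E' e by simp
  qed (use x E' in \<open>auto simp: clinear_on_def\<close>)
  thus ?thesis by simp
qed

lemmas basis_expand = onb_expand[OF basis]

lemma ip_basis_expand:
  assumes "x \<in> vecs H" "y \<in> vecs H"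
  shows "ip H x y = (\<Sum>e\<in>basis H. ip H x e * ip H e y)"
proof -
  have "ip H x y = ip H x (\<Sum>e\<in>basis H. ip H e y *\<^sub>C e)"
    using basis_expand[OF assms(2)] by simp
  also have "\<dots> = (\<Sum>e\<in>basis H. ip H x e * ip H e y)"
    using assms by (subst ip_sum_right) (auto simp: basis_in ip_scale_right mult_ac)
  finally show ?thesis .
qed

lemma hnorm_sq_basis:
  assumes "x \<in> vecs H"
  shows "(hnorm H x)\<^sup>2 = (\<Sum>e\<in>basis H. (cmod (ip H e x))\<^sup>2)"
proof -
  have "ip H x e * ip H e x = of_real ((cmod (ip H e x))\<^sup>2)" if "e \<in> basis H" for e
    using ip_cnj[of e x] assms basis_in[OF that] by (simp add: complex_norm_square mult_ac del: of_real_power)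
  hence "ip H x x = (\<Sum>e\<in>basis H. of_real ((cmod (ip H e x))\<^sup>2))"
    using ip_basis_expand[OF assms assms] by simp
  thus ?thesis
    using hnorm_sq[OF assms] by simp
qed

lemma cauchy_schwarz:
  assumes "x \<in> vecs H" "y \<in> vecs H"
  shows "cmod (ip H x y) \<le> hnorm H x * hnorm H y"
proof -
  have "cmod (ip H x y) \<le> (\<Sum>e\<in>basis H. cmod (ip H e x) * cmod (ip H e y))"
    unfolding ip_basis_expand[OF assms]
    by (rule order_trans[OF norm_sum])
      (use assms in \<open>auto intro!: sum_mono simp: norm_mult basis_in ip_cnj[of _ x]\<close>)
  also have "\<dots> = (\<Sum>e\<in>basis H. \<bar>cmod (ip H e x)\<bar> * \<bar>cmod (ip H e y)\<bar>)" by simp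
  also have "\<dots> \<le> L2_set (\<lambda>e. cmod (ip H e x)) (basis H) * L2_set (\<lambda>e. cmod (ip H e y)) (basis H)"
    by (rule L2_set_mult_ineq)
  also have "\<dots> = hnorm H x * hnorm H y"
    using assms by (simp add: L2_set_def flip: hnorm_sq_basis)
  finally show ?thesis .
qed

lemma hnorm_minus_commute: "x \<in> vecs H \<Longrightarrow> y \<in> vecs H \<Longrightarrow> hnorm H (x - y) = hnorm H (y - x)"
  by (simp add: hnorm_def ip_diff_left ip_diff_right)

text \<open>This is half of the parallelogram law.\<close>

lemma hnorm_diff_sq_le:
  assumes "x \<in> vecs H" "y \<in> vecs H"
  shows "(hnorm H (x - y))\<^sup>2 \<le> 2 * (hnorm H x)\<^sup>2 + 2 * (hnorm H y)\<^sup>2"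
proof -
  have "(hnorm H (x + y))\<^sup>2 + (hnorm H (x - y))\<^sup>2 = 2 * (hnorm H x)\<^sup>2 + 2 * (hnorm H y)\<^sup>2"
    using assms by (simp add: hnorm_sq ip_add_left ip_add_right ip_diff_left ip_diff_right)
  thus ?thesis by (smt (verit) zero_le_power2)
qed

lemma bra_apply [simp]: "x \<in> vecs H \<Longrightarrow> bra H v x = ip H v x"
  by (simp add: bra_def)

lemma bra_in: "v \<in> vecs H \<Longrightarrow> bra H v \<in> dual H"
  unfolding dual_def using ip_add_right ip_scale_right
  by (auto intro!: clinear_onI simp: bra_def)

lemma dual_add: "f \<in> dual H \<Longrightarrow> x \<in> vecs H \<Longrightarrow> y \<in> vecs H \<Longrightarrow> f (x + y) = f x + f y"
  and dual_scale: "f \<in> dual H \<Longrightarrow> x \<in> vecs H \<Longrightarrow> f (z *\<^sub>C x) = z * f x"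
  and dual_outside: "f \<in> dual H \<Longrightarrow> x \<notin> vecs H \<Longrightarrow> f x = 0"
  by (auto simp: dual_def clinear_on_def)

lemma dual_sum: "f \<in> dual H \<Longrightarrow> (\<And>i. i \<in> I \<Longrightarrow> x i \<in> vecs H) \<Longrightarrow> f (\<Sum>i\<in>I. x i) = (\<Sum>i\<in>I. f (x i))"
  unfolding dual_def using clinear_on_sum[OF _ subspace] by blast

lemma dual_zero: "f \<in> dual H \<Longrightarrow> f 0 = 0"
  using dual_scale[of f 0 0] by simp

lemma subspace_dual: "complex_vector.subspace (dual H)"
  by (auto intro!: complex_vector.subspaceI simp: dual_def clinear_on_def scaleC_fun_apply scaleC_add_right algebra_simps)

lemma dual_cong:
  assumes "f \<in> dual H" "g \<in> dual H" "\<And>x. x \<in> vecs H \<Longrightarrow> f x = g x"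
  shows "f = g"
proof
  fix x show "f x = g x" using assms dual_outside[of f x] dual_outside[of g x] by (cases "x \<in> vecs H") auto
qed

lemma dual_expand:
  assumes f: "f \<in> dual H"
  shows "f = bra H (\<Sum>e\<in>basis H. cnj (f e) *\<^sub>C e)"
proof (rule dual_cong)
  show "bra H (\<Sum>e\<in>basis H. cnj (f e) *\<^sub>C e) \<in> dual H"
    by (intro bra_in sum_in) (simp add: basis_in)
next
  fix x assume x: "x \<in> vecs H"
  have "f x = f (\<Sum>e\<in>basis H. ip H e x *\<^sub>C e)" using basis_expand[OF x] by simp
  also have "\<dots> = (\<Sum>e\<in>basis H. ip H e x * f e)"
    using f x by (subst dual_sum) (auto simp: basis_in dual_scale)
  also have "\<dots> = bra H (\<Sum>e\<in>basis H. cnj (f e) *\<^sub>C e) x"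
    using x by (simp add: ip_sum_left basis_in ip_scale_left mult_ac)
  finally show "f x = \<dots>" .
qed (rule f)

lemma bra_inj: "v \<in> vecs H \<Longrightarrow> w \<in> vecs H \<Longrightarrow> bra H v = bra H w \<Longrightarrow> v = w"
proof (rule eq_if_ip_eq)
  fix u assume vw: "v \<in> vecs H" "w \<in> vecs H" "bra H v = bra H w" and u: "u \<in> vecs H"
  have "ip H v u = ip H w u" using vw u by (metis bra_apply)
  thus "ip H u v = ip H u w" using vw u ip_cnj[of _ u] by metis
qed

lemma ket_bra [simp]: "v \<in> vecs H \<Longrightarrow> ket H (bra H v) = v"
  unfolding ket_def using bra_inj by (intro the_equality) auto

lemma bra_surj: "f \<in> dual H \<Longrightarrow> \<exists>v\<in>vecs H. f = bra H v"
  using dual_expand[of f] by (metis (no_types, lifting) basis_in scale_in sum_in)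

lemma ket_in: "f \<in> dual H \<Longrightarrow> ket H f \<in> vecs H"
  and bra_ket [simp]: "f \<in> dual H \<Longrightarrow> bra H (ket H f) = f"
  using bra_surj[of f] by auto

lemma ip_ket [simp]: "f \<in> dual H \<Longrightarrow> x \<in> vecs H \<Longrightarrow> ip H (ket H f) x = f x"
  by (metis bra_apply bra_ket)

lemma ip_ket_right: "f \<in> dual H \<Longrightarrow> x \<in> vecs H \<Longrightarrow> ip H x (ket H f) = cnj (f x)"
  using ip_cnj[OF ket_in, of f x] by simp

lemma eq_if_dual_eq:
  assumes "x \<in> vecs H" "y \<in> vecs H" "\<And>f. f \<in> dual H \<Longrightarrow> f x = f y"
  shows "x = y"
  using assms by (intro eq_if_ip_eq) (metis bra_apply bra_in)+

lemma bra_scale: "v \<in> vecs H \<Longrightarrow> bra H (z *\<^sub>C v) = cnj z *\<^sub>C bra H v"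
  by (auto simp: bra_def ip_scale_left fun_eq_iff scaleC_fun_apply)

lemma bra_add: "v \<in> vecs H \<Longrightarrow> w \<in> vecs H \<Longrightarrow> bra H (v + w) = bra H v + bra H w"
  by (auto simp: bra_def ip_add_left fun_eq_iff)

lemma ket_add: "f \<in> dual H \<Longrightarrow> g \<in> dual H \<Longrightarrow> ket H (f + g) = ket H f + ket H g"
  by (metis add_in bra_add bra_ket ket_bra ket_in)

lemma ket_scale: "f \<in> dual H \<Longrightarrow> ket H (z *\<^sub>C f) = cnj z *\<^sub>C ket H f"
  by (metis bra_ket bra_scale complex_cnj_cnj ket_bra ket_in scale_in)

lemma dual_basis_expand:
  assumes f: "f \<in> dual H"
  shows "f = (\<Sum>e\<in>basis H. f e *\<^sub>C bra H e)"
proof (rule dual_cong[OF f])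
  show "(\<Sum>e\<in>basis H. f e *\<^sub>C bra H e) \<in> dual H"
    by (intro complex_vector.subspace_sum subspace_dual complex_vector.subspace_scale) (auto simp: bra_in basis_in)
  fix x assume x: "x \<in> vecs H"
  have "f x = f (\<Sum>e\<in>basis H. ip H e x *\<^sub>C e)" using basis_expand[OF x] by simp
  also have "\<dots> = (\<Sum>e\<in>basis H. f e *\<^sub>C bra H e) x"
    using x f by (subst dual_sum) (auto simp: basis_in dual_scale sum_fun_apply scaleC_fun_apply mult_ac)
  finally show "f x = \<dots>" .
qed

text \<open>Finite dimensional spaces are reflexive: the vector is assembled from the values on the dual basis.\<close>

lemma dual_functional_represented:
  assumes "clinear_on (dual H) UNIV L"
  shows "\<exists>w\<in>vecs H. \<forall>f\<in>dual H. L f = f w"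
proof (intro bexI ballI)
  fix f assume f: "f \<in> dual H"
  have "L f = (\<Sum>e\<in>basis H. f e * L (bra H e))"
    by (subst dual_basis_expand[OF f], subst clinear_on_sum[OF assms subspace_dual])
      (auto simp: clinear_on_scale[OF assms] bra_in basis_in complex_vector.subspace_scale[OF subspace_dual])
  also have "\<dots> = f (\<Sum>e\<in>basis H. L (bra H e) *\<^sub>C e)"
    using f by (subst dual_sum) (auto simp: basis_in dual_scale mult_ac)
  finally show "L f = \<dots>" .
qed (auto intro!: sum_in simp: basis_in)

end

text \<open>The extension is a sum over two orthonormal bases, and it is unique because elementary tensors
  span.  It underlies all descriptions of functionals and operators on a tensor product by their
  values on elementary tensors.\<close>

lemma (in fd_hilbert_space) tensor_extend:
  assumes H: "fd_hilbert_space H1" "fd_hilbert_space H2" and t: "tensor_unitary H1 H2 H t"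
    and W: "complex_vector.subspace W"
    and b1: "\<And>x. x \<in> vecs H1 \<Longrightarrow> clinear_on (vecs H2) W (\<beta> x)"
    and b2: "\<And>y. y \<in> vecs H2 \<Longrightarrow> clinear_on (vecs H1) W (\<lambda>x. \<beta> x y)"
  shows "\<exists>!L. clinear_on (vecs H) W L \<and> (\<forall>w. w \<notin> vecs H \<longrightarrow> L w = 0) \<and>
     (\<forall>x\<in>vecs H1. \<forall>y\<in>vecs H2. L (t x y) = \<beta> x y)"
proof (rule ex_ex1I)
  interpret H1: fd_hilbert_space H1 by fact
  interpret H2: fd_hilbert_space H2 by fact
  have t_in: "t x y \<in> vecs H" if "x \<in> vecs H1" "y \<in> vecs H2" for x y
    using t that by (auto simp: tensor_unitary_def clinear_on_def)
  have t_ip: "ip H (t x y) (t x' y') = ip H1 x x' * ip H2 y y'"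
    if "x \<in> vecs H1" "y \<in> vecs H2" "x' \<in> vecs H1" "y' \<in> vecs H2" for x y x' y'
    using t that by (auto simp: tensor_unitary_def)
  let ?B = "basis H1 \<times> basis H2"
  define L where "L w = (if w \<in> vecs H then \<Sum>(e,e')\<in>?B. ip H (t e e') w *\<^sub>C \<beta> e e' else 0)" for w
  have "clinear_on (vecs H) W L"
  proof (rule clinear_onI)
    fix w assume "w \<in> vecs H"
    then show "L w \<in> W"
      unfolding L_def using clinear_on_in[OF b1]
      by (auto intro!: complex_vector.subspace_sum W complex_vector.subspace_scale simp: H1.basis_in H2.basis_in)
  qed (auto simp: L_def ip_add_right ip_scale_right t_in H1.basis_in H2.basis_in scaleC_add_left sum.distrib
        split_def complex_vector.scale_sum_right intro!: sum.cong simp flip: sum.distrib)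
  moreover have "L (t x y) = \<beta> x y" if xy: "x \<in> vecs H1" "y \<in> vecs H2" for x y
  proof -
    have "\<beta> x y = \<beta> (\<Sum>e\<in>basis H1. ip H1 e x *\<^sub>C e) y"
      using H1.basis_expand[OF xy(1)] by simp
    also have "\<dots> = (\<Sum>e\<in>basis H1. ip H1 e x *\<^sub>C \<beta> e y)"
      by (subst clinear_on_sum[OF b2[OF xy(2)] H1.subspace])
        (auto simp: H1.basis_in clinear_on_scale[OF b2[OF xy(2)]])
    also have "\<dots> = (\<Sum>e\<in>basis H1. \<Sum>e'\<in>basis H2. ip H1 e x *\<^sub>C ip H2 e' y *\<^sub>C \<beta> e e')"
    proof (intro sum.cong refl)
      fix e assume e: "e \<in> basis H1"
      note b = b1[OF H1.basis_in[OF e]]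
      have "\<beta> e y = \<beta> e (\<Sum>e'\<in>basis H2. ip H2 e' y *\<^sub>C e')"
        using H2.basis_expand[OF xy(2)] by simp
      also have "\<dots> = (\<Sum>e'\<in>basis H2. ip H2 e' y *\<^sub>C \<beta> e e')"
        by (subst clinear_on_sum[OF b H2.subspace]) (auto simp: H2.basis_in clinear_on_scale[OF b])
      finally show "ip H1 e x *\<^sub>C \<beta> e y = (\<Sum>e'\<in>basis H2. ip H1 e x *\<^sub>C ip H2 e' y *\<^sub>C \<beta> e e')"
        by (simp add: complex_vector.scale_sum_right)
    qed
    also have "\<dots> = L (t x y)"
      using xy by (auto simp: L_def t_in sum.cartesian_product t_ip H1.basis_in H2.basis_in intro!: sum.cong)
    finally show ?thesis by simp
  qed
  ultimately show "\<exists>L. clinear_on (vecs H) W L \<and> (\<forall>w. w \<notin> vecs H \<longrightarrow> L w = 0) \<and>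
     (\<forall>x\<in>vecs H1. \<forall>y\<in>vecs H2. L (t x y) = \<beta> x y)"
    by (intro exI[of _ L]) (auto simp: L_def)
next
  fix L L'
  assume L: "clinear_on (vecs H) W L \<and> (\<forall>w. w \<notin> vecs H \<longrightarrow> L w = 0) \<and>
     (\<forall>x\<in>vecs H1. \<forall>y\<in>vecs H2. L (t x y) = \<beta> x y)"
    and L': "clinear_on (vecs H) W L' \<and> (\<forall>w. w \<notin> vecs H \<longrightarrow> L' w = 0) \<and>
     (\<forall>x\<in>vecs H1. \<forall>y\<in>vecs H2. L' (t x y) = \<beta> x y)"
  have span: "vecs H = complex_vector.span {t x y |x y. x \<in> vecs H1 \<and> y \<in> vecs H2}"
    using t by (auto simp: tensor_unitary_def)
  show "L = L'"
  proof
    fix w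
    show "L w = L' w"
    proof (cases "w \<in> vecs H")
      case True
      show ?thesis
        by (rule clinear_on_span_eq[of "{t x y |x y. x \<in> vecs H1 \<and> y \<in> vecs H2}" W L W L'])
          (use L L' True span in auto)
    qed (use L L' in auto)
  qed
qed

text \<open>Hermitian symmetry follows from the scalars \<open>1\<close> and \<open>\<i>\<close>.  For the inequality the scalars
  \<open>- r cnj s\<close> with \<open>r\<close> real give a real quadratic polynomial in \<open>r\<close>, whose value at \<open>r = 1 / Re q\<close> is
  the claim; if \<open>Re q = 0\<close>, the polynomial is linear and bounded below only for \<open>s = 0\<close>.\<close>

lemma nonneg_quadratic_form:
  fixes p q s t :: complex
  assumes "q \<in> \<real>\<^sub>\<ge>\<^sub>0" and pos: "\<And>z. p + z * s + cnj z * t + z * cnj z * q \<in> \<real>\<^sub>\<ge>\<^sub>0"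
  shows "t = cnj s" and "(cmod s)\<^sup>2 \<le> Re p * Re q"
proof -
  have q: "q = of_real (Re q)" "Re q \<ge> 0"
    using assms(1) by (auto simp: complex_nonneg_Reals_iff complex_eq_iff)
  have p: "Im p = 0" "Re p \<ge> 0" using pos[of 0] by (auto simp: complex_nonneg_Reals_iff)
  show ts: "t = cnj s"
    using pos[of 1] pos[of \<i>] p q(1) by (auto simp: complex_nonneg_Reals_iff complex_eq_iff)
  have main: "Re p - 2 * r * (cmod s)\<^sup>2 + r\<^sup>2 * (cmod s)\<^sup>2 * Re q \<ge> 0" for r
  proof -
    have "Re (p + z * s + cnj z * t + z * cnj z * q) \<ge> 0" for z
      using pos[of z] by (simp add: complex_nonneg_Reals_iff)
    from this[of "- of_real r * cnj s"] show ?thesis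
      unfolding cmod_power2
      by (subst (asm) q(1), unfold ts) (simp add: power2_eq_square algebra_simps)
  qed
  show "(cmod s)\<^sup>2 \<le> Re p * Re q"
  proof (cases "Re q = 0")
    case False
    with q(2) have "Re q > 0" by simp
    have "Re p - 2 * (1 / Re q) * (cmod s)\<^sup>2 + (1 / Re q)\<^sup>2 * (cmod s)\<^sup>2 * Re q \<ge> 0" by (rule main)
    hence "Re p - (cmod s)\<^sup>2 / Re q \<ge> 0"
      using \<open>Re q > 0\<close> by (simp add: power2_eq_square field_simps)
    thus ?thesis using \<open>Re q > 0\<close> by (simp add: field_simps)
  next
    case True
    have "s = 0"
    proof (rule ccontr)
      assume "s \<noteq> 0"
      hence s: "(cmod s)\<^sup>2 > 0" by simp
      show False using main[of "(Re p + 1) / (2 * (cmod s)\<^sup>2)"] s True by simp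
    qed
    thus ?thesis using True by simp
  qed
qed

context fd_hilbert_space
begin

lemma hnorm_triangle:
  assumes "x \<in> vecs H" "y \<in> vecs H"
  shows "hnorm H (x + y) \<le> hnorm H x + hnorm H y"
proof (rule power2_le_imp_le)
  have "Re (ip H x y) \<le> hnorm H x * hnorm H y"
    using cauchy_schwarz[OF assms] complex_Re_le_cmod order_trans by blast
  moreover have "Re (ip H y x) = Re (ip H x y)" using ip_cnj[OF assms] by simp
  ultimately show "(hnorm H (x + y))\<^sup>2 \<le> (hnorm H x + hnorm H y)\<^sup>2"
    using assms by (simp add: power2_sum hnorm_sq ip_add_left ip_add_right)
qed (use assms in auto)

lemma hnorm_sum_le:
  assumes "\<And>i. i \<in> I \<Longrightarrow> x i \<in> vecs H"
  shows "hnorm H (\<Sum>i\<in>I. x i) \<le> (\<Sum>i\<in>I. hnorm H (x i))"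
  using assms
proof (induction I rule: infinite_finite_induct)
  case (insert i I)
  then show ?case using hnorm_triangle[of "x i" "\<Sum>i\<in>I. x i"] sum_in[of I x] by fastforce
qed auto

text \<open>A positive operator is a sum of rank one operators: subtracting the rank one operator built
  from \<open>T e\<close> keeps positivity, by Cauchy--Schwarz for the form of \<open>T\<close>, and kills one more basis
  vector \<open>e\<close>.\<close>

lemma positive_op_decompose:
  assumes "positive_op H T"
  shows "\<exists>ts. set ts \<subseteq> vecs H \<and> (\<forall>x\<in>vecs H. T x = (\<Sum>t\<leftarrow>ts. ip H t x *\<^sub>C t))"
  using assms
proof (induction "card {e \<in> basis H. T e \<noteq> 0}" arbitrary: T rule: less_induct)
  case less
  have lin: "clinear_on (vecs H) (vecs H) T" and pos: "\<And>x. x \<in> vecs H \<Longrightarrow> ip H x (T x) \<in> \<real>\<^sub>\<ge>\<^sub>0"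
    using less.prems by (auto simp: positive_op_def)
  note T_in [simp] = clinear_on_in[OF lin]
  have form: "ip H y (T x) = cnj (ip H x (T y))" "(cmod (ip H x (T y)))\<^sup>2 \<le> Re (ip H x (T x)) * Re (ip H y (T y))"
    if "x \<in> vecs H" "y \<in> vecs H" for x y
  proof -
    have "ip H (x + z *\<^sub>C y) (T (x + z *\<^sub>C y)) =
        ip H x (T x) + z * ip H x (T y) + cnj z * ip H y (T x) + z * cnj z * ip H y (T y)" for z
      using that by (simp add: clinear_on_add[OF lin] clinear_on_scale[OF lin] ip_add_left ip_add_right
          ip_scale_left ip_scale_right algebra_simps)
    hence "ip H x (T x) + z * ip H x (T y) + cnj z * ip H y (T x) + z * cnj z * ip H y (T y) \<in> \<real>\<^sub>\<ge>\<^sub>0" for z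
      using pos[of "x + z *\<^sub>C y"] that by simp
    from nonneg_quadratic_form[OF pos[OF that(2)] this]
    show "ip H y (T x) = cnj (ip H x (T y))" "(cmod (ip H x (T y)))\<^sup>2 \<le> Re (ip H x (T x)) * Re (ip H y (T y))" .
  qed
  show ?case
  proof (cases "\<exists>e\<in>basis H. T e \<noteq> 0")
    case False
    have "T x = 0" if "x \<in> vecs H" for x
    proof -
      have "T x = T (\<Sum>e\<in>basis H. ip H e x *\<^sub>C e)" using basis_expand[OF that] by simp
      also have "\<dots> = (\<Sum>e\<in>basis H. ip H e x *\<^sub>C T e)"
        by (subst clinear_on_sum[OF lin subspace]) (auto simp: basis_in clinear_on_scale[OF lin])
      finally show ?thesis using False by simp
    qed
    thus ?thesis by (intro exI[of _ "[]"]) auto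
  next
    case True
    then obtain e where e: "e \<in> basis H" "T e \<noteq> 0" by auto
    note e_in = basis_in[OF e(1)]
    define q where "q = Re (ip H e (T e))"
    have q: "ip H e (T e) = of_real q" "q \<ge> 0"
      using pos[OF e_in] by (auto simp: q_def complex_nonneg_Reals_iff complex_eq_iff)
    have "q \<noteq> 0"
    proof
      assume "q = 0"
      hence "cmod (ip H x (T e)) = 0" if "x \<in> vecs H" for x
        using form(2)[OF that e_in] q_def by (simp add: power2_eq_square mult_le_0_iff)
      hence "ip H (T e) (T e) = 0" using e_in by simp
      thus False using e(2) ip_self_eq_0[of "T e"] e_in by simp
    qed
    hence q0: "q > 0" using q by simp
    define t0 where "t0 = of_real (1 / sqrt q) *\<^sub>C T e"
    define T' where "T' x = T x - ip H t0 x *\<^sub>C t0" for x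
    have t0_in [simp]: "t0 \<in> vecs H" using e_in by (simp add: t0_def)
    have t0_ip: "ip H t0 x = of_real (1 / sqrt q) * cnj (ip H x (T e))" if "x \<in> vecs H" for x
      using that e_in ip_cnj[of x "T e"] by (simp add: t0_def ip_scale_left)
    have lin': "clinear_on (vecs H) (vecs H) T'"
      unfolding T'_def using clinear_on_add[OF lin] clinear_on_scale[OF lin]
      by (intro clinear_onI) (auto simp: ip_add_right ip_scale_right scaleC_add_left algebra_simps
          complex_vector.scale_right_diff_distrib)
    have "positive_op H T'"
      unfolding positive_op_def
    proof (intro conjI ballI lin')
      fix x assume x: "x \<in> vecs H"
      have "ip H x (T' x) = ip H x (T x) - ip H t0 x * ip H x t0"
        using x by (simp add: T'_def ip_diff_right ip_scale_right)
      also have "ip H t0 x * ip H x t0 = of_real ((cmod (ip H t0 x))\<^sup>2)"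
        using ip_cnj[of t0 x] x by (simp add: complex_norm_square del: of_real_power)
      also have "(cmod (ip H t0 x))\<^sup>2 = (cmod (ip H x (T e)))\<^sup>2 / q"
        using x q0 by (simp add: t0_ip norm_mult power_mult_distrib norm_divide power_divide)
      finally have "ip H x (T' x) = ip H x (T x) - of_real ((cmod (ip H x (T e)))\<^sup>2 / q)" .
      moreover have "(cmod (ip H x (T e)))\<^sup>2 / q \<le> Re (ip H x (T x))"
        using form(2)[OF x e_in] q0 by (simp add: q_def field_simps)
      ultimately show "ip H x (T' x) \<in> \<real>\<^sub>\<ge>\<^sub>0"
        using pos[OF x] by (simp add: complex_nonneg_Reals_iff)
    qed
    moreover have "{e' \<in> basis H. T' e' \<noteq> 0} \<subset> {e' \<in> basis H. T e' \<noteq> 0}"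
    proof -
      have "T' e = 0"
      proof -
        have "1 / sqrt q * q = sqrt q" using q0 by (simp add: real_div_sqrt)
        hence "ip H t0 e = of_real (sqrt q)"
          using t0_ip[OF e_in] q(1) by (metis complex_cnj_complex_of_real of_real_mult)
        hence "T' e = T e - of_real (sqrt q * (1 / sqrt q)) *\<^sub>C T e"
          unfolding T'_def by (simp add: t0_def flip: of_real_mult)
        thus ?thesis using q0 by simp
      qed
      moreover have "T' e' = 0" if "e' \<in> basis H" "T e' = 0" for e'
      proof -
        have "ip H e' (T e) = cnj (ip H e (T e'))" by (rule form(1)[OF e_in basis_in[OF that(1)]])
        also have "\<dots> = 0" using that e_in by simp
        finally have "ip H t0 e' = 0" using t0_ip[OF basis_in[OF that(1)]] by simp
        thus ?thesis using that by (simp add: T'_def)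
      qed
      ultimately show ?thesis using e by blast
    qed
    hence "card {e' \<in> basis H. T' e' \<noteq> 0} < card {e' \<in> basis H. T e' \<noteq> 0}"
      by (intro psubset_card_mono) auto
    ultimately obtain ts where ts: "set ts \<subseteq> vecs H" "\<forall>x\<in>vecs H. T' x = (\<Sum>t\<leftarrow>ts. ip H t x *\<^sub>C t)"
      using less.hyps by blast
    show ?thesis
      using ts by (intro exI[of _ "t0 # ts"]) (auto simp: T'_def algebra_simps)
  qed
qed

end

section \<open>Maps prescribed on elementary tensors\<close>

text \<open>Bilinear maps are the case where \<open>\<sigma>\<close> is the identity, maps antilinear in both arguments the
  case of complex conjugation.\<close>

definition semibilinear_map ::
  "'v::complex_vector hilb \<Rightarrow> (complex \<Rightarrow> complex) \<Rightarrow> (('v \<Rightarrow> complex) \<Rightarrow> 'v \<Rightarrow> 'w::complex_vector) \<Rightarrow> bool"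
  where
  "semibilinear_map H \<sigma> \<beta> \<longleftrightarrow>
     (\<forall>f\<in>dual H. \<forall>v\<in>vecs H. \<forall>w\<in>vecs H. \<beta> f (v + w) = \<beta> f v + \<beta> f w) \<and>
     (\<forall>f\<in>dual H. \<forall>v\<in>vecs H. \<forall>z. \<beta> f (z *\<^sub>C v) = \<sigma> z *\<^sub>C \<beta> f v) \<and>
     (\<forall>f\<in>dual H. \<forall>g\<in>dual H. \<forall>v\<in>vecs H. \<beta> (f + g) v = \<beta> f v + \<beta> g v) \<and>
     (\<forall>f\<in>dual H. \<forall>v\<in>vecs H. \<forall>z. \<beta> (z *\<^sub>C f) v = \<sigma> z *\<^sub>C \<beta> f v)"

abbreviation bilinear_map :: "'v::complex_vector hilb \<Rightarrow> (('v \<Rightarrow> complex) \<Rightarrow> 'v \<Rightarrow> 'w::complex_vector) \<Rightarrow> bool" where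
  "bilinear_map H \<equiv> semibilinear_map H (\<lambda>z. z)"

abbreviation biantilinear_map :: "'v::complex_vector hilb \<Rightarrow> (('v \<Rightarrow> complex) \<Rightarrow> 'v \<Rightarrow> 'w::complex_vector) \<Rightarrow> bool" where
  "biantilinear_map H \<equiv> semibilinear_map H cnj"

lemma elt_apply: "elt f v x = f x *\<^sub>C v"
  by (simp add: elt_def)

lemma elt_add_right: "elt f (v + w) = elt f v + elt f w"
  and elt_scale_right: "elt f (z *\<^sub>C v) = z *\<^sub>C elt f v"
  and elt_add_left: "elt (f + g) v = elt f v + elt g v"
  and elt_scale_left: "elt (z *\<^sub>C f) v = z *\<^sub>C elt f v"
  by (auto simp: fun_eq_iff elt_apply scaleC_fun_apply scaleC_add_right scaleC_add_left mult.commute)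

context fd_hilbert_space
begin

lemma elt_in: "f \<in> dual H \<Longrightarrow> v \<in> vecs H \<Longrightarrow> elt f v \<in> dual_tensor H"
  unfolding dual_tensor_def by (intro complex_vector.span_base) auto

lemma subspace_dual_tensor: "complex_vector.subspace (dual_tensor H)"
  by (simp add: dual_tensor_def complex_vector.subspace_span)

lemma dual_tensor_in: "t \<in> dual_tensor H \<Longrightarrow> t x \<in> vecs H"
  unfolding dual_tensor_def
  by (induction t rule: complex_vector.span_induct_alt) (auto simp: scaleC_fun_apply elt_apply)

text \<open>This decomposition of \<open>t\<close> depends linearly on \<open>t\<close>, so it can be used to prescribe maps.\<close>

lemma dual_tensor_expand:
  assumes "t \<in> dual_tensor H"
  shows "t = (\<Sum>e\<in>basis H. elt (bra H e) (t e))"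
  using assms unfolding dual_tensor_def
proof (induction t rule: complex_vector.span_induct_alt)
  case base
  show ?case by (auto simp: fun_eq_iff sum_fun_apply scaleC_fun_apply elt_apply)
next
  case (step c x y)
  from step(1) obtain f v where x: "x = elt f v" and f: "f \<in> dual H" and v: "v \<in> vecs H" by auto
  have "x = (\<Sum>e\<in>basis H. elt (bra H e) (x e))"
  proof
    fix u
    have "f u = (\<Sum>e\<in>basis H. f e *\<^sub>C bra H e) u"
      by (rule fun_cong[OF dual_basis_expand[OF f]])
    thus "x u = (\<Sum>e\<in>basis H. elt (bra H e) (x e)) u"
      by (simp add: x sum_fun_apply scaleC_fun_apply elt_apply complex_vector.scale_sum_left mult.commute)
  qed
  hence "c *\<^sub>C x + y = c *\<^sub>C (\<Sum>e\<in>basis H. elt (bra H e) (x e)) + (\<Sum>e\<in>basis H. elt (bra H e) (y e))"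
    by (rule arg_cong2[where f = "\<lambda>x y. c *\<^sub>C x + y", OF _ step(2)])
  also have "\<dots> = (\<Sum>e\<in>basis H. elt (bra H e) ((c *\<^sub>C x + y) e))"
    by (auto simp: fun_eq_iff sum_fun_apply scaleC_fun_apply elt_apply scaleC_add_right sum.distrib complex_vector.scale_sum_right mult_ac)
  finally show ?case .
qed

text \<open>Expand \<open>f\<close> in the dual basis and move the scalars to the vector: the result depends on \<open>f\<close> and
  \<open>v\<close> only through the rank one map \<open>elt f v\<close>.\<close>

lemma semibilinear_map_expand:
  assumes "semibilinear_map H \<sigma> \<beta>" "f \<in> dual H" "v \<in> vecs H"
  shows "\<beta> f v = (\<Sum>e\<in>basis H. \<beta> (bra H e) (f e *\<^sub>C v))"
proof -
  have add: "\<beta> (f + g) v = \<beta> f v + \<beta> g v" if "f \<in> dual H" "g \<in> dual H" for f g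
    using assms that by (auto simp: semibilinear_map_def)
  have "0 \<in> dual H" by (rule complex_vector.subspace_0[OF subspace_dual])
  hence zero: "\<beta> 0 v = 0" using add[of 0 0] by simp
  have bra': "f e *\<^sub>C bra H e \<in> dual H" if "e \<in> basis H" for e
    using that by (intro complex_vector.subspace_scale subspace_dual) (auto simp: bra_in basis_in)
  have "\<beta> f v = \<beta> (\<Sum>e\<in>basis H. f e *\<^sub>C bra H e) v"
    by (rule arg_cong[OF dual_basis_expand[OF assms(2)]])
  also have "\<dots> = (\<Sum>e\<in>basis H. \<beta> (f e *\<^sub>C bra H e) v)"
  proof -
    have "\<beta> (\<Sum>e\<in>A. f e *\<^sub>C bra H e) v = (\<Sum>e\<in>A. \<beta> (f e *\<^sub>C bra H e) v)" if "finite A" "A \<subseteq> basis H" for A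
      using that
    proof (induction A rule: finite_induct)
      case (insert a A)
      have "(\<Sum>e\<in>A. f e *\<^sub>C bra H e) \<in> dual H"
        using bra' insert by (intro complex_vector.subspace_sum subspace_dual) auto
      moreover have "f a *\<^sub>C bra H a \<in> dual H" using bra' insert by auto
      moreover have "(\<Sum>e\<in>insert a A. f e *\<^sub>C bra H e) = f a *\<^sub>C bra H a + (\<Sum>e\<in>A. f e *\<^sub>C bra H e)"
        using insert by (intro sum.insert) auto
      ultimately have "\<beta> (\<Sum>e\<in>insert a A. f e *\<^sub>C bra H e) v = \<beta> (f a *\<^sub>C bra H a) v + \<beta> (\<Sum>e\<in>A. f e *\<^sub>C bra H e) v"
        by (simp only: add)
      also have "\<beta> (\<Sum>e\<in>A. f e *\<^sub>C bra H e) v = (\<Sum>e\<in>A. \<beta> (f e *\<^sub>C bra H e) v)"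
        using insert by blast
      finally show ?case using insert by (simp only: sum.insert not_False_eq_True)
    qed (simp add: zero)
    thus ?thesis by simp
  qed
  also have "\<dots> = (\<Sum>e\<in>basis H. \<beta> (bra H e) (f e *\<^sub>C v))"
    using assms(1,3) by (intro sum.cong) (auto simp: semibilinear_map_def bra_in basis_in)
  finally show ?thesis .
qed

text \<open>By the previous formula every decomposition into elementary tensors gives the right hand side.\<close>

lemma bilin_ext_expand:
  assumes \<beta>: "semibilinear_map H \<sigma> \<beta>" and t: "t \<in> dual_tensor H"
  shows "bilin_ext H \<beta> t = (\<Sum>e\<in>basis H. \<beta> (bra H e) (t e))"
  unfolding bilin_ext_def
proof (rule the_equality)
  note exp = semibilinear_map_expand[OF \<beta>]
  have add: "\<beta> (bra H e) (v + w) = \<beta> (bra H e) v + \<beta> (bra H e) w"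
    if "e \<in> basis H" "v \<in> vecs H" "w \<in> vecs H" for e v w
    using \<beta> that bra_in[OF basis_in[OF that(1)]] by (simp add: semibilinear_map_def)
  obtain es where es: "set es = basis H" "distinct es"
    using finite_distinct_list[OF finite_basis] by auto
  have S: "(\<Sum>x\<leftarrow>es. g x) = (\<Sum>x\<in>basis H. g x)" for g :: "'v \<Rightarrow> 'x::comm_monoid_add"
    using es by (metis sum.distinct_set_conv_list)
  show "\<exists>ps. set ps \<subseteq> dual H \<times> vecs H \<and> t = (\<Sum>(f, v)\<leftarrow>ps. elt f v) \<and>
      (\<Sum>e\<in>basis H. \<beta> (bra H e) (t e)) = (\<Sum>(f, v)\<leftarrow>ps. \<beta> f v)"
    using t dual_tensor_expand[OF t]
    by (intro exI[of _ "map (\<lambda>e. (bra H e, t e)) es"])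
      (auto simp: es comp_def S bra_in basis_in dual_tensor_in)
  fix s assume "\<exists>ps. set ps \<subseteq> dual H \<times> vecs H \<and> t = (\<Sum>(f, v)\<leftarrow>ps. elt f v) \<and> s = (\<Sum>(f, v)\<leftarrow>ps. \<beta> f v)"
  then obtain ps where ps: "set ps \<subseteq> dual H \<times> vecs H" "t = (\<Sum>(f, v)\<leftarrow>ps. elt f v)" "s = (\<Sum>(f, v)\<leftarrow>ps. \<beta> f v)"
    by auto
  have zero: "\<beta> (bra H e) 0 = 0" if "e \<in> basis H" for e
    using add[OF that, of 0 0] by simp
  have "(\<Sum>(f, v)\<leftarrow>ps. \<beta> f v) = (\<Sum>e\<in>basis H. \<beta> (bra H e) ((\<Sum>(f, v)\<leftarrow>ps. elt f v) e))
    \<and> (\<forall>e. (\<Sum>(f, v)\<leftarrow>ps. elt f v) e \<in> vecs H)"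
    using ps(1)
  proof (induction ps)
    case (Cons p ps)
    obtain f v where p: "p = (f, v)" by (cases p)
    have IH: "(\<Sum>(f, v)\<leftarrow>ps. \<beta> f v) = (\<Sum>e\<in>basis H. \<beta> (bra H e) ((\<Sum>(f, v)\<leftarrow>ps. elt f v) e))"
      "\<And>e. (\<Sum>(f, v)\<leftarrow>ps. elt f v) e \<in> vecs H"
      using Cons by auto
    have fv: "f \<in> dual H" "v \<in> vecs H" using Cons.prems p by auto
    have cons: "(\<Sum>(f, v)\<leftarrow>p # ps. elt f v) e = f e *\<^sub>C v + (\<Sum>(f, v)\<leftarrow>ps. elt f v) e" for e
      by (simp only: p list.map sum_list.Cons split_conv plus_fun_apply elt_apply)
    have "(\<Sum>(f, v)\<leftarrow>p # ps. \<beta> f v) = \<beta> f v + (\<Sum>(f, v)\<leftarrow>ps. \<beta> f v)"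
      by (simp add: p)
    also have "\<dots> = (\<Sum>e\<in>basis H. \<beta> (bra H e) (f e *\<^sub>C v)) + (\<Sum>e\<in>basis H. \<beta> (bra H e) ((\<Sum>(f, v)\<leftarrow>ps. elt f v) e))"
      by (simp only: IH(1) exp[OF fv])
    also have "\<dots> = (\<Sum>e\<in>basis H. \<beta> (bra H e) ((\<Sum>(f, v)\<leftarrow>p # ps. elt f v) e))"
      unfolding cons sum.distrib[symmetric] using IH(2) fv by (intro sum.cong refl add[symmetric]) auto
    finally show ?case
      unfolding cons using IH(2) fv by (intro conjI allI) (simp, intro add_in scale_in)
  qed (simp add: zero)
  thus "s = (\<Sum>e\<in>basis H. \<beta> (bra H e) (t e))" using ps by simp
qed

lemma bilin_ext_sum:
  assumes \<beta>: "semibilinear_map H \<sigma> \<beta>" and fv: "\<And>i. i \<in> I \<Longrightarrow> f i \<in> dual H" "\<And>i. i \<in> I \<Longrightarrow> v i \<in> vecs H"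
  shows "bilin_ext H \<beta> (\<Sum>i\<in>I. c i *\<^sub>C elt (f i) (v i)) = (\<Sum>i\<in>I. \<sigma> (c i) *\<^sub>C \<beta> (f i) (v i))"
proof -
  have add: "\<beta> (bra H e) (x + y) = \<beta> (bra H e) x + \<beta> (bra H e) y" and sc: "\<beta> (bra H e) (z *\<^sub>C x) = \<sigma> z *\<^sub>C \<beta> (bra H e) x"
    if "e \<in> basis H" "x \<in> vecs H" "y \<in> vecs H" for e x y z
    using \<beta> bra_in[OF basis_in[OF that(1)]] that by (simp_all add: semibilinear_map_def)
  have zero: "\<beta> (bra H e) 0 = 0" if "e \<in> basis H" for e
    using add[OF that zero_in zero_in] by simp
  have "bilin_ext H \<beta> (\<Sum>i\<in>I. c i *\<^sub>C elt (f i) (v i)) =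
      (\<Sum>e\<in>basis H. \<beta> (bra H e) ((\<Sum>i\<in>I. c i *\<^sub>C elt (f i) (v i)) e))"
    by (intro bilin_ext_expand[OF \<beta>] complex_vector.subspace_sum complex_vector.subspace_scale subspace_dual_tensor elt_in fv)
  also have "\<dots> = (\<Sum>e\<in>basis H. \<Sum>i\<in>I. \<sigma> (c i) *\<^sub>C \<beta> (bra H e) (f i e *\<^sub>C v i))"
  proof (rule sum.cong[OF refl])
    fix e assume e: "e \<in> basis H"
    have "(\<Sum>i\<in>I. c i *\<^sub>C elt (f i) (v i)) e = (\<Sum>i\<in>I. c i *\<^sub>C (f i e *\<^sub>C v i))"
      by (simp only: sum_fun_apply scaleC_fun_apply elt_apply)
    hence "\<beta> (bra H e) ((\<Sum>i\<in>I. c i *\<^sub>C elt (f i) (v i)) e) = \<beta> (bra H e) (\<Sum>i\<in>I. c i *\<^sub>C (f i e *\<^sub>C v i))"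
      by (simp only:)
    also have "\<dots> = (\<Sum>i\<in>I. \<beta> (bra H e) (c i *\<^sub>C (f i e *\<^sub>C v i)))"
      using fv(2)
    proof (induction I rule: infinite_finite_induct)
      case (insert i I)
      have "(\<Sum>i\<in>I. c i *\<^sub>C (f i e *\<^sub>C v i)) \<in> vecs H" "c i *\<^sub>C (f i e *\<^sub>C v i) \<in> vecs H"
        using insert.prems by (auto intro!: sum_in scale_in)
      thus ?case using insert add[OF e] by simp
    qed (simp_all add: zero[OF e])
    also have "\<dots> = (\<Sum>i\<in>I. \<sigma> (c i) *\<^sub>C \<beta> (bra H e) (f i e *\<^sub>C v i))"
      by (intro sum.cong refl sc[OF e _ zero_in] scale_in fv)
    finally show "\<beta> (bra H e) ((\<Sum>i\<in>I. c i *\<^sub>C elt (f i) (v i)) e) = (\<Sum>i\<in>I. \<sigma> (c i) *\<^sub>C \<beta> (bra H e) (f i e *\<^sub>C v i))" .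
  qed
  also have "\<dots> = (\<Sum>i\<in>I. \<sigma> (c i) *\<^sub>C (\<Sum>e\<in>basis H. \<beta> (bra H e) (f i e *\<^sub>C v i)))"
    by (subst sum.swap) (simp add: complex_vector.scale_sum_right)
  also have "\<dots> = (\<Sum>i\<in>I. \<sigma> (c i) *\<^sub>C \<beta> (f i) (v i))"
    by (intro sum.cong refl) (simp only: semibilinear_map_expand[OF \<beta> fv, symmetric])
  finally show ?thesis .
qed

end

lemma bilinear_map_cong:
  assumes "bilinear_map H \<beta>" "\<And>f v. f \<in> dual H \<Longrightarrow> v \<in> vecs H \<Longrightarrow> \<gamma> f v = \<beta> f v" "fd_hilbert_space H"
  shows "bilinear_map H \<gamma>"
proof -
  interpret fd_hilbert_space H by fact
  show ?thesis
    using assms(1,2) unfolding semibilinear_map_def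
    by (auto simp: complex_vector.subspace_add[OF subspace_dual] complex_vector.subspace_scale[OF subspace_dual])
qed

section \<open>Diagonal multipliers and their blocks\<close>

definition op_bound :: "'v hilb \<Rightarrow> ('v \<Rightarrow> 'v) \<Rightarrow> real \<Rightarrow> bool" where
  "op_bound H T k \<longleftrightarrow> (\<forall>x\<in>vecs H. hnorm H (T x) \<le> k * hnorm H x)"

abbreviation dev :: "('v \<Rightarrow> 'v::complex_vector) \<Rightarrow> 'v \<Rightarrow> 'v" where
  "dev T \<equiv> (\<lambda>x. T x - x)"

text \<open>Operator bounds are read off from matrix coefficients, so they pass through a (possibly
  conjugated and transposed) unitary equivalence.\<close>

lemma op_bound_iff_form:
  assumes "fd_hilbert_space H" "\<And>x. x \<in> vecs H \<Longrightarrow> T x \<in> vecs H" "k \<ge> 0"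
  shows "op_bound H T k \<longleftrightarrow> (\<forall>x\<in>vecs H. \<forall>y\<in>vecs H. cmod (ip H x (T y)) \<le> k * hnorm H x * hnorm H y)"
proof -
  interpret fd_hilbert_space H by fact
  show ?thesis
  proof
    assume b: "op_bound H T k"
    show "\<forall>x\<in>vecs H. \<forall>y\<in>vecs H. cmod (ip H x (T y)) \<le> k * hnorm H x * hnorm H y"
    proof (intro ballI)
      fix x y assume xy: "x \<in> vecs H" "y \<in> vecs H"
      have "cmod (ip H x (T y)) \<le> hnorm H x * hnorm H (T y)"
        using cauchy_schwarz xy assms(2) by blast
      also have "\<dots> \<le> hnorm H x * (k * hnorm H y)"
        using b xy by (intro mult_left_mono) (auto simp: op_bound_def)
      finally show "cmod (ip H x (T y)) \<le> k * hnorm H x * hnorm H y" by (simp add: mult_ac)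
    qed
  next
    assume b: "\<forall>x\<in>vecs H. \<forall>y\<in>vecs H. cmod (ip H x (T y)) \<le> k * hnorm H x * hnorm H y"
    show "op_bound H T k"
      unfolding op_bound_def
    proof
      fix x assume x: "x \<in> vecs H"
      have "(hnorm H (T x))\<^sup>2 \<le> k * hnorm H (T x) * hnorm H x"
      proof -
        have "cmod (ip H (T x) (T x)) \<le> k * hnorm H (T x) * hnorm H x"
          using b assms(2)[OF x] x by blast
        thus ?thesis using ip_self[OF assms(2)[OF x]] by (simp add: norm_power)
      qed
      hence "hnorm H (T x) * (hnorm H (T x)) \<le> hnorm H (T x) * (k * hnorm H x)"
        by (simp add: power2_eq_square mult_ac)
      moreover have "0 \<le> k * hnorm H x" using assms(3) x by simp
      moreover have "hnorm H (T x) \<ge> 0" using assms(2) x by simp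
      ultimately show "hnorm H (T x) \<le> k * hnorm H x"
        by (metis mult_le_cancel_left_pos order_le_less)
    qed
  qed
qed

lemma op_bound_transpose:
  assumes H: "fd_hilbert_space H" "fd_hilbert_space H'" and k: "k \<ge> 0"
    and T: "\<And>x. x \<in> vecs H \<Longrightarrow> T x \<in> vecs H" and T': "\<And>x. x \<in> vecs H' \<Longrightarrow> T' x \<in> vecs H'"
    and U: "U ` vecs H' = vecs H"
    and iso: "\<And>x y. x \<in> vecs H' \<Longrightarrow> y \<in> vecs H' \<Longrightarrow> ip H' x y = ip H (U x) (U y)"
    and form: "\<And>x y. x \<in> vecs H' \<Longrightarrow> y \<in> vecs H' \<Longrightarrow> ip H' x (T' y) = cnj (ip H (U y) (T (U x)))"
  shows "op_bound H' T' k \<longleftrightarrow> op_bound H T k"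
proof -
  have n: "hnorm H' x = hnorm H (U x)" if "x \<in> vecs H'" for x
    using iso[OF that that] by (simp add: hnorm_def)
  have "op_bound H' T' k \<longleftrightarrow> (\<forall>x\<in>vecs H'. \<forall>y\<in>vecs H'. cmod (ip H (U y) (T (U x))) \<le> k * hnorm H (U y) * hnorm H (U x))"
    by (subst op_bound_iff_form[OF H(2) T' k]) (auto simp: form n mult_ac)
  also have "\<dots> \<longleftrightarrow> (\<forall>x\<in>vecs H. \<forall>y\<in>vecs H. cmod (ip H x (T y)) \<le> k * hnorm H x * hnorm H y)"
    unfolding U[symmetric] by blast
  also have "\<dots> \<longleftrightarrow> op_bound H T k"
    using op_bound_iff_form[OF H(1) T k] by simp
  finally show ?thesis .
qed

definition single :: "'o \<Rightarrow> 'v::zero \<Rightarrow> 'o \<Rightarrow> 'v" where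
  "single a x = (\<lambda>_. 0)(a := x)"

lemma single_apply: "single a x b = (if b = a then x else 0)"
  by (simp add: single_def)

locale hilbert_family =
  fixes I :: "'o set" and V :: "'o \<Rightarrow> 'v::complex_vector hilb"
  assumes fd: "fd_hilbert_space (V a)"
begin

sublocale V: fd_hilbert_space "V a" for a by (rule fd)

abbreviation sq :: "('o \<Rightarrow> 'v) \<Rightarrow> 'o \<Rightarrow> real" where
  "sq v a \<equiv> (hnorm (V a) (v a))\<^sup>2"

text \<open>The summands of the definition become squares of norms, to which the tools for sums of nonnegative reals apply.\<close>

lemma l2sum_iff: "v \<in> l2sum I V \<longleftrightarrow> (\<forall>a\<in>I. v a \<in> vecs (V a)) \<and> (\<forall>a. a \<notin> I \<longrightarrow> v a = 0) \<and> sq v summable_on I"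
proof -
  have "(\<lambda>a. Re (ip (V a) (v a) (v a))) summable_on I \<longleftrightarrow> sq v summable_on I" if "\<forall>a\<in>I. v a \<in> vecs (V a)"
    using that by (intro summable_on_cong) (auto simp: V.hnorm_sq)
  thus ?thesis unfolding l2sum_def by blast
qed

lemma l2sumD:
  assumes "v \<in> l2sum I V"
  shows "\<And>a. a \<in> I \<Longrightarrow> v a \<in> vecs (V a)" "\<And>a. a \<notin> I \<Longrightarrow> v a = 0" "sq v summable_on I"
  using assms by (auto simp: l2sum_iff)

lemma l2norm_sq:
  assumes "\<And>a. a \<in> I \<Longrightarrow> v a \<in> vecs (V a)"
  shows "(l2norm I V v)\<^sup>2 = (\<Sum>\<^sub>\<infinity>a\<in>I. sq v a)"
proof -
  have "(\<Sum>\<^sub>\<infinity>a\<in>I. Re (ip (V a) (v a) (v a))) = (\<Sum>\<^sub>\<infinity>a\<in>I. sq v a)"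
    using assms by (intro infsum_cong) (auto simp: V.hnorm_sq)
  thus ?thesis by (simp add: l2norm_def infsum_nonneg)
qed

lemma l2norm_nonneg: "(\<And>a. a \<in> I \<Longrightarrow> v a \<in> vecs (V a)) \<Longrightarrow> l2norm I V v \<ge> 0"
proof -
  assume v: "\<And>a. a \<in> I \<Longrightarrow> v a \<in> vecs (V a)"
  have "(\<Sum>\<^sub>\<infinity>a\<in>I. Re (ip (V a) (v a) (v a))) = (\<Sum>\<^sub>\<infinity>a\<in>I. sq v a)"
    using v by (intro infsum_cong) (auto simp: V.hnorm_sq)
  thus ?thesis by (simp add: l2norm_def infsum_nonneg)
qed

lemma diff_in_l2sum:
  assumes "v \<in> l2sum I V" "w \<in> l2sum I V"
  shows "v - w \<in> l2sum I V"
proof -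
  note v = l2sumD[OF assms(1)] and w = l2sumD[OF assms(2)]
  have "(\<lambda>a. 2 * sq v a + 2 * sq w a) summable_on I"
    by (intro summable_on_add summable_on_cmult_right v w)
  hence "sq (v - w) summable_on I"
    by (rule summable_on_comparison_test) (auto intro!: V.hnorm_diff_sq_le v w)
  thus ?thesis using v w by (auto simp: l2sum_iff)
qed

lemma hnorm_block_le:
  assumes "v \<in> l2sum I V" "a \<in> I"
  shows "hnorm (V a) (v a) \<le> l2norm I V v"
proof (rule power2_le_imp_le)
  have "(\<Sum>b\<in>{a}. sq v b) \<le> (\<Sum>\<^sub>\<infinity>b\<in>I. sq v b)"
    using assms by (intro finite_sum_le_infsum l2sumD(3)) auto
  thus "sq v a \<le> (l2norm I V v)\<^sup>2"
    using l2norm_sq[of v] l2sumD(1)[OF assms(1)] by simp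
qed (use l2norm_nonneg[of v] l2sumD(1)[OF assms(1)] in auto)

lemma single_in_l2sum:
  assumes "a \<in> I" "x \<in> vecs (V a)"
  shows "single a x \<in> l2sum I V" and l2norm_single: "l2norm I V (single a x) = hnorm (V a) x"
proof -
  have hs: "(sq (single a x) has_sum (hnorm (V a) x)\<^sup>2) I"
  proof -
    have "(sq (single a x) has_sum (\<Sum>b\<in>{a}. sq (single a x) b)) {a}" by (rule has_sum_finite) simp
    hence "(sq (single a x) has_sum (hnorm (V a) x)\<^sup>2) {a}" by (simp add: single_apply)
    thus ?thesis
      by (rule has_sum_cong_neutral[THEN iffD1, rotated -1]) (use assms in \<open>auto simp: single_apply\<close>)
  qed
  have blocks: "single a x b \<in> vecs (V b)" for b using assms by (auto simp: single_apply)
  show "single a x \<in> l2sum I V"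
    using hs blocks assms(1) by (auto simp: l2sum_iff single_apply has_sum_imp_summable)
  have "(l2norm I V (single a x))\<^sup>2 = (hnorm (V a) x)\<^sup>2"
    using l2norm_sq[of "single a x"] blocks infsumI[OF hs] by simp
  thus "l2norm I V (single a x) = hnorm (V a) x"
    using l2norm_nonneg[of "single a x"] blocks assms by (simp add: power2_eq_iff_nonneg)
qed

text \<open>The norm bound is part of the notion since the blockwise criteria for convergence and compactness rest on it.\<close>

definition contractive :: "('o \<Rightarrow> 'v \<Rightarrow> 'v) \<Rightarrow> bool" where
  "contractive m \<longleftrightarrow> (\<forall>a\<in>I. clinear_on (vecs (V a)) (vecs (V a)) (m a) \<and> op_bound (V a) (m a) 1)"

context
  fixes m
  assumes m: "contractive m"
begin

lemma m_linear: "a \<in> I \<Longrightarrow> clinear_on (vecs (V a)) (vecs (V a)) (m a)"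
  using m by (auto simp: contractive_def)

lemma m_in: "a \<in> I \<Longrightarrow> x \<in> vecs (V a) \<Longrightarrow> m a x \<in> vecs (V a)"
  using clinear_on_in[OF m_linear] .

lemma m_zero: "a \<in> I \<Longrightarrow> m a 0 = 0"
  using clinear_on_zero[OF m_linear V.subspace] .

lemma m_bound: "a \<in> I \<Longrightarrow> x \<in> vecs (V a) \<Longrightarrow> hnorm (V a) (m a x) \<le> hnorm (V a) x"
  using m by (auto simp: contractive_def op_bound_def)

lemma diag_in_l2sum:
  assumes "v \<in> l2sum I V"
  shows "diag_op I m v \<in> l2sum I V"
proof -
  note v = l2sumD[OF assms]
  have "sq (diag_op I m v) summable_on I"
    by (rule summable_on_comparison_test[OF v(3)])
      (auto intro!: power_mono m_bound v V.hnorm_nonneg m_in simp: diag_op_def)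
  thus ?thesis using v m_in by (auto simp: l2sum_iff diag_op_def)
qed

lemma diag_single: "a \<in> I \<Longrightarrow> diag_op I m (single a x) = single a (m a x)"
  by (auto simp: diag_op_def single_apply fun_eq_iff m_zero)

text \<open>Only finitely many blocks are nonzero: a nonzero value from each nonzero block gives a linearly
  independent family in the range.\<close>

lemma finite_rank_iff: "finite_rank I V m \<longleftrightarrow> finite {a \<in> I. \<not> op_bound (V a) (m a) 0}"
proof -
  let ?A = "{a \<in> I. \<not> op_bound (V a) (m a) 0}"
  have zero: "m a x = 0" if "a \<in> I" "a \<notin> ?A" "x \<in> vecs (V a)" for a x
  proof -
    have "hnorm (V a) (m a x) \<le> 0" using that by (auto simp: op_bound_def)
    moreover have "m a x \<in> vecs (V a)" using that m_in by blast
    ultimately show ?thesis using V.hnorm_eq_0 V.hnorm_nonneg by (metis order_antisym)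
  qed
  show ?thesis
  proof
    assume fin: "finite ?A"
    let ?B = "\<Union>a\<in>?A. single a ` basis (V a)"
    have "diag_op I m v \<in> complex_vector.span ?B" if v: "v \<in> l2sum I V" for v
    proof -
      have "diag_op I m v = (\<Sum>a\<in>?A. single a (m a (v a)))"
      proof
        fix b
        have "(\<Sum>a\<in>?A. single a (m a (v a)) b) = (\<Sum>a\<in>?A. if a = b then m b (v b) else 0)"
          by (intro sum.cong) (auto simp: single_apply)
        also have "\<dots> = diag_op I m v b"
          using fin zero[of b] l2sumD(1)[OF v] by (auto simp: diag_op_def)
        finally show "diag_op I m v b = (\<Sum>a\<in>?A. single a (m a (v a))) b" by (simp add: sum_fun_apply)
      qed
      also have "\<dots> \<in> complex_vector.span ?B"
      proof (intro complex_vector.span_sum)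
        fix a assume a: "a \<in> ?A"
        define y where "y = m a (v a)"
        have y: "y \<in> vecs (V a)" using a l2sumD(1)[OF v] m_in by (auto simp: y_def)
        have "single a y = single a (\<Sum>e\<in>basis (V a). ip (V a) e y *\<^sub>C e)" using V.basis_expand[OF y] by simp
        also have "\<dots> = (\<Sum>e\<in>basis (V a). ip (V a) e y *\<^sub>C single a e)"
          by (auto simp: fun_eq_iff sum_fun_apply single_apply scaleC_fun_apply)
        also have "\<dots> \<in> complex_vector.span ?B"
          using a by (intro complex_vector.span_sum complex_vector.span_scale complex_vector.span_base) auto
        finally show "single a (m a (v a)) \<in> complex_vector.span ?B" by (simp add: y_def)
      qed
      finally show ?thesis .
    qed
    moreover have "finite ?B" using fin by auto
    ultimately show "finite_rank I V m" unfolding finite_rank_def by blast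
  next
    assume "finite_rank I V m"
    then obtain B where B: "finite B" "diag_op I m ` l2sum I V \<subseteq> complex_vector.span B"
      by (auto simp: finite_rank_def)
    have "\<forall>a\<in>?A. \<exists>x. x \<in> vecs (V a) \<and> m a x \<noteq> 0"
    proof
      fix a assume "a \<in> ?A"
      then obtain x where x: "x \<in> vecs (V a)" "\<not> hnorm (V a) (m a x) \<le> 0 * hnorm (V a) x"
        by (auto simp: op_bound_def)
      hence "m a x \<noteq> 0" by auto
      thus "\<exists>x. x \<in> vecs (V a) \<and> m a x \<noteq> 0" using x by blast
    qed
    from bchoice[OF this] obtain x where x: "\<And>a. a \<in> ?A \<Longrightarrow> x a \<in> vecs (V a)" "\<And>a. a \<in> ?A \<Longrightarrow> m a (x a) \<noteq> 0"
      by blast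
    define s where "s a = single a (m a (x a))" for a
    have inj: "inj_on s ?A"
    proof (rule inj_onI)
      fix a b assume ab: "a \<in> ?A" "b \<in> ?A" "s a = s b"
      hence "s a a = s b a" by simp
      thus "a = b" using x(2)[OF ab(1)] by (auto simp: s_def single_apply split: if_splits)
    qed
    have "complex_vector.independent (s ` ?A)"
      unfolding complex_vector.dependent_explicit
    proof clarsimp
      fix t u z assume t: "finite t" "t \<subseteq> s ` ?A" "(\<Sum>v\<in>t. u v *\<^sub>C v) = 0" and z: "z \<in> t"
      obtain a where a: "a \<in> ?A" "z = s a" using t z by auto
      have "0 = (\<Sum>v\<in>t. u v *\<^sub>C v) a" using t(3) by simp
      also have "\<dots> = (\<Sum>v\<in>t. if v = z then u z *\<^sub>C z a else 0)"
        unfolding sum_fun_apply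
      proof (rule sum.cong[OF refl])
        fix v assume "v \<in> t"
        then obtain b where b: "b \<in> ?A" "v = s b" using t by auto
        show "(u v *\<^sub>C v) a = (if v = z then u z *\<^sub>C z a else 0)"
        proof (cases "v = z")
          case False
          hence "a \<noteq> b" using a b by auto
          thus ?thesis using b False by (simp add: scaleC_fun_apply s_def single_apply)
        qed (simp add: scaleC_fun_apply)
      qed
      also have "\<dots> = u z *\<^sub>C z a" using t(1) z by simp
      finally have "u z *\<^sub>C m a (x a) = 0" using a by (simp add: s_def single_apply)
      thus "u z = 0" using x(2)[OF a(1)] complex_vector.scale_eq_0_iff by blast
    qed
    moreover have "s ` ?A \<subseteq> complex_vector.span B"
    proof
      fix y assume "y \<in> s ` ?A"
      then obtain a where a: "a \<in> ?A" "y = s a" by auto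
      have "y = diag_op I m (single a (x a))" using a by (simp add: s_def diag_single)
      thus "y \<in> complex_vector.span B" using B(2) single_in_l2sum[of a "x a"] a x(1)[OF a(1)] by auto
    qed
    ultimately have "finite (s ` ?A)" using complex_vector.independent_span_bound[OF B(1)] by blast
    thus "finite ?A" using inj finite_imageD by blast
  qed
qed

lemma uniform_bound_iff:
  assumes "e \<ge> 0"
  shows "(\<forall>v\<in>l2sum I V. l2norm I V (diag_op I m v - v) \<le> e * l2norm I V v) \<longleftrightarrow>
    (\<forall>a\<in>I. op_bound (V a) (dev (m a)) e)"
proof (intro iffI ballI)
  fix a assume unif: "\<forall>v\<in>l2sum I V. l2norm I V (diag_op I m v - v) \<le> e * l2norm I V v" and a: "a \<in> I"
  show "op_bound (V a) (dev (m a)) e"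
    unfolding op_bound_def
  proof
    fix x assume x: "x \<in> vecs (V a)"
    have "diag_op I m (single a x) - single a x = single a (m a x - x)"
      using a by (auto simp: diag_single fun_eq_iff single_apply)
    thus "hnorm (V a) (m a x - x) \<le> e * hnorm (V a) x"
      using unif single_in_l2sum[OF a x] l2norm_single[OF a x] l2norm_single[of a "m a x - x"] a x m_in[OF a x]
      by fastforce
  qed
next
  fix v assume b: "\<forall>a\<in>I. op_bound (V a) (dev (m a)) e" and v: "v \<in> l2sum I V"
  let ?w = "diag_op I m v - v"
  note vD = l2sumD[OF v]
  have w: "?w \<in> l2sum I V" using diff_in_l2sum diag_in_l2sum v by blast
  show "l2norm I V ?w \<le> e * l2norm I V v"
  proof (rule power2_le_imp_le)
    have "(l2norm I V ?w)\<^sup>2 = (\<Sum>\<^sub>\<infinity>a\<in>I. sq ?w a)"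
      by (intro l2norm_sq l2sumD[OF w])
    also have "\<dots> \<le> (\<Sum>\<^sub>\<infinity>a\<in>I. e\<^sup>2 * sq v a)"
    proof (intro infsum_mono summable_on_cmult_right vD l2sumD(3)[OF w])
      fix a assume a: "a \<in> I"
      have "hnorm (V a) (?w a) \<le> e * hnorm (V a) (v a)"
        using b a vD(1)[OF a] by (auto simp: op_bound_def diag_op_def)
      hence "sq ?w a \<le> (e * hnorm (V a) (v a))\<^sup>2"
        using l2sumD(1)[OF w a] by (intro power_mono) auto
      thus "sq ?w a \<le> e\<^sup>2 * sq v a" by (simp add: power_mult_distrib)
    qed
    also have "\<dots> = (e * l2norm I V v)\<^sup>2"
      using l2norm_sq[of v] vD by (simp add: power_mult_distrib infsum_cmult_right)
    finally show "(l2norm I V ?w)\<^sup>2 \<le> (e * l2norm I V v)\<^sup>2" .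
  qed (use assms l2norm_nonneg[of v] vD in auto)
qed

end

lemma l2sum_tail:
  assumes "v \<in> l2sum I V" "e > 0"
  shows "\<exists>A. finite A \<and> A \<subseteq> I \<and> (\<Sum>\<^sub>\<infinity>a\<in>I - A. sq v a) \<le> e"
proof -
  note v = l2sumD[OF assms(1)]
  obtain A where A: "finite A" "A \<subseteq> I" "dist (sum (sq v) A) (\<Sum>\<^sub>\<infinity>a\<in>I. sq v a) \<le> e"
    using infsum_finite_approximation[OF v(3) assms(2)] by blast
  have "(\<Sum>\<^sub>\<infinity>a\<in>I - A. sq v a) = (\<Sum>\<^sub>\<infinity>a\<in>I. sq v a) - (\<Sum>\<^sub>\<infinity>a\<in>A. sq v a)"
    using A by (intro infsum_Diff v(3)) auto
  thus ?thesis using A by (intro exI[of _ A]) (auto simp: dist_real_def)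
qed

lemma l2norm_split_bound:
  assumes "w \<in> l2sum I V" "finite A" "A \<subseteq> I"
  shows "(l2norm I V w)\<^sup>2 = (\<Sum>a\<in>A. sq w a) + (\<Sum>\<^sub>\<infinity>a\<in>I - A. sq w a)"
proof -
  note w = l2sumD[OF assms(1)]
  have "(\<Sum>\<^sub>\<infinity>a\<in>I - A. sq w a) = (\<Sum>\<^sub>\<infinity>a\<in>I. sq w a) - (\<Sum>\<^sub>\<infinity>a\<in>A. sq w a)"
    using assms by (intro infsum_Diff w(3)) auto
  thus ?thesis using l2norm_sq[of w] w assms(2) by simp
qed

text \<open>On a block strong convergence is norm convergence, because the block is finite dimensional.
  Conversely split off the finitely many blocks that carry almost all of a vector; on the others the
  uniform bound on the multipliers suffices.\<close>

lemma converges_pointwise_iff: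
  assumes S: "\<And>m. m \<in> S \<Longrightarrow> contractive m" and N: "net_in S N"
  shows "converges_pointwise I V N \<longleftrightarrow> (\<forall>a\<in>I. \<forall>e>0. \<forall>\<^sub>F m in N. op_bound (V a) (dev (m a)) e)"
proof
  have inS: "\<forall>\<^sub>F m in N. contractive m"
    using N S by (auto simp: net_in_def elim: eventually_mono)
  assume conv: "converges_pointwise I V N"
  show "\<forall>a\<in>I. \<forall>e>0. \<forall>\<^sub>F m in N. op_bound (V a) (dev (m a)) e"
  proof (intro ballI allI impI)
    fix a and e :: real assume a: "a \<in> I" and e: "e > 0"
    \<comment> \<open>Errors of size \<open>d\<close> on the basis vectors add up to at most \<open>e\<close>; the summand \<open>1\<close> covers a zero block.\<close>
    define d where "d = e / (real (card (basis (V a))) + 1)"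
    have d: "d > 0" "card (basis (V a)) * d \<le> e" using e by (auto simp: d_def field_simps)
    have "\<forall>\<^sub>F m in N. \<forall>b\<in>basis (V a). l2norm I V (diag_op I m (single a b) - single a b) < d"
    proof (intro eventually_ball_finite ballI V.finite_basis)
      fix b assume b: "b \<in> basis (V a)"
      have "((\<lambda>m. l2norm I V (diag_op I m (single a b) - single a b)) \<longlongrightarrow> 0) N"
        using conv single_in_l2sum[OF a V.basis_in[OF b]] by (auto simp: converges_pointwise_def)
      thus "\<forall>\<^sub>F m in N. l2norm I V (diag_op I m (single a b) - single a b) < d"
        using d(1) by (rule order_tendstoD)
    qed
    with inS show "\<forall>\<^sub>F m in N. op_bound (V a) (dev (m a)) e"
    proof eventually_elim
      case (elim m)
      note mD = m_linear[OF elim(1) a] m_in[OF elim(1) a]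
      have small: "hnorm (V a) (m a b - b) \<le> d" if b: "b \<in> basis (V a)" for b
      proof -
        have "diag_op I m (single a b) - single a b = single a (m a b - b)"
          using a by (auto simp: diag_single[OF elim(1)] fun_eq_iff single_apply)
        thus ?thesis using elim(2) b a l2norm_single[of a "m a b - b"] mD V.basis_in[OF b] by fastforce
      qed
      show ?case unfolding op_bound_def
      proof
        fix x assume x: "x \<in> vecs (V a)"
        have "m a x - x = m a (\<Sum>b\<in>basis (V a). ip (V a) b x *\<^sub>C b) - (\<Sum>b\<in>basis (V a). ip (V a) b x *\<^sub>C b)"
          using V.basis_expand[OF x] by simp
        also have "\<dots> = (\<Sum>b\<in>basis (V a). ip (V a) b x *\<^sub>C (m a b - b))"
          by (subst clinear_on_sum[OF mD(1) V.subspace])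
            (auto simp: V.basis_in clinear_on_scale[OF mD(1)] complex_vector.scale_right_diff_distrib sum_subtractf)
        finally have "hnorm (V a) (m a x - x) \<le> (\<Sum>b\<in>basis (V a). hnorm (V a) (ip (V a) b x *\<^sub>C (m a b - b)))"
          using V.hnorm_sum_le[of "basis (V a)" "\<lambda>b. ip (V a) b x *\<^sub>C (m a b - b)" a] mD V.basis_in by simp
        also have "\<dots> \<le> (\<Sum>b\<in>basis (V a). hnorm (V a) x * d)"
        proof (rule sum_mono)
          fix b assume b: "b \<in> basis (V a)"
          have "hnorm (V a) b = 1" using V.basis_ip[OF b b] by (simp add: hnorm_def)
          hence "cmod (ip (V a) b x) \<le> hnorm (V a) x"
            using V.cauchy_schwarz[OF V.basis_in[OF b] x] by simp
          hence "cmod (ip (V a) b x) * hnorm (V a) (m a b - b) \<le> hnorm (V a) x * d"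
            using small[OF b] x V.basis_in[OF b] mD(2) by (intro mult_mono) simp_all
          thus "hnorm (V a) (ip (V a) b x *\<^sub>C (m a b - b)) \<le> hnorm (V a) x * d"
            using V.hnorm_scale[of "m a b - b" a] V.basis_in[OF b] mD(2) by simp
        qed
        also have "\<dots> = (card (basis (V a)) * d) * hnorm (V a) x" by simp
        also have "\<dots> \<le> e * hnorm (V a) x" using d x by (intro mult_right_mono) auto
        finally show "hnorm (V a) (m a x - x) \<le> e * hnorm (V a) x" .
      qed
    qed
  qed
next
  have inS: "\<forall>\<^sub>F m in N. contractive m"
    using N S by (auto simp: net_in_def elim: eventually_mono)
  assume block: "\<forall>a\<in>I. \<forall>e>0. \<forall>\<^sub>F m in N. op_bound (V a) (dev (m a)) e"
  show "converges_pointwise I V N"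
    unfolding converges_pointwise_def
  proof (intro ballI tendstoI)
    fix v and e :: real assume v: "v \<in> l2sum I V" and e: "e > 0"
    note vD = l2sumD[OF v]
    \<comment> \<open>Outside \<open>A\<close> the operator \<open>m - 1\<close> has norm at most \<open>2\<close>, which turns \<open>e\<^sup>2 / 16\<close> into \<open>e\<^sup>2 / 4\<close>; the choice of \<open>d\<close>
    bounds the blocks in \<open>A\<close> by the same amount.\<close>
    obtain A where A: "finite A" "A \<subseteq> I" "(\<Sum>\<^sub>\<infinity>a\<in>I - A. sq v a) \<le> e\<^sup>2 / 16"
      using l2sum_tail[OF v, of "e\<^sup>2/16"] e by auto
    define n where "n = (\<Sum>a\<in>A. sq v a) + 1"
    have n: "n > 0" by (simp add: n_def sum_nonneg add_nonneg_pos)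
    define d where "d = e / (2 * sqrt n)"
    have d: "d > 0" "d\<^sup>2 * n = e\<^sup>2 / 4" using n e by (auto simp: d_def power_divide power_mult_distrib)
    have "\<forall>\<^sub>F m in N. \<forall>a\<in>A. op_bound (V a) (dev (m a)) d"
      using A d(1) block by (intro eventually_ball_finite) auto
    with inS show "\<forall>\<^sub>F m in N. dist (l2norm I V (diag_op I m v - v)) 0 < e"
    proof eventually_elim
      case (elim m)
      let ?w = "diag_op I m v - v"
      have w: "?w \<in> l2sum I V" using diff_in_l2sum diag_in_l2sum[OF elim(1)] v by blast
      have "(\<Sum>a\<in>A. sq ?w a) \<le> (\<Sum>a\<in>A. d\<^sup>2 * sq v a)"
      proof (rule sum_mono)
        fix a assume a: "a \<in> A"
        have "hnorm (V a) (?w a) \<le> d * hnorm (V a) (v a)"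
          using elim(2) a A(2) vD(1)[of a] by (auto simp: op_bound_def diag_op_def)
        hence "sq ?w a \<le> (d * hnorm (V a) (v a))\<^sup>2"
          using l2sumD(1)[OF w] a A(2) by (intro power_mono) auto
        thus "sq ?w a \<le> d\<^sup>2 * sq v a" by (simp add: power_mult_distrib)
      qed
      also have "\<dots> \<le> d\<^sup>2 * n" by (simp add: n_def sum_distrib_left distrib_left)
      finally have 1: "(\<Sum>a\<in>A. sq ?w a) \<le> e\<^sup>2 / 4" using d by simp
      have sI: "sq u summable_on I - A" if "u \<in> l2sum I V" for u
        using l2sumD(3)[OF that] by (rule summable_on_subset_banach) auto
      have "(\<Sum>\<^sub>\<infinity>a\<in>I - A. sq ?w a) \<le> (\<Sum>\<^sub>\<infinity>a\<in>I - A. 4 * sq v a)"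
      proof (intro infsum_mono summable_on_cmult_right sI w v)
        fix a assume a: "a \<in> I - A"
        have "sq ?w a \<le> 2 * (hnorm (V a) (m a (v a)))\<^sup>2 + 2 * sq v a"
          using V.hnorm_diff_sq_le[of "m a (v a)" a "v a"] m_in[OF elim(1)] vD(1) a by (auto simp: diag_op_def)
        also have "(hnorm (V a) (m a (v a)))\<^sup>2 \<le> sq v a"
          using m_bound[OF elim(1), of a "v a"] m_in[OF elim(1), of a "v a"] vD(1) a by (intro power_mono) auto
        finally show "sq ?w a \<le> 4 * sq v a" by simp
      qed
      also have "\<dots> = 4 * (\<Sum>\<^sub>\<infinity>a\<in>I - A. sq v a)" by (intro infsum_cmult_right sI v)
      also have "\<dots> \<le> e\<^sup>2 / 4" using A(3) by simp
      finally have "(l2norm I V ?w)\<^sup>2 \<le> e\<^sup>2 / 4 + e\<^sup>2 / 4"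
        using 1 l2norm_split_bound[OF w A(1,2)] by simp
      also have "\<dots> < e\<^sup>2" using e by simp
      finally have "l2norm I V ?w < e" using e by (simp add: power2_less_imp_less)
      thus ?case using l2norm_nonneg[of ?w] l2sumD(1)[OF w] by simp
    qed
  qed
qed

lemma converges_uniformly_iff:
  assumes S: "\<And>m. m \<in> S \<Longrightarrow> contractive m" and N: "net_in S N"
  shows "converges_uniformly I V N \<longleftrightarrow> (\<forall>e>0. \<forall>\<^sub>F m in N. \<forall>a\<in>I. op_bound (V a) (dev (m a)) e)"
proof -
  have "(\<forall>\<^sub>F m in N. \<forall>v\<in>l2sum I V. l2norm I V (diag_op I m v - v) \<le> e * l2norm I V v) \<longleftrightarrow>
      (\<forall>\<^sub>F m in N. \<forall>a\<in>I. op_bound (V a) (dev (m a)) e)" if "e > 0" for e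
  proof (rule eventually_subst)
    show "\<forall>\<^sub>F m in N. (\<forall>v\<in>l2sum I V. l2norm I V (diag_op I m v - v) \<le> e * l2norm I V v) \<longleftrightarrow>
      (\<forall>a\<in>I. op_bound (V a) (dev (m a)) e)"
      using N that unfolding net_in_def by (auto elim!: eventually_mono intro!: uniform_bound_iff S)
  qed
  thus ?thesis unfolding converges_uniformly_def by simp
qed

end

context hilbert_family
begin

text \<open>Unit vectors in infinitely many blocks of norm above \<open>e\<close> are mapped to vectors of norm above \<open>e\<close>
  in different blocks.  A limit of a subsequence would vanish on the blocks of the subsequence, so all its
  terms would keep a distance above \<open>e\<close> from the limit.\<close>

lemma compact_imp_blocks_vanish:
  assumes m: "contractive m" and comp: "compact_mult I V m" and e: "e > 0"
  shows "finite {a \<in> I. \<not> op_bound (V a) (m a) e}"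
proof (rule ccontr)
  let ?A = "{a \<in> I. \<not> op_bound (V a) (m a) e}"
  assume "infinite ?A"
  then obtain f :: "nat \<Rightarrow> 'o" where f: "inj f" "range f \<subseteq> ?A"
    using infinite_countable_subset by blast
  have fI: "f n \<in> I" for n using f by auto
  have "\<forall>n. \<exists>y. y \<in> vecs (V (f n)) \<and> hnorm (V (f n)) y = 1 \<and> hnorm (V (f n)) (m (f n) y) > e"
  proof
    fix n
    have "\<not> op_bound (V (f n)) (m (f n)) e" using f by auto
    then obtain x where x: "x \<in> vecs (V (f n))" "hnorm (V (f n)) (m (f n) x) > e * hnorm (V (f n)) x"
      by (auto simp: op_bound_def not_le)
    have "x \<noteq> 0" using x(2) m_zero[OF m fI] by auto
    hence h: "hnorm (V (f n)) x > 0" using V.hnorm_eq_0[OF x(1)] V.hnorm_nonneg[OF x(1)] by simp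
    let ?c = "complex_of_real (1 / hnorm (V (f n)) x)"
    have c: "cmod ?c = 1 / hnorm (V (f n)) x" using h by (simp add: norm_divide)
    have 1: "hnorm (V (f n)) (?c *\<^sub>C x) = 1"
      using h by (simp only: V.hnorm_scale[OF x(1)] c) simp
    have 2: "hnorm (V (f n)) (m (f n) (?c *\<^sub>C x)) > e"
      using x(2) h by (simp only: clinear_on_scale[OF m_linear[OF m fI] x(1)] V.hnorm_scale[OF m_in[OF m fI x(1)]] c)
        (simp add: field_simps)
    show "\<exists>y. y \<in> vecs (V (f n)) \<and> hnorm (V (f n)) y = 1 \<and> hnorm (V (f n)) (m (f n) y) > e"
      using 1 2 V.scale_in[OF x(1)] by blast
  qed
  from choice[OF this] obtain y where y: "\<And>n. y n \<in> vecs (V (f n))" "\<And>n. hnorm (V (f n)) (y n) = 1"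
    "\<And>n. hnorm (V (f n)) (m (f n) (y n)) > e" by blast
  define X where "X n = single (f n) (y n)" for n
  have "\<forall>n. X n \<in> l2sum I V \<and> l2norm I V (X n) \<le> 1"
    using single_in_l2sum[OF fI y(1)] l2norm_single[OF fI y(1)] y(2) by (simp add: X_def)
  then obtain r w where r: "strict_mono r" and w: "w \<in> l2sum I V"
    and lim: "(\<lambda>n. l2norm I V (diag_op I m (X (r n)) - w)) \<longlonglongrightarrow> 0"
    using comp unfolding compact_mult_def by blast
  have D: "diag_op I m (X n) = single (f n) (m (f n) (y n))" for n
    unfolding X_def using diag_single[OF m fI] .
  have DI: "diag_op I m (X n) - w \<in> l2sum I V" for n
    unfolding D using diff_in_l2sum[OF single_in_l2sum(1)[OF fI m_in[OF m fI y(1)]] w] .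
  have w0: "w (f (r k)) = 0" for k
  proof -
    have "hnorm (V (f (r k))) (w (f (r k))) \<le> l2norm I V (diag_op I m (X (r n)) - w)" if "n \<ge> Suc k" for n
    proof -
      have "r n \<noteq> r k" using that strict_mono_eq[OF r, of n k] by simp
      hence "f (r k) \<noteq> f (r n)" using f(1) by (simp add: inj_eq)
      hence "(diag_op I m (X (r n)) - w) (f (r k)) = 0 - w (f (r k))" by (simp add: D single_apply)
      moreover have "hnorm (V (f (r k))) (0 - w (f (r k))) = hnorm (V (f (r k))) (w (f (r k)))"
        using V.hnorm_minus_commute[of 0 "f (r k)" "w (f (r k))"] l2sumD(1)[OF w fI] by simp
      ultimately show ?thesis using hnorm_block_le[OF DI[of "r n"] fI[of "r k"]] by metis
    qed
    hence "hnorm (V (f (r k))) (w (f (r k))) \<le> 0"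
      by (intro LIMSEQ_le_const[OF lim]) blast
    thus ?thesis
      using V.hnorm_eq_0 V.hnorm_nonneg l2sumD(1)[OF w fI] by (metis order_antisym)
  qed
  have "e \<le> l2norm I V (diag_op I m (X (r n)) - w)" for n
  proof -
    have "(diag_op I m (X (r n)) - w) (f (r n)) = m (f (r n)) (y (r n))" by (simp add: D single_apply w0)
    thus ?thesis using hnorm_block_le[OF DI[of "r n"] fI[of "r n"]] y(3)[of "r n"] by simp
  qed
  hence "e \<le> 0" by (intro LIMSEQ_le_const[OF lim]) blast
  thus False using e by simp
qed

text \<open>Conversely, the blocks on which the multiplier does not vanish are countably many, so all
  coordinates of a bounded sequence in them converge along one diagonal subsequence.  Outside finitely
  many blocks the multiplier is uniformly small.\<close>

lemma blocks_vanish_imp_compact: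
  assumes m: "contractive m" and fin: "\<And>e. e > 0 \<Longrightarrow> finite {a \<in> I. \<not> op_bound (V a) (m a) e}"
  shows "compact_mult I V m"
  unfolding compact_mult_def
proof (intro allI impI)
  fix X :: "nat \<Rightarrow> 'o \<Rightarrow> 'v" assume "\<forall>n. X n \<in> l2sum I V \<and> l2norm I V (X n) \<le> 1"
  hence X: "\<And>n. X n \<in> l2sum I V" "\<And>n. l2norm I V (X n) \<le> 1" by auto
  note XD = l2sumD[OF X(1)]
  define A where "A k = {a \<in> I. \<not> op_bound (V a) (m a) (1 / real (Suc k))}" for k
  have A: "finite (A k)" "A k \<subseteq> I" for k unfolding A_def by (rule fin) auto
  define J where "J = (\<Union>k. A k)"
  have J: "J \<subseteq> I" "countable J" using A by (auto simp: J_def intro: countable_finite)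
  define P where "P = (SIGMA a:J. basis (V a))"
  have "countable P" unfolding P_def using J by (intro countable_SIGMA) (auto intro: countable_finite)
  define coord where "coord p n = ip (V (fst p)) (snd p) (X n (fst p))" for p n
  have coord_le: "cmod (coord p n) \<le> 1" if "p \<in> P" for p n
  proof -
    obtain a e where p: "p = (a, e)" "a \<in> I" "e \<in> basis (V a)" using \<open>p \<in> P\<close> J by (auto simp: P_def)
    have "hnorm (V a) e = 1" using V.basis_ip[OF p(3) p(3)] by (simp add: hnorm_def)
    hence "cmod (coord p n) \<le> hnorm (V a) (X n a)"
      using V.cauchy_schwarz[OF V.basis_in[OF p(3)] XD(1)[OF p(2)]] by (simp add: coord_def p)
    also have "\<dots> \<le> 1" using hnorm_block_le[OF X(1) p(2)] X(2) order_trans by blast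
    finally show ?thesis .
  qed
  define Q where "Q n s \<longleftrightarrow> (from_nat_into P n \<in> P \<longrightarrow> convergent (\<lambda>k. coord (from_nat_into P n) (s k)))" for n s
  interpret subseqs Q
  proof
    fix n and s :: "nat \<Rightarrow> nat" assume "strict_mono s"
    show "\<exists>r'. strict_mono r' \<and> Q n (s \<circ> r')"
    proof (cases "from_nat_into P n \<in> P")
      case True
      have "bounded (range (\<lambda>k. coord (from_nat_into P n) (s k)))"
        using coord_le[OF True] by (intro boundedI[of _ 1]) auto
      from bounded_imp_convergent_subsequence[OF this] obtain l r' where
        "strict_mono r'" "((\<lambda>k. coord (from_nat_into P n) (s k)) \<circ> r') \<longlonglongrightarrow> l" by blast
      thus ?thesis by (intro exI[of _ r']) (auto simp: Q_def o_def convergent_def)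
    qed (auto simp: Q_def intro!: exI[of _ id] simp: strict_mono_def)
  qed
  define r where "r = diagseq"
  have r: "strict_mono r" unfolding r_def by (rule subseq_diagseq)
  have conv: "convergent (\<lambda>k. coord p (r k))" if "p \<in> P" for p
  proof -
    define n where "n = to_nat_on P p"
    have n: "from_nat_into P n = p" using \<open>countable P\<close> that by (simp add: n_def)
    have "Q n (diagseq \<circ> ((+) (Suc n)))"
    proof (rule diagseq_holds)
      fix r s n assume r: "strict_mono (r :: nat \<Rightarrow> nat)" and "Q n s"
      thus "Q n (s \<circ> r)"
        unfolding Q_def convergent_def using LIMSEQ_subseq_LIMSEQ[OF _ r] by (fastforce simp: o_def)
    qed
    hence "convergent (\<lambda>k. coord p (diagseq (k + Suc n)))"
      using that by (simp add: Q_def n o_def add_ac)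
    thus ?thesis unfolding r_def
      using convergent_ignore_initial_segment[of "\<lambda>k. coord p (diagseq k)" "Suc n"] by simp
  qed
  \<comment> \<open>The limit of the coordinates on the blocks in \<open>J\<close>, and \<open>0\<close> on the others, where \<open>m\<close> vanishes.\<close>
  define y where "y a = (if a \<in> J then \<Sum>e\<in>basis (V a). lim (\<lambda>k. coord (a, e) (r k)) *\<^sub>C e else 0)" for a
  have y_in: "y a \<in> vecs (V a)" for a
    by (auto simp: y_def V.basis_in intro!: V.sum_in V.scale_in)
  have y_ip: "ip (V a) e (y a) = lim (\<lambda>k. coord (a, e) (r k))" if "a \<in> J" "e \<in> basis (V a)" for a e
  proof -
    have "ip (V a) e (y a) = (\<Sum>e'\<in>basis (V a). ip (V a) e (lim (\<lambda>k. coord (a, e') (r k)) *\<^sub>C e'))"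
      using that by (simp add: y_def V.ip_sum_right V.basis_in)
    also have "\<dots> = (\<Sum>e'\<in>basis (V a). if e = e' then lim (\<lambda>k. coord (a, e') (r k)) else 0)"
      using that(2) by (intro sum.cong) (simp_all add: V.ip_scale_right V.basis_in V.basis_ip)
    finally show ?thesis using that by simp
  qed
  have coord_lim: "(\<lambda>k. ip (V a) e (X (r k) a)) \<longlonglongrightarrow> ip (V a) e (y a)" if "a \<in> J" "e \<in> basis (V a)" for a e
    using conv[of "(a, e)"] that convergent_LIMSEQ_iff[of "\<lambda>k. coord (a, e) (r k)"] by (simp add: y_ip P_def coord_def)
  have block_lim: "(\<lambda>k. (hnorm (V a) (X (r k) a - y a))\<^sup>2) \<longlonglongrightarrow> 0" if a: "a \<in> J" for a
  proof -
    have "(\<lambda>k. \<Sum>e\<in>basis (V a). (cmod (ip (V a) e (X (r k) a) - ip (V a) e (y a)))\<^sup>2) \<longlonglongrightarrow> (\<Sum>e\<in>basis (V a). (cmod (ip (V a) e (y a) - ip (V a) e (y a)))\<^sup>2)"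
      by (intro tendsto_intros coord_lim a)
    moreover have "(\<Sum>e\<in>basis (V a). (cmod (ip (V a) e (X (r k) a) - ip (V a) e (y a)))\<^sup>2) = (hnorm (V a) (X (r k) a - y a))\<^sup>2" for k
      using XD(1)[of a] a J(1) y_in by (subst V.hnorm_sq_basis) (auto intro!: sum.cong simp: V.ip_diff_right V.basis_in)
    ultimately show ?thesis by simp
  qed
  have sq_lim: "(\<lambda>k. sq (X (r k)) a) \<longlonglongrightarrow> sq y a" if a: "a \<in> J" for a
  proof -
    have "(\<lambda>k. \<Sum>e\<in>basis (V a). (cmod (ip (V a) e (X (r k) a)))\<^sup>2) \<longlonglongrightarrow> (\<Sum>e\<in>basis (V a). (cmod (ip (V a) e (y a)))\<^sup>2)"
      by (intro tendsto_intros coord_lim a)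
    thus ?thesis using XD(1)[of a] a J(1) y_in by (auto simp flip: V.hnorm_sq_basis)
  qed
  have sum_le: "(\<Sum>a\<in>B. sq y a) \<le> 1" if B: "finite B" "B \<subseteq> I" for B
  proof -
    have "(\<Sum>a\<in>B. sq y a) = (\<Sum>a\<in>B \<inter> J. sq y a)"
      using B by (intro sum.mono_neutral_right) (auto simp: y_def)
    also have "\<dots> \<le> 1"
    proof (rule LIMSEQ_le_const2)
      show "(\<lambda>k. \<Sum>a\<in>B \<inter> J. sq (X (r k)) a) \<longlonglongrightarrow> (\<Sum>a\<in>B \<inter> J. sq y a)"
        by (intro tendsto_sum sq_lim) auto
      have "(\<Sum>a\<in>B \<inter> J. sq (X n) a) \<le> 1" for n
      proof -
        have "(\<Sum>a\<in>B \<inter> J. sq (X n) a) \<le> (\<Sum>\<^sub>\<infinity>a\<in>I. sq (X n) a)"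
          using B by (intro finite_sum_le_infsum XD(3)) auto
        also have "\<dots> = (l2norm I V (X n))\<^sup>2" using l2norm_sq[of "X n"] XD by simp
        also have "\<dots> \<le> 1" using X(2)[of n] l2norm_nonneg[of "X n"] XD(1) by (intro power_le_one) auto
        finally show ?thesis .
      qed
      thus "\<exists>N. \<forall>n\<ge>N. (\<Sum>a\<in>B \<inter> J. sq (X (r n)) a) \<le> 1" by blast
    qed
    finally show ?thesis .
  qed
  have y: "y \<in> l2sum I V"
    unfolding l2sum_iff
  proof (intro conjI ballI allI impI y_in)
    show "y a = 0" if "a \<notin> I" for a using that J by (auto simp: y_def)
    show "sq y summable_on I"
      using sum_le by (intro nonneg_bdd_above_summable_on bdd_aboveI[of _ 1]) auto
  qed
  have y1: "(\<Sum>\<^sub>\<infinity>a\<in>I. sq y a) \<le> 1" using sum_le l2sumD(3)[OF y] by (intro infsum_le_finite_sums) auto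
  define Z where "Z n = X (r n) - y" for n
  have Z: "Z n \<in> l2sum I V" for n unfolding Z_def by (rule diff_in_l2sum[OF X(1) y])
  have Zapp: "Z n a = X (r n) a - y a" for n a by (simp add: Z_def)
  have Z4: "(\<Sum>\<^sub>\<infinity>a\<in>I. sq (Z n) a) \<le> 4" for n
  proof -
    have "(\<Sum>\<^sub>\<infinity>a\<in>I. sq (Z n) a) \<le> (\<Sum>\<^sub>\<infinity>a\<in>I. 2 * sq (X (r n)) a + 2 * sq y a)"
      unfolding Zapp using l2sumD(3)[OF Z[of n]] XD(3) l2sumD(3)[OF y]
      by (intro infsum_mono summable_on_add summable_on_cmult_right V.hnorm_diff_sq_le XD y_in) (simp_all add: Zapp)
    also have "\<dots> = 2 * (\<Sum>\<^sub>\<infinity>a\<in>I. sq (X (r n)) a) + 2 * (\<Sum>\<^sub>\<infinity>a\<in>I. sq y a)"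
      using XD(3) l2sumD(3)[OF y] by (simp add: infsum_add summable_on_cmult_right infsum_cmult_right)
    also have "(\<Sum>\<^sub>\<infinity>a\<in>I. sq (X (r n)) a) \<le> 1"
    proof -
      have "(\<Sum>\<^sub>\<infinity>a\<in>I. sq (X (r n)) a) = (l2norm I V (X (r n)))\<^sup>2" using l2norm_sq[of "X (r n)"] XD by simp
      thus ?thesis using X(2)[of "r n"] l2norm_nonneg[of "X (r n)"] XD(1) by (auto intro: power_le_one)
    qed
    finally show ?thesis using y1 by simp
  qed
  define w where "w = diag_op I m y"
  have w: "w \<in> l2sum I V" unfolding w_def by (rule diag_in_l2sum[OF m y])
  have DZ: "diag_op I m (X (r n)) - w = diag_op I m (Z n)" for n
    using clinear_on_diff[OF m_linear[OF m] V.subspace XD(1) y_in]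
    by (auto simp: w_def diag_op_def fun_eq_iff Zapp)
  have "(\<lambda>n. l2norm I V (diag_op I m (X (r n)) - w)) \<longlonglongrightarrow> 0"
    unfolding DZ
  proof (rule tendstoI)
    fix e :: real assume e: "e > 0"
    \<comment> \<open>Outside \<open>A k\<close> the multiplier has norm at most \<open>1 / (k + 1)\<close>, and the vectors \<open>Z n\<close> have squared
    norm at most \<open>4\<close>; this \<open>k\<close> keeps that part below \<open>e\<^sup>2 / 2\<close>.\<close>
    obtain k where k: "8 / e\<^sup>2 < real k" using reals_Archimedean2 by blast
    have "4 / (real (Suc k))\<^sup>2 < e\<^sup>2 / 2"
    proof -
      have "8 < e\<^sup>2 * real k" using k e by (simp add: field_simps)
      also have "\<dots> \<le> e\<^sup>2 * (real (Suc k))\<^sup>2"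
        by (intro mult_left_mono) (auto simp: power2_eq_square algebra_simps)
      finally show ?thesis by (simp add: field_simps)
    qed
    moreover have "(\<lambda>n. \<Sum>a\<in>A k. sq (Z n) a) \<longlonglongrightarrow> (\<Sum>a\<in>A k. 0)"
      unfolding Zapp by (intro tendsto_sum block_lim) (auto simp: J_def)
    hence "\<forall>\<^sub>F n in sequentially. (\<Sum>a\<in>A k. sq (Z n) a) < e\<^sup>2 / 2"
      using e by (intro order_tendstoD) auto
    ultimately show "\<forall>\<^sub>F n in sequentially. dist (l2norm I V (diag_op I m (Z n))) 0 < e"
    proof (elim eventually_mono)
      fix n assume k: "4 / (real (Suc k))\<^sup>2 < e\<^sup>2 / 2" and n: "(\<Sum>a\<in>A k. sq (Z n) a) < e\<^sup>2 / 2"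
      let ?d = "1 / real (Suc k)"
      note DI = diag_in_l2sum[OF m Z[of n]]
      have ZD: "a \<in> I \<Longrightarrow> Z n a \<in> vecs (V a)" for a using l2sumD(1)[OF Z] .
      have sI: "sq u summable_on I - A k" if "u \<in> l2sum I V" for u
        using l2sumD(3)[OF that] by (rule summable_on_subset_banach) auto
      have "(\<Sum>a\<in>A k. sq (diag_op I m (Z n)) a) \<le> (\<Sum>a\<in>A k. sq (Z n) a)"
        using A(2)[of k] ZD m_bound[OF m] m_in[OF m]
        by (intro sum_mono power_mono) (auto simp: diag_op_def subset_iff)
      moreover have "(\<Sum>\<^sub>\<infinity>a\<in>I - A k. sq (diag_op I m (Z n)) a) \<le> (\<Sum>\<^sub>\<infinity>a\<in>I - A k. ?d\<^sup>2 * sq (Z n) a)"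
      proof (intro infsum_mono summable_on_cmult_right sI DI Z)
        fix a assume a: "a \<in> I - A k"
        have "hnorm (V a) (diag_op I m (Z n) a) \<le> ?d * hnorm (V a) (Z n a)"
          using a ZD by (auto simp: A_def op_bound_def diag_op_def)
        hence "sq (diag_op I m (Z n)) a \<le> (?d * hnorm (V a) (Z n a))\<^sup>2"
          using l2sumD(1)[OF DI] a by (intro power_mono) auto
        thus "sq (diag_op I m (Z n)) a \<le> ?d\<^sup>2 * sq (Z n) a" by (simp only: power_mult_distrib)
      qed
      moreover have "(\<Sum>\<^sub>\<infinity>a\<in>I - A k. ?d\<^sup>2 * sq (Z n) a) = ?d\<^sup>2 * (\<Sum>\<^sub>\<infinity>a\<in>I - A k. sq (Z n) a)"
        by (intro infsum_cmult_right sI Z)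
      moreover have "(\<Sum>\<^sub>\<infinity>a\<in>I - A k. sq (Z n) a) \<le> (\<Sum>\<^sub>\<infinity>a\<in>I. sq (Z n) a)"
        by (intro infsum_mono_neutral sI Z l2sumD(3)[OF Z]) auto
      hence "?d\<^sup>2 * (\<Sum>\<^sub>\<infinity>a\<in>I - A k. sq (Z n) a) \<le> ?d\<^sup>2 * 4"
        using Z4[of n] by (intro mult_left_mono) auto
      moreover have "?d\<^sup>2 * 4 = 4 / (real (Suc k))\<^sup>2" by (simp add: power_divide)
      ultimately have "(l2norm I V (diag_op I m (Z n)))\<^sup>2 < e\<^sup>2"
        using l2norm_split_bound[OF DI A, of k] n k by linarith
      hence "l2norm I V (diag_op I m (Z n)) < e" using e by (simp add: power2_less_imp_less)
      thus "dist (l2norm I V (diag_op I m (Z n))) 0 < e"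
        using l2norm_nonneg[of "diag_op I m (Z n)"] l2sumD(1)[OF DI] by simp
    qed
  qed
  thus "\<exists>r. strict_mono r \<and> (\<exists>w\<in>l2sum I V. (\<lambda>n. l2norm I V (diag_op I m (X (r n)) - w)) \<longlonglongrightarrow> 0)"
    using r w by blast
qed

lemma compact_mult_iff:
  "contractive m \<Longrightarrow> compact_mult I V m \<longleftrightarrow> (\<forall>e>0. finite {a \<in> I. \<not> op_bound (V a) (m a) e})"
  using compact_imp_blocks_vanish blocks_vanish_imp_compact by blast

end

text \<open>A map of multipliers that preserves the norms of the blocks of \<open>m\<close> and \<open>m - 1\<close> up to a permutation
  carries finite rank or compact approximations of the identity forward, and with them amenability and
  the Haagerup property.  It also carries pointwise convergent nets forward, so that uniform convergence
  of their images, and hence property (T), is pulled back.\<close>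

lemma transfer_along_map:
  fixes V :: "'o \<Rightarrow> 'v::complex_vector hilb" and V' :: "'o \<Rightarrow> 'w::complex_vector hilb"
  assumes fam: "hilbert_family V" "hilbert_family V'"
    and S: "\<And>m. m \<in> S \<Longrightarrow> hilbert_family.contractive I V m"
    and S': "\<And>m. m \<in> S' \<Longrightarrow> hilbert_family.contractive I V' m"
    and T: "\<And>m. m \<in> S \<Longrightarrow> T m \<in> S'" and \<sigma>: "bij_betw \<sigma> I I"
    and bound: "\<And>m a k. m \<in> S \<Longrightarrow> a \<in> I \<Longrightarrow> k \<ge> 0 \<Longrightarrow> op_bound (V' a) (T m a) k \<longleftrightarrow> op_bound (V (\<sigma> a)) (m (\<sigma> a)) k"
    and dev: "\<And>m a k. m \<in> S \<Longrightarrow> a \<in> I \<Longrightarrow> k \<ge> 0 \<Longrightarrow> op_bound (V' a) (dev (T m a)) k \<longleftrightarrow> op_bound (V (\<sigma> a)) (dev (m (\<sigma> a))) k"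
  shows "mult_amenable I V S \<Longrightarrow> mult_amenable I V' S'"
    and "mult_haagerup I V S \<Longrightarrow> mult_haagerup I V' S'"
    and "mult_property_T I V' S' \<Longrightarrow> mult_property_T I V S"
proof -
  interpret V: hilbert_family I V by fact
  interpret V': hilbert_family I V' by fact
  have fin: "finite {a \<in> I. \<not> op_bound (V' a) (T m a) k}" if "m \<in> S" "k \<ge> 0" "finite {a \<in> I. \<not> op_bound (V a) (m a) k}" for m k
  proof -
    have "\<sigma> ` {a \<in> I. \<not> op_bound (V' a) (T m a) k} \<subseteq> {a \<in> I. \<not> op_bound (V a) (m a) k}"
      using bound[OF that(1) _ that(2)] bij_betwE[OF \<sigma>] by auto
    moreover have "inj_on \<sigma> {a \<in> I. \<not> op_bound (V' a) (T m a) k}"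
      using \<sigma> by (auto simp: bij_betw_def intro: inj_on_subset)
    ultimately show ?thesis by (rule finite_imageD[OF finite_subset[OF _ that(3)]])
  qed
  have net: "net_in S' (filtermap T N)" if "net_in S N" for N
    using that unfolding net_in_def filtermap_bot_iff eventually_filtermap
    by (auto elim!: eventually_mono T)
  have pw: "converges_pointwise I V' (filtermap T N)" if N: "net_in S N" and c: "converges_pointwise I V N" for N
  proof (rule V'.converges_pointwise_iff[OF S' net[OF N], THEN iffD2], assumption,
      unfold eventually_filtermap, intro ballI allI impI)
    fix a and e :: real assume a: "a \<in> I" and e: "e > 0"
    have "\<sigma> a \<in> I" using a \<sigma> by (auto simp: bij_betw_def)
    hence "\<forall>\<^sub>F m in N. op_bound (V (\<sigma> a)) (dev (m (\<sigma> a))) e"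
      using c e V.converges_pointwise_iff[OF S N] by blast
    moreover have "\<forall>\<^sub>F m in N. m \<in> S" using N by (simp add: net_in_def)
    ultimately show "\<forall>\<^sub>F m in N. op_bound (V' a) (dev (T m a)) e"
      by eventually_elim (use dev a e in auto)
  qed
  show "mult_amenable I V' S'" if amen: "mult_amenable I V S"
  proof -
    obtain N where N: "net_in {m \<in> S. finite_rank I V m} N" "converges_pointwise I V N"
      using amen by (auto simp: mult_amenable_def)
    have "finite_rank I V' (T m)" if "m \<in> S" "finite_rank I V m" for m
      using that fin[of m 0] V.finite_rank_iff[OF S] V'.finite_rank_iff[OF S'[OF T]] by auto
    hence "net_in {m \<in> S'. finite_rank I V' m} (filtermap T N)"
      using N(1) unfolding net_in_def filtermap_bot_iff eventually_filtermap
      by (auto elim!: eventually_mono T)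
    moreover have "net_in S N" using N(1) unfolding net_in_def by (auto elim!: eventually_mono)
    ultimately show ?thesis using pw N(2) unfolding mult_amenable_def by blast
  qed
  show "mult_haagerup I V' S'" if haag: "mult_haagerup I V S"
  proof -
    obtain N where N: "net_in {m \<in> S. compact_mult I V m} N" "converges_pointwise I V N"
      using haag by (auto simp: mult_haagerup_def)
    have "compact_mult I V' (T m)" if "m \<in> S" "compact_mult I V m" for m
      using that fin[of m] V.compact_mult_iff[OF S] V'.compact_mult_iff[OF S'[OF T]] by simp
    hence "net_in {m \<in> S'. compact_mult I V' m} (filtermap T N)"
      using N(1) unfolding net_in_def filtermap_bot_iff eventually_filtermap
      by (auto elim!: eventually_mono T)
    moreover have "net_in S N" using N(1) unfolding net_in_def by (auto elim!: eventually_mono)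
    ultimately show ?thesis using pw N(2) unfolding mult_haagerup_def by blast
  qed
  show "mult_property_T I V S" if propT: "mult_property_T I V' S'"
    unfolding mult_property_T_def
  proof (intro allI impI, elim conjE)
    fix N assume N: "net_in S N" "converges_pointwise I V N"
    have "converges_uniformly I V' (filtermap T N)"
      using propT net[OF N(1)] pw[OF N] by (simp add: mult_property_T_def)
    hence u: "\<forall>e>0. \<forall>\<^sub>F m in N. \<forall>a\<in>I. op_bound (V' a) (dev (T m a)) e"
      using V'.converges_uniformly_iff[OF S' net[OF N(1)]] by (simp add: eventually_filtermap)
    show "converges_uniformly I V N"
    proof (rule V.converges_uniformly_iff[OF S N(1), THEN iffD2], assumption, intro allI impI)
      fix e :: real assume e: "e > 0"
      have "\<forall>\<^sub>F m in N. m \<in> S" using N(1) by (simp add: net_in_def)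
      moreover have "\<forall>\<^sub>F m in N. \<forall>a\<in>I. op_bound (V' a) (dev (T m a)) e" using u e by blast
      ultimately show "\<forall>\<^sub>F m in N. \<forall>a\<in>I. op_bound (V a) (dev (m a)) e"
      proof eventually_elim
        case (elim m)
        show ?case
        proof
          fix b assume "b \<in> I"
          then obtain a where "a \<in> I" "b = \<sigma> a" using \<sigma> by (auto simp: bij_betw_def)
          thus "op_bound (V b) (dev (m b)) e" using elim dev e by auto
        qed
      qed
    qed
  qed
qed

text \<open>The three properties only see the norms of the blocks of \<open>m\<close> and of \<open>m - 1\<close>; the previous lemma is
  applied to \<open>T\<close> and to its inverse.\<close>

theorem multiplier_transfer:
  fixes V :: "'o \<Rightarrow> 'v::complex_vector hilb" and V' :: "'o \<Rightarrow> 'w::complex_vector hilb"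
  assumes fam: "hilbert_family V" "hilbert_family V'"
    and S: "\<And>m. m \<in> S \<Longrightarrow> hilbert_family.contractive I V m"
    and S': "\<And>m a. m \<in> S' \<Longrightarrow> a \<in> I \<Longrightarrow> clinear_on (vecs (V' a)) (vecs (V' a)) (m a)"
    and T: "bij_betw T S S'" and \<sigma>: "bij_betw \<sigma> I I"
    and bound: "\<And>m a k. m \<in> S \<Longrightarrow> a \<in> I \<Longrightarrow> k \<ge> 0 \<Longrightarrow> op_bound (V' a) (T m a) k \<longleftrightarrow> op_bound (V (\<sigma> a)) (m (\<sigma> a)) k"
    and dev: "\<And>m a k. m \<in> S \<Longrightarrow> a \<in> I \<Longrightarrow> k \<ge> 0 \<Longrightarrow> op_bound (V' a) (dev (T m a)) k \<longleftrightarrow> op_bound (V (\<sigma> a)) (dev (m (\<sigma> a))) k"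
  shows "mult_amenable I V S \<longleftrightarrow> mult_amenable I V' S'"
    and "mult_haagerup I V S \<longleftrightarrow> mult_haagerup I V' S'"
    and "mult_property_T I V S \<longleftrightarrow> mult_property_T I V' S'"
proof -
  define U where "U = inv_into S T"
  define \<tau> where "\<tau> = inv_into I \<sigma>"
  have U: "U m \<in> S" "T (U m) = m" if "m \<in> S'" for m
    using that T by (auto simp: U_def bij_betw_def inv_into_into f_inv_into_f)
  have \<tau>: "bij_betw \<tau> I I" unfolding \<tau>_def by (rule bij_betw_inv_into[OF \<sigma>])
  have \<sigma>\<tau>: "\<tau> a \<in> I" "\<sigma> (\<tau> a) = a" if "a \<in> I" for a
    using that \<sigma> by (auto simp: \<tau>_def bij_betw_def inv_into_into f_inv_into_f)
  have S'c: "hilbert_family.contractive I V' m" if m: "m \<in> S'" for m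
    unfolding hilbert_family.contractive_def[OF fam(2)]
  proof (intro ballI conjI S' m)
    fix a assume a: "a \<in> I"
    have "\<sigma> a \<in> I" using a \<sigma> by (auto simp: bij_betw_def)
    hence "op_bound (V (\<sigma> a)) (U m (\<sigma> a)) 1"
      using S[OF U(1)[OF m]] by (auto simp: hilbert_family.contractive_def[OF fam(1)])
    thus "op_bound (V' a) (m a) 1" using bound[OF U(1)[OF m] a, of 1] U(2)[OF m] by simp
  qed
  have T_in: "T m \<in> S'" if "m \<in> S" for m using that T by (auto simp: bij_betw_def)
  note fw = transfer_along_map[OF fam S S'c T_in \<sigma> bound dev]
  have "op_bound (V a) (U m a) k \<longleftrightarrow> op_bound (V' (\<tau> a)) (m (\<tau> a)) k"
    "op_bound (V a) (dev (U m a)) k \<longleftrightarrow> op_bound (V' (\<tau> a)) (dev (m (\<tau> a))) k"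
    if "m \<in> S'" "a \<in> I" "k \<ge> 0" for m a k
    using that bound[OF U(1) \<sigma>\<tau>(1), of m a k] dev[OF U(1) \<sigma>\<tau>(1), of m a k] U \<sigma>\<tau> by simp_all
  note bw = transfer_along_map[OF fam(2,1) S'c S U(1) \<tau> this]
  show "mult_amenable I V S \<longleftrightarrow> mult_amenable I V' S'"
    "mult_haagerup I V S \<longleftrightarrow> mult_haagerup I V' S'"
    "mult_property_T I V S \<longleftrightarrow> mult_property_T I V' S'"
    by (rule iffI[OF fw(1) bw(1)] iffI[OF fw(2) bw(2)] iffI[OF bw(3) fw(3)]; assumption)+
qed

section \<open>Morphisms as operators\<close>

context discrete_quantum_group
begin

abbreviation hv :: "'o \<Rightarrow> 'h set" where "hv a \<equiv> vecs (obj F a)"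
abbreviation cj :: "'o \<Rightarrow> 'o" where "cj \<equiv> conj_obj C"

sublocale O: fd_hilbert_space "obj F a" for a
  by unfold_locales (rule obj_hilbert)

lemma assoc_in: "assoc C a b c \<in> Hom C ((a \<boxtimes> b) \<boxtimes> c) (a \<boxtimes> (b \<boxtimes> c))"
  and lunit_in: "lunit C a \<in> Hom C (\<I> \<boxtimes> a) a"
  and runit_in: "runit C a \<in> Hom C (a \<boxtimes> \<I>) a"
  using assoc_unitary lunit_unitary runit_unitary by (auto simp: unitary_mor_def)

lemmas typing = comp_in tens_in ident_in ev_in coev_in assoc_in lunit_in runit_in dag_in

lemma zero_Hom [simp]: "0 \<in> Hom C a b"
  by (rule complex_vector.subspace_0[OF Hom_subspace])

lemma comp_add_right: "g \<in> Hom C b c \<Longrightarrow> f \<in> Hom C a b \<Longrightarrow> f' \<in> Hom C a b \<Longrightarrow> g \<cdot> (f + f') = g \<cdot> f + g \<cdot> f'"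
  using clinear_on_add[OF comp_linear_right] .
lemma comp_add_left: "g \<in> Hom C b c \<Longrightarrow> g' \<in> Hom C b c \<Longrightarrow> f \<in> Hom C a b \<Longrightarrow> (g + g') \<cdot> f = g \<cdot> f + g' \<cdot> f"
  using clinear_on_add[OF comp_linear_left] .
lemma comp_scale_right: "g \<in> Hom C b c \<Longrightarrow> f \<in> Hom C a b \<Longrightarrow> g \<cdot> (z *\<^sub>C f) = z *\<^sub>C (g \<cdot> f)"
  using clinear_on_scale[OF comp_linear_right] .
lemma comp_scale_left: "g \<in> Hom C b c \<Longrightarrow> f \<in> Hom C a b \<Longrightarrow> (z *\<^sub>C g) \<cdot> f = z *\<^sub>C (g \<cdot> f)"
  using clinear_on_scale[OF comp_linear_left] .
lemma comp_zero_right: "g \<in> Hom C b c \<Longrightarrow> g \<cdot> 0 = 0"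
  using clinear_on_zero[OF comp_linear_right Hom_subspace] .
lemma comp_zero_left: "f \<in> Hom C a b \<Longrightarrow> 0 \<cdot> f = 0"
  using clinear_on_zero[OF comp_linear_left Hom_subspace] .
lemma tens_zero_right: "f \<in> Hom C a b \<Longrightarrow> f \<otimes> 0 = 0"
  using clinear_on_zero[OF tens_linear_right Hom_subspace] .

lemma dag_zero: "(0::'m)\<^bold>* = 0"
  using dag_scale[OF zero_Hom, of 0] by simp

lemma ident_dag: "(\<one> a)\<^bold>* = \<one> a"
proof -
  have d: "(\<one> a)\<^bold>* \<in> Hom C a a" by (rule typing)+
  have "(\<one> a)\<^bold>* = (\<one> a)\<^bold>* \<cdot> \<one> a" using ident_right[OF d] by simp
  also have "\<dots> = ((\<one> a)\<^bold>* \<cdot> \<one> a)\<^bold>*" using dag_comp[OF d ident_in] dag_dag[OF ident_in] by simp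
  also have "\<dots> = \<one> a" using ident_right[OF d] dag_dag[OF ident_in] by simp
  finally show ?thesis .
qed

lemma mor_in: "f \<in> Hom C a b \<Longrightarrow> x \<in> hv a \<Longrightarrow> mor F f x \<in> hv b"
  using clinear_on_in[OF mor_linear] .
lemma mor_add_vec: "f \<in> Hom C a b \<Longrightarrow> x \<in> hv a \<Longrightarrow> y \<in> hv a \<Longrightarrow> mor F f (x + y) = mor F f x + mor F f y"
  using clinear_on_add[OF mor_linear] .
lemma mor_scale_vec: "f \<in> Hom C a b \<Longrightarrow> x \<in> hv a \<Longrightarrow> mor F f (z *\<^sub>C x) = z *\<^sub>C mor F f x"
  using clinear_on_scale[OF mor_linear] .
lemma mor_zero_vec: "f \<in> Hom C a b \<Longrightarrow> mor F f 0 = 0"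
  using clinear_on_zero[OF mor_linear O.subspace] .
lemma mor_sum_vec: "f \<in> Hom C a b \<Longrightarrow> (\<And>i. i \<in> I \<Longrightarrow> x i \<in> hv a) \<Longrightarrow> mor F f (\<Sum>i\<in>I. x i) = (\<Sum>i\<in>I. mor F f (x i))"
  using clinear_on_sum[OF mor_linear O.subspace] .
lemma mor_zero: "x \<in> hv a \<Longrightarrow> mor F 0 x = 0"
  using mor_scale[where z = 0, OF zero_Hom] by simp

lemma mor_comp3: "\<lbrakk>h \<in> Hom C c d; g \<in> Hom C b c; f \<in> Hom C a b; x \<in> hv a\<rbrakk>
    \<Longrightarrow> mor F (h \<cdot> g \<cdot> f) x = mor F h (mor F g (mor F f x))"
  using mor_comp[OF comp_in, of h c d g b f a x] mor_comp[of h c d g b "mor F f x"] mor_in[of f a b x] by simp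
lemma mor_sum:
  assumes "\<And>i. i \<in> I \<Longrightarrow> f i \<in> Hom C a b" "x \<in> hv a"
  shows "mor F (\<Sum>i\<in>I. f i) x = (\<Sum>i\<in>I. mor F (f i) x)"
proof -
  have "clinear_on (Hom C a b) UNIV (\<lambda>f. mor F f x)"
    using assms(2) by (intro clinear_onI) (auto simp: mor_add mor_scale)
  from clinear_on_sum[OF this Hom_subspace, of I f, OF assms(1)] show ?thesis .
qed

lemma mor_adj: "f \<in> Hom C a b \<Longrightarrow> x \<in> hv a \<Longrightarrow> y \<in> hv b \<Longrightarrow> ip (obj F b) (mor F f x) y = ip (obj F a) x (mor F (f\<^bold>*) y)"
  using mor_dag[of "f\<^bold>*" b a y x] dag_dag[of f a b] dag_in[of f a b] by simp

lemma vac_in [simp]: "vac F \<in> hv \<I>" and vac_ip [simp]: "ip (obj F \<I>) (vac F) (vac F) = 1"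
  using vac_unit by auto

lemma vac_nonzero: "vac F \<noteq> 0"
  using vac_ip by fastforce

abbreviation vacc :: "'h \<Rightarrow> complex" where "vacc w \<equiv> ip (obj F \<I>) (vac F) w"

lemma unit_expand: "w \<in> hv \<I> \<Longrightarrow> w = vacc w *\<^sub>C vac F"
proof -
  assume "w \<in> hv \<I>"
  then obtain z where "w = z *\<^sub>C vac F"
    using vac_unit(3) by (auto simp: complex_vector.span_singleton)
  thus ?thesis by (simp add: O.ip_scale_right)
qed

lemma lax_in: "x \<in> hv a \<Longrightarrow> y \<in> hv b \<Longrightarrow> lax F a b x y \<in> hv (a \<boxtimes> b)"
  using lax_unitary[of a b] by (auto simp: tensor_unitary_def clinear_on_def)
lemma lax_linear_right: "x \<in> hv a \<Longrightarrow> clinear_on (hv b) (hv (a \<boxtimes> b)) (lax F a b x)"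
  and lax_linear_left: "y \<in> hv b \<Longrightarrow> clinear_on (hv a) (hv (a \<boxtimes> b)) (\<lambda>x. lax F a b x y)"
  and lax_ip: "\<lbrakk>x \<in> hv a; x' \<in> hv a; y \<in> hv b; y' \<in> hv b\<rbrakk> \<Longrightarrow>
     ip (obj F (a \<boxtimes> b)) (lax F a b x y) (lax F a b x' y') = ip (obj F a) x x' * ip (obj F b) y y'"
  and lax_span: "hv (a \<boxtimes> b) = complex_vector.span {lax F a b x y |x y. x \<in> hv a \<and> y \<in> hv b}"
  using lax_unitary[of a b] by (auto simp: tensor_unitary_def)

lemmas lax_scale_right = clinear_on_scale[OF lax_linear_right]
lemmas lax_scale_left = clinear_on_scale[OF lax_linear_left]
lemmas lax_add_right = clinear_on_add[OF lax_linear_right]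
lemmas lax_add_left = clinear_on_add[OF lax_linear_left]
lemmas lax_zero_right = clinear_on_zero[OF lax_linear_right O.subspace]
lemma tensor_linear_eq:
  assumes "clinear_on (hv (a \<boxtimes> b)) W T" "clinear_on (hv (a \<boxtimes> b)) W' T'" "w \<in> hv (a \<boxtimes> b)"
    and "\<And>x y. x \<in> hv a \<Longrightarrow> y \<in> hv b \<Longrightarrow> T (lax F a b x y) = T' (lax F a b x y)"
  shows "T w = T' w"
  by (rule clinear_on_span_eq[of "{lax F a b x y |x y. x \<in> hv a \<and> y \<in> hv b}" W T W' T'])
    (use assms lax_span in auto)

lemma tensor_eqI:
  assumes "u \<in> hv (a \<boxtimes> b)" "w \<in> hv (a \<boxtimes> b)"
    and "\<And>x y. x \<in> hv a \<Longrightarrow> y \<in> hv b \<Longrightarrow> ip (obj F (a \<boxtimes> b)) u (lax F a b x y) = ip (obj F (a \<boxtimes> b)) w (lax F a b x y)"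
  shows "u = w"
proof (rule O.eq_if_ip_eq[OF assms(1,2)])
  fix v assume v: "v \<in> hv (a \<boxtimes> b)"
  have "ip (obj F (a \<boxtimes> b)) u v = ip (obj F (a \<boxtimes> b)) w v"
    by (rule tensor_linear_eq[OF O.ip_linear O.ip_linear v]) (use assms in auto)
  thus "ip (obj F (a \<boxtimes> b)) v u = ip (obj F (a \<boxtimes> b)) v w"
    using O.ip_cnj assms(1,2) v by metis
qed

lemma clinear_on_mor_comp: "clinear_on V (hv a) T \<Longrightarrow> f \<in> Hom C a b \<Longrightarrow> clinear_on V (hv b) (\<lambda>x. mor F f (T x))"
  by (intro clinear_onI) (auto simp: clinear_on_def mor_in mor_add_vec mor_scale_vec)

lemma clinear_on_dual_comp: "clinear_on V (hv a) T \<Longrightarrow> f \<in> dual (obj F a) \<Longrightarrow> clinear_on V UNIV (\<lambda>x. f (T x))"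
  by (intro clinear_onI) (auto simp: clinear_on_def O.dual_add O.dual_scale)

lemma mor_isometry_id:
  assumes "u \<in> Hom C a b" "u\<^bold>* \<cdot> u = \<one> a" "x \<in> hv a"
  shows "mor F (u\<^bold>*) (mor F u x) = x"
  using mor_comp[OF dag_in[OF assms(1)] assms(1,3)] mor_ident[OF assms(3)] assms(2) by simp

lemma mor_assoc_dag:
  "\<lbrakk>x \<in> hv a; y \<in> hv b; w \<in> hv c\<rbrakk> \<Longrightarrow>
    mor F ((assoc C a b c)\<^bold>*) (lax F a (b \<boxtimes> c) x (lax F b c y w)) = lax F (a \<boxtimes> b) c (lax F a b x y) w"
  using mor_isometry_id[of "assoc C a b c" "(a \<boxtimes> b) \<boxtimes> c" "a \<boxtimes> (b \<boxtimes> c)" "lax F (a \<boxtimes> b) c (lax F a b x y) w"] assoc_unitary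
  by (simp add: unitary_mor_def lax_assoc lax_in)

lemma mor_lunit_dag: "x \<in> hv a \<Longrightarrow> mor F ((lunit C a)\<^bold>*) x = lax F \<I> a (vac F) x"
  using mor_isometry_id[of "lunit C a" "\<I> \<boxtimes> a" a "lax F \<I> a (vac F) x"] lunit_unitary
  by (simp add: unitary_mor_def lax_lunit lax_in)

lemma mor_runit_dag: "x \<in> hv a \<Longrightarrow> mor F ((runit C a)\<^bold>*) x = lax F a \<I> x (vac F)"
  using mor_isometry_id[of "runit C a" "a \<boxtimes> \<I>" a "lax F a \<I> x (vac F)"] runit_unitary
  by (simp add: unitary_mor_def lax_runit lax_in)

text \<open>The scalar \<open>ev (1 \<otimes> f\<^sup>* f) ev\<^sup>*\<close> is seen by \<open>F\<close>, so it is zero if \<open>F\<close> kills \<open>f\<close>;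
  hence \<open>ev (1 \<otimes> f\<^sup>*) = 0\<close>, and the conjugate equation recovers \<open>f\<^sup>*\<close>.\<close>

lemma faithful:
  assumes f: "f \<in> Hom C a b" and zero: "\<And>x. x \<in> hv a \<Longrightarrow> mor F f x = 0"
  shows "f = 0"
proof -
  define k where "k = (\<one> (cj a) \<otimes> f) \<cdot> (ev C a)\<^bold>*"
  have k: "k \<in> Hom C \<I> (cj a \<boxtimes> b)" unfolding k_def by (rule typing f)+
  have "k\<^bold>* \<cdot> k \<in> Hom C \<I> \<I>" by (rule typing k)+
  then obtain z where z: "k\<^bold>* \<cdot> k = z *\<^sub>C \<one> \<I>" using unit_simple by (auto simp: simple_def)
  have "mor F (\<one> (cj a) \<otimes> f) w = 0" if "w \<in> hv (cj a \<boxtimes> a)" for w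
  proof (rule tensor_linear_eq[OF mor_linear _ that, where T' = "\<lambda>_. 0" and W' = UNIV])
    show "\<one> (cj a) \<otimes> f \<in> Hom C (cj a \<boxtimes> a) (cj a \<boxtimes> b)" by (rule typing f)+
  next
    fix x y assume "x \<in> hv (cj a)" "y \<in> hv a"
    thus "mor F (\<one> (cj a) \<otimes> f) (lax F (cj a) a x y) = 0"
      using lax_natural[OF ident_in f] zero by (simp add: mor_ident lax_zero_right)
  qed (auto intro: clinear_onI)
  hence "mor F k (vac F) = 0"
    unfolding k_def using mor_comp[of "\<one> (cj a) \<otimes> f" "cj a \<boxtimes> a" "cj a \<boxtimes> b" "(ev C a)\<^bold>*" \<I> "vac F"]
      mor_in[of "(ev C a)\<^bold>*" \<I> "cj a \<boxtimes> a" "vac F"] by (simp add: typing f)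
  hence "mor F (k\<^bold>* \<cdot> k) (vac F) = 0"
    using mor_comp[OF dag_in[OF k] k vac_in] mor_zero_vec[OF dag_in[OF k]] by simp
  hence "z *\<^sub>C vac F = 0" using mor_scale[OF ident_in vac_in, of z] mor_ident[OF vac_in] z by simp
  hence "z = 0" using vac_nonzero complex_vector.scale_eq_0_iff by blast
  hence "mnorm C (k\<^bold>* \<cdot> k) = 0" using z norm_eq_0[OF zero_Hom] by simp
  hence "k = 0" using norm_cstar[OF k] norm_eq_0[OF k] by simp
  hence "k\<^bold>* = 0" using dag_zero by simp
  moreover have "k\<^bold>* = ev C a \<cdot> (\<one> (cj a) \<otimes> f\<^bold>*)"
    unfolding k_def
    using dag_comp[of "\<one> (cj a) \<otimes> f" "cj a \<boxtimes> a" "cj a \<boxtimes> b" "(ev C a)\<^bold>*" \<I>]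
      dag_dag[OF ev_in] tens_dag[OF ident_in f] ident_dag
      tens_in[OF ident_in f, of "cj a"] dag_in[OF ev_in[of a]] by simp
  ultimately have ev0: "ev C a \<cdot> (\<one> (cj a) \<otimes> f\<^bold>*) = 0" by simp
  define g where "g = f\<^bold>*"
  have g: "g \<in> Hom C b a" unfolding g_def by (rule typing f)+
  let ?L = "lunit C" and ?A = "assoc C a (cj a)" and ?c = "coev C a"
  have 1: "(?L a)\<^bold>* \<cdot> g = (\<one> \<I> \<otimes> g) \<cdot> (?L b)\<^bold>*"
  proof -
    have ty: "(?L a)\<^bold>* \<in> Hom C a (\<I> \<boxtimes> a)" "(?L b)\<^bold>* \<in> Hom C b (\<I> \<boxtimes> b)" "\<one> \<I> \<otimes> g \<in> Hom C (\<I> \<boxtimes> b) (\<I> \<boxtimes> a)"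
      by (rule typing g)+
    have "(\<one> \<I> \<otimes> g) \<cdot> (?L b)\<^bold>* = ((?L a)\<^bold>* \<cdot> ?L a) \<cdot> ((\<one> \<I> \<otimes> g) \<cdot> (?L b)\<^bold>*)"
      using lunit_unitary[of a] ident_left[OF comp_in[OF ty(3,2)]] by (simp add: unitary_mor_def)
    also have "\<dots> = (?L a)\<^bold>* \<cdot> (?L a \<cdot> ((\<one> \<I> \<otimes> g) \<cdot> (?L b)\<^bold>*))"
      by (rule comp_assoc[OF ty(1) lunit_in comp_in[OF ty(3,2)]])
    also have "?L a \<cdot> ((\<one> \<I> \<otimes> g) \<cdot> (?L b)\<^bold>*) = (g \<cdot> ?L b) \<cdot> (?L b)\<^bold>*"
      using comp_assoc[OF lunit_in ty(3,2)] lunit_natural[OF g] by simp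
    also have "\<dots> = g \<cdot> (?L b \<cdot> (?L b)\<^bold>*)" by (rule comp_assoc[OF g lunit_in ty(2)])
    also have "\<dots> = g" using lunit_unitary[of b] ident_right[OF g] by (simp add: unitary_mor_def)
    finally show ?thesis by simp
  qed
  have 2: "(?c \<otimes> \<one> a) \<cdot> (\<one> \<I> \<otimes> g) = (\<one> (a \<boxtimes> cj a) \<otimes> g) \<cdot> (?c \<otimes> \<one> b)"
    using tens_comp[OF coev_in[of a] ident_in ident_in g] tens_comp[OF ident_in coev_in g ident_in, of a]
      ident_left[OF g] ident_right[OF g] ident_left[OF coev_in[of a]] ident_right[OF coev_in[of a]] by simp
  have 3: "?A a \<cdot> (\<one> (a \<boxtimes> cj a) \<otimes> g) = (\<one> a \<otimes> (\<one> (cj a) \<otimes> g)) \<cdot> ?A b"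
    using assoc_natural[OF ident_in ident_in g, of a "cj a"] tens_ident by simp
  have 4: "(\<one> a \<otimes> ev C a) \<cdot> (\<one> a \<otimes> (\<one> (cj a) \<otimes> g)) = 0"
    using tens_comp[OF ident_in ident_in ev_in, of "\<one> (cj a) \<otimes> g" "cj a \<boxtimes> b" a a]
      ev0 ident_left[OF ident_in, of a] tens_zero_right[OF ident_in, of a] by (simp add: typing g flip: g_def)
  define X where "X = runit C a \<cdot> (\<one> a \<otimes> ev C a)"
  have X: "X \<in> Hom C (a \<boxtimes> (cj a \<boxtimes> a)) a" unfolding X_def by (rule typing)+
  have X0: "X \<cdot> (\<one> a \<otimes> (\<one> (cj a) \<otimes> g)) = 0"
    unfolding X_def using comp_assoc[of "runit C a" "a \<boxtimes> \<I>" a "\<one> a \<otimes> ev C a" "a \<boxtimes> (cj a \<boxtimes> a)" "\<one> a \<otimes> (\<one> (cj a) \<otimes> g)" "a \<boxtimes> (cj a \<boxtimes> b)"]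
      4 comp_zero_right[OF runit_in] by (simp add: typing g)
  have ty: "?A a \<in> Hom C ((a \<boxtimes> cj a) \<boxtimes> a) (a \<boxtimes> (cj a \<boxtimes> a))" "?c \<otimes> \<one> a \<in> Hom C (\<I> \<boxtimes> a) ((a \<boxtimes> cj a) \<boxtimes> a)"
    "(?L a)\<^bold>* \<in> Hom C a (\<I> \<boxtimes> a)" "(?L b)\<^bold>* \<in> Hom C b (\<I> \<boxtimes> b)" "\<one> \<I> \<otimes> g \<in> Hom C (\<I> \<boxtimes> b) (\<I> \<boxtimes> a)"
    "\<one> (a \<boxtimes> cj a) \<otimes> g \<in> Hom C ((a \<boxtimes> cj a) \<boxtimes> b) ((a \<boxtimes> cj a) \<boxtimes> a)" "?c \<otimes> \<one> b \<in> Hom C (\<I> \<boxtimes> b) ((a \<boxtimes> cj a) \<boxtimes> b)"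
    "\<one> a \<otimes> (\<one> (cj a) \<otimes> g) \<in> Hom C (a \<boxtimes> (cj a \<boxtimes> b)) (a \<boxtimes> (cj a \<boxtimes> a))"
    "?A b \<in> Hom C ((a \<boxtimes> cj a) \<boxtimes> b) (a \<boxtimes> (cj a \<boxtimes> b))"
    by (rule typing g)+
  have "g = \<one> a \<cdot> g" using ident_left[OF g] by simp
  also have "\<one> a = ((X \<cdot> ?A a) \<cdot> (?c \<otimes> \<one> a)) \<cdot> (?L a)\<^bold>*" using conjugate_eq by (simp add: X_def)
  also have "\<dots> \<cdot> g = ((X \<cdot> ?A a) \<cdot> (?c \<otimes> \<one> a)) \<cdot> ((?L a)\<^bold>* \<cdot> g)"
    by (rule comp_assoc[OF comp_in[OF comp_in[OF X ty(1)] ty(2)] ty(3) g])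
  also have "\<dots> = (((X \<cdot> ?A a) \<cdot> (?c \<otimes> \<one> a)) \<cdot> (\<one> \<I> \<otimes> g)) \<cdot> (?L b)\<^bold>*"
    unfolding 1 by (rule comp_assoc[symmetric, OF comp_in[OF comp_in[OF X ty(1)] ty(2)] ty(5) ty(4)])
  also have "((X \<cdot> ?A a) \<cdot> (?c \<otimes> \<one> a)) \<cdot> (\<one> \<I> \<otimes> g) = (X \<cdot> ?A a) \<cdot> ((?c \<otimes> \<one> a) \<cdot> (\<one> \<I> \<otimes> g))"
    by (rule comp_assoc[OF comp_in[OF X ty(1)] ty(2) ty(5)])
  also have "\<dots> = ((X \<cdot> ?A a) \<cdot> (\<one> (a \<boxtimes> cj a) \<otimes> g)) \<cdot> (?c \<otimes> \<one> b)"
    unfolding 2 by (rule comp_assoc[symmetric, OF comp_in[OF X ty(1)] ty(6) ty(7)])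
  also have "(X \<cdot> ?A a) \<cdot> (\<one> (a \<boxtimes> cj a) \<otimes> g) = X \<cdot> (?A a \<cdot> (\<one> (a \<boxtimes> cj a) \<otimes> g))"
    by (rule comp_assoc[OF X ty(1) ty(6)])
  also have "\<dots> = (X \<cdot> (\<one> a \<otimes> (\<one> (cj a) \<otimes> g))) \<cdot> ?A b"
    unfolding 3 by (rule comp_assoc[symmetric, OF X ty(8) ty(9)])
  also have "\<dots> = 0" unfolding X0 by (rule comp_zero_left[OF ty(9)])
  finally have "g = 0" using comp_zero_left[OF ty(7)] comp_zero_left[OF ty(4)] by simp
  thus ?thesis using dag_dag[OF f] dag_zero by (simp add: g_def)
qed

lemma faithful_eq:
  assumes "f \<in> Hom C a b" "g \<in> Hom C a b" "\<And>x. x \<in> hv a \<Longrightarrow> mor F f x = mor F g x"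
  shows "f = g"
proof -
  have "f - g \<in> Hom C a b" by (rule complex_vector.subspace_diff[OF Hom_subspace assms(1,2)])
  moreover have "mor F (f - g) x = 0" if "x \<in> hv a" for x
    using mor_add[OF calculation assms(2) that] assms(3)[OF that] by simp
  ultimately show ?thesis using faithful by fastforce
qed

section \<open>Conjugates as dual spaces\<close>

text \<open>The maps prescribed by definite descriptions exist by linear extension along the tensor product.\<close>

lemma slice_spec:
  assumes f: "f \<in> dual (obj F a)"
  shows "clinear_on (hv (a \<boxtimes> b)) (hv b) (slice C F a b f)"
    and "\<And>x y. x \<in> hv a \<Longrightarrow> y \<in> hv b \<Longrightarrow> slice C F a b f (lax F a b x y) = f x *\<^sub>C y"
proof -
  have "\<exists>!L. clinear_on (hv (a \<boxtimes> b)) (hv b) L \<and> (\<forall>w. w \<notin> hv (a \<boxtimes> b) \<longrightarrow> L w = 0) \<and>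
     (\<forall>x\<in>hv a. \<forall>y\<in>hv b. L (lax F a b x y) = f x *\<^sub>C y)"
    by (rule O.tensor_extend[OF O.fd_hilbert_space_axioms O.fd_hilbert_space_axioms lax_unitary O.subspace])
      (auto intro!: clinear_onI simp: scaleC_add_right scaleC_add_left O.dual_add[OF f] O.dual_scale[OF f] mult_ac)
  from theI'[OF this] show "clinear_on (hv (a \<boxtimes> b)) (hv b) (slice C F a b f)"
    "\<And>x y. x \<in> hv a \<Longrightarrow> y \<in> hv b \<Longrightarrow> slice C F a b f (lax F a b x y) = f x *\<^sub>C y"
    unfolding slice_def by auto
qed

lemma tens_fun_spec:
  assumes f: "f \<in> dual (obj F a)" and g: "g \<in> dual (obj F b)"
  shows "tens_fun C F a b f g \<in> dual (obj F (a \<boxtimes> b))"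
    and "\<And>x y. x \<in> hv a \<Longrightarrow> y \<in> hv b \<Longrightarrow> tens_fun C F a b f g (lax F a b x y) = f x * g y"
proof -
  have "\<exists>!L. clinear_on (hv (a \<boxtimes> b)) UNIV L \<and> (\<forall>w. w \<notin> hv (a \<boxtimes> b) \<longrightarrow> L w = 0) \<and>
     (\<forall>x\<in>hv a. \<forall>y\<in>hv b. L (lax F a b x y) = f x * g y)"
    by (rule O.tensor_extend[OF O.fd_hilbert_space_axioms O.fd_hilbert_space_axioms lax_unitary complex_vector.subspace_UNIV])
      (auto intro!: clinear_onI simp: O.dual_add[OF f] O.dual_scale[OF f] O.dual_add[OF g] O.dual_scale[OF g] algebra_simps)
  hence "\<exists>!h. h \<in> dual (obj F (a \<boxtimes> b)) \<and> (\<forall>x\<in>hv a. \<forall>y\<in>hv b. h (lax F a b x y) = f x * g y)"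
    by (simp add: dual_def conj_assoc)
  from theI'[OF this] show "tens_fun C F a b f g \<in> dual (obj F (a \<boxtimes> b))"
    "\<And>x y. x \<in> hv a \<Longrightarrow> y \<in> hv b \<Longrightarrow> tens_fun C F a b f g (lax F a b x y) = f x * g y"
    unfolding tens_fun_def by auto
qed

lemma tensor_dual_eqI:
  assumes "f \<in> dual (obj F (a \<boxtimes> b))" "g \<in> dual (obj F (a \<boxtimes> b))"
    and "\<And>x y. x \<in> hv a \<Longrightarrow> y \<in> hv b \<Longrightarrow> f (lax F a b x y) = g (lax F a b x y)"
  shows "f = g"
proof (rule O.dual_cong[OF assms(1,2)])
  fix w assume w: "w \<in> hv (a \<boxtimes> b)"
  show "f w = g w"
    by (rule tensor_linear_eq[OF _ _ w, of UNIV f UNIV g]) (use assms in \<open>auto simp: dual_def\<close>)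
qed

text \<open>\<open>pairing a \<xi>\<close> is the functional \<open>x \<mapsto> ev (\<xi> \<otimes> x)\<close>, and \<open>copairing a\<close> is the vector of the
  coevaluation.\<close>

definition pairing :: "'o \<Rightarrow> 'h \<Rightarrow> 'h \<Rightarrow> complex" where
  "pairing a \<xi> = (\<lambda>x. if x \<in> hv a then hat_ev C F a \<xi> x else 0)"

definition copairing :: "'o \<Rightarrow> 'h" where
  "copairing a = mor F (coev C a) (vac F)"

lemma copairing_in: "copairing a \<in> hv (a \<boxtimes> cj a)"
  unfolding copairing_def by (rule mor_in[OF coev_in vac_in])

lemma mor_ev: "\<xi> \<in> hv (cj a) \<Longrightarrow> x \<in> hv a \<Longrightarrow> mor F (ev C a) (lax F (cj a) a \<xi> x) = hat_ev C F a \<xi> x *\<^sub>C vac F"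
  unfolding hat_ev_def using unit_expand[OF mor_in[OF ev_in lax_in]] .

lemma hat_ev_linear_right: "\<xi> \<in> hv (cj a) \<Longrightarrow> clinear_on (hv a) UNIV (hat_ev C F a \<xi>)"
  unfolding hat_ev_def
  by (intro clinear_onI) (simp_all add: lax_add_right lax_scale_right mor_add_vec[OF ev_in] mor_scale_vec[OF ev_in]
      mor_in[OF ev_in] lax_in O.ip_add_right O.ip_scale_right)

lemma hat_ev_linear_left: "x \<in> hv a \<Longrightarrow> clinear_on (hv (cj a)) UNIV (\<lambda>\<xi>. hat_ev C F a \<xi> x)"
  unfolding hat_ev_def
  by (intro clinear_onI) (simp_all add: lax_add_left lax_scale_left mor_add_vec[OF ev_in] mor_scale_vec[OF ev_in]
      mor_in[OF ev_in] lax_in O.ip_add_right O.ip_scale_right)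

lemmas hat_ev_scale_right = clinear_on_scale[OF hat_ev_linear_right, simplified scaleC_complex]
lemmas hat_ev_scale_left = clinear_on_scale[OF hat_ev_linear_left, simplified scaleC_complex]
lemmas hat_ev_add_right = clinear_on_add[OF hat_ev_linear_right]
lemmas hat_ev_add_left = clinear_on_add[OF hat_ev_linear_left]

lemma pairing_in: "\<xi> \<in> hv (cj a) \<Longrightarrow> pairing a \<xi> \<in> dual (obj F a)"
  unfolding dual_def pairing_def
  by (auto intro!: clinear_onI simp: hat_ev_add_right hat_ev_scale_right)

lemma pairing_apply [simp]: "x \<in> hv a \<Longrightarrow> pairing a \<xi> x = hat_ev C F a \<xi> x"
  by (simp add: pairing_def)

lemma slice_in: "f \<in> dual (obj F a) \<Longrightarrow> w \<in> hv (a \<boxtimes> b) \<Longrightarrow> slice C F a b f w \<in> hv b"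
  using clinear_on_in[OF slice_spec(1)] .

text \<open>The two conjugate equations say that slicing the copairing inverts the pairing.\<close>

lemma slice_copairing:
  assumes g: "g \<in> dual (obj F a)" and y: "y \<in> hv a"
  shows "hat_ev C F a (slice C F a (cj a) g (copairing a)) y = g y"
proof -
  define X where "X = runit C a \<cdot> (\<one> a \<otimes> ev C a) \<cdot> assoc C a (cj a) a"
  have X: "X \<in> Hom C ((a \<boxtimes> cj a) \<boxtimes> a) a" unfolding X_def by (rule typing)+
  have X_lax: "mor F X (lax F (a \<boxtimes> cj a) a (lax F a (cj a) x \<xi>) y) = hat_ev C F a \<xi> y *\<^sub>C x"
    if x: "x \<in> hv a" and xi: "\<xi> \<in> hv (cj a)" for x \<xi>
  proof -
    have "mor F X (lax F (a \<boxtimes> cj a) a (lax F a (cj a) x \<xi>) y) =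
        mor F (runit C a) (mor F (\<one> a \<otimes> ev C a) (mor F (assoc C a (cj a) a) (lax F (a \<boxtimes> cj a) a (lax F a (cj a) x \<xi>) y)))"
      unfolding X_def
      by (rule mor_comp3[OF runit_in tens_in[OF ident_in ev_in] assoc_in]) (intro lax_in x xi y)
    also have "\<dots> = mor F (runit C a) (lax F a \<I> x (hat_ev C F a \<xi> y *\<^sub>C vac F))"
      using lax_natural[OF ident_in ev_in x, of "lax F (cj a) a \<xi> y" a] x xi y
      by (simp add: lax_assoc lax_in mor_ident mor_ev)
    also have "\<dots> = hat_ev C F a \<xi> y *\<^sub>C x"
      using x by (simp add: lax_scale_right lax_in mor_scale_vec[OF runit_in] lax_runit)
    finally show ?thesis .
  qed
  have "mor F (coev C a \<otimes> \<one> a) (mor F ((lunit C a)\<^bold>*) y) = lax F (a \<boxtimes> cj a) a (copairing a) y"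
    using y lax_natural[OF coev_in ident_in vac_in y] by (simp add: mor_lunit_dag mor_ident copairing_def)
  moreover have "mor F (X \<cdot> (coev C a \<otimes> \<one> a) \<cdot> (lunit C a)\<^bold>*) y = mor F X (mor F (coev C a \<otimes> \<one> a) (mor F ((lunit C a)\<^bold>*) y))"
    by (rule mor_comp3[OF X tens_in[OF coev_in ident_in] dag_in[OF lunit_in] y])
  ultimately have "y = mor F X (lax F (a \<boxtimes> cj a) a (copairing a) y)"
    using conjugate_eq[of a] mor_ident[OF y] by (simp add: X_def)
  moreover have "hat_ev C F a (slice C F a (cj a) g (copairing a)) y = g (mor F X (lax F (a \<boxtimes> cj a) a (copairing a) y))"
  proof (rule tensor_linear_eq[OF _ _ copairing_in, where W = UNIV and W' = UNIV])
    show "clinear_on (hv (a \<boxtimes> cj a)) UNIV (\<lambda>w. hat_ev C F a (slice C F a (cj a) g w) y)"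
      using slice_spec(1)[OF g] y by (intro clinear_onI)
        (auto simp: clinear_on_def hat_ev_add_left hat_ev_scale_left)
    show "clinear_on (hv (a \<boxtimes> cj a)) UNIV (\<lambda>w. g (mor F X (lax F (a \<boxtimes> cj a) a w y)))"
      by (rule clinear_on_dual_comp[OF clinear_on_mor_comp[OF lax_linear_left[OF y] X] g])
  next
    fix x \<xi> assume x: "x \<in> hv a" and xi: "\<xi> \<in> hv (cj a)"
    show "hat_ev C F a (slice C F a (cj a) g (lax F a (cj a) x \<xi>)) y = g (mor F X (lax F (a \<boxtimes> cj a) a (lax F a (cj a) x \<xi>) y))"
      unfolding X_lax[OF x xi] slice_spec(2)[OF g x xi] using x xi y g
      by (simp add: hat_ev_scale_left O.dual_scale)
  qed
  ultimately show ?thesis by simp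
qed

lemma slice_pairing:
  assumes xi: "\<xi> \<in> hv (cj a)"
  shows "slice C F a (cj a) (pairing a \<xi>) (copairing a) = \<xi>"
proof -
  let ?c = "cj a"
  define X where "X = lunit C ?c \<cdot> (ev C a \<otimes> \<one> ?c) \<cdot> (assoc C ?c a ?c)\<^bold>*"
  have X: "X \<in> Hom C (?c \<boxtimes> (a \<boxtimes> ?c)) ?c" unfolding X_def by (rule typing)+
  have X_lax: "mor F X (lax F ?c (a \<boxtimes> ?c) \<xi> (lax F a ?c x \<eta>)) = hat_ev C F a \<xi> x *\<^sub>C \<eta>"
    if x: "x \<in> hv a" and eta: "\<eta> \<in> hv ?c" for x \<eta>
  proof -
    have "mor F X (lax F ?c (a \<boxtimes> ?c) \<xi> (lax F a ?c x \<eta>)) =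
        mor F (lunit C ?c) (mor F (ev C a \<otimes> \<one> ?c) (mor F ((assoc C ?c a ?c)\<^bold>*) (lax F ?c (a \<boxtimes> ?c) \<xi> (lax F a ?c x \<eta>))))"
      unfolding X_def
      by (rule mor_comp3[OF lunit_in tens_in[OF ev_in ident_in] dag_in[OF assoc_in]]) (intro lax_in x xi eta)
    also have "\<dots> = mor F (lunit C ?c) (lax F \<I> ?c (hat_ev C F a \<xi> x *\<^sub>C vac F) \<eta>)"
      using lax_natural[OF ev_in ident_in _ eta, of "lax F ?c a \<xi> x" a] x xi eta
      by (simp add: mor_assoc_dag lax_in mor_ident mor_ev)
    also have "\<dots> = hat_ev C F a \<xi> x *\<^sub>C \<eta>"
      using eta by (simp add: lax_scale_left lax_in mor_scale_vec[OF lunit_in] lax_lunit)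
    finally show ?thesis .
  qed
  have "mor F (\<one> ?c \<otimes> coev C a) (mor F ((runit C ?c)\<^bold>*) \<xi>) = lax F ?c (a \<boxtimes> ?c) \<xi> (copairing a)"
    using xi lax_natural[OF ident_in coev_in xi vac_in] by (simp add: mor_runit_dag mor_ident copairing_def)
  moreover have "mor F (X \<cdot> (\<one> ?c \<otimes> coev C a) \<cdot> (runit C ?c)\<^bold>*) \<xi> = mor F X (mor F (\<one> ?c \<otimes> coev C a) (mor F ((runit C ?c)\<^bold>*) \<xi>))"
    by (rule mor_comp3[OF X tens_in[OF ident_in coev_in] dag_in[OF runit_in] xi])
  ultimately have "\<xi> = mor F X (lax F ?c (a \<boxtimes> ?c) \<xi> (copairing a))"
    using conjugate_eq'[of a] mor_ident[OF xi] by (simp add: X_def)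
  also have "\<dots> = slice C F a ?c (pairing a \<xi>) (copairing a)"
  proof (rule tensor_linear_eq[OF _ slice_spec(1)[OF pairing_in[OF xi]] copairing_in])
    show "clinear_on (hv (a \<boxtimes> cj a)) (hv ?c) (\<lambda>w. mor F X (lax F ?c (a \<boxtimes> ?c) \<xi> w))"
      by (rule clinear_on_mor_comp[OF lax_linear_right[OF xi] X])
  qed (simp add: X_lax slice_spec(2)[OF pairing_in[OF xi]])
  finally show ?thesis by simp
qed

lemma hat_ev_nondegenerate_left:
  assumes "\<xi> \<in> hv (cj a)" "\<eta> \<in> hv (cj a)" "\<And>x. x \<in> hv a \<Longrightarrow> hat_ev C F a \<xi> x = hat_ev C F a \<eta> x"
  shows "\<xi> = \<eta>"
proof -
  have "pairing a \<xi> = pairing a \<eta>" using assms(3) by (auto simp: pairing_def)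
  hence "slice C F a (cj a) (pairing a \<xi>) (copairing a) = slice C F a (cj a) (pairing a \<eta>) (copairing a)"
    by (rule arg_cong)
  thus ?thesis by (simp only: slice_pairing assms(1,2))
qed

lemma hat_ev_nondegenerate_right:
  assumes "x \<in> hv a" "y \<in> hv a" "\<And>\<xi>. \<xi> \<in> hv (cj a) \<Longrightarrow> hat_ev C F a \<xi> x = hat_ev C F a \<xi> y"
  shows "x = y"
proof (rule O.eq_if_dual_eq[OF assms(1,2)])
  fix g assume g: "g \<in> dual (obj F a)"
  show "g x = g y"
    using slice_copairing[OF g] assms(1,2) assms(3)[OF slice_in[OF g copairing_in]] by metis
qed

text \<open>The vector \<open>v\<^sup>\<sharp>\<close> of the conjugate that represents the functional \<open>\<langle>v, \<cdot>\<rangle>\<close>.\<close>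

definition sharp :: "'o \<Rightarrow> 'h \<Rightarrow> 'h" where
  "sharp a v = slice C F a (cj a) (bra (obj F a) v) (copairing a)"

lemma sharp_in: "v \<in> hv a \<Longrightarrow> sharp a v \<in> hv (cj a)"
  unfolding sharp_def by (intro slice_in O.bra_in copairing_in)

lemma hat_ev_sharp: "v \<in> hv a \<Longrightarrow> y \<in> hv a \<Longrightarrow> hat_ev C F a (sharp a v) y = ip (obj F a) v y"
  unfolding sharp_def using slice_copairing[OF O.bra_in] by simp

lemma sharp_eqI:
  assumes "v \<in> hv a" "\<xi> \<in> hv (cj a)" "\<And>y. y \<in> hv a \<Longrightarrow> hat_ev C F a \<xi> y = ip (obj F a) v y"
  shows "sharp a v = \<xi>"
  by (rule hat_ev_nondegenerate_left[OF sharp_in]) (simp_all add: assms hat_ev_sharp)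

lemma slice_eq_sharp: "g \<in> dual (obj F a) \<Longrightarrow> slice C F a (cj a) g (copairing a) = sharp a (ket (obj F a) g)"
  by (simp add: sharp_def)

lemma sharp_add: "v \<in> hv a \<Longrightarrow> w \<in> hv a \<Longrightarrow> sharp a (v + w) = sharp a v + sharp a w"
  by (rule sharp_eqI) (simp_all add: sharp_in hat_ev_add_left hat_ev_sharp O.ip_add_left)

lemma sharp_scale: "v \<in> hv a \<Longrightarrow> sharp a (z *\<^sub>C v) = cnj z *\<^sub>C sharp a v"
  by (rule sharp_eqI) (simp_all add: sharp_in hat_ev_scale_left hat_ev_sharp O.ip_scale_left)

lemma sharp_surj: "\<xi> \<in> hv (cj a) \<Longrightarrow> \<exists>v\<in>hv a. \<xi> = sharp a v"
  using slice_eq_sharp[OF pairing_in] slice_pairing O.ket_in[OF pairing_in] by metis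

text \<open>A pairing morphism into the unit is bent into a morphism into a conjugate, and in the second lemma
  into a morphism out of the right factor, by composition with a coevaluation; the effect of the result
  under \<open>F\<close> is computed by slicing the copairing.\<close>

lemma curry_conj:
  assumes p: "p \<in> Hom C (b \<boxtimes> c) \<I>"
  shows "\<exists>\<beta>\<in>Hom C b (cj c). \<forall>x\<in>hv b. \<forall>w\<in>hv c. hat_ev C F c (mor F \<beta> x) w = vacc (mor F p (lax F b c x w))"
proof -
  let ?c = "cj c"
  define X where "X = lunit C ?c \<cdot> (p \<otimes> \<one> ?c) \<cdot> (assoc C b c ?c)\<^bold>*"
  define \<beta> where "\<beta> = X \<cdot> (\<one> b \<otimes> coev C c) \<cdot> (runit C b)\<^bold>*"
  have X: "X \<in> Hom C (b \<boxtimes> (c \<boxtimes> ?c)) ?c" unfolding X_def by (rule typing p)+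
  have \<beta>: "\<beta> \<in> Hom C b ?c" unfolding \<beta>_def by (rule typing X)+
  have "hat_ev C F c (mor F \<beta> x) w = vacc (mor F p (lax F b c x w))" if x: "x \<in> hv b" and w: "w \<in> hv c" for x w
  proof -
    define g where "g = (\<lambda>y. if y \<in> hv c then vacc (mor F p (lax F b c x y)) else 0)"
    have g: "g \<in> dual (obj F c)"
      unfolding g_def dual_def using x
      by (auto intro!: clinear_onI simp: lax_add_right lax_scale_right lax_in mor_add_vec[OF p] mor_scale_vec[OF p]
          mor_in[OF p] O.ip_add_right O.ip_scale_right)
    have X_lax: "mor F X (lax F b (c \<boxtimes> ?c) x (lax F c ?c y \<eta>)) = g y *\<^sub>C \<eta>"
      if y: "y \<in> hv c" and eta: "\<eta> \<in> hv ?c" for y \<eta>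
    proof -
      have "mor F X (lax F b (c \<boxtimes> ?c) x (lax F c ?c y \<eta>)) =
          mor F (lunit C ?c) (mor F (p \<otimes> \<one> ?c) (mor F ((assoc C b c ?c)\<^bold>*) (lax F b (c \<boxtimes> ?c) x (lax F c ?c y \<eta>))))"
        unfolding X_def
        by (rule mor_comp3[OF lunit_in tens_in[OF p ident_in] dag_in[OF assoc_in]]) (intro lax_in x y eta)
      also have "\<dots> = mor F (lunit C ?c) (lax F \<I> ?c (g y *\<^sub>C vac F) \<eta>)"
        using lax_natural[OF p ident_in _ eta, of "lax F b c x y"] x y eta unit_expand[OF mor_in[OF p lax_in[OF x y]]]
        by (simp add: mor_assoc_dag lax_in mor_ident g_def)
      also have "\<dots> = g y *\<^sub>C \<eta>"
        using eta by (simp add: lax_scale_left lax_in mor_scale_vec[OF lunit_in] lax_lunit)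
      finally show ?thesis .
    qed
    have "mor F (\<one> b \<otimes> coev C c) (mor F ((runit C b)\<^bold>*) x) = lax F b (c \<boxtimes> ?c) x (copairing c)"
      using x lax_natural[OF ident_in coev_in x vac_in] by (simp add: mor_runit_dag mor_ident copairing_def)
    moreover have "mor F \<beta> x = mor F X (mor F (\<one> b \<otimes> coev C c) (mor F ((runit C b)\<^bold>*) x))"
      unfolding \<beta>_def
      by (rule mor_comp3[OF X tens_in[OF ident_in coev_in] dag_in[OF runit_in] x])
    ultimately have "mor F \<beta> x = mor F X (lax F b (c \<boxtimes> ?c) x (copairing c))" by simp
    also have "\<dots> = slice C F c ?c g (copairing c)"
    proof (rule tensor_linear_eq[OF _ slice_spec(1)[OF g] copairing_in])
      show "clinear_on (hv (c \<boxtimes> ?c)) (hv ?c) (\<lambda>w. mor F X (lax F b (c \<boxtimes> ?c) x w))"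
        by (rule clinear_on_mor_comp[OF lax_linear_right[OF x] X])
    qed (simp add: X_lax slice_spec(2)[OF g])
    finally show ?thesis using slice_copairing[OF g w] w by (simp add: g_def)
  qed
  thus ?thesis using \<beta> by blast
qed

lemma curry_obj:
  assumes p: "p \<in> Hom C (cj a \<boxtimes> c) \<I>"
  shows "\<exists>\<alpha>\<in>Hom C c a. \<forall>\<xi>\<in>hv (cj a). \<forall>w\<in>hv c. hat_ev C F a \<xi> (mor F \<alpha> w) = vacc (mor F p (lax F (cj a) c \<xi> w))"
proof -
  let ?a = "cj a"
  define X where "X = runit C a \<cdot> (\<one> a \<otimes> p) \<cdot> assoc C a ?a c"
  define \<alpha> where "\<alpha> = X \<cdot> (coev C a \<otimes> \<one> c) \<cdot> (lunit C c)\<^bold>*"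
  have X: "X \<in> Hom C ((a \<boxtimes> ?a) \<boxtimes> c) a" unfolding X_def by (rule typing p)+
  have \<alpha>: "\<alpha> \<in> Hom C c a" unfolding \<alpha>_def by (rule typing X)+
  have "hat_ev C F a \<xi> (mor F \<alpha> w) = vacc (mor F p (lax F ?a c \<xi> w))" if xi: "\<xi> \<in> hv ?a" and w: "w \<in> hv c" for \<xi> w
  proof -
    have X_lax: "mor F X (lax F (a \<boxtimes> ?a) c (lax F a ?a x \<eta>) w) = vacc (mor F p (lax F ?a c \<eta> w)) *\<^sub>C x"
      if x: "x \<in> hv a" and eta: "\<eta> \<in> hv ?a" for x \<eta>
    proof -
      have "mor F X (lax F (a \<boxtimes> ?a) c (lax F a ?a x \<eta>) w) =
          mor F (runit C a) (mor F (\<one> a \<otimes> p) (mor F (assoc C a ?a c) (lax F (a \<boxtimes> ?a) c (lax F a ?a x \<eta>) w)))"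
        unfolding X_def
        by (rule mor_comp3[OF runit_in tens_in[OF ident_in p] assoc_in]) (intro lax_in x w eta)
      also have "\<dots> = mor F (runit C a) (lax F a \<I> x (vacc (mor F p (lax F ?a c \<eta> w)) *\<^sub>C vac F))"
        using lax_natural[OF ident_in p x, of "lax F ?a c \<eta> w"] x w eta unit_expand[OF mor_in[OF p lax_in[OF eta w]]]
        by (simp add: lax_assoc lax_in mor_ident)
      also have "\<dots> = vacc (mor F p (lax F ?a c \<eta> w)) *\<^sub>C x"
        using x by (simp add: lax_scale_right lax_in mor_scale_vec[OF runit_in] lax_runit)
      finally show ?thesis .
    qed
    have "mor F (coev C a \<otimes> \<one> c) (mor F ((lunit C c)\<^bold>*) w) = lax F (a \<boxtimes> ?a) c (copairing a) w"
      using w lax_natural[OF coev_in ident_in vac_in w] by (simp add: mor_lunit_dag mor_ident copairing_def)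
    moreover have "mor F \<alpha> w = mor F X (mor F (coev C a \<otimes> \<one> c) (mor F ((lunit C c)\<^bold>*) w))"
      unfolding \<alpha>_def
      by (rule mor_comp3[OF X tens_in[OF coev_in ident_in] dag_in[OF lunit_in] w])
    ultimately have "hat_ev C F a \<xi> (mor F \<alpha> w) = pairing a \<xi> (mor F X (lax F (a \<boxtimes> ?a) c (copairing a) w))"
      using mor_in[OF \<alpha> w] by simp
    also have "\<dots> = vacc (mor F p (lax F ?a c (slice C F a ?a (pairing a \<xi>) (copairing a)) w))"
    proof (rule tensor_linear_eq[OF _ _ copairing_in, where W = UNIV and W' = UNIV])
      show "clinear_on (hv (a \<boxtimes> ?a)) UNIV (\<lambda>u. pairing a \<xi> (mor F X (lax F (a \<boxtimes> ?a) c u w)))"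
        by (rule clinear_on_dual_comp[OF clinear_on_mor_comp[OF lax_linear_left[OF w] X] pairing_in[OF xi]])
      show "clinear_on (hv (a \<boxtimes> ?a)) UNIV (\<lambda>u. vacc (mor F p (lax F ?a c (slice C F a ?a (pairing a \<xi>) u) w)))"
        using slice_spec(1)[OF pairing_in[OF xi]] w
        by (intro clinear_onI) (auto simp: clinear_on_def lax_add_left lax_scale_left lax_in mor_add_vec[OF p] mor_scale_vec[OF p]
          mor_in[OF p] O.ip_add_right O.ip_scale_right)
    next
      fix x \<eta> assume x: "x \<in> hv a" and eta: "\<eta> \<in> hv ?a"
      show "pairing a \<xi> (mor F X (lax F (a \<boxtimes> ?a) c (lax F a ?a x \<eta>) w)) =
        vacc (mor F p (lax F ?a c (slice C F a ?a (pairing a \<xi>) (lax F a ?a x \<eta>)) w))"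
        unfolding X_lax[OF x eta] slice_spec(2)[OF pairing_in[OF xi] x eta] using x eta xi w
        by (simp add: hat_ev_scale_right lax_scale_left lax_in mor_scale_vec[OF p] mor_in[OF p] O.ip_scale_right)
    qed
    finally show ?thesis using slice_pairing[OF xi] by simp
  qed
  thus ?thesis using \<alpha> by blast
qed

section \<open>Simple objects\<close>

lemma simple_ident: "simple C a \<Longrightarrow> \<one> a \<noteq> 0"
  by (simp add: simple_def)

lemma unit_vector:
  assumes "\<one> a \<noteq> 0"
  shows "\<exists>x\<in>hv a. ip (obj F a) x x = 1"
proof -
  have "basis (obj F a) \<noteq> {}"
  proof
    assume "basis (obj F a) = {}"
    hence "x = 0" if "x \<in> hv a" for x using O.basis_expand[OF that] by simp
    hence "mor F (\<one> a) x = 0" if "x \<in> hv a" for x using mor_ident[OF that] that by simp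
    thus False using faithful[OF ident_in] assms by blast
  qed
  thus ?thesis using O.basis_in O.basis_ip by force
qed

text \<open>The scalar by which an endomorphism of a simple object acts.\<close>

definition sc :: "'o \<Rightarrow> 'm \<Rightarrow> complex" where
  "sc a f = (THE z. f = z *\<^sub>C \<one> a)"

lemma sc_eqI:
  assumes "\<one> a \<noteq> 0" "f = z *\<^sub>C \<one> a"
  shows "sc a f = z"
  unfolding sc_def
  by (rule the_equality) (use assms complex_vector.scale_right_imp_eq in \<open>auto simp: complex_vector.scale_cancel_right\<close>)

lemma simple_scalar: "simple C a \<Longrightarrow> f \<in> Hom C a a \<Longrightarrow> f = sc a f *\<^sub>C \<one> a"
  using sc_eqI[of a f] by (auto simp: simple_def)

lemma mor_simple: "simple C a \<Longrightarrow> f \<in> Hom C a a \<Longrightarrow> x \<in> hv a \<Longrightarrow> mor F f x = sc a f *\<^sub>C x"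
  using simple_scalar[of a f] mor_scale[OF ident_in, of x a "sc a f"] mor_ident[of x a] by metis

lemma sc_form:
  assumes "simple C a" "f \<in> Hom C a a" "x \<in> hv a" "ip (obj F a) x x = 1"
  shows "sc a f = ip (obj F a) x (mor F f x)"
  using assms by (simp add: mor_simple O.ip_scale_right)

lemma comp_scaled:
  "f \<in> Hom C a b \<Longrightarrow> g \<in> Hom C b c \<Longrightarrow> (z *\<^sub>C g) \<cdot> (w *\<^sub>C f) = (z * w) *\<^sub>C (g \<cdot> f)"
  using comp_scale_left[of g b c "w *\<^sub>C f" a z] comp_scale_right[of g b c f a w]
    complex_vector.subspace_scale[OF Hom_subspace, of f a b w] by simp

text \<open>Both \<open>f\<^sup>* f\<close> and \<open>f f\<^sup>*\<close> are scalars, the scalars agree and are positive, and dividing \<open>f\<close> by their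
  square root gives a unitary.\<close>

lemma schur:
  assumes a: "simple C a" and b: "simple C b" and f: "f \<in> Hom C a b" "f \<noteq> 0"
  shows "\<exists>u k. unitary_mor C a b u \<and> f = k *\<^sub>C u"
proof -
  have fd: "f\<^bold>* \<in> Hom C b a" by (rule typing f)+
  define z where "z = sc a (f\<^bold>* \<cdot> f)"
  define z' where "z' = sc b (f \<cdot> f\<^bold>*)"
  have z: "f\<^bold>* \<cdot> f = z *\<^sub>C \<one> a" unfolding z_def by (rule simple_scalar[OF a]) (rule typing f)+
  have z': "f \<cdot> f\<^bold>* = z' *\<^sub>C \<one> b" unfolding z'_def by (rule simple_scalar[OF b]) (rule typing f)+
  obtain x where x: "x \<in> hv a" "ip (obj F a) x x = 1" using unit_vector[OF simple_ident[OF a]] by blast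
  have "z = ip (obj F a) x (mor F (f\<^bold>* \<cdot> f) x)"
    unfolding z_def by (rule sc_form[OF a comp_in[OF fd f(1)] x])
  also have "\<dots> = ip (obj F b) (mor F f x) (mor F f x)"
    using mor_comp[OF fd f(1) x(1)] mor_adj[OF f(1) x(1) mor_in[OF f(1) x(1)]] by simp
  finally have zr: "z = of_real ((hnorm (obj F b) (mor F f x))\<^sup>2)"
    using O.ip_self[OF mor_in[OF f(1) x(1)]] by simp
  have "z \<noteq> 0"
  proof
    assume "z = 0"
    hence "(mnorm C f)\<^sup>2 = 0" using norm_cstar[OF f(1)] z norm_eq_0[OF zero_Hom] by simp
    thus False using norm_eq_0[OF f(1)] f(2) by simp
  qed
  have "z *\<^sub>C f = f \<cdot> (z *\<^sub>C \<one> a)"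
    using comp_scale_right[OF f(1) ident_in] ident_right[OF f(1)] by simp
  also have "\<dots> = (f \<cdot> f\<^bold>*) \<cdot> f" unfolding z[symmetric] by (rule comp_assoc[symmetric, OF f(1) fd f(1)])
  also have "\<dots> = z' *\<^sub>C f" unfolding z' comp_scale_left[OF ident_in f(1)] ident_left[OF f(1)] ..
  finally have zz: "z' = z" using f(2) complex_vector.scale_cancel_right[of z f z'] by simp
  define s where "s = hnorm (obj F b) (mor F f x)"
  have s: "of_real s * of_real s = z" "s \<noteq> 0"
    using zr \<open>z \<noteq> 0\<close> by (auto simp: s_def power2_eq_square)
  define k where "k = complex_of_real (1 / s)"
  have k: "cnj k * k * z = 1" "k \<noteq> 0" "k * cnj k * z = 1"
    using s by (auto simp: k_def field_simps simp flip: s(1))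
  define u where "u = k *\<^sub>C f"
  have u: "u \<in> Hom C a b" unfolding u_def using f complex_vector.subspace_scale[OF Hom_subspace] by blast
  have ud: "u\<^bold>* = cnj k *\<^sub>C f\<^bold>*" unfolding u_def by (rule dag_scale[OF f(1)])
  have "u\<^bold>* \<cdot> u = \<one> a" unfolding ud unfolding u_def using comp_scaled[OF f(1) fd] z k by simp
  moreover have "u \<cdot> u\<^bold>* = \<one> b" unfolding ud unfolding u_def using comp_scaled[OF fd f(1)] z' zz k by simp
  moreover have "f = (1 / k) *\<^sub>C u" using k by (simp add: u_def)
  ultimately show ?thesis using u unfolding unitary_mor_def by blast
qed

lemma unitary_isomorphic: "unitary_mor C a b u \<Longrightarrow> isomorphic C a b"
  unfolding unitary_mor_def isomorphic_def using dag_in by blast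

lemma Irr_simple: "a \<in> Irr \<Longrightarrow> simple C a"
  using Irr by (auto simp: irr_representatives_def)

lemma Irr_unique: "simple C c \<Longrightarrow> a \<in> Irr \<Longrightarrow> b \<in> Irr \<Longrightarrow> isomorphic C c a \<Longrightarrow> isomorphic C c b \<Longrightarrow> a = b"
  using Irr unfolding irr_representatives_def by blast

lemma isomorphic_refl: "isomorphic C a a"
  unfolding isomorphic_def using ident_in ident_left by blast

lemma Irr_Hom_zero:
  assumes "a \<in> Irr" "b \<in> Irr" "a \<noteq> b" "f \<in> Hom C a b"
  shows "f = 0"
proof (rule ccontr)
  assume "f \<noteq> 0"
  then obtain u where "unitary_mor C a b u"
    using schur[OF Irr_simple[OF assms(1)] Irr_simple[OF assms(2)] assms(4)] by blast
  thus False
    using Irr_unique[OF Irr_simple[OF assms(1)] assms(1,2) isomorphic_refl unitary_isomorphic] assms(3) by blast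
qed

lemma Irr_representative:
  assumes c: "simple C c"
  shows "\<exists>r\<in>Irr. \<exists>u. unitary_mor C c r u"
proof -
  obtain r where r: "r \<in> Irr" "isomorphic C c r"
    using Irr c unfolding irr_representatives_def by blast
  then obtain f g where fg: "f \<in> Hom C c r" "g \<in> Hom C r c" "g \<cdot> f = \<one> c"
    unfolding isomorphic_def by blast
  have "f \<noteq> 0" using fg comp_zero_right[OF fg(2)] simple_ident[OF c] by auto
  thus ?thesis using schur[OF c Irr_simple[OF r(1)] fg(1)] r(1) by blast
qed

lemma mor_unitary:
  assumes "unitary_mor C a b u"
  shows "u \<in> Hom C a b" "\<And>x. x \<in> hv a \<Longrightarrow> mor F (u\<^bold>*) (mor F u x) = x"
    "\<And>y. y \<in> hv b \<Longrightarrow> mor F u (mor F (u\<^bold>*) y) = y"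
proof -
  show u: "u \<in> Hom C a b" using assms by (simp add: unitary_mor_def)
  show "mor F (u\<^bold>*) (mor F u x) = x" if "x \<in> hv a" for x
    using mor_isometry_id[OF u _ that] assms by (simp add: unitary_mor_def)
  show "mor F u (mor F (u\<^bold>*) y) = y" if "y \<in> hv b" for y
    using mor_comp[OF u dag_in[OF u] that] mor_ident[OF that] assms by (simp add: unitary_mor_def)
qed

section \<open>Mates and conjugates of simple objects\<close>

text \<open>A morphism and its mate are transposes of each other for the pairings of objects with their
  conjugates, and each of them determines the other.\<close>

lemma mate_exists:
  assumes \<alpha>: "\<alpha> \<in> Hom C c a"
  shows "\<exists>\<beta>\<in>Hom C (cj a) (cj c). \<forall>\<xi>\<in>hv (cj a). \<forall>w\<in>hv c. hat_ev C F c (mor F \<beta> \<xi>) w = hat_ev C F a \<xi> (mor F \<alpha> w)"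
proof -
  have p: "ev C a \<cdot> (\<one> (cj a) \<otimes> \<alpha>) \<in> Hom C (cj a \<boxtimes> c) \<I>" by (rule typing \<alpha>)+
  have "vacc (mor F (ev C a \<cdot> (\<one> (cj a) \<otimes> \<alpha>)) (lax F (cj a) c \<xi> w)) = hat_ev C F a \<xi> (mor F \<alpha> w)"
    if "\<xi> \<in> hv (cj a)" "w \<in> hv c" for \<xi> w
    using mor_comp[OF ev_in tens_in[OF ident_in \<alpha>] lax_in[OF that]] lax_natural[OF ident_in \<alpha> that]
    by (simp add: hat_ev_def mor_ident that)
  thus ?thesis using curry_conj[OF p] by auto
qed

lemma unmate_exists:
  assumes \<beta>: "\<beta> \<in> Hom C (cj a) (cj c)"
  shows "\<exists>\<alpha>\<in>Hom C c a. \<forall>\<xi>\<in>hv (cj a). \<forall>w\<in>hv c. hat_ev C F a \<xi> (mor F \<alpha> w) = hat_ev C F c (mor F \<beta> \<xi>) w"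
proof -
  have p: "ev C c \<cdot> (\<beta> \<otimes> \<one> c) \<in> Hom C (cj a \<boxtimes> c) \<I>" by (rule typing \<beta>)+
  have "vacc (mor F (ev C c \<cdot> (\<beta> \<otimes> \<one> c)) (lax F (cj a) c \<xi> w)) = hat_ev C F c (mor F \<beta> \<xi>) w"
    if "\<xi> \<in> hv (cj a)" "w \<in> hv c" for \<xi> w
    using mor_comp[OF ev_in tens_in[OF \<beta> ident_in] lax_in[OF that]] lax_natural[OF \<beta> ident_in that]
    by (simp add: hat_ev_def mor_ident that)
  thus ?thesis using curry_obj[OF p] by auto
qed

lemma conj_nonzero:
  assumes "\<one> a \<noteq> 0"
  shows "\<one> (cj a) \<noteq> 0"
proof
  assume 0: "\<one> (cj a) = 0"
  obtain x where x: "x \<in> hv a" "ip (obj F a) x x = 1" using unit_vector[OF assms] by blast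
  have "sharp a x = mor F (\<one> (cj a)) (sharp a x)" using mor_ident[OF sharp_in[OF x(1)]] by simp
  also have "\<dots> = 0" using 0 mor_zero[OF sharp_in[OF x(1)]] by simp
  finally have "hat_ev C F a 0 x = 1" using hat_ev_sharp[OF x(1,1)] x by simp
  thus False using hat_ev_scale_left[OF x(1), of 0 0] by simp
qed

text \<open>Passing to mates identifies the endomorphisms of the conjugate with those of the object.\<close>

lemma conj_simple:
  assumes a: "simple C a"
  shows "simple C (cj a)"
proof -
  have "\<exists>z. T = z *\<^sub>C \<one> (cj a)" if T: "T \<in> Hom C (cj a) (cj a)" for T
  proof -
    obtain \<alpha> where \<alpha>: "\<alpha> \<in> Hom C a a" "\<And>\<xi> w. \<xi> \<in> hv (cj a) \<Longrightarrow> w \<in> hv a \<Longrightarrow> hat_ev C F a \<xi> (mor F \<alpha> w) = hat_ev C F a (mor F T \<xi>) w"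
      using unmate_exists[OF T] by blast
    have "T = sc a \<alpha> *\<^sub>C \<one> (cj a)"
    proof (rule faithful_eq[OF T complex_vector.subspace_scale[OF Hom_subspace ident_in]])
      fix \<xi> assume xi: "\<xi> \<in> hv (cj a)"
      have "mor F T \<xi> = sc a \<alpha> *\<^sub>C \<xi>"
        by (rule hat_ev_nondegenerate_left[OF mor_in[OF T xi] O.scale_in[OF xi]])
          (simp add: \<alpha>(2)[symmetric] xi mor_simple[OF a \<alpha>(1)] hat_ev_scale_left hat_ev_scale_right)
      thus "mor F T \<xi> = mor F (sc a \<alpha> *\<^sub>C \<one> (cj a)) \<xi>"
        using mor_scale[OF ident_in xi] mor_ident[OF xi] by simp
    qed
    thus ?thesis by blast
  qed
  moreover have "z *\<^sub>C \<one> (cj a) \<in> Hom C (cj a) (cj a)" for z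
    using complex_vector.subspace_scale[OF Hom_subspace ident_in] .
  ultimately show ?thesis using conj_nonzero[OF simple_ident[OF a]] by (auto simp: simple_def)
qed

lemma sc_dag:
  assumes a: "simple C a" and f: "f \<in> Hom C a a"
  shows "sc a (f\<^bold>*) = cnj (sc a f)"
proof -
  have "f\<^bold>* = (sc a f *\<^sub>C \<one> a)\<^bold>*" by (rule arg_cong[OF simple_scalar[OF a f]])
  also have "\<dots> = cnj (sc a f) *\<^sub>C \<one> a" using dag_scale[OF ident_in] ident_dag by simp
  finally show ?thesis by (rule sc_eqI[OF simple_ident[OF a]])
qed

lemma sc_comp_dag_commute:
  assumes r: "simple C r" and f: "f \<in> Hom C d r" and g: "g \<in> Hom C d r"
  shows "sc r (g \<cdot> f\<^bold>*) = cnj (sc r (f \<cdot> g\<^bold>*))"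
proof -
  have "(f \<cdot> g\<^bold>*)\<^bold>* = g \<cdot> f\<^bold>*" using dag_comp[OF f dag_in[OF g]] dag_dag[OF g] by simp
  thus ?thesis using sc_dag[OF r comp_in[OF f dag_in[OF g]]] by simp
qed

lemma sc_comp_dag_nonneg:
  assumes r: "simple C r" and f: "f \<in> Hom C d r"
  shows "sc r (f \<cdot> f\<^bold>*) \<in> \<real>\<^sub>\<ge>\<^sub>0"
proof -
  obtain y0 where y0: "y0 \<in> hv r" "ip (obj F r) y0 y0 = 1" using unit_vector[OF simple_ident[OF r]] by blast
  have "sc r (f \<cdot> f\<^bold>*) = ip (obj F r) y0 (mor F f (mor F (f\<^bold>*) y0))"
    using sc_form[OF r comp_in[OF f dag_in[OF f]] y0] mor_comp[OF f dag_in[OF f] y0(1)] by simp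
  also have "\<dots> = ip (obj F d) (mor F (f\<^bold>*) y0) (mor F (f\<^bold>*) y0)"
    using mor_dag[OF f mor_in[OF dag_in[OF f] y0(1)] y0(1)] by simp
  finally show ?thesis using O.ip_self_nonneg[OF mor_in[OF dag_in[OF f] y0(1)]] by simp
qed

lemma sc_add:
  assumes a: "simple C a" and f: "f \<in> Hom C a a" "g \<in> Hom C a a"
  shows "sc a (f + g) = sc a f + sc a g"
proof (rule sc_eqI[OF simple_ident[OF a]])
  show "f + g = (sc a f + sc a g) *\<^sub>C \<one> a"
    unfolding scaleC_add_left by (rule arg_cong2[OF simple_scalar[OF a f(1)] simple_scalar[OF a f(2)]])
qed

lemma sc_scale:
  assumes a: "simple C a" and f: "f \<in> Hom C a a"
  shows "sc a (z *\<^sub>C f) = z * sc a f"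
proof (rule sc_eqI[OF simple_ident[OF a]])
  show "z *\<^sub>C f = (z * sc a f) *\<^sub>C \<one> a"
    unfolding scaleC_scaleC[symmetric] by (rule arg_cong[OF simple_scalar[OF a f]])
qed

section \<open>The categorical trace\<close>

text \<open>The vector by which \<open>F\<close> represents the adjoint of the evaluation.\<close>

definition evvec :: "'o \<Rightarrow> 'h" where
  "evvec a = mor F ((ev C a)\<^bold>*) (vac F)"

lemma evvec_in: "evvec a \<in> hv (cj a \<boxtimes> a)"
  unfolding evvec_def by (rule mor_in[OF dag_in[OF ev_in] vac_in])

lemma ip_evvec: "\<xi> \<in> hv (cj a) \<Longrightarrow> x \<in> hv a \<Longrightarrow> ip (obj F (cj a \<boxtimes> a)) (evvec a) (lax F (cj a) a \<xi> x) = hat_ev C F a \<xi> x"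
  unfolding evvec_def hat_ev_def by (rule mor_dag[OF ev_in lax_in vac_in])

lemma ip_copairing:
  assumes v: "v \<in> hv a" and eta: "\<eta> \<in> hv (cj a)"
  shows "ip (obj F (a \<boxtimes> cj a)) (lax F a (cj a) v \<eta>) (copairing a) = ip (obj F (cj a)) \<eta> (sharp a v)"
  unfolding sharp_def
proof (rule tensor_linear_eq[OF O.ip_linear _ copairing_in, where W' = UNIV])
  show "clinear_on (hv (a \<boxtimes> cj a)) UNIV (\<lambda>w. ip (obj F (cj a)) \<eta> (slice C F a (cj a) (bra (obj F a) v) w))"
    using slice_spec(1)[OF O.bra_in[OF v]] eta
    by (intro clinear_onI) (auto simp: clinear_on_def O.ip_add_right O.ip_scale_right)
qed (simp_all add: assms lax_in lax_ip slice_spec(2)[OF O.bra_in[OF v]] O.ip_scale_right)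

text \<open>These are the left and the right trace as seen by \<open>F\<close>, where standardness enters.\<close>

lemma cat_trace_form:
  assumes f: "f \<in> Hom C a a"
  shows "cat_trace C a f = ip (obj F (cj a \<boxtimes> a)) (evvec a) (mor F (\<one> (cj a) \<otimes> f) (evvec a))"
    and "cat_trace C a f = ip (obj F (a \<boxtimes> cj a)) (copairing a) (mor F (f \<otimes> \<one> (cj a)) (copairing a))"
proof -
  let ?t = "ev C a \<cdot> (\<one> (cj a) \<otimes> f) \<cdot> (ev C a)\<^bold>*"
  let ?s = "(coev C a)\<^bold>* \<cdot> (f \<otimes> \<one> (cj a)) \<cdot> coev C a"
  have t: "?t \<in> Hom C \<I> \<I>" by (rule typing f)+
  have "cat_trace C a f = sc \<I> ?t" by (simp add: cat_trace_def sc_def)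
  also have sc: "\<dots> = vacc (mor F ?t (vac F))"
    by (rule sc_form[OF unit_simple t vac_in vac_ip])
  also have "mor F ?t (vac F) = mor F (ev C a) (mor F (\<one> (cj a) \<otimes> f) (evvec a))"
    unfolding evvec_def by (rule mor_comp3[OF ev_in tens_in[OF ident_in f] dag_in[OF ev_in] vac_in])
  also have "vacc \<dots> = ip (obj F (cj a \<boxtimes> a)) (evvec a) (mor F (\<one> (cj a) \<otimes> f) (evvec a))"
    unfolding evvec_def by (rule mor_dag[symmetric, OF ev_in mor_in[OF tens_in[OF ident_in f] mor_in[OF dag_in[OF ev_in] vac_in]] vac_in])
  finally show "cat_trace C a f = ip (obj F (cj a \<boxtimes> a)) (evvec a) (mor F (\<one> (cj a) \<otimes> f) (evvec a))" .
  have "cat_trace C a f = vacc (mor F ?s (vac F))"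
    using sc standard[OF f] by (simp add: cat_trace_def sc_def)
  also have "mor F ?s (vac F) = mor F ((coev C a)\<^bold>*) (mor F (f \<otimes> \<one> (cj a)) (copairing a))"
    unfolding copairing_def by (rule mor_comp3[OF dag_in[OF coev_in] tens_in[OF f ident_in] coev_in vac_in])
  also have "vacc \<dots> = ip (obj F (a \<boxtimes> cj a)) (copairing a) (mor F (f \<otimes> \<one> (cj a)) (copairing a))"
    unfolding copairing_def
    by (rule mor_adj[symmetric, OF coev_in vac_in mor_in[OF tens_in[OF f ident_in] mor_in[OF coev_in vac_in]]])
  finally show "cat_trace C a f = ip (obj F (a \<boxtimes> cj a)) (copairing a) (mor F (f \<otimes> \<one> (cj a)) (copairing a))" .
qed

lemma qdim_form:
  shows "qdim C a = ip (obj F (cj a \<boxtimes> a)) (evvec a) (evvec a)"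
    and "qdim C a = ip (obj F (a \<boxtimes> cj a)) (copairing a) (copairing a)"
  using cat_trace_form[OF ident_in, of a] mor_ident[OF evvec_in] mor_ident[OF copairing_in]
  by (simp_all add: qdim_def tens_ident)

lemma qdim_pos:
  assumes "\<one> a \<noteq> 0"
  shows "\<exists>q>0. qdim C a = complex_of_real q"
proof -
  obtain x where x: "x \<in> hv a" "ip (obj F a) x x = 1" using unit_vector[OF assms] by blast
  have "evvec a \<noteq> 0"
  proof
    assume "evvec a = 0"
    hence "hat_ev C F a (sharp a x) x = 0"
      using ip_evvec[OF sharp_in[OF x(1)] x(1)] O.ip_zero_left[OF lax_in[OF sharp_in[OF x(1)] x(1)]] by simp
    thus False using hat_ev_sharp[OF x(1,1)] x by simp
  qed
  hence "hnorm (obj F (cj a \<boxtimes> a)) (evvec a) > 0"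
    using O.hnorm_eq_0[OF evvec_in] O.hnorm_nonneg[OF evvec_in] by (metis order_le_less)
  thus ?thesis unfolding qdim_form(1) O.ip_self[OF evvec_in] by (intro exI[of _ "(hnorm (obj F (cj a \<boxtimes> a)) (evvec a))\<^sup>2"]) auto
qed

text \<open>A morphism \<open>\<phi> : d \<rightarrow> r\<close> has the two
  transposes \<open>A = \<phi>\<^sup>\<or>\<close> and \<open>B = ((\<phi>\<^sup>*)\<^sup>\<or>)\<^sup>*\<close> from the conjugate of \<open>r\<close> to that of \<open>d\<close>.  Up to
  the dimension of \<open>r\<close>, the right trace of \<open>\<psi>\<^sup>* \<phi>\<close> is the inner product of the \<open>A\<close>'s and the left
  trace that of the \<open>B\<close>'s, so
  standardness makes \<open>B \<mapsto> A\<close> unitary; and \<open>\<langle>B, A\<rangle>\<close> is the scalar \<open>\<phi> \<psi>\<^sup>*\<close>, so that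
  this unitary is positive.  Hence \<open>A = B\<close>, and the trace of \<open>\<psi>\<^sup>* \<phi>\<close> is \<open>\<langle>B, A\<rangle>\<close> times
  the dimension of \<open>r\<close>.\<close>

lemma cat_trace_comp:
  assumes r: "simple C r" and \<phi>: "\<phi> \<in> Hom C d r" and \<psi>: "\<psi> \<in> Hom C d r"
  shows "cat_trace C d (\<psi>\<^bold>* \<cdot> \<phi>) = sc r (\<phi> \<cdot> \<psi>\<^bold>*) * qdim C r"
proof -
  let ?r = "cj r" and ?d = "cj d"
  define isA where "isA f A \<longleftrightarrow> A \<in> Hom C ?r ?d \<and>
    (\<forall>\<xi>\<in>hv ?r. \<forall>w\<in>hv d. hat_ev C F d (mor F A \<xi>) w = hat_ev C F r \<xi> (mor F f w))" for f A
  define isB where "isB f B \<longleftrightarrow> B \<in> Hom C ?r ?d \<and>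
    (\<forall>\<xi>\<in>hv ?d. \<forall>w\<in>hv r. hat_ev C F r (mor F (B\<^bold>*) \<xi>) w = hat_ev C F d \<xi> (mor F (f\<^bold>*) w))" for f B
  have exA: "\<exists>A. isA f A" if "f \<in> Hom C d r" for f
    using mate_exists[OF that] by (auto simp: isA_def)
  have exB: "\<exists>B. isB f B" if f: "f \<in> Hom C d r" for f
  proof -
    obtain \<beta> where "\<beta> \<in> Hom C ?d ?r" "\<forall>\<xi>\<in>hv ?d. \<forall>w\<in>hv r. hat_ev C F r (mor F \<beta> \<xi>) w = hat_ev C F d \<xi> (mor F (f\<^bold>*) w)"
      using mate_exists[OF dag_in[OF f]] by blast
    thus ?thesis unfolding isB_def using dag_in dag_dag by (intro exI[of _ "\<beta>\<^bold>*"]) fastforce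
  qed
  have surjB: "\<exists>f\<in>Hom C d r. isB f B" if B: "B \<in> Hom C ?r ?d" for B
  proof -
    obtain \<alpha> where "\<alpha> \<in> Hom C r d" "\<forall>\<xi>\<in>hv ?d. \<forall>w\<in>hv r. hat_ev C F d \<xi> (mor F \<alpha> w) = hat_ev C F r (mor F (B\<^bold>*) \<xi>) w"
      using unmate_exists[OF dag_in[OF B]] by blast
    thus ?thesis unfolding isB_def using B dag_in dag_dag by (intro bexI[of _ "\<alpha>\<^bold>*"]) auto
  qed
  have rr: "simple C ?r" by (rule conj_simple[OF r])
  obtain x0 where x0: "x0 \<in> hv ?r" "ip (obj F ?r) x0 x0 = 1"
    using unit_vector[OF simple_ident[OF rr]] by blast
  \<comment> \<open>The inner product of two morphisms from the simple object \<open>cj r\<close>: the scalar of \<open>\<beta>\<^sup>* \<gamma>\<close>.\<close>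
  define S where "S \<beta> \<gamma> = ip (obj F ?d) (mor F \<beta> x0) (mor F \<gamma> x0)" for \<beta> \<gamma>
  have S: "sc ?r (\<beta>\<^bold>* \<cdot> \<gamma>) = S \<beta> \<gamma>" if b: "\<beta> \<in> Hom C ?r ?d" "\<gamma> \<in> Hom C ?r ?d" for \<beta> \<gamma>
  proof -
    have "sc ?r (\<beta>\<^bold>* \<cdot> \<gamma>) = ip (obj F ?r) x0 (mor F (\<beta>\<^bold>*) (mor F \<gamma> x0))"
      using sc_form[OF rr comp_in[OF dag_in[OF b(1)] b(2)] x0] mor_comp[OF dag_in[OF b(1)] b(2) x0(1)] by simp
    also have "\<dots> = S \<beta> \<gamma>"
      unfolding S_def using mor_adj[OF b(1) x0(1) mor_in[OF b(2) x0(1)]] by simp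
    finally show ?thesis .
  qed
  have dagcomp: "(\<one> c \<otimes> g)\<^bold>* = \<one> c \<otimes> g\<^bold>*" "(g \<otimes> \<one> c)\<^bold>* = g\<^bold>* \<otimes> \<one> c" if "g \<in> Hom C a b" for a b c g
    using tens_dag[OF ident_in that] tens_dag[OF that ident_in] ident_dag by simp_all
  have adj_tens: "ip (obj F (c \<boxtimes> b)) (mor F (\<one> c \<otimes> g) u) (mor F (\<one> c \<otimes> h) u) = ip (obj F (c \<boxtimes> a)) u (mor F (\<one> c \<otimes> (g\<^bold>* \<cdot> h)) u)"
    if gh: "g \<in> Hom C a b" "h \<in> Hom C a b" and u: "u \<in> hv (c \<boxtimes> a)" for a b c g h u
    using mor_adj[OF tens_in[OF ident_in gh(1)] u mor_in[OF tens_in[OF ident_in gh(2)] u]] dagcomp[OF gh(1)]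
      mor_comp[OF tens_in[OF ident_in dag_in[OF gh(1)]] tens_in[OF ident_in gh(2)] u]
      tens_comp[OF ident_in ident_in dag_in[OF gh(1)] gh(2), of c] ident_left[OF ident_in, of c] by simp
  have adj_tens': "ip (obj F (b \<boxtimes> c)) (mor F (g \<otimes> \<one> c) u) (mor F (h \<otimes> \<one> c) u) = ip (obj F (a \<boxtimes> c)) u (mor F ((g\<^bold>* \<cdot> h) \<otimes> \<one> c) u)"
    if gh: "g \<in> Hom C a b" "h \<in> Hom C a b" and u: "u \<in> hv (a \<boxtimes> c)" for a b c g h u
    using mor_adj[OF tens_in[OF gh(1) ident_in] u mor_in[OF tens_in[OF gh(2) ident_in] u]] dagcomp[OF gh(1)]
      mor_comp[OF tens_in[OF dag_in[OF gh(1)] ident_in] tens_in[OF gh(2) ident_in] u]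
      tens_comp[OF dag_in[OF gh(1)] gh(2) ident_in ident_in, of c] ident_left[OF ident_in, of c] by simp
  have M1: "mor F (\<one> ?d \<otimes> f) (evvec d) = mor F (B \<otimes> \<one> r) (evvec r)" if f: "f \<in> Hom C d r" and B: "isB f B" for f B
  proof (rule tensor_eqI)
    have B': "B \<in> Hom C ?r ?d" using B by (simp add: isB_def)
    show "mor F (\<one> ?d \<otimes> f) (evvec d) \<in> hv (?d \<boxtimes> r)" by (rule mor_in[OF tens_in[OF ident_in f] evvec_in])
    show "mor F (B \<otimes> \<one> r) (evvec r) \<in> hv (?d \<boxtimes> r)" by (rule mor_in[OF tens_in[OF B' ident_in] evvec_in])
    fix \<xi> x assume xi: "\<xi> \<in> hv ?d" and x: "x \<in> hv r"
    have "ip (obj F (?d \<boxtimes> r)) (mor F (\<one> ?d \<otimes> f) (evvec d)) (lax F ?d r \<xi> x) = hat_ev C F d \<xi> (mor F (f\<^bold>*) x)"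
      using mor_adj[OF tens_in[OF ident_in f] evvec_in lax_in[OF xi x]] dagcomp(1)[OF f]
        lax_natural[OF ident_in dag_in[OF f] xi x] ip_evvec[OF xi mor_in[OF dag_in[OF f] x]]
      by (simp add: mor_ident xi)
    also have "\<dots> = hat_ev C F r (mor F (B\<^bold>*) \<xi>) x" using B xi x by (simp add: isB_def)
    also have "\<dots> = ip (obj F (?d \<boxtimes> r)) (mor F (B \<otimes> \<one> r) (evvec r)) (lax F ?d r \<xi> x)"
      using mor_adj[OF tens_in[OF B' ident_in] evvec_in lax_in[OF xi x]] dagcomp(2)[OF B']
        lax_natural[OF dag_in[OF B'] ident_in xi x] ip_evvec[OF mor_in[OF dag_in[OF B'] xi] x]
      by (simp add: mor_ident x)
    finally show "ip (obj F (?d \<boxtimes> r)) (mor F (\<one> ?d \<otimes> f) (evvec d)) (lax F ?d r \<xi> x) =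
      ip (obj F (?d \<boxtimes> r)) (mor F (B \<otimes> \<one> r) (evvec r)) (lax F ?d r \<xi> x)" .
  qed
  have M2: "mor F (f \<otimes> \<one> ?d) (copairing d) = mor F (\<one> r \<otimes> A) (copairing r)" if f: "f \<in> Hom C d r" and A: "isA f A" for f A
  proof (rule tensor_eqI)
    have A': "A \<in> Hom C ?r ?d" using A by (simp add: isA_def)
    show 1: "mor F (f \<otimes> \<one> ?d) (copairing d) \<in> hv (r \<boxtimes> ?d)" by (rule mor_in[OF tens_in[OF f ident_in] copairing_in])
    show 2: "mor F (\<one> r \<otimes> A) (copairing r) \<in> hv (r \<boxtimes> ?d)" by (rule mor_in[OF tens_in[OF ident_in A'] copairing_in])
    fix y \<eta> assume y: "y \<in> hv r" and eta: "\<eta> \<in> hv ?d"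
    have fy: "mor F (f\<^bold>*) y \<in> hv d" by (rule mor_in[OF dag_in[OF f] y])
    have sh: "sharp d (mor F (f\<^bold>*) y) = mor F A (sharp r y)"
      by (rule sharp_eqI[OF fy mor_in[OF A' sharp_in[OF y]]])
        (use A in \<open>simp add: isA_def sharp_in[OF y] hat_ev_sharp y mor_in[OF f] mor_dag[OF f]\<close>)
    have "ip (obj F (r \<boxtimes> ?d)) (lax F r ?d y \<eta>) (mor F (f \<otimes> \<one> ?d) (copairing d)) = ip (obj F ?d) \<eta> (sharp d (mor F (f\<^bold>*) y))"
      using mor_dag[OF tens_in[OF f ident_in] copairing_in lax_in[OF y eta]] dagcomp(2)[OF f]
        lax_natural[OF dag_in[OF f] ident_in y eta] ip_copairing[OF fy eta]
      by (simp add: mor_ident eta)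
    also have "\<dots> = ip (obj F (r \<boxtimes> ?d)) (lax F r ?d y \<eta>) (mor F (\<one> r \<otimes> A) (copairing r))"
      unfolding sh
      using mor_dag[OF tens_in[OF ident_in A'] copairing_in lax_in[OF y eta]] dagcomp(1)[OF A']
        lax_natural[OF ident_in dag_in[OF A'] y eta] ip_copairing[OF y mor_in[OF dag_in[OF A'] eta]]
        mor_dag[OF A' sharp_in[OF y] eta]
      by (simp add: mor_ident y)
    finally show "ip (obj F (r \<boxtimes> ?d)) (mor F (f \<otimes> \<one> ?d) (copairing d)) (lax F r ?d y \<eta>) =
      ip (obj F (r \<boxtimes> ?d)) (mor F (\<one> r \<otimes> A) (copairing r)) (lax F r ?d y \<eta>)"
      using O.ip_cnj[OF lax_in[OF y eta] 1] O.ip_cnj[OF lax_in[OF y eta] 2] by simp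
  qed
  have scal_tens: "mor F (g \<otimes> \<one> c) u = sc b g *\<^sub>C u" "mor F (\<one> c \<otimes> g) v = sc b g *\<^sub>C v"
    if g: "g \<in> Hom C b b" and b: "simple C b" and u: "u \<in> hv (b \<boxtimes> c)" and v: "v \<in> hv (c \<boxtimes> b)" for b c g u v
  proof -
    have "g \<otimes> \<one> c = (sc b g *\<^sub>C \<one> b) \<otimes> \<one> c" by (rule arg_cong[OF simple_scalar[OF b g]])
    also have "\<dots> = sc b g *\<^sub>C \<one> (b \<boxtimes> c)"
      using clinear_on_scale[OF tens_linear_left[OF ident_in[of c]] ident_in[of b]] tens_ident by simp
    finally have 1: "g \<otimes> \<one> c = sc b g *\<^sub>C \<one> (b \<boxtimes> c)" .
    have "\<one> c \<otimes> g = \<one> c \<otimes> (sc b g *\<^sub>C \<one> b)" by (rule arg_cong[OF simple_scalar[OF b g]])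
    also have "\<dots> = sc b g *\<^sub>C \<one> (c \<boxtimes> b)"
      using clinear_on_scale[OF tens_linear_right[OF ident_in[of c]] ident_in[of b]] tens_ident by simp
    finally have 2: "\<one> c \<otimes> g = sc b g *\<^sub>C \<one> (c \<boxtimes> b)" .
    show "mor F (g \<otimes> \<one> c) u = sc b g *\<^sub>C u" "mor F (\<one> c \<otimes> g) v = sc b g *\<^sub>C v"
      unfolding 1 2 using mor_scale[OF ident_in u] mor_ident[OF u] mor_scale[OF ident_in v] mor_ident[OF v] by simp_all
  qed
  have left: "cat_trace C d (g\<^bold>* \<cdot> f) = S Bg Bf * qdim C r"
    if f: "f \<in> Hom C d r" "isB f Bf" and g: "g \<in> Hom C d r" "isB g Bg" for f g Bf Bg
  proof -
    have B: "Bf \<in> Hom C ?r ?d" "Bg \<in> Hom C ?r ?d" using f g by (auto simp: isB_def)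
    have "cat_trace C d (g\<^bold>* \<cdot> f) = ip (obj F (?d \<boxtimes> r)) (mor F (\<one> ?d \<otimes> g) (evvec d)) (mor F (\<one> ?d \<otimes> f) (evvec d))"
      using cat_trace_form(1)[OF comp_in[OF dag_in[OF g(1)] f(1)]] adj_tens[OF g(1) f(1) evvec_in] by simp
    also have "\<dots> = ip (obj F (?r \<boxtimes> r)) (evvec r) (mor F ((Bg\<^bold>* \<cdot> Bf) \<otimes> \<one> r) (evvec r))"
      unfolding M1[OF f] M1[OF g] by (rule adj_tens'[OF B(2,1) evvec_in])
    also have "mor F ((Bg\<^bold>* \<cdot> Bf) \<otimes> \<one> r) (evvec r) = S Bg Bf *\<^sub>C evvec r"
      using scal_tens(1)[OF comp_in[OF dag_in[OF B(2)] B(1)] rr evvec_in O.zero_in] S[OF B(2,1)] by simp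
    also have "ip (obj F (?r \<boxtimes> r)) (evvec r) (S Bg Bf *\<^sub>C evvec r) = S Bg Bf * qdim C r"
      using O.ip_scale_right[OF evvec_in evvec_in] qdim_form(1) by simp
    finally show ?thesis .
  qed
  have right: "cat_trace C d (g\<^bold>* \<cdot> f) = S Ag Af * qdim C r"
    if f: "f \<in> Hom C d r" "isA f Af" and g: "g \<in> Hom C d r" "isA g Ag" for f g Af Ag
  proof -
    have A: "Af \<in> Hom C ?r ?d" "Ag \<in> Hom C ?r ?d" using f g by (auto simp: isA_def)
    have "cat_trace C d (g\<^bold>* \<cdot> f) = ip (obj F (r \<boxtimes> ?d)) (mor F (g \<otimes> \<one> ?d) (copairing d)) (mor F (f \<otimes> \<one> ?d) (copairing d))"
      using cat_trace_form(2)[OF comp_in[OF dag_in[OF g(1)] f(1)]] adj_tens'[OF g(1) f(1) copairing_in] by simp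
    also have "\<dots> = ip (obj F (r \<boxtimes> ?r)) (copairing r) (mor F (\<one> r \<otimes> (Ag\<^bold>* \<cdot> Af)) (copairing r))"
      unfolding M2[OF f] M2[OF g] by (rule adj_tens[OF A(2,1) copairing_in])
    also have "mor F (\<one> r \<otimes> (Ag\<^bold>* \<cdot> Af)) (copairing r) = S Ag Af *\<^sub>C copairing r"
      using scal_tens(2)[OF comp_in[OF dag_in[OF A(2)] A(1)] rr O.zero_in copairing_in] S[OF A(2,1)] by simp
    also have "ip (obj F (r \<boxtimes> ?r)) (copairing r) (S Ag Af *\<^sub>C copairing r) = S Ag Af * qdim C r"
      using O.ip_scale_right[OF copairing_in copairing_in] qdim_form(2) by simp
    finally show ?thesis .
  qed
  have mixed: "S Bg Af = sc r (f \<cdot> g\<^bold>*)"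
    if f: "f \<in> Hom C d r" "isA f Af" and g: "g \<in> Hom C d r" "isB g Bg" for f g Af Bg
  proof -
    have AB: "Af \<in> Hom C ?r ?d" "Bg \<in> Hom C ?r ?d" using f g by (auto simp: isA_def isB_def)
    have fg: "f \<cdot> g\<^bold>* \<in> Hom C r r" by (rule typing f g)+
    have "mor F (Bg\<^bold>* \<cdot> Af) x0 = sc r (f \<cdot> g\<^bold>*) *\<^sub>C x0"
    proof (rule hat_ev_nondegenerate_left)
      show "mor F (Bg\<^bold>* \<cdot> Af) x0 \<in> hv ?r" by (rule mor_in[OF comp_in[OF dag_in[OF AB(2)] AB(1)] x0(1)])
      show "sc r (f \<cdot> g\<^bold>*) *\<^sub>C x0 \<in> hv ?r" using x0 by simp
      fix x assume x: "x \<in> hv r"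
      have gx: "mor F (g\<^bold>*) x \<in> hv d" by (rule mor_in[OF dag_in[OF g(1)] x])
      have "hat_ev C F r (mor F (Bg\<^bold>* \<cdot> Af) x0) x = hat_ev C F r (mor F (Bg\<^bold>*) (mor F Af x0)) x"
        using mor_comp[OF dag_in[OF AB(2)] AB(1) x0(1)] by simp
      also have "\<dots> = hat_ev C F d (mor F Af x0) (mor F (g\<^bold>*) x)"
        using g(2) mor_in[OF AB(1) x0(1)] x unfolding isB_def by blast
      also have "\<dots> = hat_ev C F r x0 (mor F f (mor F (g\<^bold>*) x))"
        using f(2) x0(1) gx unfolding isA_def by blast
      also have "mor F f (mor F (g\<^bold>*) x) = sc r (f \<cdot> g\<^bold>*) *\<^sub>C x"
        using mor_comp[OF f(1) dag_in[OF g(1)] x] mor_simple[OF r fg x] by simp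
      finally show "hat_ev C F r (mor F (Bg\<^bold>* \<cdot> Af) x0) x = hat_ev C F r (sc r (f \<cdot> g\<^bold>*) *\<^sub>C x0) x"
        using x x0 by (simp add: hat_ev_scale_left hat_ev_scale_right)
    qed
    hence "ip (obj F ?r) x0 (mor F (Bg\<^bold>* \<cdot> Af) x0) = sc r (f \<cdot> g\<^bold>*)"
      using x0 by (simp add: O.ip_scale_right)
    thus ?thesis
      using S[OF AB(2,1)] sc_form[OF rr comp_in[OF dag_in[OF AB(2)] AB(1)] x0] by simp
  qed
  note herm = sc_comp_dag_commute[OF r]
  note pos = sc_comp_dag_nonneg[OF r]
  have q: "qdim C r \<noteq> 0" using qdim_pos[OF simple_ident[OF r]] by auto
  have Scnj: "S \<gamma> \<beta> = cnj (S \<beta> \<gamma>)" if "\<beta> \<in> Hom C ?r ?d" "\<gamma> \<in> Hom C ?r ?d" for \<beta> \<gamma>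
    unfolding S_def by (rule O.ip_cnj[OF mor_in[OF that(1) x0(1)] mor_in[OF that(2) x0(1)]])
  obtain A where A: "isA \<phi> A" using exA[OF \<phi>] by (elim exE)
  obtain B where B: "isB \<phi> B" using exB[OF \<phi>] by (elim exE)
  obtain Bp where Bp: "isB \<psi> Bp" using exB[OF \<psi>] by (elim exE)
  have AB: "A \<in> Hom C ?r ?d" "B \<in> Hom C ?r ?d" "Bp \<in> Hom C ?r ?d" using A B Bp by (auto simp: isA_def isB_def)
  \<comment> \<open>To prove \<open>X = 0\<close>, take the morphism \<open>f\<close> whose second transpose is \<open>X\<close> itself: the nonnegative scalar of
  \<open>f f\<^sup>*\<close> turns out to be \<open>- \<langle>X, X\<rangle>\<close>.\<close>
  define X where "X = A - B"
  have X: "X \<in> Hom C ?r ?d" unfolding X_def by (rule complex_vector.subspace_diff[OF Hom_subspace AB(1,2)])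
  obtain f where f': "f \<in> Hom C d r" "isB f X" using surjB[OF X] by (elim bexE)
  obtain A' where A'': "isA f A'" using exA[OF f'(1)] by (elim exE)
  note f = f' A''
  have A': "A' \<in> Hom C ?r ?d" using f by (simp add: isA_def)
  have "mor F A x0 = mor F (X + B) x0" by (simp add: X_def)
  hence Ax: "mor F A x0 = mor F X x0 + mor F B x0" using mor_add[OF X AB(2) x0(1)] by simp
  have "S X A' = sc r (f \<cdot> f\<^bold>*)" by (rule mixed[OF f(1,3) f(1,2)])
  moreover have "S X A' = - S X X"
  proof -
    have AX: "S A' A = S X B"
      using left[OF \<phi> B f(1,2)] right[OF \<phi> A f(1,3)] q by simp
    have BA: "S A' B = S X A"
      using mixed[OF f(1,3) \<phi> B] mixed[OF \<phi> A f(1,2)] herm[OF \<phi> f(1)] Scnj[OF AB(2) A'] by simp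
    have "S A' A = S A' X + S A' B"
      unfolding S_def Ax by (rule O.ip_add_right) (intro mor_in[OF A' x0(1)] mor_in[OF X x0(1)] mor_in[OF AB(2) x0(1)])+
    hence "S A' X = S X B - S X A" using AX BA by simp
    also have "S X A = S X X + S X B"
      unfolding S_def Ax by (rule O.ip_add_right) (intro mor_in[OF X x0(1)] mor_in[OF AB(2) x0(1)])+
    finally have "S A' X = - S X X" by simp
    thus ?thesis using Scnj[OF A' X] Scnj[OF X X] by simp
  qed
  moreover have "S X X \<in> \<real>\<^sub>\<ge>\<^sub>0" unfolding S_def by (rule O.ip_self_nonneg[OF mor_in[OF X x0(1)]])
  ultimately have "S X X = 0"
    using pos[OF f(1)] by (auto simp: complex_nonneg_Reals_iff complex_eq_iff)
  hence "mor F X x0 = 0" unfolding S_def by (rule O.ip_self_eq_0[OF mor_in[OF X x0(1)]])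
  hence "S Bp A = S Bp B" unfolding S_def Ax by simp
  thus ?thesis using left[OF \<phi> B \<psi> Bp] mixed[OF \<phi> A \<psi> Bp] by simp
qed

section \<open>Orthonormal bases of morphism spaces\<close>

text \<open>By faithfulness a morphism is determined by the finitely many matrix entries of its image.\<close>

lemma Hom_finite: "\<exists>B. finite B \<and> Hom C a b = complex_vector.span B"
proof -
  let ?P = "basis (obj F a) \<times> basis (obj F b)"
  define G where "G f = (\<lambda>p. if p \<in> ?P then ip (obj F b) (snd p) (mor F f (fst p)) else 0)" for f
  show ?thesis
  proof (rule finite_span_if_embedded[OF Hom_subspace, where G = G])
    show "clinear_on (Hom C a b) UNIV G"
      by (intro clinear_onI) (auto simp: G_def fun_eq_iff O.basis_in mor_add mor_scale mor_in O.ip_add_right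
          O.ip_scale_right scaleC_fun_apply)
  next
    fix f assume f: "f \<in> Hom C a b" and "G f = 0"
    have 0: "ip (obj F b) e' (mor F f e) = 0" if "e \<in> basis (obj F a)" "e' \<in> basis (obj F b)" for e e'
    proof -
      have "G f (e, e') = 0" unfolding \<open>G f = 0\<close> by simp
      thus ?thesis using that by (simp add: G_def)
    qed
    have e0: "mor F f e = 0" if e: "e \<in> basis (obj F a)" for e
    proof -
      have fe: "mor F f e \<in> hv b" by (rule mor_in[OF f O.basis_in[OF e]])
      have "mor F f e = (\<Sum>e'\<in>basis (obj F b). ip (obj F b) e' (mor F f e) *\<^sub>C e')" by (rule O.basis_expand[OF fe])
      also have "\<dots> = 0" using 0[OF e] by simp
      finally show ?thesis .
    qed
    show "f = 0"
    proof (rule faithful[OF f])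
      fix x assume x: "x \<in> hv a"
      have "mor F f x = mor F f (\<Sum>e\<in>basis (obj F a). ip (obj F a) e x *\<^sub>C e)" using O.basis_expand[OF x] by simp
      also have "\<dots> = (\<Sum>e\<in>basis (obj F a). ip (obj F a) e x *\<^sub>C mor F f e)"
        by (subst mor_sum_vec[OF f]) (auto simp: O.basis_in mor_scale_vec[OF f])
      finally show "mor F f x = 0" using e0 by simp
    qed
  next
    show "finite ((\<lambda>p. single p (1::complex)) ` ?P)" by simp
    show "G ` Hom C a b \<subseteq> complex_vector.span ((\<lambda>p. single p (1::complex)) ` ?P)"
    proof clarify
      fix f
      have "G f = (\<Sum>p\<in>?P. G f p *\<^sub>C single p 1)"
      proof
        fix q
        have "(\<Sum>p\<in>?P. G f p *\<^sub>C single p 1) q = (\<Sum>p\<in>?P. if p = q then G f q else 0)"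
          unfolding sum_fun_apply by (intro sum.cong) (auto simp: scaleC_fun_apply single_apply)
        also have "\<dots> = G f q" by (auto simp: G_def)
        finally show "G f q = (\<Sum>p\<in>?P. G f p *\<^sub>C single p 1) q" by simp
      qed
      also have "\<dots> \<in> complex_vector.span ((\<lambda>p. single p 1) ` ?P)"
        by (intro complex_vector.span_sum complex_vector.span_scale complex_vector.span_base) auto
      finally show "G f \<in> complex_vector.span ((\<lambda>p. single p 1) ` ?P)" .
    qed
  qed
qed

text \<open>The morphism space with the trace inner product, as an instance of the notion of Hilbert space used for the
  values of \<open>F\<close>.\<close>

definition homH :: "'o \<Rightarrow> 'o \<Rightarrow> 'm hilb" where
  "homH d r = \<lparr> vecs = Hom C d r, ip = (\<lambda>\<psi> \<phi>. cat_trace C d (\<psi>\<^bold>* \<cdot> \<phi>)) \<rparr>"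

lemma homH_simps [simp]: "vecs (homH d r) = Hom C d r" "ip (homH d r) \<psi> \<phi> = cat_trace C d (\<psi>\<^bold>* \<cdot> \<phi>)"
  by (simp_all add: homH_def)

text \<open>By the trace property the form is a positive multiple of the scalar of \<open>\<phi> \<psi>\<^sup>*\<close>, which is definite by the
  C*-identity.\<close>

lemma homH_hilbert:
  assumes r: "simple C r"
  shows "fd_hilbert_space (homH d r)"
proof
  obtain q where q: "q > 0" "qdim C r = complex_of_real q" using qdim_pos[OF simple_ident[OF r]] by blast
  note tr = cat_trace_comp[OF r, of _ d]
  show "fd_hilbert (homH d r)"
    unfolding fd_hilbert_def homH_simps(1)
  proof (intro conjI ballI Hom_finite)
    fix \<psi> assume \<psi>: "\<psi> \<in> Hom C d r"
    note \<psi>' = dag_in[OF \<psi>]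
    show "clinear_on (Hom C d r) UNIV (ip (homH d r) \<psi>)"
    proof (rule clinear_onI)
      fix x y assume xy: "x \<in> Hom C d r" "y \<in> Hom C d r"
      have "x + y \<in> Hom C d r" by (rule complex_vector.subspace_add[OF Hom_subspace xy])
      thus "ip (homH d r) \<psi> (x + y) = ip (homH d r) \<psi> x + ip (homH d r) \<psi> y"
        using tr[OF _ \<psi>] xy comp_add_left[OF xy \<psi>'] sc_add[OF r comp_in[OF xy(1) \<psi>'] comp_in[OF xy(2) \<psi>']]
        by (simp add: distrib_right)
    next
      fix x z assume x: "x \<in> Hom C d r"
      have "z *\<^sub>C x \<in> Hom C d r" by (rule complex_vector.subspace_scale[OF Hom_subspace x])
      thus "ip (homH d r) \<psi> (z *\<^sub>C x) = z *\<^sub>C ip (homH d r) \<psi> x"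
        using tr[OF _ \<psi>] x comp_scale_left[OF x \<psi>'] sc_scale[OF r comp_in[OF x \<psi>']]
        by simp
    qed simp
    show "ip (homH d r) \<phi> \<psi> = cnj (ip (homH d r) \<psi> \<phi>)" if \<phi>: "\<phi> \<in> Hom C d r" for \<phi>
      using tr[OF \<psi> \<phi>] tr[OF \<phi> \<psi>] sc_comp_dag_commute[OF r \<phi> \<psi>] q by simp
    show "ip (homH d r) \<psi> \<psi> \<in> \<real>\<^sub>\<ge>\<^sub>0"
      using tr[OF \<psi> \<psi>] sc_comp_dag_nonneg[OF r \<psi>] q by (simp add: complex_nonneg_Reals_iff)
    show "ip (homH d r) \<psi> \<psi> = 0 \<longrightarrow> \<psi> = 0"
    proof
      assume "ip (homH d r) \<psi> \<psi> = 0"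
      hence "sc r (\<psi> \<cdot> \<psi>\<^bold>*) = 0" using tr[OF \<psi> \<psi>] q by simp
      hence "\<psi> \<cdot> \<psi>\<^bold>* = 0" using simple_scalar[OF r comp_in[OF \<psi> \<psi>']] by simp
      hence "mnorm C (\<psi>\<^bold>*) = 0" using norm_cstar[OF \<psi>'] dag_dag[OF \<psi>] norm_eq_0[OF zero_Hom] by simp
      hence "\<psi>\<^bold>* = 0" using norm_eq_0[OF \<psi>'] by simp
      thus "\<psi> = 0" using dag_dag[OF \<psi>] dag_zero by simp
    qed
  qed
qed

lemma ONB_onb:
  assumes r: "simple C r"
  shows "onb (homH d r) (ONB C d r)"
proof -
  have iff: "is_ONB C d r B \<longleftrightarrow> onb (homH d r) B" for B
    unfolding is_ONB_def onb_def homH_simps using complex_vector.span_superset[of B] by auto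
  interpret M: fd_hilbert_space "homH d r" by (rule homH_hilbert[OF r])
  have "is_ONB C d r (ONB C d r)"
    unfolding ONB_def by (rule someI[of "is_ONB C d r" "basis (homH d r)"]) (use iff M.basis in simp)
  thus ?thesis using iff by simp
qed

lemma ONB_finite: "simple C r \<Longrightarrow> finite (ONB C d r)"
  and ONB_in: "simple C r \<Longrightarrow> \<alpha> \<in> ONB C d r \<Longrightarrow> \<alpha> \<in> Hom C d r"
  using ONB_onb[of r d] by (auto simp: onb_def)

text \<open>The Fourier expansion of \<open>\<phi>\<close>, with coefficients computed by the trace property.\<close>

lemma mor_ONB_expand:
  assumes r: "simple C r" and \<phi>: "\<phi> \<in> Hom C d r" and x: "x \<in> hv d"
  shows "mor F \<phi> x = (\<Sum>\<alpha>\<in>ONB C d r. (sc r (\<phi> \<cdot> \<alpha>\<^bold>*) * qdim C r) *\<^sub>C mor F \<alpha> x)"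
proof -
  interpret M: fd_hilbert_space "homH d r" by (rule homH_hilbert[OF r])
  have "\<phi> = (\<Sum>\<alpha>\<in>ONB C d r. cat_trace C d (\<alpha>\<^bold>* \<cdot> \<phi>) *\<^sub>C \<alpha>)"
    using M.onb_expand[OF ONB_onb[OF r]] \<phi> by simp
  hence "mor F \<phi> x = mor F (\<Sum>\<alpha>\<in>ONB C d r. cat_trace C d (\<alpha>\<^bold>* \<cdot> \<phi>) *\<^sub>C \<alpha>) x" by simp
  also have "\<dots> = (\<Sum>\<alpha>\<in>ONB C d r. mor F (cat_trace C d (\<alpha>\<^bold>* \<cdot> \<phi>) *\<^sub>C \<alpha>) x)"
    by (rule mor_sum[OF complex_vector.subspace_scale[OF Hom_subspace ONB_in[OF r]] x])
  also have "\<dots> = (\<Sum>\<alpha>\<in>ONB C d r. (sc r (\<phi> \<cdot> \<alpha>\<^bold>*) * qdim C r) *\<^sub>C mor F \<alpha> x)"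
    by (intro sum.cong refl) (simp add: mor_scale[OF ONB_in[OF r] x] cat_trace_comp[OF r \<phi> ONB_in[OF r]])
  finally show ?thesis .
qed

lemma qdim_real: "simple C r \<Longrightarrow> cnj (qdim C r) = qdim C r"
  using qdim_pos[OF simple_ident] by force

lemma mor_ONB_expand_dag:
  assumes r: "simple C r" and \<phi>: "\<phi> \<in> Hom C r d" and w: "w \<in> hv r"
  shows "mor F \<phi> w = (\<Sum>\<beta>\<in>ONB C d r. (sc r (\<beta> \<cdot> \<phi>) * qdim C r) *\<^sub>C mor F (\<beta>\<^bold>*) w)"
proof (rule O.eq_if_ip_eq)
  show "mor F \<phi> w \<in> hv d" by (rule mor_in[OF \<phi> w])
  show "(\<Sum>\<beta>\<in>ONB C d r. (sc r (\<beta> \<cdot> \<phi>) * qdim C r) *\<^sub>C mor F (\<beta>\<^bold>*) w) \<in> hv d"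
    by (intro O.sum_in O.scale_in mor_in[OF dag_in w] ONB_in[OF r])
  fix x assume x: "x \<in> hv d"
  have coeff: "cnj (sc r (\<phi>\<^bold>* \<cdot> \<beta>\<^bold>*)) = sc r (\<beta> \<cdot> \<phi>)" if "\<beta> \<in> ONB C d r" for \<beta>
  proof -
    have b: "\<beta> \<in> Hom C d r" by (rule ONB_in[OF r that])
    show ?thesis using sc_dag[OF r comp_in[OF b \<phi>]] dag_comp[OF b \<phi>] by simp
  qed
  have "ip (obj F d) x (mor F \<phi> w) = ip (obj F r) (mor F (\<phi>\<^bold>*) x) w"
    using mor_dag[OF \<phi> w x] by simp
  also have "\<dots> = (\<Sum>\<beta>\<in>ONB C d r. ip (obj F r) ((sc r (\<phi>\<^bold>* \<cdot> \<beta>\<^bold>*) * qdim C r) *\<^sub>C mor F \<beta> x) w)"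
    unfolding mor_ONB_expand[OF r dag_in[OF \<phi>] x]
    by (rule O.ip_sum_left[OF w O.scale_in[OF mor_in[OF ONB_in[OF r] x]]])
  also have "\<dots> = (\<Sum>\<beta>\<in>ONB C d r. ip (obj F d) x ((sc r (\<beta> \<cdot> \<phi>) * qdim C r) *\<^sub>C mor F (\<beta>\<^bold>*) w))"
  proof (rule sum.cong[OF refl])
    fix \<beta> assume \<beta>: "\<beta> \<in> ONB C d r"
    note b = ONB_in[OF r \<beta>]
    show "ip (obj F r) ((sc r (\<phi>\<^bold>* \<cdot> \<beta>\<^bold>*) * qdim C r) *\<^sub>C mor F \<beta> x) w = ip (obj F d) x ((sc r (\<beta> \<cdot> \<phi>) * qdim C r) *\<^sub>C mor F (\<beta>\<^bold>*) w)"
      using coeff[OF \<beta>] mor_adj[OF b x w] qdim_real[OF r]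
      by (simp add: O.ip_scale_left[OF w mor_in[OF b x]] O.ip_scale_right[OF x mor_in[OF dag_in[OF b] w]])
  qed
  also have "\<dots> = ip (obj F d) x (\<Sum>\<beta>\<in>ONB C d r. (sc r (\<beta> \<cdot> \<phi>) * qdim C r) *\<^sub>C mor F (\<beta>\<^bold>*) w)"
    by (rule O.ip_sum_right[symmetric, OF x O.scale_in[OF mor_in[OF dag_in[OF ONB_in[OF r]] w]]])
  finally show "ip (obj F d) x (mor F \<phi> w) = \<dots>" .
qed

section \<open>Semisimplicity\<close>

text \<open>The value of the polynomial \<open>p\<close> at the endomorphism \<open>h\<close>, by the Horner scheme.\<close>

definition pm :: "'o \<Rightarrow> 'm \<Rightarrow> complex poly \<Rightarrow> 'm" where
  "pm c h p = foldr (\<lambda>a g. a *\<^sub>C \<one> c + h \<cdot> g) (coeffs p) 0"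

context
  fixes c h
  assumes h: "h \<in> Hom C c c"
begin

lemma pm_0: "pm c h 0 = 0"
  by (simp add: pm_def)

lemma pm_pCons: "pm c h (pCons a p) = a *\<^sub>C \<one> c + h \<cdot> pm c h p"
  using comp_zero_right[OF h] by (cases "a = 0 \<and> p = 0") (auto simp: pm_def cCons_def)

lemma pm_in: "pm c h p \<in> Hom C c c"
  by (induction p) (auto simp: pm_0 pm_pCons intro!: complex_vector.subspace_add complex_vector.subspace_scale
      Hom_subspace ident_in comp_in[OF h])

lemma pm_add: "pm c h (p + q) = pm c h p + pm c h q"
  by (induction p q rule: poly_induct2)
    (simp_all add: pm_0 pm_pCons comp_add_right[OF h pm_in pm_in] scaleC_add_left algebra_simps)

lemma pm_smult: "pm c h (smult z p) = z *\<^sub>C pm c h p"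
  by (induction p) (simp_all add: pm_0 pm_pCons comp_scale_right[OF h pm_in] scaleC_add_right)

lemma pm_sum: "pm c h (\<Sum>i\<in>I. p i) = (\<Sum>i\<in>I. pm c h (p i))"
  by (induction I rule: infinite_finite_induct) (simp_all add: pm_0 pm_add)

lemma pm_annihilating: "\<exists>p. p \<noteq> 0 \<and> pm c h p = 0"
proof -
  obtain B where B: "finite B" "Hom C c c = complex_vector.span B" using Hom_finite by blast
  have "pm c h (monom 1 i) \<in> complex_vector.span B" for i using pm_in B by blast
  from finite_span_sequence_dependent[of B "\<lambda>i. pm c h (monom 1 i)", OF B(1) this]
  obtain T u i where T: "finite T" "(\<Sum>i\<in>T. u i *\<^sub>C pm c h (monom 1 i)) = 0" "i \<in> T" "u i \<noteq> 0" by blast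
  define p where "p = (\<Sum>i\<in>T. monom (u i) i)"
  have "pm c h p = (\<Sum>i\<in>T. u i *\<^sub>C pm c h (monom 1 i))"
    unfolding p_def pm_sum pm_smult[symmetric] smult_monom by simp
  moreover have "coeff p i = u i" using T by (simp add: p_def coeff_sum)
  hence "p \<noteq> 0" using T by auto
  ultimately show ?thesis using T by auto
qed

text \<open>An eigenvector for left multiplication by \<open>h\<close> is obtained by cancelling one root from a minimal
  annihilating polynomial.\<close>

lemma eigen_morphism:
  assumes c: "\<one> c \<noteq> 0"
  shows "\<exists>s q \<kappa>. s = pm c h q \<and> s \<noteq> 0 \<and> h \<cdot> s = \<kappa> *\<^sub>C s"
proof -
  obtain p where p: "p \<noteq> 0" "pm c h p = 0" and minp: "\<And>q. q \<noteq> 0 \<Longrightarrow> pm c h q = 0 \<Longrightarrow> degree p \<le> degree q"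
    using ex_has_least_nat[of "\<lambda>p. p \<noteq> 0 \<and> pm c h p = 0" _ degree] pm_annihilating by metis
  have "degree p \<noteq> 0"
  proof
    assume "degree p = 0"
    then obtain z where "p = [:z:]" by (rule degree_eq_zeroE)
    hence "z *\<^sub>C \<one> c = 0" using p(2) comp_zero_right[OF h] by (simp add: pm_pCons pm_0)
    hence "z = 0" using c complex_vector.scale_eq_0_iff by blast
    thus False using p \<open>p = [:z:]\<close> by simp
  qed
  hence "\<not> constant (poly p)" by (simp add: constant_degree)
  then obtain \<kappa> where "poly p \<kappa> = 0" using fundamental_theorem_of_algebra by blast
  then obtain q where q: "p = [:-\<kappa>, 1:] * q" unfolding poly_eq_0_iff_dvd by (rule dvdE)
  have "q \<noteq> 0" using q p by auto
  have "degree ([:-\<kappa>, 1:] * q) = degree [:-\<kappa>, 1:] + degree q"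
    by (rule degree_mult_eq) (use \<open>q \<noteq> 0\<close> in auto)
  hence "degree p = Suc (degree q)" unfolding q[symmetric] by simp
  hence s: "pm c h q \<noteq> 0" using minp[OF \<open>q \<noteq> 0\<close>] by auto
  have "p = pCons 0 q + smult (-\<kappa>) q" by (simp add: q)
  hence "0 = h \<cdot> pm c h q + (-\<kappa>) *\<^sub>C pm c h q" using p(2) by (simp only: pm_add pm_pCons pm_smult) simp
  hence "h \<cdot> pm c h q = \<kappa> *\<^sub>C pm c h q" by (simp add: complex_vector.scale_minus_left add_eq_0_iff)
  thus ?thesis using s by blast
qed

lemma pm_right_eigen:
  assumes t: "t \<in> Hom C c c" "t \<cdot> h = \<kappa> *\<^sub>C t"
  shows "t \<cdot> pm c h q = poly q \<kappa> *\<^sub>C t"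
proof (induction q)
  case 0
  show ?case using comp_zero_right[OF t(1)] by (simp add: pm_0)
next
  case (pCons a q)
  have sc: "a *\<^sub>C \<one> c \<in> Hom C c c" by (rule complex_vector.subspace_scale[OF Hom_subspace ident_in])
  have "t \<cdot> pm c h (pCons a q) = t \<cdot> (a *\<^sub>C \<one> c) + t \<cdot> (h \<cdot> pm c h q)"
    unfolding pm_pCons by (rule comp_add_right[OF t(1) sc comp_in[OF h pm_in]])
  also have "t \<cdot> (a *\<^sub>C \<one> c) = a *\<^sub>C t" using comp_scale_right[OF t(1) ident_in] ident_right[OF t(1)] by simp
  also have "t \<cdot> (h \<cdot> pm c h q) = (t \<cdot> h) \<cdot> pm c h q" by (rule comp_assoc[symmetric, OF t(1) h pm_in])
  also have "\<dots> = \<kappa> *\<^sub>C (t \<cdot> pm c h q)" unfolding t(2) by (rule comp_scale_left[OF t(1) pm_in])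
  also have "\<dots> = \<kappa> *\<^sub>C (poly q \<kappa> *\<^sub>C t)" unfolding pCons.IH ..
  finally show ?case by (simp add: scaleC_add_left)
qed

end

text \<open>If \<open>h\<close> is self-adjoint and \<open>h s = \<kappa> s\<close> with \<open>s\<close> a polynomial in \<open>h\<close>, then \<open>s s\<^sup>*\<close> is a
  multiple of a projection \<open>e\<close> with \<open>h e = \<kappa> e\<close>; it is proper when \<open>h\<close> is not a scalar.\<close>

lemma proper_projection:
  assumes c: "\<one> c \<noteq> 0" and ns: "\<not> simple C c"
  shows "\<exists>e\<in>Hom C c c. e \<cdot> e = e \<and> e\<^bold>* = e \<and> e \<noteq> 0 \<and> e \<noteq> \<one> c"
proof -
  have sub: "x + y \<in> Hom C c c" "z *\<^sub>C x \<in> Hom C c c" if "x \<in> Hom C c c" "y \<in> Hom C c c" for x y z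
    using that complex_vector.subspace_add[OF Hom_subspace] complex_vector.subspace_scale[OF Hom_subspace] by auto
  \<comment> \<open>If all self-adjoint endomorphisms were scalars, so would be all endomorphisms, by real and imaginary
  parts.\<close>
  have "\<exists>h\<in>Hom C c c. h\<^bold>* = h \<and> (\<forall>z. h \<noteq> z *\<^sub>C \<one> c)"
  proof (rule ccontr)
    assume no: "\<not> (\<exists>h\<in>Hom C c c. h\<^bold>* = h \<and> (\<forall>z. h \<noteq> z *\<^sub>C \<one> c))"
    have sa: "\<exists>z. h = z *\<^sub>C \<one> c" if "h \<in> Hom C c c" "h\<^bold>* = h" for h
      using no that by blast
    have "\<exists>z. g = z *\<^sub>C \<one> c" if g: "g \<in> Hom C c c" for g
    proof -
      note g' = dag_in[OF g]
      have "(g + g\<^bold>*)\<^bold>* = g + g\<^bold>*" using dag_add[OF g g'] dag_dag[OF g] by (simp add: add.commute)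
      then obtain z where z: "g + g\<^bold>* = z *\<^sub>C \<one> c" using sa[OF sub(1)[OF g g']] by blast
      have i: "\<i> *\<^sub>C g \<in> Hom C c c" "(-\<i>) *\<^sub>C g\<^bold>* \<in> Hom C c c"
        by (rule sub(2)[OF g g], rule sub(2)[OF g' g])
      have "(\<i> *\<^sub>C g + (-\<i>) *\<^sub>C g\<^bold>*)\<^bold>* = \<i> *\<^sub>C g + (-\<i>) *\<^sub>C g\<^bold>*"
        using dag_add[OF i] dag_scale[OF g, of \<i>] dag_scale[OF g', of "-\<i>"] dag_dag[OF g] by (simp add: add.commute)
      then obtain w where w: "\<i> *\<^sub>C g + (-\<i>) *\<^sub>C g\<^bold>* = w *\<^sub>C \<one> c" using sa[OF sub(1)[OF i]] by blast
      have "(1/2) *\<^sub>C (g + g\<^bold>*) + (-\<i>/2) *\<^sub>C (\<i> *\<^sub>C g + (-\<i>) *\<^sub>C g\<^bold>*) = (1/2 + 1/2) *\<^sub>C g"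
        by (simp add: scaleC_add_right scaleC_add_left[symmetric] algebra_simps flip: scaleC_add_left)
      hence "g = (1/2) *\<^sub>C (z *\<^sub>C \<one> c) + (-\<i>/2) *\<^sub>C (w *\<^sub>C \<one> c)" unfolding z w by simp
      hence "g = ((1/2) * z + (-\<i>/2) * w) *\<^sub>C \<one> c" by (simp only: scaleC_add_left scaleC_scaleC)
      thus ?thesis by blast
    qed
    moreover have "z *\<^sub>C \<one> c \<in> Hom C c c" for z using sub(2) ident_in by blast
    ultimately have "simple C c" using c by (auto simp: simple_def)
    thus False using ns by simp
  qed
  then obtain h where h: "h \<in> Hom C c c" "h\<^bold>* = h" "\<And>z. h \<noteq> z *\<^sub>C \<one> c" by blast
  obtain s q \<kappa> where s: "s = pm c h q" "s \<noteq> 0" "h \<cdot> s = \<kappa> *\<^sub>C s" using eigen_morphism[OF h(1) c] by blast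
  have sH: "s \<in> Hom C c c" unfolding s(1) by (rule pm_in[OF h(1)])
  note sH' = dag_in[OF sH]
  define t where "t = s \<cdot> s\<^bold>*"
  have tH: "t \<in> Hom C c c" unfolding t_def by (rule comp_in[OF sH sH'])
  have t_dag: "t\<^bold>* = t" unfolding t_def using dag_comp[OF sH sH'] dag_dag[OF sH] by simp
  have ht: "h \<cdot> t = \<kappa> *\<^sub>C t"
    unfolding t_def comp_assoc[symmetric, OF h(1) sH sH'] s(3) by (rule comp_scale_left[OF sH sH'])
  have "t \<cdot> h = (h \<cdot> t)\<^bold>*" using dag_comp[OF h(1) tH] t_dag h(2) by simp
  hence th: "t \<cdot> h = cnj \<kappa> *\<^sub>C t" unfolding ht dag_scale[OF tH] t_dag .
  have ts: "t \<cdot> s = poly q (cnj \<kappa>) *\<^sub>C t" unfolding s(1) by (rule pm_right_eigen[OF h(1) tH th])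
  define k where "k = poly q (cnj \<kappa>)"
  have "t \<noteq> 0"
  proof
    assume "t = 0"
    hence "mnorm C (s\<^bold>*) = 0" using norm_cstar[OF sH'] dag_dag[OF sH] norm_eq_0[OF zero_Hom] by (simp add: t_def)
    hence "s\<^bold>* = 0" using norm_eq_0[OF sH'] by simp
    thus False using s(2) dag_dag[OF sH] dag_zero by simp
  qed
  have tt: "t \<cdot> t = k *\<^sub>C (t \<cdot> s\<^bold>*)"
    using comp_assoc[OF tH sH sH'] ts comp_scale_left[OF tH sH'] by (simp add: t_def k_def)
  have tt0: "t \<cdot> t \<noteq> 0"
  proof
    assume "t \<cdot> t = 0"
    hence "mnorm C t = 0" using norm_cstar[OF tH] t_dag norm_eq_0[OF zero_Hom] by simp
    thus False using \<open>t \<noteq> 0\<close> norm_eq_0[OF tH] by simp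
  qed
  have "\<exists>K. t \<cdot> t = K *\<^sub>C t"
  proof -
    \<comment> \<open>The eigenvalue is real, so \<open>s\<^sup>*\<close> is an eigenvector for right multiplication by \<open>h\<close>; hence \<open>s\<^sup>* s\<close>
    is a multiple of \<open>s\<^sup>*\<close> and, being self-adjoint, of \<open>s\<close>.\<close>
    have "\<kappa> *\<^sub>C (t \<cdot> t) = t \<cdot> (h \<cdot> t)" unfolding ht by (rule comp_scale_right[symmetric, OF tH tH])
    also have "\<dots> = cnj \<kappa> *\<^sub>C (t \<cdot> t)" unfolding comp_assoc[symmetric, OF tH h(1) tH] th by (rule comp_scale_left[OF tH tH])
    finally have \<kappa>: "cnj \<kappa> = \<kappa>" using tt0 complex_vector.scale_cancel_right[of \<kappa> "t \<cdot> t" "cnj \<kappa>"] by simp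
    have "s\<^bold>* \<cdot> h = \<kappa> *\<^sub>C s\<^bold>*"
      using dag_comp[OF h(1) sH] s(3) dag_scale[OF sH, of \<kappa>] h(2) \<kappa> by simp
    hence "s\<^bold>* \<cdot> s = poly q \<kappa> *\<^sub>C s\<^bold>*" using pm_right_eigen[OF h(1) sH'] s(1) by simp
    hence "(s\<^bold>* \<cdot> s)\<^bold>* = cnj (poly q \<kappa>) *\<^sub>C s" using dag_scale[OF sH'] dag_dag[OF sH] by simp
    hence *: "poly q \<kappa> *\<^sub>C s\<^bold>* = cnj (poly q \<kappa>) *\<^sub>C s"
      using dag_comp[OF sH' sH] dag_dag[OF sH] \<open>s\<^bold>* \<cdot> s = poly q \<kappa> *\<^sub>C s\<^bold>*\<close> by simp
    have "t \<cdot> t = t \<cdot> (k *\<^sub>C s\<^bold>*)" using tt comp_scale_right[OF tH sH'] by simp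
    also have "k *\<^sub>C s\<^bold>* = cnj k *\<^sub>C s" using * \<kappa> by (simp add: k_def)
    also have "t \<cdot> (cnj k *\<^sub>C s) = (cnj k * k) *\<^sub>C t" using comp_scale_right[OF tH sH] ts by (simp add: k_def)
    finally show ?thesis by blast
  qed
  then obtain K where K: "t \<cdot> t = K *\<^sub>C t" by blast
  have "K \<noteq> 0" using K tt0 by auto
  have "cnj K *\<^sub>C t = (t \<cdot> t)\<^bold>*" unfolding K dag_scale[OF tH] t_dag ..
  also have "\<dots> = K *\<^sub>C t" using dag_comp[OF tH tH] t_dag K by simp
  finally have Kr: "cnj K = K" using \<open>t \<noteq> 0\<close> complex_vector.scale_cancel_right[of "cnj K" t K] by simp
  define e where "e = (1 / K) *\<^sub>C t"
  have eH: "e \<in> Hom C c c" unfolding e_def using sub(2) tH by blast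
  have "e \<cdot> e = e" unfolding e_def comp_scaled[OF tH tH] K using \<open>K \<noteq> 0\<close> by simp
  moreover have "e\<^bold>* = e" unfolding e_def dag_scale[OF tH] t_dag using Kr by simp
  moreover have "e \<noteq> 0" unfolding e_def using \<open>t \<noteq> 0\<close> \<open>K \<noteq> 0\<close> by (simp add: complex_vector.scale_eq_0_iff)
  moreover have "e \<noteq> \<one> c"
  proof
    assume "e = \<one> c"
    moreover have "h \<cdot> e = \<kappa> *\<^sub>C e" unfolding e_def comp_scale_right[OF h(1) tH] ht by (simp add: mult.commute)
    ultimately show False using h(3) ident_right[OF h(1)] by simp
  qed
  ultimately show ?thesis using eH by blast
qed

lemma nonsimple_splits:
  assumes c: "\<one> c \<noteq> 0" and ns: "\<not> simple C c"
  shows "\<exists>c1 c2. \<exists>v1\<in>Hom C c1 c. \<exists>v2\<in>Hom C c2 c. v1\<^bold>* \<cdot> v1 = \<one> c1 \<and> v2\<^bold>* \<cdot> v2 = \<one> c2 \<and>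
    v1 \<cdot> v1\<^bold>* + v2 \<cdot> v2\<^bold>* = \<one> c \<and> \<one> c1 \<noteq> 0 \<and> \<one> c2 \<noteq> 0"
proof -
  obtain e where e: "e \<in> Hom C c c" "e \<cdot> e = e" "e\<^bold>* = e" "e \<noteq> 0" "e \<noteq> \<one> c"
    using proper_projection[OF c ns] by blast
  define p where "p = \<one> c + (-1) *\<^sub>C e"
  have e': "(-1) *\<^sub>C e \<in> Hom C c c" by (rule complex_vector.subspace_scale[OF Hom_subspace e(1)])
  have p: "p \<in> Hom C c c" unfolding p_def by (rule complex_vector.subspace_add[OF Hom_subspace ident_in e'])
  have "e \<cdot> p = 0"
    unfolding p_def comp_add_right[OF e(1) ident_in e'] comp_scale_right[OF e(1,1)] e(2) ident_right[OF e(1)]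
    by (simp add: complex_vector.scale_minus_left)
  have "p \<cdot> p = \<one> c \<cdot> p + ((-1) *\<^sub>C e) \<cdot> p"
    by (subst (1) p_def) (rule comp_add_left[OF ident_in e' p])
  also have "\<dots> = p"
    unfolding comp_scale_left[OF e(1) p] \<open>e \<cdot> p = 0\<close> ident_left[OF p] by simp
  finally have "p \<cdot> p = p" .
  moreover have "p\<^bold>* = p"
    unfolding p_def dag_add[OF ident_in e'] dag_scale[OF e(1)] e(3) ident_dag by simp
  ultimately obtain c2 v2 where 2: "v2 \<in> Hom C c2 c" "v2\<^bold>* \<cdot> v2 = \<one> c2" "v2 \<cdot> v2\<^bold>* = p"
    using subobjects[OF p] by blast
  obtain c1 v1 where 1: "v1 \<in> Hom C c1 c" "v1\<^bold>* \<cdot> v1 = \<one> c1" "v1 \<cdot> v1\<^bold>* = e"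
    using subobjects[OF e(1-3)] by blast
  have nz: "\<one> b \<noteq> 0" if v: "v \<in> Hom C b c" "v \<cdot> v\<^bold>* \<noteq> 0" for b v
  proof
    assume "\<one> b = 0"
    hence "v = 0" using ident_right[OF v(1)] comp_zero_right[OF v(1)] by simp
    thus False using v comp_zero_left[OF dag_in[OF v(1)]] by simp
  qed
  have "v1 \<cdot> v1\<^bold>* + v2 \<cdot> v2\<^bold>* = \<one> c" unfolding 1(3) 2(3) p_def by (simp add: complex_vector.scale_minus_left)
  moreover have "p \<noteq> 0" using e(5) by (simp add: p_def complex_vector.scale_minus_left)
  ultimately show ?thesis using 1 2 nz[OF 1(1)] nz[OF 2(1)] e(4) by blast
qed

text \<open>The dimension is the trace of the range projection, and traces are additive for orthogonal decompositions.\<close>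

lemma isometry_card_basis:
  assumes v: "v \<in> Hom C b c" "v\<^bold>* \<cdot> v = \<one> b"
  shows "real (card (basis (obj F b))) = (\<Sum>f\<in>basis (obj F c). (hnorm (obj F b) (mor F (v\<^bold>*) f))\<^sup>2)"
proof -
  have "(\<Sum>f\<in>basis (obj F c). (hnorm (obj F b) (mor F (v\<^bold>*) f))\<^sup>2) =
      (\<Sum>f\<in>basis (obj F c). \<Sum>e\<in>basis (obj F b). (cmod (ip (obj F c) f (mor F v e)))\<^sup>2)"
  proof (rule sum.cong[OF refl])
    fix f assume f: "f \<in> basis (obj F c)"
    have "cmod (ip (obj F b) e (mor F (v\<^bold>*) f)) = cmod (ip (obj F c) f (mor F v e))" if "e \<in> basis (obj F b)" for e
      using mor_adj[OF v(1) O.basis_in[OF that] O.basis_in[OF f]]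
        O.ip_cnj[OF mor_in[OF v(1) O.basis_in[OF that]] O.basis_in[OF f]] by simp
    thus "(hnorm (obj F b) (mor F (v\<^bold>*) f))\<^sup>2 = (\<Sum>e\<in>basis (obj F b). (cmod (ip (obj F c) f (mor F v e)))\<^sup>2)"
      unfolding O.hnorm_sq_basis[OF mor_in[OF dag_in[OF v(1)] O.basis_in[OF f]]] by simp
  qed
  also have "\<dots> = (\<Sum>e\<in>basis (obj F b). \<Sum>f\<in>basis (obj F c). (cmod (ip (obj F c) f (mor F v e)))\<^sup>2)"
    by (rule sum.swap)
  also have "\<dots> = (\<Sum>e\<in>basis (obj F b). 1)"
  proof (rule sum.cong[OF refl])
    fix e assume e: "e \<in> basis (obj F b)"
    note ve = mor_in[OF v(1) O.basis_in[OF e]]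
    have "(hnorm (obj F c) (mor F v e))\<^sup>2 = Re (ip (obj F b) e (mor F (v\<^bold>*) (mor F v e)))"
      unfolding O.hnorm_sq[OF ve] using mor_adj[OF v(1) O.basis_in[OF e] ve] by simp
    also have "\<dots> = 1" using mor_isometry_id[OF v O.basis_in[OF e]] O.basis_ip[OF e e] by simp
    finally show "(\<Sum>f\<in>basis (obj F c). (cmod (ip (obj F c) f (mor F v e)))\<^sup>2) = 1"
      unfolding O.hnorm_sq_basis[OF ve] .
  qed
  finally show ?thesis by simp
qed

lemma split_card_basis:
  assumes v1: "v1 \<in> Hom C c1 c" "v1\<^bold>* \<cdot> v1 = \<one> c1" and v2: "v2 \<in> Hom C c2 c" "v2\<^bold>* \<cdot> v2 = \<one> c2"
    and id: "\<And>x. x \<in> hv c \<Longrightarrow> mor F v1 (mor F (v1\<^bold>*) x) + mor F v2 (mor F (v2\<^bold>*) x) = x"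
  shows "card (basis (obj F c1)) + card (basis (obj F c2)) = card (basis (obj F c))"
proof -
  have "(hnorm (obj F c1) (mor F (v1\<^bold>*) f))\<^sup>2 + (hnorm (obj F c2) (mor F (v2\<^bold>*) f))\<^sup>2 = 1"
    if f: "f \<in> basis (obj F c)" for f
  proof -
    note fi = O.basis_in[OF f]
    have m: "mor F (v1\<^bold>*) f \<in> hv c1" "mor F (v2\<^bold>*) f \<in> hv c2"
      using mor_in[OF dag_in[OF v1(1)] fi] mor_in[OF dag_in[OF v2(1)] fi] by auto
    have "(hnorm (obj F c1) (mor F (v1\<^bold>*) f))\<^sup>2 + (hnorm (obj F c2) (mor F (v2\<^bold>*) f))\<^sup>2
      = Re (ip (obj F c) f (mor F v1 (mor F (v1\<^bold>*) f))) + Re (ip (obj F c) f (mor F v2 (mor F (v2\<^bold>*) f)))"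
      unfolding O.hnorm_sq[OF m(1)] O.hnorm_sq[OF m(2)]
      using mor_dag[OF v1(1) m(1) fi] mor_dag[OF v2(1) m(2) fi] by simp
    also have "\<dots> = Re (ip (obj F c) f (mor F v1 (mor F (v1\<^bold>*) f) + mor F v2 (mor F (v2\<^bold>*) f)))"
      by (simp add: O.ip_add_right[OF fi mor_in[OF v1(1) m(1)] mor_in[OF v2(1) m(2)]])
    also have "\<dots> = 1" unfolding id[OF fi] using O.basis_ip[OF f f] by simp
    finally show ?thesis .
  qed
  hence "(\<Sum>f\<in>basis (obj F c). (hnorm (obj F c1) (mor F (v1\<^bold>*) f))\<^sup>2 + (hnorm (obj F c2) (mor F (v2\<^bold>*) f))\<^sup>2)
    = real (card (basis (obj F c)))" by simp
  hence "real (card (basis (obj F c1)) + card (basis (obj F c2))) = real (card (basis (obj F c)))"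
    unfolding sum.distrib isometry_card_basis[OF v1, symmetric] isometry_card_basis[OF v2, symmetric] by simp
  thus ?thesis by linarith
qed

lemma split_mor:
  assumes "v1 \<in> Hom C c1 c" "v2 \<in> Hom C c2 c" "v1 \<cdot> v1\<^bold>* + v2 \<cdot> v2\<^bold>* = \<one> c" "x \<in> hv c"
  shows "mor F v1 (mor F (v1\<^bold>*) x) + mor F v2 (mor F (v2\<^bold>*) x) = x"
  using mor_add[OF comp_in[OF assms(1) dag_in[OF assms(1)]] comp_in[OF assms(2) dag_in[OF assms(2)]] assms(4)]
    mor_comp[OF assms(1) dag_in[OF assms(1)] assms(4)] mor_comp[OF assms(2) dag_in[OF assms(2)] assms(4)]
    mor_ident[OF assms(4)] assms(3) by simp

text \<open>The vectors reached from the members of \<open>A\<close> by morphisms; decompositions into simple objects are stated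
  through their span.\<close>

definition from_simples :: "'o set \<Rightarrow> 'o \<Rightarrow> 'h set" where
  "from_simples A c = {mor F w x |w a x. a \<in> A \<and> w \<in> Hom C a c \<and> x \<in> hv a}"

lemma from_simples_mor:
  assumes v: "v \<in> Hom C b c" and y: "y \<in> complex_vector.span (from_simples A b)"
    and b: "hv b = complex_vector.span (from_simples A b)" and AB: "A \<subseteq> B"
  shows "mor F v y \<in> complex_vector.span (from_simples B c)"
proof -
  let ?M = "{y \<in> hv b. mor F v y \<in> complex_vector.span (from_simples B c)}"
  have "complex_vector.subspace ?M"
    by (intro complex_vector.subspaceI)
      (auto simp: mor_zero_vec[OF v] mor_add_vec[OF v] mor_scale_vec[OF v]
        intro: complex_vector.span_zero complex_vector.span_add complex_vector.span_scale)
  moreover have "from_simples A b \<subseteq> ?M"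
  proof
    fix z assume "z \<in> from_simples A b"
    then obtain w a x where z: "z = mor F w x" "a \<in> A" "w \<in> Hom C a b" "x \<in> hv a" by (auto simp: from_simples_def)
    have "mor F v z = mor F (v \<cdot> w) x" using mor_comp[OF v z(3,4)] z(1) by simp
    hence "mor F v z \<in> from_simples B c"
      using comp_in[OF v z(3)] z(2,4) AB unfolding from_simples_def by blast
    thus "z \<in> ?M" using mor_in[OF z(3,4)] z(1) by (auto intro: complex_vector.span_base)
  qed
  ultimately have "complex_vector.span (from_simples A b) \<subseteq> ?M" by (intro complex_vector.span_minimal)
  thus ?thesis using y by auto
qed

lemma from_simples_subset: "complex_vector.span (from_simples A c) \<subseteq> hv c"
  by (rule complex_vector.span_minimal[OF _ O.subspace]) (auto simp: from_simples_def mor_in)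

text \<open>Induction on the dimension: a nonzero object that is not simple has a proper projection, hence splits
  into two objects of smaller dimension.\<close>

theorem semisimple: "\<exists>A. finite A \<and> A \<subseteq> Irr \<and> hv c = complex_vector.span (from_simples A c)"
proof (induction "card (basis (obj F c))" arbitrary: c rule: less_induct)
  case less
  consider "\<one> c = 0" | "simple C c" | "\<one> c \<noteq> 0" "\<not> simple C c" by blast
  thus ?case
  proof cases
    case 1
    have "x = 0" if "x \<in> hv c" for x using mor_ident[OF that] mor_zero[OF that] 1 by simp
    hence "hv c \<subseteq> complex_vector.span (from_simples {} c)" using complex_vector.span_zero by blast
    thus ?thesis using from_simples_subset[of "{}" c] by (intro exI[of _ "{}"]) auto
  next
    case 2
    obtain r u where r: "r \<in> Irr" "unitary_mor C c r u" using Irr_representative[OF 2] by blast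
    note u = mor_unitary[OF r(2)]
    have "hv c \<subseteq> complex_vector.span (from_simples {r} c)"
    proof
      fix x assume x: "x \<in> hv c"
      have "x = mor F (u\<^bold>*) (mor F u x)" using u(2)[OF x] by simp
      hence "x \<in> from_simples {r} c"
        unfolding from_simples_def using dag_in[OF u(1)] mor_in[OF u(1) x] by blast
      thus "x \<in> complex_vector.span (from_simples {r} c)" by (rule complex_vector.span_base)
    qed
    thus ?thesis using from_simples_subset[of "{r}" c] r(1) by (intro exI[of _ "{r}"]) auto
  next
    case 3
    obtain c1 c2 v1 v2 where v1: "v1 \<in> Hom C c1 c" "v1\<^bold>* \<cdot> v1 = \<one> c1" and v2: "v2 \<in> Hom C c2 c" "v2\<^bold>* \<cdot> v2 = \<one> c2"
      and id: "v1 \<cdot> v1\<^bold>* + v2 \<cdot> v2\<^bold>* = \<one> c" and nz: "\<one> c1 \<noteq> 0" "\<one> c2 \<noteq> 0"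
      using nonsimple_splits[OF 3] by blast
    note id' = split_mor[OF v1(1) v2(1) id]
    have pos: "card (basis (obj F b)) > 0" if b: "\<one> b \<noteq> 0" for b
    proof -
      obtain x where x: "x \<in> hv b" "ip (obj F b) x x = 1" using unit_vector[OF b] by blast
      have "basis (obj F b) \<noteq> {}"
      proof
        assume "basis (obj F b) = {}"
        hence "x = 0" using O.basis_expand[OF x(1)] by simp
        thus False using x by simp
      qed
      thus ?thesis by (simp add: card_gt_0_iff)
    qed
    have less': "card (basis (obj F c1)) < card (basis (obj F c))" "card (basis (obj F c2)) < card (basis (obj F c))"
      using split_card_basis[OF v1 v2 id'] pos[OF nz(1)] pos[OF nz(2)] by auto
    obtain A1 where A1: "finite A1" "A1 \<subseteq> Irr" "hv c1 = complex_vector.span (from_simples A1 c1)"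
      using less.hyps[OF less'(1)] by blast
    obtain A2 where A2: "finite A2" "A2 \<subseteq> Irr" "hv c2 = complex_vector.span (from_simples A2 c2)"
      using less.hyps[OF less'(2)] by blast
    have "hv c \<subseteq> complex_vector.span (from_simples (A1 \<union> A2) c)"
    proof
      fix x assume x: "x \<in> hv c"
      have "mor F (v1\<^bold>*) x \<in> complex_vector.span (from_simples A1 c1)" "mor F (v2\<^bold>*) x \<in> complex_vector.span (from_simples A2 c2)"
        using mor_in[OF dag_in[OF v1(1)] x] mor_in[OF dag_in[OF v2(1)] x] A1(3) A2(3) by auto
      hence "mor F v1 (mor F (v1\<^bold>*) x) + mor F v2 (mor F (v2\<^bold>*) x) \<in> complex_vector.span (from_simples (A1 \<union> A2) c)"
        using from_simples_mor[OF v1(1) _ A1(3), of _ "A1 \<union> A2"] from_simples_mor[OF v2(1) _ A2(3), of _ "A1 \<union> A2"]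
        by (intro complex_vector.span_add) auto
      thus "x \<in> complex_vector.span (from_simples (A1 \<union> A2) c)" unfolding id'[OF x] .
    qed
    thus ?thesis using from_simples_subset[of "A1 \<union> A2" c] A1 A2 by (intro exI[of _ "A1 \<union> A2"]) auto
  qed
qed

definition supp :: "'o \<Rightarrow> 'o set" where
  "supp c = {r \<in> Irr. Hom C c r \<noteq> {0}}"

lemma supp_Irr: "r \<in> supp c \<Longrightarrow> r \<in> Irr"
  by (simp add: supp_def)

lemma not_supp_zero: "r \<in> Irr \<Longrightarrow> r \<notin> supp c \<Longrightarrow> \<alpha> \<in> Hom C c r \<Longrightarrow> \<alpha> = 0"
  by (auto simp: supp_def)

lemma finite_supp: "finite (supp c)"
proof -
  obtain A where A: "finite A" "A \<subseteq> Irr" "hv c = complex_vector.span (from_simples A c)"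
    using semisimple by blast
  have "supp c \<subseteq> A"
  proof
    fix r assume r: "r \<in> supp c"
    show "r \<in> A"
    proof (rule ccontr)
      assume "r \<notin> A"
      have "\<alpha> = 0" if \<alpha>: "\<alpha> \<in> Hom C c r" for \<alpha>
      proof (rule faithful[OF \<alpha>])
        fix x assume x: "x \<in> hv c"
        show "mor F \<alpha> x = 0"
        proof (rule clinear_on_span_eq[of "from_simples A c" "hv r" "mor F \<alpha>" UNIV "\<lambda>_. 0"])
          show "clinear_on (complex_vector.span (from_simples A c)) (hv r) (mor F \<alpha>)"
            using mor_linear[OF \<alpha>] A(3) by simp
          show "x \<in> complex_vector.span (from_simples A c)" using x A(3) by simp
          fix z assume "z \<in> from_simples A c"
          then obtain w a y where z: "z = mor F w y" "a \<in> A" "w \<in> Hom C a c" "y \<in> hv a" by (auto simp: from_simples_def)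
          have "\<alpha> \<cdot> w = 0"
            using Irr_Hom_zero[of a r "\<alpha> \<cdot> w"] comp_in[OF \<alpha> z(3)] z(2) A(2) supp_Irr[OF r] \<open>r \<notin> A\<close> by blast
          thus "mor F \<alpha> z = 0" using mor_comp[OF \<alpha> z(3,4)] mor_zero[OF z(4)] z(1) by simp
        qed (auto intro: clinear_onI)
      qed
      thus False using r by (auto simp: supp_def)
    qed
  qed
  thus ?thesis using A(1) finite_subset by blast
qed

text \<open>The identity of \<open>c\<close> is decomposed along the orthonormal bases.  By semisimplicity it suffices to
  consider a vector that comes from some \<open>a \<in> Irr\<close> by a morphism; there only the terms of \<open>a\<close> survive,
  and they form a Fourier expansion.\<close>

theorem completeness:
  assumes x: "x \<in> hv c"
  shows "(\<Sum>r\<in>supp c. \<Sum>\<alpha>\<in>ONB C c r. qdim C r *\<^sub>C mor F (\<alpha>\<^bold>*) (mor F \<alpha> x)) = x"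
proof -
  obtain A where A: "finite A" "A \<subseteq> Irr" "hv c = complex_vector.span (from_simples A c)"
    using semisimple by blast
  let ?P = "\<lambda>x. \<Sum>r\<in>supp c. \<Sum>\<alpha>\<in>ONB C c r. qdim C r *\<^sub>C mor F (\<alpha>\<^bold>*) (mor F \<alpha> x)"
  have in_Hom: "\<alpha> \<in> Hom C c r" if "r \<in> supp c" "\<alpha> \<in> ONB C c r" for r \<alpha>
    using that ONB_in[OF Irr_simple[OF supp_Irr]] by blast
  have "?P x = (\<lambda>x. x) x"
  proof (rule clinear_on_span_eq[of "from_simples A c" "hv c" ?P "hv c"])
    show "clinear_on (complex_vector.span (from_simples A c)) (hv c) ?P"
      unfolding A(3)[symmetric]
    proof (rule clinear_onI)
      fix x assume x: "x \<in> hv c"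
      show "?P x \<in> hv c" by (intro O.sum_in O.scale_in mor_in[OF dag_in mor_in[OF _ x]] in_Hom)
      show "?P (z *\<^sub>C x) = z *\<^sub>C ?P x" for z
        unfolding complex_vector.scale_sum_right
        by (intro sum.cong refl)
          (simp add: mor_scale_vec[OF in_Hom x] mor_scale_vec[OF dag_in[OF in_Hom] mor_in[OF in_Hom x]] mult.commute)
      fix y assume y: "y \<in> hv c"
      show "?P (x + y) = ?P x + ?P y"
        unfolding sum.distrib[symmetric]
        by (intro sum.cong refl)
          (simp add: mor_add_vec[OF in_Hom x y] mor_add_vec[OF dag_in[OF in_Hom] mor_in[OF in_Hom x] mor_in[OF in_Hom y]] scaleC_add_right)
    qed
    show "clinear_on (complex_vector.span (from_simples A c)) (hv c) (\<lambda>x. x)"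
      unfolding A(3)[symmetric] by (intro clinear_onI) auto
    show "x \<in> complex_vector.span (from_simples A c)" using x A(3) by simp
    fix z assume "z \<in> from_simples A c"
    then obtain w a y where z: "z = mor F w y" "a \<in> A" "w \<in> Hom C a c" "y \<in> hv a" by (auto simp: from_simples_def)
    have a: "a \<in> Irr" "simple C a" using z A Irr_simple by auto
    show "?P z = z"
    proof (cases "a \<in> supp c")
      case False
      hence "w\<^bold>* = 0" using not_supp_zero[OF a(1) _ dag_in[OF z(3)]] by blast
      hence "w = 0" using dag_dag[OF z(3)] dag_zero by simp
      hence "z = 0" using mor_zero[OF z(4)] z(1) by simp
      thus ?thesis by (simp add: mor_zero_vec[OF in_Hom] mor_zero_vec[OF dag_in[OF in_Hom]])
    next
      case True
      have aw: "mor F \<alpha> z = mor F (\<alpha> \<cdot> w) y" if "\<alpha> \<in> Hom C c r" for \<alpha> r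
        using mor_comp[OF that z(3,4)] z(1) by simp
      have "?P z = (\<Sum>r\<in>supp c. if r = a then \<Sum>\<alpha>\<in>ONB C c a. qdim C a *\<^sub>C mor F (\<alpha>\<^bold>*) (mor F \<alpha> z) else 0)"
      proof (rule sum.cong[OF refl])
        fix r assume r: "r \<in> supp c"
        show "(\<Sum>\<alpha>\<in>ONB C c r. qdim C r *\<^sub>C mor F (\<alpha>\<^bold>*) (mor F \<alpha> z)) =
          (if r = a then \<Sum>\<alpha>\<in>ONB C c a. qdim C a *\<^sub>C mor F (\<alpha>\<^bold>*) (mor F \<alpha> z) else 0)"
        proof (cases "r = a")
          case False
          have "mor F \<alpha> z = 0" if "\<alpha> \<in> ONB C c r" for \<alpha>
          proof -
            note al = in_Hom[OF r that]
            have "\<alpha> \<cdot> w = 0" using Irr_Hom_zero[OF a(1) supp_Irr[OF r] _ comp_in[OF al z(3)]] False by blast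
            thus ?thesis using aw[OF al] mor_zero[OF z(4)] by simp
          qed
          thus ?thesis using False by (simp add: mor_zero_vec[OF dag_in[OF in_Hom[OF r]]])
        qed simp
      qed
      also have "\<dots> = (\<Sum>\<alpha>\<in>ONB C c a. qdim C a *\<^sub>C mor F (\<alpha>\<^bold>*) (mor F \<alpha> z))"
        using True finite_supp by simp
      also have "\<dots> = (\<Sum>\<alpha>\<in>ONB C c a. (sc a (\<alpha> \<cdot> w) * qdim C a) *\<^sub>C mor F (\<alpha>\<^bold>*) y)"
      proof (rule sum.cong[OF refl])
        fix \<alpha> assume "\<alpha> \<in> ONB C c a"
        note al = in_Hom[OF True this]
        show "qdim C a *\<^sub>C mor F (\<alpha>\<^bold>*) (mor F \<alpha> z) = (sc a (\<alpha> \<cdot> w) * qdim C a) *\<^sub>C mor F (\<alpha>\<^bold>*) y"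
          unfolding aw[OF al] mor_simple[OF a(2) comp_in[OF al z(3)] z(4)] mor_scale_vec[OF dag_in[OF al] z(4)]
          by (simp add: mult.commute)
      qed
      also have "\<dots> = z" unfolding z(1) by (rule mor_ONB_expand_dag[symmetric, OF a(2) z(3,4)])
      finally show ?thesis .
    qed
  qed
  thus ?thesis by simp
qed

section \<open>Matrix coefficients\<close>

lemma alg_map_apply: "x \<in> hv c \<Longrightarrow> alg_map F c t f x = f (mor F t x)"
  by (simp add: alg_map_def)

lemma alg_map_in: "t \<in> Hom C c d \<Longrightarrow> f \<in> dual (obj F d) \<Longrightarrow> alg_map F c t f \<in> dual (obj F c)"
  by (auto simp: dual_def[of "obj F c"] alg_map_def mor_add_vec mor_scale_vec mor_in O.dual_add O.dual_scale intro!: clinear_onI)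

lemma alg_map_add: "alg_map F c t (f + g) = alg_map F c t f + alg_map F c t g"
  and alg_map_scale: "alg_map F c t (z *\<^sub>C f) = z *\<^sub>C alg_map F c t f"
  by (auto simp: fun_eq_iff alg_map_def scaleC_fun_apply)

text \<open>The matrix coefficient of an arbitrary object \<open>c\<close>, decomposed into simple ones.  The weights are
  those of the product formula, so that the product of elementary tensors is the matrix coefficient of a
  tensor product.\<close>

definition coef :: "'o \<Rightarrow> ('h \<Rightarrow> complex) \<Rightarrow> 'h \<Rightarrow> 'o \<Rightarrow> 'h \<Rightarrow> 'h" where
  "coef c f v = (\<lambda>r. if r \<in> Irr
     then \<Sum>\<alpha>\<in>ONB C c r. qdim C r *\<^sub>C elt (alg_map F r (\<alpha>\<^bold>*) f) (mor F \<alpha> v) else 0)"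

lemma ONB_Irr: "r \<in> Irr \<Longrightarrow> \<alpha> \<in> ONB C c r \<Longrightarrow> \<alpha> \<in> Hom C c r"
  using ONB_in[OF Irr_simple] .

lemma coef_add_right: "v \<in> hv c \<Longrightarrow> w \<in> hv c \<Longrightarrow> coef c f (v + w) = coef c f v + coef c f w"
  by (auto simp: coef_def fun_eq_iff mor_add_vec[OF ONB_Irr] elt_add_right scaleC_add_right sum.distrib intro!: sum.cong)

lemma coef_scale_right: "v \<in> hv c \<Longrightarrow> coef c f (z *\<^sub>C v) = z *\<^sub>C coef c f v"
  by (rule ext, subst scaleC_fun_apply)
    (auto simp: coef_def mor_scale_vec[OF ONB_Irr] elt_scale_right complex_vector.scale_sum_right mult.commute intro!: sum.cong)

lemma coef_add_left: "coef c (f + g) v = coef c f v + coef c g v"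
  by (auto simp: coef_def fun_eq_iff alg_map_add elt_add_left scaleC_add_right sum.distrib)

lemma coef_scale_left: "coef c (z *\<^sub>C f) v = z *\<^sub>C coef c f v"
  by (rule ext, subst scaleC_fun_apply)
    (auto simp: coef_def alg_map_scale elt_scale_left complex_vector.scale_sum_right mult.commute intro!: sum.cong)

lemma coef_linear_right: "clinear_on (hv c) UNIV (coef c f)"
  by (intro clinear_onI coef_add_right coef_scale_right) auto

lemma coef_linear_left: "clinear_on V UNIV (\<lambda>f. coef c f v)"
  by (intro clinear_onI coef_add_left coef_scale_left) auto

lemmas coef_sum_right = clinear_on_sum[OF coef_linear_right O.subspace]
lemmas coef_zero_right = clinear_on_zero[OF coef_linear_right O.subspace]

lemma coef_eqI:
  assumes "\<And>r w. r \<in> Irr \<Longrightarrow> w \<in> hv r \<Longrightarrow>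
      (\<Sum>\<alpha>\<in>ONB C c r. (qdim C r * f (mor F (\<alpha>\<^bold>*) w)) *\<^sub>C mor F \<alpha> v) =
      (\<Sum>\<beta>\<in>ONB C d r. (qdim C r * g (mor F (\<beta>\<^bold>*) w)) *\<^sub>C mor F \<beta> u)"
  shows "coef c f v = coef d g u"
proof (intro ext)
  fix r w
  show "coef c f v r w = coef d g u r w"
    using assms[of r w] by (cases "w \<in> hv r") (auto simp: coef_def sum_fun_apply scaleC_fun_apply elt_apply alg_map_def)
qed

text \<open>Expand \<open>t \<alpha>\<^sup>*\<close> in the orthonormal basis at \<open>d\<close> on one side and \<open>\<beta> t\<close> in the one at \<open>c\<close> on the other:
  both sides become the same double sum with the scalars of \<open>\<beta> t \<alpha>\<^sup>*\<close>.\<close>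

lemma coef_natural:
  assumes t: "t \<in> Hom C c d" and f: "f \<in> dual (obj F d)" and v: "v \<in> hv c"
  shows "coef c (alg_map F c t f) v = coef d f (mor F t v)"
proof (rule coef_eqI)
  fix r w assume r: "r \<in> Irr" and w: "w \<in> hv r"
  note rs = Irr_simple[OF r]
  let ?s = "\<lambda>\<beta> \<alpha>. sc r (\<beta> \<cdot> t \<cdot> \<alpha>\<^bold>*)"
  have "(\<Sum>\<alpha>\<in>ONB C c r. (qdim C r * alg_map F c t f (mor F (\<alpha>\<^bold>*) w)) *\<^sub>C mor F \<alpha> v) =
    (\<Sum>\<alpha>\<in>ONB C c r. \<Sum>\<beta>\<in>ONB C d r. (qdim C r * (?s \<beta> \<alpha> * qdim C r) * f (mor F (\<beta>\<^bold>*) w)) *\<^sub>C mor F \<alpha> v)"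
  proof (rule sum.cong[OF refl])
    fix \<alpha> assume "\<alpha> \<in> ONB C c r"
    note al = ONB_Irr[OF r this]
    have ta: "t \<cdot> \<alpha>\<^bold>* \<in> Hom C r d" by (rule typing t al)+
    have "alg_map F c t f (mor F (\<alpha>\<^bold>*) w) = f (mor F (t \<cdot> \<alpha>\<^bold>*) w)"
      using mor_comp[OF t dag_in[OF al] w] by (simp add: alg_map_apply mor_in[OF dag_in[OF al] w])
    also have "\<dots> = f (\<Sum>\<beta>\<in>ONB C d r. (sc r (\<beta> \<cdot> (t \<cdot> \<alpha>\<^bold>*)) * qdim C r) *\<^sub>C mor F (\<beta>\<^bold>*) w)"
      unfolding mor_ONB_expand_dag[OF rs ta w] ..
    also have "\<dots> = (\<Sum>\<beta>\<in>ONB C d r. (sc r (\<beta> \<cdot> (t \<cdot> \<alpha>\<^bold>*)) * qdim C r) * f (mor F (\<beta>\<^bold>*) w))"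
      by (subst O.dual_sum[OF f])
        (auto intro!: sum.cong simp: O.dual_scale[OF f] mor_in[OF dag_in[OF ONB_Irr[OF r]] w])
    also have "\<dots> = (\<Sum>\<beta>\<in>ONB C d r. (?s \<beta> \<alpha> * qdim C r) * f (mor F (\<beta>\<^bold>*) w))"
      by (intro sum.cong refl) (simp add: comp_assoc[OF ONB_Irr[OF r] t dag_in[OF al]])
    finally show "(qdim C r * alg_map F c t f (mor F (\<alpha>\<^bold>*) w)) *\<^sub>C mor F \<alpha> v =
      (\<Sum>\<beta>\<in>ONB C d r. (qdim C r * (?s \<beta> \<alpha> * qdim C r) * f (mor F (\<beta>\<^bold>*) w)) *\<^sub>C mor F \<alpha> v)"
      by (simp add: sum_distrib_left complex_vector.scale_sum_left mult.assoc)
  qed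
  also have "\<dots> = (\<Sum>\<beta>\<in>ONB C d r. \<Sum>\<alpha>\<in>ONB C c r. (qdim C r * (?s \<beta> \<alpha> * qdim C r) * f (mor F (\<beta>\<^bold>*) w)) *\<^sub>C mor F \<alpha> v)"
    by (rule sum.swap)
  also have "\<dots> = (\<Sum>\<beta>\<in>ONB C d r. (qdim C r * f (mor F (\<beta>\<^bold>*) w)) *\<^sub>C mor F \<beta> (mor F t v))"
  proof (rule sum.cong[OF refl])
    fix \<beta> assume "\<beta> \<in> ONB C d r"
    note be = ONB_Irr[OF r this]
    have "mor F \<beta> (mor F t v) = (\<Sum>\<alpha>\<in>ONB C c r. (?s \<beta> \<alpha> * qdim C r) *\<^sub>C mor F \<alpha> v)"
      using mor_comp[OF be t v] mor_ONB_expand[OF rs comp_in[OF be t] v] by simp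
    thus "(\<Sum>\<alpha>\<in>ONB C c r. (qdim C r * (?s \<beta> \<alpha> * qdim C r) * f (mor F (\<beta>\<^bold>*) w)) *\<^sub>C mor F \<alpha> v) =
      (qdim C r * f (mor F (\<beta>\<^bold>*) w)) *\<^sub>C mor F \<beta> (mor F t v)"
      by (simp add: complex_vector.scale_sum_right mult_ac)
  qed
  finally show "(\<Sum>\<alpha>\<in>ONB C c r. (qdim C r * alg_map F c t f (mor F (\<alpha>\<^bold>*) w)) *\<^sub>C mor F \<alpha> v) =
    (\<Sum>\<beta>\<in>ONB C d r. (qdim C r * f (mor F (\<beta>\<^bold>*) w)) *\<^sub>C mor F \<beta> (mor F t v))" .
qed

lemma coef_outside_supp:
  assumes "r \<notin> supp c"
  shows "coef c f v r = 0"
proof (cases "r \<in> Irr")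
  case True
  have "\<alpha> = 0" if "\<alpha> \<in> ONB C c r" for \<alpha>
    using not_supp_zero[OF True assms ONB_Irr[OF True that]] .
  moreover have "0 \<in> ONB C c r \<Longrightarrow> False"
  proof -
    interpret M: fd_hilbert_space "homH c r" by (rule homH_hilbert[OF Irr_simple[OF True]])
    assume "0 \<in> ONB C c r"
    hence "ip (homH c r) 0 0 = 1" using ONB_onb[OF Irr_simple[OF True]] unfolding onb_def by simp
    thus False using M.ip_zero_right[OF M.zero_in] by simp
  qed
  ultimately have "ONB C c r = {}" by blast
  thus ?thesis by (simp add: coef_def)
qed (simp add: coef_def)

lemma subspace_qg_alg: "complex_vector.subspace (qg_alg F Irr)"
proof (rule complex_vector.subspaceI)
  show "0 \<in> qg_alg F Irr"
    by (auto simp: qg_alg_def complex_vector.subspace_0[OF O.subspace_dual_tensor])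
  fix x y assume x: "x \<in> qg_alg F Irr" and y: "y \<in> qg_alg F Irr"
  have "{a. (x + y) a \<noteq> 0} \<subseteq> {a. x a \<noteq> 0} \<union> {a. y a \<noteq> 0}" by auto
  hence "finite {a. (x + y) a \<noteq> 0}"
    using x y finite_subset unfolding qg_alg_def by blast
  thus "x + y \<in> qg_alg F Irr"
    using x y by (auto simp: qg_alg_def intro!: complex_vector.subspace_add[OF O.subspace_dual_tensor])
next
  fix z x assume x: "x \<in> qg_alg F Irr"
  have "{a. (z *\<^sub>C x) a \<noteq> 0} \<subseteq> {a. x a \<noteq> 0}" by (auto simp: scaleC_fun_apply[of z x])
  hence "finite {a. (z *\<^sub>C x) a \<noteq> 0}"
    using x finite_subset unfolding qg_alg_def by blast
  thus "z *\<^sub>C x \<in> qg_alg F Irr"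
    using x by (auto simp: qg_alg_def scaleC_fun_apply[of z x] intro!: complex_vector.subspace_scale[OF O.subspace_dual_tensor])
qed

lemma coef_in: 
  assumes f: "f \<in> dual (obj F c)" and v: "v \<in> hv c"
  shows "coef c f v \<in> qg_alg F Irr"
proof -
  have "{r. coef c f v r \<noteq> 0} \<subseteq> supp c" using coef_outside_supp by blast
  hence "finite {r. coef c f v r \<noteq> 0}" using finite_supp finite_subset by blast
  moreover have "coef c f v r \<in> dual_tensor (obj F r)" if r: "r \<in> Irr" for r
    using r by (auto simp: coef_def intro!: complex_vector.subspace_sum complex_vector.subspace_scale O.subspace_dual_tensor
        O.elt_in alg_map_in[OF dag_in[OF ONB_Irr[OF r]] f] mor_in[OF ONB_Irr[OF r] v])
  ultimately show ?thesis by (auto simp: qg_alg_def coef_def)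
qed

lemma coef_Irr:
  assumes r: "r \<in> Irr" and f: "f \<in> dual (obj F r)" and v: "v \<in> hv r"
  shows "coef r f v = (\<lambda>_. 0)(r := elt f v)"
proof
  fix s
  note rs = Irr_simple[OF r]
  show "coef r f v s = ((\<lambda>_. 0)(r := elt f v)) s"
  proof (cases "s = r")
    case False
    have "s \<notin> supp r" using Irr_Hom_zero[OF r] False by (auto simp: supp_def)
    thus ?thesis using coef_outside_supp False by simp
  next
    case True
    have "coef r f v r w = elt f v w" for w
    proof (cases "w \<in> hv r")
      case w: True
      have "coef r f v r w = (\<Sum>\<alpha>\<in>ONB C r r. (qdim C r * f (mor F (\<alpha>\<^bold>*) w)) *\<^sub>C mor F \<alpha> v)"
        using r w by (simp add: coef_def sum_fun_apply scaleC_fun_apply elt_apply alg_map_apply)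
      also have "\<dots> = (\<Sum>\<alpha>\<in>ONB C r r. f w *\<^sub>C ((sc r (\<one> r \<cdot> \<alpha>\<^bold>*) * qdim C r) *\<^sub>C mor F \<alpha> v))"
      proof (rule sum.cong[OF refl])
        fix \<alpha> assume "\<alpha> \<in> ONB C r r"
        note al = dag_in[OF ONB_Irr[OF r this]]
        show "(qdim C r * f (mor F (\<alpha>\<^bold>*) w)) *\<^sub>C mor F \<alpha> v = f w *\<^sub>C ((sc r (\<one> r \<cdot> \<alpha>\<^bold>*) * qdim C r) *\<^sub>C mor F \<alpha> v)"
          using mor_simple[OF rs al w] ident_left[OF al] O.dual_scale[OF f w] by (simp add: mult_ac)
      qed
      also have "\<dots> = f w *\<^sub>C v"
        unfolding complex_vector.scale_sum_right[symmetric] mor_ONB_expand[OF rs ident_in v, symmetric] mor_ident[OF v] ..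
      finally show ?thesis by (simp add: elt_apply)
    next
      case False
      thus ?thesis using r O.dual_outside[OF f False]
        by (simp add: coef_def sum_fun_apply scaleC_fun_apply elt_apply alg_map_def)
    qed
    thus ?thesis using True by (simp add: fun_eq_iff)
  qed
qed

text \<open>By naturality along a unitary onto the representative, whichever unitary is chosen.\<close>

lemma place_eq_coef:
  assumes c: "simple C c" and f: "f \<in> dual (obj F c)" and v: "v \<in> hv c"
  shows "place C F Irr c f v = coef c f v"
proof -
  obtain r u0 where r: "r \<in> Irr" "unitary_mor C c r u0" using Irr_representative[OF c] by blast
  define u where "u = (SOME u. unitary_mor C c r u)"
  have "unitary_mor C c r u" unfolding u_def by (rule someI[of "unitary_mor C c r", OF r(2)])
  note u = mor_unitary[OF this]
  let ?g = "alg_map F r (u\<^bold>*) f"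
  have g: "?g \<in> dual (obj F r)" by (rule alg_map_in[OF dag_in[OF u(1)] f])
  have "f = alg_map F c u ?g"
    by (rule O.dual_cong[OF f alg_map_in[OF u(1) g]]) (simp add: alg_map_apply mor_in[OF u(1)] u(2))
  hence "coef c f v = coef c (alg_map F c u ?g) v" by (rule arg_cong)
  also have "\<dots> = coef r ?g (mor F u v)" by (rule coef_natural[OF u(1) g v])
  also have "\<dots> = (\<lambda>_. 0)(r := elt ?g (mor F u v))" by (rule coef_Irr[OF r(1) g mor_in[OF u(1) v]])
  also have "\<dots> = place C F Irr c f v"
  proof
    fix s
    show "((\<lambda>_. 0)(r := elt ?g (mor F u v))) s = place C F Irr c f v s"
    proof (cases "s = r")
      case True
      thus ?thesis using r by (auto simp: place_def Let_def u_def alg_map_def)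
    next
      case False
      have "\<not> (s \<in> Irr \<and> (\<exists>u. unitary_mor C c s u))"
        using Irr_unique[OF c _ r(1)] unitary_isomorphic r(2) False by blast
      thus ?thesis using False by (auto simp: place_def)
    qed
  qed
  finally show ?thesis by simp
qed

text \<open>The range projections of two isometries that add up to the identity are orthogonal.\<close>

lemma direct_sum_morphisms:
  "\<exists>s. \<exists>v\<in>Hom C a s. \<exists>w\<in>Hom C b s.
    (\<forall>x\<in>hv a. mor F (v\<^bold>*) (mor F v x) = x) \<and> (\<forall>y\<in>hv b. mor F (w\<^bold>*) (mor F w y) = y) \<and>
    (\<forall>x\<in>hv a. mor F (w\<^bold>*) (mor F v x) = 0) \<and> (\<forall>y\<in>hv b. mor F (v\<^bold>*) (mor F w y) = 0)"
proof -
  obtain s v w where v: "v \<in> Hom C a s" "v\<^bold>* \<cdot> v = \<one> a" and w: "w \<in> Hom C b s" "w\<^bold>* \<cdot> w = \<one> b"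
    and id: "v \<cdot> v\<^bold>* + w \<cdot> w\<^bold>* = \<one> s"
    using direct_sums[of a b] by blast
  note vd = dag_in[OF v(1)] and wd = dag_in[OF w(1)]
  have wvx: "mor F (w\<^bold>*) (mor F v x) = 0" if x: "x \<in> hv a" for x
  proof -
    note vx = mor_in[OF v(1) x]
    have "mor F w (mor F (w\<^bold>*) (mor F v x)) = 0"
      using split_mor[OF v(1) w(1) id vx] mor_isometry_id[OF v x] by simp
    hence "mor F (w\<^bold>*) (mor F w (mor F (w\<^bold>*) (mor F v x))) = 0" using mor_zero_vec[OF wd] by simp
    thus ?thesis using mor_isometry_id[OF w mor_in[OF wd vx]] by simp
  qed
  have vwy: "mor F (v\<^bold>*) (mor F w y) = 0" if y: "y \<in> hv b" for y
  proof -
    note wy = mor_in[OF w(1) y]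
    have "mor F v (mor F (v\<^bold>*) (mor F w y)) = 0"
      using split_mor[OF v(1) w(1) id wy] mor_isometry_id[OF w y] by simp
    hence "mor F (v\<^bold>*) (mor F v (mor F (v\<^bold>*) (mor F w y))) = 0" using mor_zero_vec[OF vd] by simp
    thus ?thesis using mor_isometry_id[OF v mor_in[OF vd wy]] by simp
  qed
  show ?thesis
    by (intro exI[of _ s] bexI[OF _ v(1)] bexI[OF _ w(1)] conjI ballI wvx vwy mor_isometry_id[OF v] mor_isometry_id[OF w])
qed

text \<open>Place both coefficients on a direct sum; the mixed terms vanish by naturality.\<close>

lemma coef_add_coef:
  assumes f: "f \<in> dual (obj F a)" and x: "x \<in> hv a" and g: "g \<in> dual (obj F b)" and y: "y \<in> hv b"
  shows "\<exists>s h z. h \<in> dual (obj F s) \<and> z \<in> hv s \<and> coef a f x + coef b g y = coef s h z"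
proof -
  obtain s v w where v: "v \<in> Hom C a s" and w: "w \<in> Hom C b s"
    and iso: "\<And>x. x \<in> hv a \<Longrightarrow> mor F (v\<^bold>*) (mor F v x) = x" "\<And>y. y \<in> hv b \<Longrightarrow> mor F (w\<^bold>*) (mor F w y) = y"
    and cross: "\<And>x. x \<in> hv a \<Longrightarrow> mor F (w\<^bold>*) (mor F v x) = 0" "\<And>y. y \<in> hv b \<Longrightarrow> mor F (v\<^bold>*) (mor F w y) = 0"
    using direct_sum_morphisms[of a b] by blast
  note vx = mor_in[OF v x] and wy = mor_in[OF w y]
  note vd = dag_in[OF v] and wd = dag_in[OF w]
  let ?h = "alg_map F s (v\<^bold>*) f + alg_map F s (w\<^bold>*) g"
  have "coef s ?h (mor F v x + mor F w y) = coef a f x + coef b g y"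
    unfolding coef_add_left coef_add_right[OF vx wy]
      coef_natural[OF vd f vx] coef_natural[OF vd f wy] coef_natural[OF wd g vx] coef_natural[OF wd g wy]
    using iso x y cross by (simp add: coef_zero_right)
  moreover have "?h \<in> dual (obj F s)"
    by (rule complex_vector.subspace_add[OF O.subspace_dual alg_map_in[OF vd f] alg_map_in[OF wd g]])
  ultimately show ?thesis using O.add_in[OF vx wy] by metis
qed

lemma qg_alg_expand:
  assumes x: "x \<in> qg_alg F Irr"
  shows "x = (\<Sum>a\<in>{a. x a \<noteq> 0}. \<Sum>e\<in>basis (obj F a). coef a (bra (obj F a) e) (x a e))"
proof
  fix b
  have fin: "finite {a. x a \<noteq> 0}" and sub: "{a. x a \<noteq> 0} \<subseteq> Irr" and dt: "\<And>a. a \<in> Irr \<Longrightarrow> x a \<in> dual_tensor (obj F a)"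
    using x by (auto simp: qg_alg_def)
  have "(\<Sum>a\<in>{a. x a \<noteq> 0}. \<Sum>e\<in>basis (obj F a). coef a (bra (obj F a) e) (x a e)) b =
    (\<Sum>a\<in>{a. x a \<noteq> 0}. (\<Sum>e\<in>basis (obj F a). coef a (bra (obj F a) e) (x a e)) b)"
    by (rule sum_fun_apply)
  also have "\<dots> = (\<Sum>a\<in>{a. x a \<noteq> 0}. if a = b then x b else 0)"
  proof (rule sum.cong[OF refl])
    fix a assume "a \<in> {a. x a \<noteq> 0}"
    hence a: "a \<in> Irr" using sub by auto
    have "(\<Sum>e\<in>basis (obj F a). coef a (bra (obj F a) e) (x a e)) b = (\<Sum>e\<in>basis (obj F a). coef a (bra (obj F a) e) (x a e) b)"
      by (rule sum_fun_apply)
    also have "\<dots> =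
       (\<Sum>e\<in>basis (obj F a). if a = b then elt (bra (obj F a) e) (x a e) else 0)"
      using coef_Irr[OF a O.bra_in[OF O.basis_in] O.dual_tensor_in[OF dt[OF a]]] by (intro sum.cong) auto
    also have "\<dots> = (if a = b then x b else 0)"
      using O.dual_tensor_expand[OF dt[OF a]] by auto
    finally show "(\<Sum>e\<in>basis (obj F a). coef a (bra (obj F a) e) (x a e)) b = (if a = b then x b else 0)" .
  qed
  also have "\<dots> = x b" using fin by simp
  finally show "x b = (\<Sum>a\<in>{a. x a \<noteq> 0}. \<Sum>e\<in>basis (obj F a). coef a (bra (obj F a) e) (x a e)) b" by simp
qed

text \<open>It is this description of the elements of the algebra, by single coefficients of possibly reducible objects, that
  reduces the positivity of a functional on all elements \<open>x\<^sup># x\<close> to the objects of the category.\<close>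

lemma qg_alg_coef:
  assumes x: "x \<in> qg_alg F Irr"
  shows "\<exists>c f v. f \<in> dual (obj F c) \<and> v \<in> hv c \<and> x = coef c f v"
proof -
  define K where "K = {y. \<exists>c f v. f \<in> dual (obj F c) \<and> v \<in> hv c \<and> y = coef c f v}"
  have zero: "0 \<in> K"
    unfolding K_def using coef_zero_right[of \<I> 0] complex_vector.subspace_0[OF O.subspace_dual] O.zero_in by fastforce
  have add: "y + z \<in> K" if "y \<in> K" "z \<in> K" for y z
    using that coef_add_coef unfolding K_def by blast
  have "(\<Sum>a\<in>{a. x a \<noteq> 0}. \<Sum>e\<in>basis (obj F a). coef a (bra (obj F a) e) (x a e)) \<in> K"
  proof (intro sum_mem[OF zero add])
    fix a e assume a: "a \<in> {a. x a \<noteq> 0}" and e: "e \<in> basis (obj F a)"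
    have "x a \<in> dual_tensor (obj F a)" using x a by (auto simp: qg_alg_def)
    thus "coef a (bra (obj F a) e) (x a e) \<in> K"
      unfolding K_def using O.bra_in[OF O.basis_in[OF e]] O.dual_tensor_in by blast
  qed
  hence "x \<in> K" using qg_alg_expand[OF x] by simp
  thus ?thesis by (simp add: K_def)
qed

section \<open>Product and involution on matrix coefficients\<close>

lemma tens_fun_add_left: "f \<in> dual (obj F a) \<Longrightarrow> f' \<in> dual (obj F a) \<Longrightarrow> g \<in> dual (obj F b) \<Longrightarrow>
    tens_fun C F a b (f + f') g = tens_fun C F a b f g + tens_fun C F a b f' g"
  by (rule tensor_dual_eqI[of _ a b])
    (simp_all add: tens_fun_spec scaleC_fun_apply complex_vector.subspace_add[OF O.subspace_dual]
        complex_vector.subspace_scale[OF O.subspace_dual] algebra_simps)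

lemma tens_fun_add_right: "f \<in> dual (obj F a) \<Longrightarrow> g \<in> dual (obj F b) \<Longrightarrow> g' \<in> dual (obj F b) \<Longrightarrow>
    tens_fun C F a b f (g + g') = tens_fun C F a b f g + tens_fun C F a b f g'"
  by (rule tensor_dual_eqI[of _ a b])
    (simp_all add: tens_fun_spec scaleC_fun_apply complex_vector.subspace_add[OF O.subspace_dual]
        complex_vector.subspace_scale[OF O.subspace_dual] algebra_simps)

lemma tens_fun_scale_left: "f \<in> dual (obj F a) \<Longrightarrow> g \<in> dual (obj F b) \<Longrightarrow>
    tens_fun C F a b (z *\<^sub>C f) g = z *\<^sub>C tens_fun C F a b f g"
  by (rule tensor_dual_eqI[of _ a b])
    (simp_all add: tens_fun_spec scaleC_fun_apply complex_vector.subspace_add[OF O.subspace_dual]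
        complex_vector.subspace_scale[OF O.subspace_dual] algebra_simps)

lemma tens_fun_scale_right: "f \<in> dual (obj F a) \<Longrightarrow> g \<in> dual (obj F b) \<Longrightarrow>
    tens_fun C F a b f (z *\<^sub>C g) = z *\<^sub>C tens_fun C F a b f g"
  by (rule tensor_dual_eqI[of _ a b])
    (simp_all add: tens_fun_spec scaleC_fun_apply complex_vector.subspace_add[OF O.subspace_dual]
        complex_vector.subspace_scale[OF O.subspace_dual] algebra_simps)

lemma tens_fun_alg_map:
  assumes t: "t \<in> Hom C a a'" and s: "s \<in> Hom C b b'" and f: "f \<in> dual (obj F a')" and g: "g \<in> dual (obj F b')"
  shows "tens_fun C F a b (alg_map F a t f) (alg_map F b s g) = alg_map F (a \<boxtimes> b) (t \<otimes> s) (tens_fun C F a' b' f g)"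
proof (rule tensor_dual_eqI)
  show "tens_fun C F a b (alg_map F a t f) (alg_map F b s g) \<in> dual (obj F (a \<boxtimes> b))"
    by (rule tens_fun_spec(1)[OF alg_map_in[OF t f] alg_map_in[OF s g]])
  show "alg_map F (a \<boxtimes> b) (t \<otimes> s) (tens_fun C F a' b' f g) \<in> dual (obj F (a \<boxtimes> b))"
    by (rule alg_map_in[OF tens_in[OF t s] tens_fun_spec(1)[OF f g]])
  fix x y assume x: "x \<in> hv a" and y: "y \<in> hv b"
  show "tens_fun C F a b (alg_map F a t f) (alg_map F b s g) (lax F a b x y) =
    alg_map F (a \<boxtimes> b) (t \<otimes> s) (tens_fun C F a' b' f g) (lax F a b x y)"
    unfolding tens_fun_spec(2)[OF alg_map_in[OF t f] alg_map_in[OF s g] x y] alg_map_apply[OF lax_in[OF x y]]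
      lax_natural[OF t s x y] tens_fun_spec(2)[OF f g mor_in[OF t x] mor_in[OF s y]] alg_map_apply[OF x] alg_map_apply[OF y] ..
qed

lemma coef_natural_dag:
  "r \<in> Irr \<Longrightarrow> \<alpha> \<in> ONB C c r \<Longrightarrow> s \<in> Irr \<Longrightarrow> \<beta> \<in> ONB C e s \<Longrightarrow> f \<in> dual (obj F c) \<Longrightarrow> g \<in> dual (obj F e) \<Longrightarrow>
   x \<in> hv r \<Longrightarrow> y \<in> hv s \<Longrightarrow>
   coef (r \<boxtimes> s) (tens_fun C F r s (alg_map F r (\<alpha>\<^bold>*) f) (alg_map F s (\<beta>\<^bold>*) g)) (lax F r s x y) =
   coef (c \<boxtimes> e) (tens_fun C F c e f g) (lax F c e (mor F (\<alpha>\<^bold>*) x) (mor F (\<beta>\<^bold>*) y))"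
  using tens_fun_alg_map[OF dag_in[OF ONB_Irr] dag_in[OF ONB_Irr]]
    coef_natural[OF tens_in[OF dag_in[OF ONB_Irr] dag_in[OF ONB_Irr]] tens_fun_spec(1) lax_in]
    lax_natural[OF dag_in[OF ONB_Irr] dag_in[OF ONB_Irr]] by simp

lemma qg_mult_elt_coef:
  "qg_mult_elt C F Irr a b x1 x2 y1 y2 = coef (a \<boxtimes> b) (tens_fun C F a b x1 y1) (lax F a b x2 y2)"
  unfolding qg_mult_elt_def coef_def alg_map_def ..

lemma mult_elt_bilinear:
  assumes x: "x1 \<in> dual (obj F a)" "x2 \<in> hv a"
  shows "bilinear_map (obj F b) (\<lambda>y1 y2. qg_mult_elt C F Irr a b x1 x2 y1 y2)"
  unfolding semibilinear_map_def qg_mult_elt_coef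
  using x by (auto intro!: clinear_onI simp: lax_add_right lax_scale_right lax_in coef_add_right coef_scale_right
      tens_fun_add_right tens_fun_scale_right coef_add_left coef_scale_left)

lemma mult_elt_bilinear':
  assumes y: "\<And>e. e \<in> E \<Longrightarrow> y1 e \<in> dual (obj F b)" "\<And>e. e \<in> E \<Longrightarrow> y2 e \<in> hv b"
  shows "bilinear_map (obj F a) (\<lambda>x1 x2. \<Sum>e\<in>E. c e *\<^sub>C qg_mult_elt C F Irr a b x1 x2 (y1 e) (y2 e))"
  unfolding semibilinear_map_def qg_mult_elt_coef
  using y by (auto intro!: clinear_onI sum.cong simp: lax_add_left lax_scale_left lax_in coef_add_right coef_scale_right
      tens_fun_add_left tens_fun_scale_left coef_add_left coef_scale_left scaleC_add_right sum.distrib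
      complex_vector.scale_sum_right mult.commute)

text \<open>The product may be computed from any decompositions of the components and over any finite sets of
  indices that contain the supports.\<close>

lemma qg_mult_sum:
  assumes A: "finite A" "A \<subseteq> Irr" "{a. x a \<noteq> 0} \<subseteq> A" and B: "finite B" "B \<subseteq> Irr" "{b. y b \<noteq> 0} \<subseteq> B"
    and x: "\<And>a. a \<in> A \<Longrightarrow> x a = (\<Sum>i\<in>I a. c a i *\<^sub>C elt (f a i) (v a i))"
      "\<And>a i. a \<in> A \<Longrightarrow> i \<in> I a \<Longrightarrow> f a i \<in> dual (obj F a)" "\<And>a i. a \<in> A \<Longrightarrow> i \<in> I a \<Longrightarrow> v a i \<in> hv a"
    and y: "\<And>b. b \<in> B \<Longrightarrow> y b = (\<Sum>j\<in>J b. d b j *\<^sub>C elt (g b j) (w b j))"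
      "\<And>b j. b \<in> B \<Longrightarrow> j \<in> J b \<Longrightarrow> g b j \<in> dual (obj F b)" "\<And>b j. b \<in> B \<Longrightarrow> j \<in> J b \<Longrightarrow> w b j \<in> hv b"
  shows "qg_mult C F Irr x y = (\<Sum>a\<in>A. \<Sum>b\<in>B. \<Sum>i\<in>I a. \<Sum>j\<in>J b.
    (c a i * d b j) *\<^sub>C coef (a \<boxtimes> b) (tens_fun C F a b (f a i) (g b j)) (lax F a b (v a i) (w b j)))"
proof -
  let ?m = "\<lambda>a b x1 x2. bilin_ext (obj F b) (\<lambda>y1 y2. qg_mult_elt C F Irr a b x1 x2 y1 y2) (y b)"
  have inner: "?m a b x1 x2 = (\<Sum>j\<in>J b. d b j *\<^sub>C qg_mult_elt C F Irr a b x1 x2 (g b j) (w b j))"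
    if "b \<in> B" "x1 \<in> dual (obj F a)" "x2 \<in> hv a" for a b x1 x2
    unfolding y(1)[OF that(1)]
    by (rule O.bilin_ext_sum[OF mult_elt_bilinear[OF that(2,3)]]) (use that y in auto)
  have bil: "bilinear_map (obj F a) (?m a b)" if "b \<in> B" for a b
    by (rule bilinear_map_cong[OF mult_elt_bilinear'[of "J b" "g b" b "w b" a "d b"] inner O.fd_hilbert_space_axioms])
      (use that y in auto)
  have outer: "bilin_ext (obj F a) (?m a b) (x a) = (\<Sum>i\<in>I a. \<Sum>j\<in>J b.
      (c a i * d b j) *\<^sub>C coef (a \<boxtimes> b) (tens_fun C F a b (f a i) (g b j)) (lax F a b (v a i) (w b j)))"
    if a: "a \<in> A" and b: "b \<in> B" for a b
  proof -
    have "bilin_ext (obj F a) (?m a b) (x a) = (\<Sum>i\<in>I a. c a i *\<^sub>C ?m a b (f a i) (v a i))"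
      unfolding x(1)[OF a] by (rule O.bilin_ext_sum[OF bil[OF b]]) (use a x in auto)
    also have "\<dots> = (\<Sum>i\<in>I a. c a i *\<^sub>C (\<Sum>j\<in>J b. d b j *\<^sub>C qg_mult_elt C F Irr a b (f a i) (v a i) (g b j) (w b j)))"
      by (intro sum.cong refl arg_cong2[where f = scaleC] inner b x(2,3) a)
    finally show ?thesis by (simp add: qg_mult_elt_coef complex_vector.scale_sum_right)
  qed
  have zero: "bilin_ext (obj F a) (?m a b) (x a) = 0" if ab: "a \<in> A" "b \<in> B" and 0: "x a = 0 \<or> y b = 0" for a b
  proof -
    have a0: "bilin_ext (obj F a) (?m a b) 0 = 0"
      using O.bilin_ext_sum[OF bil[OF ab(2)], of "{}"] by simp
    have "?m a b x1 x2 = 0" if "y b = 0" "x1 \<in> dual (obj F a)" "x2 \<in> hv a" for x1 x2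
      using O.bilin_ext_sum[OF mult_elt_bilinear[OF that(2,3)], of "{}"] that(1) by simp
    hence "bilin_ext (obj F a) (?m a b) (x a) = 0" if "y b = 0"
      unfolding x(1)[OF ab(1)]
      by (subst O.bilin_ext_sum[OF bil[OF ab(2)]]) (use ab x that in auto)
    thus ?thesis using 0 a0 by auto
  qed
  have "qg_mult C F Irr x y = (\<Sum>a\<in>{a. x a \<noteq> 0}. \<Sum>b\<in>{b. y b \<noteq> 0}. bilin_ext (obj F a) (?m a b) (x a))"
    by (simp add: qg_mult_def)
  also have "\<dots> = (\<Sum>a\<in>{a. x a \<noteq> 0}. \<Sum>b\<in>B. bilin_ext (obj F a) (?m a b) (x a))"
  proof (rule sum.cong[OF refl])
    fix a assume "a \<in> {a. x a \<noteq> 0}"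
    hence "a \<in> A" using A(3) by blast
    thus "(\<Sum>b\<in>{b. y b \<noteq> 0}. bilin_ext (obj F a) (?m a b) (x a)) = (\<Sum>b\<in>B. bilin_ext (obj F a) (?m a b) (x a))"
      by (intro sum.mono_neutral_left B ballI zero) auto
  qed
  also have "\<dots> = (\<Sum>a\<in>A. \<Sum>b\<in>B. bilin_ext (obj F a) (?m a b) (x a))"
    by (intro sum.mono_neutral_left A ballI sum.neutral zero) auto
  also have "\<dots> = (\<Sum>a\<in>A. \<Sum>b\<in>B. \<Sum>i\<in>I a. \<Sum>j\<in>J b.
    (c a i * d b j) *\<^sub>C coef (a \<boxtimes> b) (tens_fun C F a b (f a i) (g b j)) (lax F a b (v a i) (w b j)))"
    by (intro sum.cong refl outer)
  finally show ?thesis .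
qed

lemma coef_support: "{r. coef c f v r \<noteq> 0} \<subseteq> supp c" "supp c \<subseteq> Irr"
  using coef_outside_supp supp_Irr by blast+

text \<open>Naturality carries all terms of the product formula to coefficients of the one object \<open>c \<otimes> e\<close>, and by
  completeness the vectors add up to \<open>v \<otimes> w\<close>.\<close>

theorem mult_coef:
  assumes f: "f \<in> dual (obj F c)" and v: "v \<in> hv c" and g: "g \<in> dual (obj F e)" and w: "w \<in> hv e"
  shows "qg_mult C F Irr (coef c f v) (coef e g w) = coef (c \<boxtimes> e) (tens_fun C F c e f g) (lax F c e v w)"
proof -
  let ?T = "tens_fun C F c e f g"
  have T: "?T \<in> dual (obj F (c \<boxtimes> e))" by (rule tens_fun_spec(1)[OF f g])
  have v': "mor F (\<alpha>\<^bold>*) (mor F \<alpha> v) \<in> hv c" if "a \<in> supp c" "\<alpha> \<in> ONB C c a" for a \<alpha>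
    using mor_in[OF dag_in[OF ONB_Irr[OF supp_Irr]] mor_in[OF ONB_Irr[OF supp_Irr] v]] that by blast
  have w': "mor F (\<beta>\<^bold>*) (mor F \<beta> w) \<in> hv e" if "b \<in> supp e" "\<beta> \<in> ONB C e b" for b \<beta>
    using mor_in[OF dag_in[OF ONB_Irr[OF supp_Irr]] mor_in[OF ONB_Irr[OF supp_Irr] w]] that by blast
  define P where "P a \<alpha> = qdim C a *\<^sub>C mor F (\<alpha>\<^bold>*) (mor F \<alpha> v)" for a \<alpha>
  define Q where "Q b \<beta> = qdim C b *\<^sub>C mor F (\<beta>\<^bold>*) (mor F \<beta> w)" for b \<beta>
  have P: "P a \<alpha> \<in> hv c" if "a \<in> supp c" "\<alpha> \<in> ONB C c a" for a \<alpha>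
    unfolding P_def by (rule O.scale_in[OF v'[OF that]])
  have Q: "Q b \<beta> \<in> hv e" if "b \<in> supp e" "\<beta> \<in> ONB C e b" for b \<beta>
    unfolding Q_def by (rule O.scale_in[OF w'[OF that]])
  have "qg_mult C F Irr (coef c f v) (coef e g w) = (\<Sum>a\<in>supp c. \<Sum>b\<in>supp e. \<Sum>\<alpha>\<in>ONB C c a. \<Sum>\<beta>\<in>ONB C e b.
    (qdim C a * qdim C b) *\<^sub>C coef (a \<boxtimes> b) (tens_fun C F a b (alg_map F a (\<alpha>\<^bold>*) f) (alg_map F b (\<beta>\<^bold>*) g))
      (lax F a b (mor F \<alpha> v) (mor F \<beta> w)))"
    by (rule qg_mult_sum[where I = "ONB C c" and J = "ONB C e" and c = "\<lambda>a _. qdim C a" and d = "\<lambda>b _. qdim C b"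
          and f = "\<lambda>a \<alpha>. alg_map F a (\<alpha>\<^bold>*) f" and g = "\<lambda>b \<beta>. alg_map F b (\<beta>\<^bold>*) g"
          and v = "\<lambda>a \<alpha>. mor F \<alpha> v" and w = "\<lambda>b \<beta>. mor F \<beta> w"])
      (simp_all add: finite_supp coef_support coef_def supp_Irr alg_map_in[OF dag_in[OF ONB_Irr[OF supp_Irr]]] f g
        mor_in[OF ONB_Irr[OF supp_Irr]] v w coef_support[unfolded coef_def])
  also have "\<dots> = (\<Sum>a\<in>supp c. \<Sum>b\<in>supp e. \<Sum>\<alpha>\<in>ONB C c a. \<Sum>\<beta>\<in>ONB C e b. coef (c \<boxtimes> e) ?T (lax F c e (P a \<alpha>) (Q b \<beta>)))"
  proof (intro sum.cong refl)
    fix a b \<alpha> \<beta> assume a: "a \<in> supp c" "\<alpha> \<in> ONB C c a" and b: "b \<in> supp e" "\<beta> \<in> ONB C e b"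
    show "(qdim C a * qdim C b) *\<^sub>C coef (a \<boxtimes> b) (tens_fun C F a b (alg_map F a (\<alpha>\<^bold>*) f) (alg_map F b (\<beta>\<^bold>*) g))
      (lax F a b (mor F \<alpha> v) (mor F \<beta> w)) = coef (c \<boxtimes> e) ?T (lax F c e (P a \<alpha>) (Q b \<beta>))"
      unfolding coef_natural_dag[OF supp_Irr[OF a(1)] a(2) supp_Irr[OF b(1)] b(2) f g
          mor_in[OF ONB_Irr[OF supp_Irr[OF a(1)] a(2)] v] mor_in[OF ONB_Irr[OF supp_Irr[OF b(1)] b(2)] w]]
        P_def Q_def lax_scale_left[OF O.scale_in[OF w'[OF b]] v'[OF a]] lax_scale_right[OF v'[OF a] w'[OF b]]
        coef_scale_right[OF O.scale_in[OF lax_in[OF v'[OF a] w'[OF b]]]] coef_scale_right[OF lax_in[OF v'[OF a] w'[OF b]]]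
        scaleC_scaleC ..
  qed
  also have "\<dots> = (\<Sum>a\<in>supp c. \<Sum>\<alpha>\<in>ONB C c a. \<Sum>b\<in>supp e. \<Sum>\<beta>\<in>ONB C e b. coef (c \<boxtimes> e) ?T (lax F c e (P a \<alpha>) (Q b \<beta>)))"
    by (intro sum.cong refl sum.swap)
  also have "\<dots> = (\<Sum>a\<in>supp c. \<Sum>\<alpha>\<in>ONB C c a. coef (c \<boxtimes> e) ?T (lax F c e (P a \<alpha>) (\<Sum>b\<in>supp e. \<Sum>\<beta>\<in>ONB C e b. Q b \<beta>)))"
    by (intro sum.cong refl)
      (simp add: clinear_on_sum[OF lax_linear_right[OF P] O.subspace] coef_sum_right lax_in P Q O.sum_in)
  also have "\<dots> = coef (c \<boxtimes> e) ?T (lax F c e (\<Sum>a\<in>supp c. \<Sum>\<alpha>\<in>ONB C c a. P a \<alpha>) (\<Sum>b\<in>supp e. \<Sum>\<beta>\<in>ONB C e b. Q b \<beta>))"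
    by (simp add: clinear_on_sum[OF lax_linear_left O.subspace] coef_sum_right lax_in P Q O.sum_in)
  also have "\<dots> = coef (c \<boxtimes> e) ?T (lax F c e v w)"
    unfolding P_def Q_def completeness[OF v] completeness[OF w] ..
  finally show ?thesis .
qed

text \<open>In this form the product is visibly additive in both factors.\<close>

lemma qg_mult_expand:
  assumes x: "x \<in> qg_alg F Irr" and y: "y \<in> qg_alg F Irr"
    and A: "finite A" "A \<subseteq> Irr" "{a. x a \<noteq> 0} \<subseteq> A" and B: "finite B" "B \<subseteq> Irr" "{b. y b \<noteq> 0} \<subseteq> B"
  shows "qg_mult C F Irr x y = (\<Sum>a\<in>A. \<Sum>b\<in>B. \<Sum>e\<in>basis (obj F a). \<Sum>e'\<in>basis (obj F b).
    coef (a \<boxtimes> b) (tens_fun C F a b (bra (obj F a) e) (bra (obj F b) e')) (lax F a b (x a e) (y b e')))"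
proof -
  have dt: "x a \<in> dual_tensor (obj F a)" "y a \<in> dual_tensor (obj F a)" if "a \<in> Irr" for a
    using x y that by (auto simp: qg_alg_def)
  have "qg_mult C F Irr x y = (\<Sum>a\<in>A. \<Sum>b\<in>B. \<Sum>e\<in>basis (obj F a). \<Sum>e'\<in>basis (obj F b).
    (1 * 1) *\<^sub>C coef (a \<boxtimes> b) (tens_fun C F a b (bra (obj F a) e) (bra (obj F b) e')) (lax F a b (x a e) (y b e')))"
  proof (rule qg_mult_sum[OF A B])
    show "x a = (\<Sum>e\<in>basis (obj F a). 1 *\<^sub>C elt (bra (obj F a) e) (x a e))" if "a \<in> A" for a
      unfolding scaleC_one using O.dual_tensor_expand[OF dt(1)] that A by blast
    show "y a = (\<Sum>e\<in>basis (obj F a). 1 *\<^sub>C elt (bra (obj F a) e) (y a e))" if "a \<in> B" for a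
      unfolding scaleC_one using O.dual_tensor_expand[OF dt(2)] that B by blast
  qed (use A B in \<open>auto intro!: O.bra_in O.basis_in O.dual_tensor_in[OF dt(1)] O.dual_tensor_in[OF dt(2)]\<close>)
  thus ?thesis by simp
qed

lemma support_alg: "x \<in> qg_alg F Irr \<Longrightarrow> finite {a. x a \<noteq> 0}" "x \<in> qg_alg F Irr \<Longrightarrow> {a. x a \<noteq> 0} \<subseteq> Irr"
  "x \<in> qg_alg F Irr \<Longrightarrow> a \<in> Irr \<Longrightarrow> x a u \<in> hv a"
  using O.dual_tensor_in by (auto simp: qg_alg_def)

lemma qg_mult_add_left:
  assumes x: "x \<in> qg_alg F Irr" and x': "x' \<in> qg_alg F Irr" and y: "y \<in> qg_alg F Irr"
  shows "qg_mult C F Irr (x + x') y = qg_mult C F Irr x y + qg_mult C F Irr x' y"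
proof -
  let ?A = "{a. x a \<noteq> 0} \<union> {a. x' a \<noteq> 0}" and ?B = "{b. y b \<noteq> 0}"
  have A: "finite ?A" "?A \<subseteq> Irr" using support_alg x x' by auto
  have B: "finite ?B" "?B \<subseteq> Irr" using support_alg y by auto
  have s: "{a. (x + x') a \<noteq> 0} \<subseteq> ?A" "{a. x a \<noteq> 0} \<subseteq> ?A" "{a. x' a \<noteq> 0} \<subseteq> ?A" by auto
  note xx = complex_vector.subspace_add[OF subspace_qg_alg x x']
  show ?thesis
    unfolding qg_mult_expand[OF xx y A s(1) B subset_refl] qg_mult_expand[OF x y A s(2) B subset_refl]
      qg_mult_expand[OF x' y A s(3) B subset_refl] sum.distrib[symmetric]
  proof (intro sum.cong refl)
    fix a b e e' assume "a \<in> ?A" "b \<in> ?B"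
    hence ab: "a \<in> Irr" "b \<in> Irr" using A B by auto
    note v = support_alg(3)[OF x ab(1), of e] support_alg(3)[OF x' ab(1), of e] support_alg(3)[OF y ab(2), of e']
    show "coef (a \<boxtimes> b) (tens_fun C F a b (bra (obj F a) e) (bra (obj F b) e')) (lax F a b ((x + x') a e) (y b e')) =
      coef (a \<boxtimes> b) (tens_fun C F a b (bra (obj F a) e) (bra (obj F b) e')) (lax F a b (x a e) (y b e')) +
      coef (a \<boxtimes> b) (tens_fun C F a b (bra (obj F a) e) (bra (obj F b) e')) (lax F a b (x' a e) (y b e'))"
      using lax_add_left[OF v(3,1,2)] coef_add_right[OF lax_in[OF v(1,3)] lax_in[OF v(2,3)]] by simp
  qed
qed

lemma qg_mult_add_right:
  assumes x: "x \<in> qg_alg F Irr" and y: "y \<in> qg_alg F Irr" and y': "y' \<in> qg_alg F Irr"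
  shows "qg_mult C F Irr x (y + y') = qg_mult C F Irr x y + qg_mult C F Irr x y'"
proof -
  let ?A = "{a. x a \<noteq> 0}" and ?B = "{b. y b \<noteq> 0} \<union> {b. y' b \<noteq> 0}"
  have A: "finite ?A" "?A \<subseteq> Irr" using support_alg x by auto
  have B: "finite ?B" "?B \<subseteq> Irr" using support_alg y y' by auto
  have s: "{a. (y + y') a \<noteq> 0} \<subseteq> ?B" "{a. y a \<noteq> 0} \<subseteq> ?B" "{a. y' a \<noteq> 0} \<subseteq> ?B" by auto
  note yy = complex_vector.subspace_add[OF subspace_qg_alg y y']
  show ?thesis
    unfolding qg_mult_expand[OF x yy A subset_refl B s(1)] qg_mult_expand[OF x y A subset_refl B s(2)]
      qg_mult_expand[OF x y' A subset_refl B s(3)] sum.distrib[symmetric]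
  proof (intro sum.cong refl)
    fix a b e e' assume "a \<in> ?A" "b \<in> ?B"
    hence ab: "a \<in> Irr" "b \<in> Irr" using A B by auto
    note v = support_alg(3)[OF x ab(1), of e] support_alg(3)[OF y ab(2), of e'] support_alg(3)[OF y' ab(2), of e']
    show "coef (a \<boxtimes> b) (tens_fun C F a b (bra (obj F a) e) (bra (obj F b) e')) (lax F a b (x a e) ((y + y') b e')) =
      coef (a \<boxtimes> b) (tens_fun C F a b (bra (obj F a) e) (bra (obj F b) e')) (lax F a b (x a e) (y b e')) +
      coef (a \<boxtimes> b) (tens_fun C F a b (bra (obj F a) e) (bra (obj F b) e')) (lax F a b (x a e) (y' b e'))"
      using lax_add_right[OF v] coef_add_right[OF lax_in[OF v(1,2)] lax_in[OF v(1,3)]] by simp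
  qed
qed

text \<open>The functional \<open>\<xi> \<mapsto> ev (\<xi> \<otimes> w)\<close> on the conjugate of \<open>a\<close>.\<close>

definition evfun :: "'o \<Rightarrow> 'h \<Rightarrow> 'h \<Rightarrow> complex" where
  "evfun a w = (\<lambda>\<xi>. if \<xi> \<in> hv (cj a) then hat_ev C F a \<xi> w else 0)"

lemma evfun_apply: "\<xi> \<in> hv (cj a) \<Longrightarrow> evfun a w \<xi> = hat_ev C F a \<xi> w"
  by (simp add: evfun_def)

lemma evfun_in: "w \<in> hv a \<Longrightarrow> evfun a w \<in> dual (obj F (cj a))"
  unfolding dual_def evfun_def
  by (auto intro!: clinear_onI simp: hat_ev_add_left hat_ev_scale_left)

lemma evfun_add: "v \<in> hv a \<Longrightarrow> w \<in> hv a \<Longrightarrow> evfun a (v + w) = evfun a v + evfun a w"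
  by (auto simp: evfun_def fun_eq_iff hat_ev_add_right)

lemma evfun_scale: "w \<in> hv a \<Longrightarrow> evfun a (z *\<^sub>C w) = z *\<^sub>C evfun a w"
  by (auto simp: evfun_def fun_eq_iff scaleC_fun_apply hat_ev_scale_right)

lemma alg_star_evfun: "alg_star C F a f = evfun a (ket (obj F a) f)"
  by (simp add: alg_star_def evfun_def)

lemma alg_star_in: "f \<in> dual (obj F a) \<Longrightarrow> alg_star C F a f \<in> dual (obj F (cj a))"
  unfolding alg_star_evfun by (rule evfun_in[OF O.ket_in])

lemma ket_alg_map:
  assumes t: "t \<in> Hom C a c" and f: "f \<in> dual (obj F c)"
  shows "ket (obj F a) (alg_map F a t f) = mor F (t\<^bold>*) (ket (obj F c) f)"
proof (rule O.eq_if_ip_eq)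
  note k = O.ket_in[OF f]
  show 1: "ket (obj F a) (alg_map F a t f) \<in> hv a" by (rule O.ket_in[OF alg_map_in[OF t f]])
  show 2: "mor F (t\<^bold>*) (ket (obj F c) f) \<in> hv a" by (rule mor_in[OF dag_in[OF t] k])
  fix w assume w: "w \<in> hv a"
  show "ip (obj F a) w (ket (obj F a) (alg_map F a t f)) = ip (obj F a) w (mor F (t\<^bold>*) (ket (obj F c) f))"
    using O.ip_ket_right[OF alg_map_in[OF t f] w] mor_adj[OF t w k] O.ip_ket_right[OF f mor_in[OF t w]]
    by (simp add: alg_map_apply[OF w])
qed

lemma bra_mor:
  assumes t: "t \<in> Hom C c a" and v: "v \<in> hv c"
  shows "bra (obj F a) (mor F t v) = alg_map F a (t\<^bold>*) (bra (obj F c) v)"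
  by (rule O.dual_cong[OF O.bra_in[OF mor_in[OF t v]] alg_map_in[OF dag_in[OF t] O.bra_in[OF v]]])
    (simp add: alg_map_apply mor_adj[OF t v] mor_in[OF dag_in[OF t]])

text \<open>The mate of \<open>\<alpha>\<close> intertwines both \<open>evfun\<close> and \<open>sharp\<close>.\<close>

lemma coef_conj_natural:
  assumes \<alpha>: "\<alpha> \<in> Hom C c a" and w: "w \<in> hv c" and u: "u \<in> hv a"
  shows "coef (cj a) (evfun a (mor F \<alpha> w)) (sharp a u) = coef (cj c) (evfun c w) (sharp c (mor F (\<alpha>\<^bold>*) u))"
proof -
  obtain \<beta> where \<beta>: "\<beta> \<in> Hom C (cj a) (cj c)"
    "\<And>\<xi> w. \<xi> \<in> hv (cj a) \<Longrightarrow> w \<in> hv c \<Longrightarrow> hat_ev C F c (mor F \<beta> \<xi>) w = hat_ev C F a \<xi> (mor F \<alpha> w)"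
    using mate_exists[OF \<alpha>] by blast
  have "evfun a (mor F \<alpha> w) = alg_map F (cj a) \<beta> (evfun c w)"
    by (rule O.dual_cong[OF evfun_in[OF mor_in[OF \<alpha> w]] alg_map_in[OF \<beta>(1) evfun_in[OF w]]])
      (simp add: evfun_apply alg_map_apply mor_in[OF \<beta>(1)] \<beta>(2) w)
  moreover have "sharp c (mor F (\<alpha>\<^bold>*) u) = mor F \<beta> (sharp a u)"
    by (rule sharp_eqI[OF mor_in[OF dag_in[OF \<alpha>] u] mor_in[OF \<beta>(1) sharp_in[OF u]]])
      (simp add: \<beta>(2) sharp_in u hat_ev_sharp mor_in[OF \<alpha>] mor_dag[OF \<alpha> _ u])
  ultimately show ?thesis
    using coef_natural[OF \<beta>(1) evfun_in[OF w] sharp_in[OF u]] by simp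
qed

lemma antipode_elt_coef:
  assumes a: "a \<in> Irr" and x: "x1 \<in> dual (obj F a)" "x2 \<in> hv a"
  shows "qg_antipode_elt C F Irr a x1 x2 = coef (cj a) (evfun a x2) (sharp a (ket (obj F a) x1))"
proof -
  have "qg_antipode_elt C F Irr a x1 x2 = place C F Irr (cj a) (evfun a x2) (slice C F a (cj a) x1 (copairing a))"
    by (simp add: qg_antipode_elt_def evfun_def copairing_def)
  thus ?thesis
    using place_eq_coef[OF conj_simple[OF Irr_simple[OF a]] evfun_in[OF x(2)] sharp_in[OF O.ket_in[OF x(1)]]]
    by (simp add: slice_eq_sharp[OF x(1)])
qed

lemma antipode_elt_bilinear:
  assumes a: "a \<in> Irr"
  shows "bilinear_map (obj F a) (qg_antipode_elt C F Irr a)"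
proof (rule bilinear_map_cong[OF _ antipode_elt_coef[OF a] O.fd_hilbert_space_axioms])
  show "bilinear_map (obj F a) (\<lambda>x1 x2. coef (cj a) (evfun a x2) (sharp a (ket (obj F a) x1)))"
    unfolding semibilinear_map_def
    by (auto intro!: clinear_onI simp: evfun_add evfun_scale coef_add_left coef_scale_left O.ket_add O.ket_scale
        sharp_add sharp_scale coef_add_right coef_scale_right sharp_in O.ket_in)
qed

text \<open>On simple objects this is the definition; the sum over the components is collected by the previous naturality and
  completeness.\<close>

lemma antipode_coef:
  assumes g: "g \<in> dual (obj F c)" and w: "w \<in> hv c"
  shows "qg_antipode C F Irr (coef c g w) = coef (cj c) (evfun c w) (sharp c (ket (obj F c) g))"
proof -
  let ?S = "qg_antipode_elt C F Irr" and ?k = "ket (obj F c) g"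
  note k = O.ket_in[OF g]
  have bil: "bilin_ext (obj F a) (?S a) (coef c g w a) =
      (\<Sum>\<alpha>\<in>ONB C c a. qdim C a *\<^sub>C ?S a (alg_map F a (\<alpha>\<^bold>*) g) (mor F \<alpha> w))" if a: "a \<in> supp c" for a
  proof -
    have "coef c g w a = (\<Sum>\<alpha>\<in>ONB C c a. qdim C a *\<^sub>C elt (alg_map F a (\<alpha>\<^bold>*) g) (mor F \<alpha> w))"
      using supp_Irr[OF a] by (simp add: coef_def)
    thus ?thesis
      using O.bilin_ext_sum[OF antipode_elt_bilinear[OF supp_Irr[OF a]], of "ONB C c a" "\<lambda>\<alpha>. alg_map F a (\<alpha>\<^bold>*) g"
          "\<lambda>\<alpha>. mor F \<alpha> w" "\<lambda>_. qdim C a"] alg_map_in[OF dag_in[OF ONB_Irr[OF supp_Irr[OF a]]] g] mor_in[OF ONB_Irr[OF supp_Irr[OF a]] w]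
      by simp
  qed
  have zero: "bilin_ext (obj F a) (?S a) 0 = 0" if "a \<in> supp c" for a
    using O.bilin_ext_sum[OF antipode_elt_bilinear[OF supp_Irr[OF that]], of "{}"] by simp
  define P where "P a \<alpha> = qdim C a *\<^sub>C mor F (\<alpha>\<^bold>*) (mor F \<alpha> ?k)" for a \<alpha>
  have P0: "mor F (\<alpha>\<^bold>*) (mor F \<alpha> ?k) \<in> hv c" if "a \<in> supp c" "\<alpha> \<in> ONB C c a" for a \<alpha>
    using mor_in[OF dag_in[OF ONB_Irr[OF supp_Irr]] mor_in[OF ONB_Irr[OF supp_Irr] k]] that by blast
  have P: "P a \<alpha> \<in> hv c" if "a \<in> supp c" "\<alpha> \<in> ONB C c a" for a \<alpha>
    unfolding P_def by (rule O.scale_in[OF P0[OF that]])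
  have "qg_antipode C F Irr (coef c g w) = (\<Sum>a\<in>supp c. bilin_ext (obj F a) (?S a) (coef c g w a))"
    unfolding qg_antipode_def
    by (rule sum.mono_neutral_left) (use zero in \<open>auto simp: finite_supp coef_support coef_outside_supp\<close>)
  also have "\<dots> = (\<Sum>a\<in>supp c. \<Sum>\<alpha>\<in>ONB C c a. coef (cj c) (evfun c w) (sharp c (P a \<alpha>)))"
  proof (rule sum.cong[OF refl])
    fix a assume a: "a \<in> supp c"
    note ai = supp_Irr[OF a]
    show "bilin_ext (obj F a) (?S a) (coef c g w a) = (\<Sum>\<alpha>\<in>ONB C c a. coef (cj c) (evfun c w) (sharp c (P a \<alpha>)))"
      unfolding bil[OF a]
    proof (rule sum.cong[OF refl])
      fix \<alpha> assume al: "\<alpha> \<in> ONB C c a"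
      note al' = ONB_Irr[OF ai al]
      have "?S a (alg_map F a (\<alpha>\<^bold>*) g) (mor F \<alpha> w) = coef (cj a) (evfun a (mor F \<alpha> w)) (sharp a (mor F \<alpha> ?k))"
        using antipode_elt_coef[OF ai alg_map_in[OF dag_in[OF al'] g] mor_in[OF al' w]] ket_alg_map[OF dag_in[OF al'] g] dag_dag[OF al'] by simp
      also have "\<dots> = coef (cj c) (evfun c w) (sharp c (mor F (\<alpha>\<^bold>*) (mor F \<alpha> ?k)))"
        by (rule coef_conj_natural[OF al' w mor_in[OF al' k]])
      finally show "qdim C a *\<^sub>C ?S a (alg_map F a (\<alpha>\<^bold>*) g) (mor F \<alpha> w) = coef (cj c) (evfun c w) (sharp c (P a \<alpha>))"
        unfolding P_def by (simp add: sharp_scale[OF P0[OF a al]] coef_scale_right[OF sharp_in[OF P0[OF a al]]] qdim_real[OF Irr_simple[OF ai]])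
    qed
  qed
  also have "\<dots> = coef (cj c) (evfun c w) (\<Sum>a\<in>supp c. \<Sum>\<alpha>\<in>ONB C c a. sharp c (P a \<alpha>))"
    by (simp add: coef_sum_right sharp_in P O.sum_in)
  also have "(\<Sum>a\<in>supp c. \<Sum>\<alpha>\<in>ONB C c a. sharp c (P a \<alpha>)) = sharp c ?k"
  proof (rule sharp_eqI[symmetric, OF k])
    show in_hv: "(\<Sum>a\<in>supp c. \<Sum>\<alpha>\<in>ONB C c a. sharp c (P a \<alpha>)) \<in> hv (cj c)"
      by (intro O.sum_in sharp_in P)
    fix y assume y: "y \<in> hv c"
    have "hat_ev C F c (\<Sum>a\<in>supp c. \<Sum>\<alpha>\<in>ONB C c a. sharp c (P a \<alpha>)) y = (\<Sum>a\<in>supp c. \<Sum>\<alpha>\<in>ONB C c a. hat_ev C F c (sharp c (P a \<alpha>)) y)"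
      by (simp add: clinear_on_sum[OF hat_ev_linear_left[OF y] O.subspace] O.sum_in sharp_in P)
    also have "\<dots> = (\<Sum>a\<in>supp c. \<Sum>\<alpha>\<in>ONB C c a. ip (obj F c) (P a \<alpha>) y)"
      by (intro sum.cong refl hat_ev_sharp P y)
    also have "\<dots> = ip (obj F c) (\<Sum>a\<in>supp c. \<Sum>\<alpha>\<in>ONB C c a. P a \<alpha>) y"
      by (simp add: O.ip_sum_left y P O.sum_in)
    also have "\<dots> = ip (obj F c) ?k y" unfolding P_def completeness[OF k] ..
    finally show "hat_ev C F c (\<Sum>a\<in>supp c. \<Sum>\<alpha>\<in>ONB C c a. sharp c (P a \<alpha>)) y = ip (obj F c) ?k y" .
  qed
  finally show ?thesis .
qed

lemma adjoint_elt_biantilinear: "biantilinear_map (obj F a) (\<lambda>x1 x2. elt (bra (obj F a) x2) (ket (obj F a) x1))"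
  unfolding semibilinear_map_def
  by (auto simp: O.bra_add O.bra_scale O.ket_add O.ket_scale elt_add_left elt_add_right elt_scale_left elt_scale_right)

text \<open>The adjoint exchanges \<open>f \<otimes> v\<close> with \<open>v\<^sup>* \<otimes> f\<^sup>*\<close> on the same object, and the antipode then moves the
  coefficient to the conjugate object.\<close>

theorem star_coef:
  assumes f: "f \<in> dual (obj F c)" and v: "v \<in> hv c"
  shows "qg_star C F Irr (coef c f v) = coef (cj c) (alg_star C F c f) (sharp c v)"
proof -
  have "bilin_ext (obj F a) (\<lambda>x1 x2. elt (bra (obj F a) x2) (ket (obj F a) x1)) (coef c f v a) =
      coef c (bra (obj F c) v) (ket (obj F c) f) a" for a
  proof (cases "a \<in> Irr")
    case False
    thus ?thesis using O.bilin_ext_sum[OF adjoint_elt_biantilinear[of a], of "{}"]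
      by (simp add: coef_def)
  next
    case a: True
    have "coef c f v a = (\<Sum>\<alpha>\<in>ONB C c a. qdim C a *\<^sub>C elt (alg_map F a (\<alpha>\<^bold>*) f) (mor F \<alpha> v))"
      using a by (simp add: coef_def)
    hence "bilin_ext (obj F a) (\<lambda>x1 x2. elt (bra (obj F a) x2) (ket (obj F a) x1)) (coef c f v a) =
      (\<Sum>\<alpha>\<in>ONB C c a. cnj (qdim C a) *\<^sub>C elt (bra (obj F a) (mor F \<alpha> v)) (ket (obj F a) (alg_map F a (\<alpha>\<^bold>*) f)))"
      using O.bilin_ext_sum[OF adjoint_elt_biantilinear[of a], of "ONB C c a" "\<lambda>\<alpha>. alg_map F a (\<alpha>\<^bold>*) f"
          "\<lambda>\<alpha>. mor F \<alpha> v" "\<lambda>_. qdim C a"] alg_map_in[OF dag_in[OF ONB_Irr[OF a]] f] mor_in[OF ONB_Irr[OF a] v] by simp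
    also have "\<dots> = (\<Sum>\<alpha>\<in>ONB C c a. qdim C a *\<^sub>C elt (alg_map F a (\<alpha>\<^bold>*) (bra (obj F c) v)) (mor F \<alpha> (ket (obj F c) f)))"
    proof (rule sum.cong[OF refl])
      fix \<alpha> assume "\<alpha> \<in> ONB C c a"
      note al = ONB_Irr[OF a this]
      show "cnj (qdim C a) *\<^sub>C elt (bra (obj F a) (mor F \<alpha> v)) (ket (obj F a) (alg_map F a (\<alpha>\<^bold>*) f)) =
        qdim C a *\<^sub>C elt (alg_map F a (\<alpha>\<^bold>*) (bra (obj F c) v)) (mor F \<alpha> (ket (obj F c) f))"
        using ket_alg_map[OF dag_in[OF al] f] dag_dag[OF al] bra_mor[OF al v] qdim_real[OF Irr_simple[OF a]] by simp
    qed
    also have "\<dots> = coef c (bra (obj F c) v) (ket (obj F c) f) a" using a by (simp add: coef_def)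
    finally show ?thesis .
  qed
  hence "qg_star C F Irr (coef c f v) = qg_antipode C F Irr (coef c (bra (obj F c) v) (ket (obj F c) f))"
    unfolding qg_star_def by simp
  also have "\<dots> = coef (cj c) (evfun c (ket (obj F c) f)) (sharp c v)"
    using antipode_coef[OF O.bra_in[OF v] O.ket_in[OF f]] v by simp
  finally show ?thesis by (simp add: alg_star_evfun)
qed

text \<open>Both coefficients are placed on a direct sum, where the formula for the involution of one coefficient applies, and
  are then separated by naturality.\<close>

lemma star_add:
  assumes f: "f \<in> dual (obj F a)" and x: "x \<in> hv a" and g: "g \<in> dual (obj F b)" and y: "y \<in> hv b"
  shows "qg_star C F Irr (coef a f x + coef b g y) = qg_star C F Irr (coef a f x) + qg_star C F Irr (coef b g y)"
proof -
  obtain s v w where v: "v \<in> Hom C a s" and w: "w \<in> Hom C b s"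
    and iso: "\<And>x. x \<in> hv a \<Longrightarrow> mor F (v\<^bold>*) (mor F v x) = x" "\<And>y. y \<in> hv b \<Longrightarrow> mor F (w\<^bold>*) (mor F w y) = y"
    and cross: "\<And>x. x \<in> hv a \<Longrightarrow> mor F (w\<^bold>*) (mor F v x) = 0" "\<And>y. y \<in> hv b \<Longrightarrow> mor F (v\<^bold>*) (mor F w y) = 0"
    using direct_sum_morphisms[of a b] by blast
  note vx = mor_in[OF v x] and wy = mor_in[OF w y]
  note vd = dag_in[OF v] and wd = dag_in[OF w]
  let ?h = "alg_map F s (v\<^bold>*) f + alg_map F s (w\<^bold>*) g" and ?z = "mor F v x + mor F w y"
  have h: "?h \<in> dual (obj F s)"
    by (rule complex_vector.subspace_add[OF O.subspace_dual alg_map_in[OF vd f] alg_map_in[OF wd g]])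
  note z = O.add_in[OF vx wy]
  note kf = O.ket_in[OF f] and kg = O.ket_in[OF g]
  have "coef s ?h ?z = coef a f x + coef b g y"
    unfolding coef_add_left coef_add_right[OF vx wy]
      coef_natural[OF vd f vx] coef_natural[OF vd f wy] coef_natural[OF wd g vx] coef_natural[OF wd g wy]
    using iso x y cross by (simp add: coef_zero_right)
  hence "qg_star C F Irr (coef a f x + coef b g y) = coef (cj s) (evfun s (ket (obj F s) ?h)) (sharp s ?z)"
    using star_coef[OF h z] by (simp add: alg_star_evfun)
  also have "ket (obj F s) ?h = mor F v (ket (obj F a) f) + mor F w (ket (obj F b) g)"
    using O.ket_add[OF alg_map_in[OF vd f] alg_map_in[OF wd g]] ket_alg_map[OF vd f] ket_alg_map[OF wd g]
      dag_dag[OF v] dag_dag[OF w] by simp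
  also have "coef (cj s) (evfun s \<dots>) (sharp s ?z) =
      coef (cj a) (evfun a (ket (obj F a) f)) (sharp a x) + coef (cj b) (evfun b (ket (obj F b) g)) (sharp b y)"
  proof -
    have sharp0: "sharp e 0 = 0" for e using sharp_scale[OF O.zero_in, of e 0] by simp
    show ?thesis
      unfolding evfun_add[OF mor_in[OF v kf] mor_in[OF w kg]] sharp_add[OF vx wy] coef_add_left
        coef_add_right[OF sharp_in[OF vx] sharp_in[OF wy]]
        coef_conj_natural[OF v kf vx] coef_conj_natural[OF v kf wy] coef_conj_natural[OF w kg vx] coef_conj_natural[OF w kg wy]
      using iso x y cross by (simp add: coef_zero_right sharp0)
  qed
  finally show ?thesis by (simp only: star_coef[OF f x] star_coef[OF g y] alg_star_evfun)
qed

section \<open>The unit of the algebra\<close>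

abbreviation vacf :: "'h \<Rightarrow> complex" where "vacf \<equiv> bra (obj F \<I>) (vac F)"

lemma vacf_in: "vacf \<in> dual (obj F \<I>)"
  by (rule O.bra_in[OF vac_in])

lemma qg_one_coef: "qg_one C F Irr = coef \<I> vacf (vac F)"
  unfolding qg_one_def by (rule place_eq_coef[OF unit_simple vacf_in vac_in])

text \<open>The unit constraint identifies the coefficient of \<open>e \<otimes> 1\<close> with one of \<open>e\<close>.\<close>

lemma mult_one_right:
  assumes g: "g \<in> dual (obj F e)" and u: "u \<in> hv e"
  shows "qg_mult C F Irr (coef e g u) (coef \<I> vacf (z *\<^sub>C vac F)) = z *\<^sub>C coef e g u"
proof -
  have "tens_fun C F e \<I> g vacf = alg_map F (e \<boxtimes> \<I>) (runit C e) g"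
  proof (rule tensor_dual_eqI[OF tens_fun_spec(1)[OF g vacf_in] alg_map_in[OF runit_in g]])
    fix x w assume x: "x \<in> hv e" and w: "w \<in> hv \<I>"
    have "alg_map F (e \<boxtimes> \<I>) (runit C e) g (lax F e \<I> x w) = g (mor F (runit C e) (lax F e \<I> x (vacc w *\<^sub>C vac F)))"
      using unit_expand[OF w] alg_map_apply[OF lax_in[OF x w]] by simp
    also have "\<dots> = g x * vacc w"
      using x by (simp add: lax_scale_right lax_in mor_scale_vec[OF runit_in] lax_runit O.dual_scale[OF g])
    finally show "tens_fun C F e \<I> g vacf (lax F e \<I> x w) = alg_map F (e \<boxtimes> \<I>) (runit C e) g (lax F e \<I> x w)"
      using tens_fun_spec(2)[OF g vacf_in x w] w by simp
  qed
  hence "qg_mult C F Irr (coef e g u) (coef \<I> vacf (z *\<^sub>C vac F)) = coef e g (mor F (runit C e) (lax F e \<I> u (z *\<^sub>C vac F)))"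
    using mult_coef[OF g u vacf_in O.scale_in[OF vac_in]] coef_natural[OF runit_in g lax_in[OF u O.scale_in[OF vac_in]]] by simp
  thus ?thesis
    using u by (simp add: lax_scale_right lax_in mor_scale_vec[OF runit_in] lax_runit coef_scale_right)
qed

lemma mult_one_left:
  assumes g: "g \<in> dual (obj F e)" and u: "u \<in> hv e"
  shows "qg_mult C F Irr (coef \<I> vacf (z *\<^sub>C vac F)) (coef e g u) = z *\<^sub>C coef e g u"
proof -
  have "tens_fun C F \<I> e vacf g = alg_map F (\<I> \<boxtimes> e) (lunit C e) g"
  proof (rule tensor_dual_eqI[OF tens_fun_spec(1)[OF vacf_in g] alg_map_in[OF lunit_in g]])
    fix w x assume x: "x \<in> hv e" and w: "w \<in> hv \<I>"
    have "alg_map F (\<I> \<boxtimes> e) (lunit C e) g (lax F \<I> e w x) = g (mor F (lunit C e) (lax F \<I> e (vacc w *\<^sub>C vac F) x))"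
      using unit_expand[OF w] alg_map_apply[OF lax_in[OF w x]] by simp
    also have "\<dots> = vacc w * g x"
      using x by (simp add: lax_scale_left lax_in mor_scale_vec[OF lunit_in] lax_lunit O.dual_scale[OF g])
    finally show "tens_fun C F \<I> e vacf g (lax F \<I> e w x) = alg_map F (\<I> \<boxtimes> e) (lunit C e) g (lax F \<I> e w x)"
      using tens_fun_spec(2)[OF vacf_in g w x] w by simp
  qed
  hence "qg_mult C F Irr (coef \<I> vacf (z *\<^sub>C vac F)) (coef e g u) = coef e g (mor F (lunit C e) (lax F \<I> e (z *\<^sub>C vac F) u))"
    using mult_coef[OF vacf_in O.scale_in[OF vac_in] g u] coef_natural[OF lunit_in g lax_in[OF O.scale_in[OF vac_in] u]] by simp
  thus ?thesis
    using u by (simp add: lax_scale_left lax_in mor_scale_vec[OF lunit_in] lax_lunit coef_scale_right)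
qed

text \<open>The unit is self-adjoint: the pairing with the vacuum is a morphism from the conjugate of the
  unit object to the unit object.\<close>

lemma star_scaled_one: "qg_star C F Irr (coef \<I> vacf (z *\<^sub>C vac F)) = coef \<I> vacf (cnj z *\<^sub>C vac F)"
proof -
  let ?c = "cj \<I>"
  define t where "t = ev C \<I> \<cdot> (runit C ?c)\<^bold>*"
  have t: "t \<in> Hom C ?c \<I>" unfolding t_def by (rule typing)+
  have t_mor: "mor F t \<xi> = hat_ev C F \<I> \<xi> (vac F) *\<^sub>C vac F" if "\<xi> \<in> hv ?c" for \<xi>
    unfolding t_def using mor_comp[OF ev_in dag_in[OF runit_in] that] mor_runit_dag[OF that] mor_ev[OF that vac_in] by simp
  have "alg_star C F \<I> vacf = alg_map F ?c t vacf"
    by (rule O.dual_cong[OF alg_star_in[OF vacf_in] alg_map_in[OF t vacf_in]])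
      (simp add: alg_star_evfun evfun_apply alg_map_apply t_mor O.ip_scale_right)
  hence "qg_star C F Irr (coef \<I> vacf (z *\<^sub>C vac F)) = coef \<I> vacf (mor F t (sharp \<I> (z *\<^sub>C vac F)))"
    using star_coef[OF vacf_in O.scale_in[OF vac_in]] coef_natural[OF t vacf_in sharp_in[OF O.scale_in[OF vac_in]]] by simp
  thus ?thesis
    by (simp add: t_mor sharp_in hat_ev_sharp O.ip_scale_left)
qed

section \<open>Positivity in the algebra object\<close>

text \<open>Since \<open>sharp\<close> is an antilinear bijection, \<open>g\<close> becomes a linear functional on the dual of \<open>a\<close>, and reflexivity
  applies.\<close>

lemma evfun_surj:
  assumes g: "g \<in> dual (obj F (cj a))"
  shows "\<exists>w\<in>hv a. g = evfun a w"
proof -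
  have "clinear_on (dual (obj F a)) UNIV (\<lambda>f. g (sharp a (ket (obj F a) f)))"
    by (intro clinear_onI) (simp_all add: O.ket_add O.ket_scale sharp_add sharp_scale O.ket_in sharp_in O.dual_add[OF g] O.dual_scale[OF g])
  then obtain w where w: "w \<in> hv a" "\<And>f. f \<in> dual (obj F a) \<Longrightarrow> g (sharp a (ket (obj F a) f)) = f w"
    using O.dual_functional_represented by blast
  have "g = evfun a w"
  proof (rule O.dual_cong[OF g evfun_in[OF w(1)]])
    fix \<xi> assume xi: "\<xi> \<in> hv (cj a)"
    obtain u where u: "u \<in> hv a" "\<xi> = sharp a u" using sharp_surj[OF xi] by blast
    show "g \<xi> = evfun a w \<xi>"
      using w(2)[OF O.bra_in[OF u(1)]] u w(1) xi by (simp add: evfun_apply hat_ev_sharp)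
  qed
  thus ?thesis using w(1) by blast
qed

lemma op_to_alg_spec:
  assumes T: "clinear_on (hv c) (hv c) T"
  shows "op_to_alg C F c T \<in> dual (obj F (cj c \<boxtimes> c))"
    and "\<And>\<xi> v. \<xi> \<in> hv (cj c) \<Longrightarrow> v \<in> hv c \<Longrightarrow> op_to_alg C F c T (lax F (cj c) c \<xi> v) = hat_ev C F c \<xi> (T v)"
proof -
  have "\<exists>!L. clinear_on (hv (cj c \<boxtimes> c)) UNIV L \<and> (\<forall>w. w \<notin> hv (cj c \<boxtimes> c) \<longrightarrow> L w = 0) \<and>
     (\<forall>\<xi>\<in>hv (cj c). \<forall>v\<in>hv c. L (lax F (cj c) c \<xi> v) = hat_ev C F c \<xi> (T v))"
    by (rule O.tensor_extend[OF O.fd_hilbert_space_axioms O.fd_hilbert_space_axioms lax_unitary complex_vector.subspace_UNIV])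
      (auto intro!: clinear_onI simp: clinear_on_in[OF T] clinear_on_add[OF T] clinear_on_scale[OF T]
        hat_ev_add_right hat_ev_add_left hat_ev_scale_left hat_ev_scale_right)
  hence "\<exists>!h. h \<in> dual (obj F (cj c \<boxtimes> c)) \<and> (\<forall>\<xi>\<in>hv (cj c). \<forall>v\<in>hv c. h (lax F (cj c) c \<xi> v) = hat_ev C F c \<xi> (T v))"
    by (simp add: dual_def conj_assoc)
  from theI'[OF this] show "op_to_alg C F c T \<in> dual (obj F (cj c \<boxtimes> c))"
    "\<And>\<xi> v. \<xi> \<in> hv (cj c) \<Longrightarrow> v \<in> hv c \<Longrightarrow> op_to_alg C F c T (lax F (cj c) c \<xi> v) = hat_ev C F c \<xi> (T v)"
    unfolding op_to_alg_def by auto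
qed

text \<open>Positivity is tested on the vectors \<open>v\<^sup>\<sharp> \<otimes> v\<close>, where a functional corresponding to the operator
  \<open>T\<close> takes the value \<open>\<langle>v, T v\<rangle>\<close>.\<close>

lemma alg_positiveD:
  assumes "h \<in> alg_positive C F c"
  shows "h \<in> dual (obj F (cj c \<boxtimes> c))"
    and "\<And>v. v \<in> hv c \<Longrightarrow> h (lax F (cj c) c (sharp c v) v) \<in> \<real>\<^sub>\<ge>\<^sub>0"
proof -
  obtain T where T: "h = op_to_alg C F c T" "positive_op (obj F c) T" using assms by (auto simp: alg_positive_def)
  have lin: "clinear_on (hv c) (hv c) T" using T(2) by (simp add: positive_op_def)
  show "h \<in> dual (obj F (cj c \<boxtimes> c))" unfolding T(1) by (rule op_to_alg_spec(1)[OF lin])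
  fix v assume v: "v \<in> hv c"
  have "h (lax F (cj c) c (sharp c v) v) = ip (obj F c) v (T v)"
    unfolding T(1) by (simp add: op_to_alg_spec(2)[OF lin sharp_in[OF v] v] hat_ev_sharp v clinear_on_in[OF lin])
  thus "h (lax F (cj c) c (sharp c v) v) \<in> \<real>\<^sub>\<ge>\<^sub>0" using T(2) v by (simp add: positive_op_def)
qed

text \<open>For fixed \<open>v\<close> the functional becomes the pairing of the conjugate with some vector, which serves as \<open>T v\<close>.\<close>

lemma alg_positiveI:
  assumes h: "h \<in> dual (obj F (cj c \<boxtimes> c))" and pos: "\<And>v. v \<in> hv c \<Longrightarrow> h (lax F (cj c) c (sharp c v) v) \<in> \<real>\<^sub>\<ge>\<^sub>0"
  shows "h \<in> alg_positive C F c"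
proof -
  have "\<exists>w. w \<in> hv c \<and> (\<forall>\<xi>\<in>hv (cj c). h (lax F (cj c) c \<xi> v) = hat_ev C F c \<xi> w)" if v: "v \<in> hv c" for v
  proof -
    define g where "g = (\<lambda>\<xi>. if \<xi> \<in> hv (cj c) then h (lax F (cj c) c \<xi> v) else 0)"
    have "g \<in> dual (obj F (cj c))"
      unfolding dual_def g_def using v
      by (auto intro!: clinear_onI simp: lax_add_left lax_scale_left lax_in O.dual_add[OF h] O.dual_scale[OF h])
    then obtain w where w: "w \<in> hv c" "g = evfun c w" using evfun_surj by blast
    have "h (lax F (cj c) c \<xi> v) = hat_ev C F c \<xi> w" if xi: "\<xi> \<in> hv (cj c)" for \<xi>
      using fun_cong[OF w(2), of \<xi>] xi by (simp add: g_def evfun_apply)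
    thus ?thesis using w(1) by blast
  qed
  hence "\<forall>v\<in>hv c. \<exists>w. w \<in> hv c \<and> (\<forall>\<xi>\<in>hv (cj c). h (lax F (cj c) c \<xi> v) = hat_ev C F c \<xi> w)" by blast
  from bchoice[OF this] obtain T where T: "\<And>v. v \<in> hv c \<Longrightarrow> T v \<in> hv c"
    "\<And>v \<xi>. v \<in> hv c \<Longrightarrow> \<xi> \<in> hv (cj c) \<Longrightarrow> h (lax F (cj c) c \<xi> v) = hat_ev C F c \<xi> (T v)" by blast
  have lin: "clinear_on (hv c) (hv c) T"
  proof (rule clinear_onI[OF T(1)])
    fix x y assume x: "x \<in> hv c" and y: "y \<in> hv c"
    show "T (x + y) = T x + T y"
      by (rule hat_ev_nondegenerate_right[of _ c])
        (simp_all add: x y T(1) hat_ev_add_right T(2)[symmetric] lax_add_right lax_in O.dual_add[OF h])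
  next
    fix x z assume x: "x \<in> hv c"
    show "T (z *\<^sub>C x) = z *\<^sub>C T x"
      by (rule hat_ev_nondegenerate_right[of _ c])
        (simp_all add: x T(1) hat_ev_scale_right T(2)[symmetric] lax_scale_right lax_in O.dual_scale[OF h])
  qed
  have "ip (obj F c) v (T v) = h (lax F (cj c) c (sharp c v) v)" if v: "v \<in> hv c" for v
    by (simp add: v T sharp_in hat_ev_sharp)
  hence "positive_op (obj F c) T" using lin pos by (simp add: positive_op_def)
  moreover have "h = op_to_alg C F c T"
    by (rule tensor_dual_eqI[OF h op_to_alg_spec(1)[OF lin]]) (simp add: T(2) op_to_alg_spec(2)[OF lin])
  ultimately show ?thesis by (auto simp: alg_positive_def)
qed

text \<open>The element \<open>f\<^sup>* f\<close> of the algebra object.\<close>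

abbreviation square :: "'o \<Rightarrow> ('h \<Rightarrow> complex) \<Rightarrow> 'h \<Rightarrow> complex" where
  "square c f \<equiv> tens_fun C F (cj c) c (alg_star C F c f) f"

lemma square_in: "f \<in> dual (obj F c) \<Longrightarrow> square c f \<in> dual (obj F (cj c \<boxtimes> c))"
  by (rule tens_fun_spec(1)[OF alg_star_in])

lemma square_apply:
  "f \<in> dual (obj F c) \<Longrightarrow> \<xi> \<in> hv (cj c) \<Longrightarrow> v \<in> hv c \<Longrightarrow> square c f (lax F (cj c) c \<xi> v) = hat_ev C F c \<xi> (ket (obj F c) f) * f v"
  using tens_fun_spec(2)[OF alg_star_in] by (simp add: alg_star_evfun evfun_apply)

lemma square_positive:
  assumes f: "f \<in> dual (obj F c)"
  shows "square c f \<in> alg_positive C F c"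
proof (rule alg_positiveI[OF square_in[OF f]])
  fix v assume v: "v \<in> hv c"
  have "square c f (lax F (cj c) c (sharp c v) v) = cnj (f v) * f v"
    using square_apply[OF f sharp_in[OF v] v] hat_ev_sharp[OF v O.ket_in[OF f]] O.ip_ket_right[OF f v] by simp
  also have "\<dots> = of_real ((cmod (f v))\<^sup>2)" by (simp add: complex_norm_square mult.commute del: of_real_power)
  finally show "square c f (lax F (cj c) c (sharp c v) v) \<in> \<real>\<^sub>\<ge>\<^sub>0" by (simp add: complex_nonneg_Reals_iff)
qed

text \<open>Rank one operators correspond to squares, so positive elements are sums of squares.\<close>

lemma alg_positive_sum_squares:
  assumes "h \<in> alg_positive C F c"
  shows "\<exists>ts. set ts \<subseteq> hv c \<and> h = (\<Sum>t\<leftarrow>ts. square c (bra (obj F c) t))"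
proof -
  obtain T where T: "h = op_to_alg C F c T" "positive_op (obj F c) T" using assms by (auto simp: alg_positive_def)
  have lin: "clinear_on (hv c) (hv c) T" using T(2) by (simp add: positive_op_def)
  obtain ts where ts: "set ts \<subseteq> hv c" "\<And>x. x \<in> hv c \<Longrightarrow> T x = (\<Sum>t\<leftarrow>ts. ip (obj F c) t x *\<^sub>C t)"
    using O.positive_op_decompose[OF T(2)] by blast
  let ?sum = "\<lambda>ts. \<Sum>t\<leftarrow>ts. square c (bra (obj F c) t)"
  have S: "?sum ts \<in> dual (obj F (cj c \<boxtimes> c)) \<and> (\<forall>\<xi>\<in>hv (cj c). \<forall>v\<in>hv c.
      (\<Sum>t\<leftarrow>ts. ip (obj F c) t v *\<^sub>C t) \<in> hv c \<and>
      ?sum ts (lax F (cj c) c \<xi> v) = hat_ev C F c \<xi> (\<Sum>t\<leftarrow>ts. ip (obj F c) t v *\<^sub>C t))"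
    using ts(1)
  proof (induction ts)
    case Nil
    have "hat_ev C F c \<xi> 0 = 0" if "\<xi> \<in> hv (cj c)" for \<xi>
      using hat_ev_scale_right[OF that O.zero_in, of 0] by simp
    moreover have nil: "?sum [] = 0" by (simp only: list.map sum_list.Nil)
    have "?sum [] \<in> dual (obj F (cj c \<boxtimes> c))" unfolding nil by (rule complex_vector.subspace_0[OF O.subspace_dual])
    ultimately show ?case by (intro conjI ballI) (assumption, simp_all)
  next
    case (Cons t ts)
    have t: "t \<in> hv c" using Cons.prems by simp
    have IH: "?sum ts \<in> dual (obj F (cj c \<boxtimes> c))"
      "\<And>\<xi> v. \<xi> \<in> hv (cj c) \<Longrightarrow> v \<in> hv c \<Longrightarrow> (\<Sum>t\<leftarrow>ts. ip (obj F c) t v *\<^sub>C t) \<in> hv c"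
      "\<And>\<xi> v. \<xi> \<in> hv (cj c) \<Longrightarrow> v \<in> hv c \<Longrightarrow> ?sum ts (lax F (cj c) c \<xi> v) = hat_ev C F c \<xi> (\<Sum>t\<leftarrow>ts. ip (obj F c) t v *\<^sub>C t)"
      using Cons by auto
    have eq: "?sum (t # ts) = square c (bra (obj F c) t) + ?sum ts" by (simp only: list.map sum_list.Cons)
    show ?case
    proof (intro conjI ballI)
      show "?sum (t # ts) \<in> dual (obj F (cj c \<boxtimes> c))"
        unfolding eq by (rule complex_vector.subspace_add[OF O.subspace_dual square_in[OF O.bra_in[OF t]] IH(1)])
      fix \<xi> v assume xi: "\<xi> \<in> hv (cj c)" and v: "v \<in> hv c"
      show "(\<Sum>t\<leftarrow>t # ts. ip (obj F c) t v *\<^sub>C t) \<in> hv c" using t IH(2)[OF xi v] by simp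
      have "?sum (t # ts) (lax F (cj c) c \<xi> v) = hat_ev C F c \<xi> (ip (obj F c) t v *\<^sub>C t) + ?sum ts (lax F (cj c) c \<xi> v)"
        unfolding eq plus_fun_apply square_apply[OF O.bra_in[OF t] xi v] using t v xi by (simp add: hat_ev_scale_right)
      thus "?sum (t # ts) (lax F (cj c) c \<xi> v) = hat_ev C F c \<xi> (\<Sum>t\<leftarrow>t # ts. ip (obj F c) t v *\<^sub>C t)"
        unfolding IH(3)[OF xi v] using hat_ev_add_right[OF xi, of "ip (obj F c) t v *\<^sub>C t"] IH(2)[OF xi v] t by simp
    qed
  qed
  have "h = ?sum ts"
    unfolding T(1) by (rule tensor_dual_eqI[OF op_to_alg_spec(1)[OF lin]]) (use S in \<open>simp_all add: op_to_alg_spec(2)[OF lin] ts(2)\<close>)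
  thus ?thesis using ts(1) by blast
qed

section \<open>From states to ucp maps\<close>

context
  fixes \<phi>
  assumes state: "qg_state C F Irr \<phi>"
begin

lemma state_linear: "clinear_on (qg_alg F Irr) UNIV \<phi>"
  using state by (simp add: qg_state_def)

lemmas state_add = clinear_on_add[OF state_linear]
lemmas state_scale = clinear_on_scale[OF state_linear, simplified scaleC_complex]

lemma state_one: "\<phi> (coef \<I> vacf (vac F)) = 1"
  using state qg_one_coef by (simp add: qg_state_def)

lemma state_square_nonneg:
  assumes f: "f \<in> dual (obj F c)" and v: "v \<in> hv c"
  shows "\<phi> (coef (cj c \<boxtimes> c) (square c f) (lax F (cj c) c (sharp c v) v)) \<in> \<real>\<^sub>\<ge>\<^sub>0"
  using state coef_in[OF f v] star_coef[OF f v] mult_coef[OF alg_star_in[OF f] sharp_in[OF v] f v]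
  unfolding qg_state_def by metis

text \<open>Positivity on \<open>(y + z 1)\<^sup>#(y + z 1)\<close> for all scalars \<open>z\<close>: the state is hermitian and satisfies
  the Cauchy--Schwarz inequality against the unit.\<close>

lemma state_hermitian_bounded:
  assumes f: "f \<in> dual (obj F c)" and v: "v \<in> hv c"
  shows "\<phi> (coef (cj c) (alg_star C F c f) (sharp c v)) = cnj (\<phi> (coef c f v))"
    and "(cmod (\<phi> (coef c f v)))\<^sup>2 \<le> Re (\<phi> (coef (cj c \<boxtimes> c) (square c f) (lax F (cj c) c (sharp c v) v)))"
proof -
  let ?y = "coef c f v" and ?sy = "coef (cj c) (alg_star C F c f) (sharp c v)"
  let ?one = "\<lambda>z. coef \<I> vacf (z *\<^sub>C vac F)"
  let ?p = "coef (cj c \<boxtimes> c) (square c f) (lax F (cj c) c (sharp c v) v)"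
  note sf = alg_star_in[OF f] and sv = sharp_in[OF v]
  have y: "?y \<in> qg_alg F Irr" by (rule coef_in[OF f v])
  have sy: "?sy \<in> qg_alg F Irr" by (rule coef_in[OF sf sv])
  have one: "?one z \<in> qg_alg F Irr" for z by (rule coef_in[OF vacf_in O.scale_in[OF vac_in]])
  have p: "?p \<in> qg_alg F Irr" by (rule coef_in[OF square_in[OF f] lax_in[OF sv v]])
  note sub_add = complex_vector.subspace_add[OF subspace_qg_alg] and sub_sc = complex_vector.subspace_scale[OF subspace_qg_alg]
  have pos: "\<phi> ?p + z * \<phi> ?sy + cnj z * \<phi> ?y + z * cnj z * 1 \<in> \<real>\<^sub>\<ge>\<^sub>0" for z
  proof -
    have st: "qg_star C F Irr (?y + ?one z) = ?sy + ?one (cnj z)"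
      unfolding star_add[OF f v vacf_in O.scale_in[OF vac_in]] star_coef[OF f v] star_scaled_one ..
    have "qg_mult C F Irr (?sy + ?one (cnj z)) (?y + ?one z) =
        qg_mult C F Irr ?sy ?y + qg_mult C F Irr ?sy (?one z) + (qg_mult C F Irr (?one (cnj z)) ?y + qg_mult C F Irr (?one (cnj z)) (?one z))"
      unfolding qg_mult_add_left[OF sy one sub_add[OF y one]] qg_mult_add_right[OF sy y one] qg_mult_add_right[OF one y one] ..
    also have "\<dots> = ?p + z *\<^sub>C ?sy + (cnj z *\<^sub>C ?y + (z * cnj z) *\<^sub>C ?one 1)"
      unfolding mult_coef[OF sf sv f v] mult_one_right[OF sf sv] mult_one_left[OF f v] mult_one_right[OF vacf_in O.scale_in[OF vac_in]]
      unfolding coef_scale_right[OF vac_in] scaleC_scaleC mult_1_right ..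
    finally have "\<phi> (qg_mult C F Irr (qg_star C F Irr (?y + ?one z)) (?y + ?one z)) =
        \<phi> ?p + z * \<phi> ?sy + (cnj z * \<phi> ?y + (z * cnj z) * \<phi> (?one 1))"
      unfolding st using p sy y one
      by (simp only: state_add state_scale sub_add sub_sc)
    moreover have "\<phi> (qg_mult C F Irr (qg_star C F Irr (?y + ?one z)) (?y + ?one z)) \<in> \<real>\<^sub>\<ge>\<^sub>0"
      using state sub_add[OF y one] unfolding qg_state_def by blast
    ultimately show ?thesis using state_one by (simp add: add_ac)
  qed
  note q = nonneg_quadratic_form[OF _ pos]
  show "\<phi> ?sy = cnj (\<phi> ?y)" using q(1) by simp
  show "(cmod (\<phi> ?y))\<^sup>2 \<le> Re (\<phi> ?p)" using q by simp
qed

text \<open>The matrix of values of a state on the coefficients of a unitary corepresentation is a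
  contraction: the squares over an orthonormal basis add up to the unit.\<close>

lemma state_matrix_contraction:
  assumes v: "v \<in> hv c"
  shows "(\<Sum>e\<in>basis (obj F c). (cmod (\<phi> (coef c (bra (obj F c) e) v)))\<^sup>2) \<le> (hnorm (obj F c) v)\<^sup>2"
proof -
  let ?E = "basis (obj F c)" and ?w = "lax F (cj c) c (sharp c v) v"
  have b: "bra (obj F c) e \<in> dual (obj F c)" if "e \<in> ?E" for e by (rule O.bra_in[OF O.basis_in[OF that]])
  note w = lax_in[OF sharp_in[OF v] v]
  have sum_in: "(\<Sum>e\<in>?E. square c (bra (obj F c) e)) \<in> dual (obj F (cj c \<boxtimes> c))"
    by (rule complex_vector.subspace_sum[OF O.subspace_dual square_in[OF b]])
  have "(\<Sum>e\<in>?E. square c (bra (obj F c) e)) = alg_map F (cj c \<boxtimes> c) (ev C c) vacf"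
  proof (rule tensor_dual_eqI[OF sum_in alg_map_in[OF ev_in vacf_in]])
    fix \<xi> y assume xi: "\<xi> \<in> hv (cj c)" and y: "y \<in> hv c"
    have "(\<Sum>e\<in>?E. square c (bra (obj F c) e)) (lax F (cj c) c \<xi> y) = (\<Sum>e\<in>?E. hat_ev C F c \<xi> e * ip (obj F c) e y)"
      unfolding sum_fun_apply by (intro sum.cong refl) (simp add: square_apply[OF b xi y] O.basis_in y)
    also have "\<dots> = hat_ev C F c \<xi> (\<Sum>e\<in>?E. ip (obj F c) e y *\<^sub>C e)"
      by (subst clinear_on_sum[OF hat_ev_linear_right[OF xi] O.subspace])
        (auto simp: O.basis_in hat_ev_scale_right[OF xi] mult.commute)
    also have "\<dots> = hat_ev C F c \<xi> y" using O.basis_expand[OF y] by simp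
    also have "\<dots> = alg_map F (cj c \<boxtimes> c) (ev C c) vacf (lax F (cj c) c \<xi> y)"
      unfolding alg_map_apply[OF lax_in[OF xi y]] mor_ev[OF xi y] by (simp add: O.ip_scale_right)
    finally show "(\<Sum>e\<in>?E. square c (bra (obj F c) e)) (lax F (cj c) c \<xi> y) = alg_map F (cj c \<boxtimes> c) (ev C c) vacf (lax F (cj c) c \<xi> y)" .
  qed
  hence "coef (cj c \<boxtimes> c) (\<Sum>e\<in>?E. square c (bra (obj F c) e)) ?w = coef \<I> vacf (mor F (ev C c) ?w)"
    using coef_natural[OF ev_in vacf_in w] by simp
  also have "mor F (ev C c) ?w = ip (obj F c) v v *\<^sub>C vac F"
    using mor_ev[OF sharp_in[OF v] v] hat_ev_sharp[OF v v] by simp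
  also have "coef \<I> vacf \<dots> = ip (obj F c) v v *\<^sub>C coef \<I> vacf (vac F)" by (rule coef_scale_right[OF vac_in])
  finally have eq: "coef (cj c \<boxtimes> c) (\<Sum>e\<in>?E. square c (bra (obj F c) e)) ?w = ip (obj F c) v v *\<^sub>C coef \<I> vacf (vac F)" .
  have "(\<Sum>e\<in>?E. \<phi> (coef (cj c \<boxtimes> c) (square c (bra (obj F c) e)) ?w)) = \<phi> (\<Sum>e\<in>?E. coef (cj c \<boxtimes> c) (square c (bra (obj F c) e)) ?w)"
    by (rule clinear_on_sum[symmetric, OF state_linear subspace_qg_alg coef_in[OF square_in[OF b] w]])
  also have "(\<Sum>e\<in>?E. coef (cj c \<boxtimes> c) (square c (bra (obj F c) e)) ?w) = coef (cj c \<boxtimes> c) (\<Sum>e\<in>?E. square c (bra (obj F c) e)) ?w"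
    by (rule clinear_on_sum[symmetric, OF coef_linear_left[of UNIV] complex_vector.subspace_UNIV]) simp
  also have "\<phi> \<dots> = ip (obj F c) v v"
    unfolding eq using state_scale[OF coef_in[OF vacf_in vac_in]] state_one by simp
  finally have tot: "(\<Sum>e\<in>?E. \<phi> (coef (cj c \<boxtimes> c) (square c (bra (obj F c) e)) ?w)) = ip (obj F c) v v" .
  have "(\<Sum>e\<in>?E. (cmod (\<phi> (coef c (bra (obj F c) e) v)))\<^sup>2) \<le> (\<Sum>e\<in>?E. Re (\<phi> (coef (cj c \<boxtimes> c) (square c (bra (obj F c) e)) ?w)))"
    by (rule sum_mono[OF state_hermitian_bounded(2)[OF b v]])
  also have "\<dots> = Re (ip (obj F c) v v)" unfolding tot[symmetric] by simp
  also have "\<dots> = (hnorm (obj F c) v)\<^sup>2" using O.hnorm_sq[OF v] by simp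
  finally show ?thesis .
qed

lemma state_multiplier_spec:
  assumes a: "a \<in> Irr" and v: "v \<in> hv a"
  shows "state_multiplier F Irr \<phi> a v \<in> hv a"
    and "\<And>f. f \<in> dual (obj F a) \<Longrightarrow> f (state_multiplier F Irr \<phi> a v) = \<phi> (coef a f v)"
proof -
  have "clinear_on (dual (obj F a)) UNIV (\<lambda>f. \<phi> (coef a f v))"
    by (intro clinear_onI) (simp_all add: coef_add_left coef_scale_left state_add state_scale coef_in v)
  then obtain w where w: "w \<in> hv a" "\<And>f. f \<in> dual (obj F a) \<Longrightarrow> \<phi> (coef a f v) = f w"
    using O.dual_functional_represented by blast
  have "state_multiplier F Irr \<phi> a v = (THE w. w \<in> hv a \<and> (\<forall>f\<in>dual (obj F a). \<phi> (coef a f v) = f w))"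
    using a v by (simp add: state_multiplier_def coef_Irr[OF a _ v] cong: ball_cong)
  also have "\<dots> = w"
  proof (rule the_equality)
    fix w' assume "w' \<in> hv a \<and> (\<forall>f\<in>dual (obj F a). \<phi> (coef a f v) = f w')"
    thus "w' = w" using w by (intro O.eq_if_dual_eq[of _ a]) auto
  qed (use w in auto)
  finally have "state_multiplier F Irr \<phi> a v = w" .
  thus "state_multiplier F Irr \<phi> a v \<in> hv a"
    "\<And>f. f \<in> dual (obj F a) \<Longrightarrow> f (state_multiplier F Irr \<phi> a v) = \<phi> (coef a f v)"
    using w by auto
qed

lemma state_multiplier_linear:
  assumes a: "a \<in> Irr"
  shows "clinear_on (hv a) (hv a) (state_multiplier F Irr \<phi> a)"
proof (rule clinear_onI[OF state_multiplier_spec(1)[OF a]])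
  note m = state_multiplier_spec[OF a]
  fix x y assume x: "x \<in> hv a" and y: "y \<in> hv a"
  show "state_multiplier F Irr \<phi> a (x + y) = state_multiplier F Irr \<phi> a x + state_multiplier F Irr \<phi> a y"
    by (rule O.eq_if_dual_eq[of _ a])
      (simp_all add: m x y O.dual_add coef_add_right state_add coef_in)
next
  note m = state_multiplier_spec[OF a]
  fix x z assume x: "x \<in> hv a"
  show "state_multiplier F Irr \<phi> a (z *\<^sub>C x) = z *\<^sub>C state_multiplier F Irr \<phi> a x"
    by (rule O.eq_if_dual_eq[of _ a])
      (simp_all add: m x O.dual_scale coef_scale_right state_scale coef_in)
qed

lemma state_multiplier_contraction:
  assumes a: "a \<in> Irr"
  shows "op_bound (obj F a) (state_multiplier F Irr \<phi> a) 1"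
  unfolding op_bound_def
proof
  fix v assume v: "v \<in> hv a"
  note m = state_multiplier_spec[OF a v]
  have "(hnorm (obj F a) (state_multiplier F Irr \<phi> a v))\<^sup>2 = (\<Sum>e\<in>basis (obj F a). (cmod (\<phi> (coef a (bra (obj F a) e) v)))\<^sup>2)"
    unfolding O.hnorm_sq_basis[OF m(1)]
    by (intro sum.cong refl) (simp add: m(2)[OF O.bra_in[OF O.basis_in], symmetric] m(1))
  also have "\<dots> \<le> (hnorm (obj F a) v)\<^sup>2" by (rule state_matrix_contraction[OF v])
  finally show "hnorm (obj F a) (state_multiplier F Irr \<phi> a v) \<le> 1 * hnorm (obj F a) v"
    using power2_le_imp_le O.hnorm_nonneg[OF v] by auto
qed

text \<open>The ucp map of the state \<open>\<phi>\<close>: its component at an arbitrary object \<open>c\<close> consists of the values of \<open>\<phi>\<close> on the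
  matrix coefficients of \<open>c\<close>.\<close>

definition state_map :: "'o \<Rightarrow> ('h \<Rightarrow> complex) \<Rightarrow> 'h \<Rightarrow> complex" where
  "state_map c f = (\<lambda>v. if v \<in> hv c then \<phi> (coef c f v) else 0)"

lemma state_map_apply: "v \<in> hv c \<Longrightarrow> state_map c f v = \<phi> (coef c f v)"
  by (simp add: state_map_def)

lemma state_map_in:
  assumes f: "f \<in> dual (obj F c)"
  shows "state_map c f \<in> dual (obj F c)"
proof -
  have "clinear_on (hv c) UNIV (state_map c f)"
    by (intro clinear_onI)
      (simp_all add: state_map_def coef_add_right coef_scale_right state_add state_scale coef_in[OF f])
  thus ?thesis by (simp add: dual_def state_map_def)
qed

lemma state_map_star:
  assumes f: "f \<in> dual (obj F a)"
  shows "state_map (cj a) (alg_star C F a f) = alg_star C F a (state_map a f)"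
proof (rule O.dual_cong[OF state_map_in[OF alg_star_in[OF f]] alg_star_in[OF state_map_in[OF f]]])
  fix \<xi> assume xi: "\<xi> \<in> hv (cj a)"
  obtain v where v: "v \<in> hv a" "\<xi> = sharp a v" using sharp_surj[OF xi] by blast
  have "alg_star C F a (state_map a f) \<xi> = cnj (state_map a f v)"
    using xi v O.ip_ket_right[OF state_map_in[OF f] v(1)] hat_ev_sharp[OF v(1) O.ket_in[OF state_map_in[OF f]]]
    by (simp add: alg_star_evfun evfun_apply)
  thus "state_map (cj a) (alg_star C F a f) \<xi> = alg_star C F a (state_map a f) \<xi>"
    using state_hermitian_bounded(1)[OF f v(1)] xi v by (simp add: state_map_apply)
qed

text \<open>On a square the value at \<open>v\<^sup>\<sharp> \<otimes> v\<close> is \<open>\<phi>(x\<^sup># x)\<close> for the coefficient \<open>x\<close> of \<open>f\<close> and \<open>v\<close>.\<close>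

lemma state_map_positive:
  assumes h: "h \<in> alg_positive C F c"
  shows "state_map (cj c \<boxtimes> c) h \<in> alg_positive C F c"
proof (rule alg_positiveI[OF state_map_in[OF alg_positiveD(1)[OF h]]])
  fix v assume v: "v \<in> hv c"
  note w = lax_in[OF sharp_in[OF v] v]
  obtain ts where ts: "set ts \<subseteq> hv c" "h = (\<Sum>t\<leftarrow>ts. square c (bra (obj F c) t))"
    using alg_positive_sum_squares[OF h] by blast
  let ?sum = "\<lambda>ts. \<Sum>t\<leftarrow>ts. square c (bra (obj F c) t)"
  let ?w = "lax F (cj c) c (sharp c v) v"
  have "?sum ts \<in> dual (obj F (cj c \<boxtimes> c)) \<and> \<phi> (coef (cj c \<boxtimes> c) (?sum ts) ?w) \<in> \<real>\<^sub>\<ge>\<^sub>0"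
    using ts(1)
  proof (induction ts)
    case Nil
    have "coef (cj c \<boxtimes> c) 0 ?w = 0"
      using coef_scale_left[of "cj c \<boxtimes> c" 0 0 ?w] by simp
    moreover have "\<phi> 0 = 0" by (rule clinear_on_zero[OF state_linear subspace_qg_alg])
    moreover have "?sum [] = 0" by (simp only: list.map sum_list.Nil)
    ultimately show ?case using complex_vector.subspace_0[OF O.subspace_dual] by (simp only: nonneg_Reals_zero_I)
  next
    case (Cons t ts)
    have t: "t \<in> hv c" using Cons.prems by simp
    have IH: "?sum ts \<in> dual (obj F (cj c \<boxtimes> c))" "\<phi> (coef (cj c \<boxtimes> c) (?sum ts) ?w) \<in> \<real>\<^sub>\<ge>\<^sub>0"
      using Cons by auto
    have eq: "?sum (t # ts) = square c (bra (obj F c) t) + ?sum ts" by (simp only: list.map sum_list.Cons)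
    note sq = square_in[OF O.bra_in[OF t]]
    have "\<phi> (coef (cj c \<boxtimes> c) (?sum (t # ts)) ?w) =
        \<phi> (coef (cj c \<boxtimes> c) (square c (bra (obj F c) t)) ?w) + \<phi> (coef (cj c \<boxtimes> c) (?sum ts) ?w)"
      unfolding eq coef_add_left by (rule state_add[OF coef_in[OF sq w] coef_in[OF IH(1) w]])
    moreover have "?sum (t # ts) \<in> dual (obj F (cj c \<boxtimes> c))"
      unfolding eq by (rule complex_vector.subspace_add[OF O.subspace_dual sq IH(1)])
    ultimately show ?case
      using nonneg_Reals_add_I[OF state_square_nonneg[OF O.bra_in[OF t] v] IH(2)] by presburger
  qed
  thus "state_map (cj c \<boxtimes> c) h ?w \<in> \<real>\<^sub>\<ge>\<^sub>0"
    using ts(2) w by (simp only: state_map_apply)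
qed

theorem state_map_ucp: "ucp_map C F state_map"
  unfolding ucp_map_def
proof (intro conjI allI ballI)
  show "clinear_on (dual (obj F a)) (dual (obj F a)) (state_map a)" for a
  proof (rule clinear_onI[OF state_map_in])
    fix f g assume "f \<in> dual (obj F a)" "g \<in> dual (obj F a)"
    thus "state_map a (f + g) = state_map a f + state_map a g"
      by (intro ext) (simp add: state_map_def coef_add_left state_add coef_in)
  next
    fix f z assume "f \<in> dual (obj F a)"
    thus "state_map a (z *\<^sub>C f) = z *\<^sub>C state_map a f"
      by (intro ext) (simp add: state_map_def coef_scale_left state_scale coef_in scaleC_fun_apply)
  qed
  show "state_map a (alg_map F a f g) = alg_map F a f (state_map b g)"
    if "f \<in> Hom C a b" "g \<in> dual (obj F b)" for a b f g
    using that by (intro ext) (simp add: state_map_def alg_map_def[of F a f "\<lambda>v. if v \<in> hv b then \<phi> (coef b g v) else 0"] coef_natural mor_in)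
  show "state_map (cj a) (alg_star C F a f) = alg_star C F a (state_map a f)" if "f \<in> dual (obj F a)" for a f
    by (rule state_map_star[OF that])
  show "state_map \<I> vacf = vacf"
  proof (rule O.dual_cong[OF state_map_in[OF vacf_in] vacf_in])
    fix w assume w: "w \<in> hv \<I>"
    have "\<phi> (coef \<I> vacf w) = \<phi> (coef \<I> vacf (vacc w *\<^sub>C vac F))" using unit_expand[OF w] by simp
    also have "\<dots> = vacc w"
      unfolding coef_scale_right[OF vac_in] state_scale[OF coef_in[OF vacf_in vac_in]] state_one by simp
    finally show "state_map \<I> vacf w = vacf w" using w by (simp add: state_map_apply)
  qed
  show "state_map (cj c \<boxtimes> c) h \<in> alg_positive C F c" if "h \<in> alg_positive C F c" for c h
    by (rule state_map_positive[OF that])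
qed

end

section \<open>From ucp maps to states\<close>

context
  fixes \<Psi>
  assumes ucp: "ucp_map C F \<Psi>"
begin

lemma ucp_linear: "clinear_on (dual (obj F a)) (dual (obj F a)) (\<Psi> a)"
  and ucp_natural: "f \<in> Hom C a b \<Longrightarrow> g \<in> dual (obj F b) \<Longrightarrow> \<Psi> a (alg_map F a f g) = alg_map F a f (\<Psi> b g)"
  and ucp_unit: "\<Psi> \<I> vacf = vacf"
  and ucp_positive: "h \<in> alg_positive C F c \<Longrightarrow> \<Psi> (cj c \<boxtimes> c) h \<in> alg_positive C F c"
  using ucp unfolding ucp_map_def by blast+

lemmas ucp_in = clinear_on_in[OF ucp_linear]

lemma ucp_bilinear: "bilinear_map (obj F a) (\<Psi> a)"
  unfolding semibilinear_map_def
  by (auto intro!: clinear_onI simp: O.dual_add[OF ucp_in] O.dual_scale[OF ucp_in]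
      clinear_on_add[OF ucp_linear] clinear_on_scale[OF ucp_linear] scaleC_fun_apply)

text \<open>The linear functional determined by the components of \<open>\<Psi>\<close> at the simple objects.\<close>

definition ucp_state :: "('o \<Rightarrow> 'h \<Rightarrow> 'h) \<Rightarrow> complex" where
  "ucp_state x = (\<Sum>a\<in>{a. x a \<noteq> 0}. bilin_ext (obj F a) (\<Psi> a) (x a))"

lemma ucp_state_expand:
  assumes x: "x \<in> qg_alg F Irr" and A: "finite A" "{a. x a \<noteq> 0} \<subseteq> A" "A \<subseteq> Irr"
  shows "ucp_state x = (\<Sum>a\<in>A. \<Sum>e\<in>basis (obj F a). \<Psi> a (bra (obj F a) e) (x a e))"
proof -
  have b: "bilin_ext (obj F a) (\<Psi> a) (x a) = (\<Sum>e\<in>basis (obj F a). \<Psi> a (bra (obj F a) e) (x a e))" if "a \<in> A" for a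
    using x A that by (intro O.bilin_ext_expand[OF ucp_bilinear]) (auto simp: qg_alg_def)
  have "ucp_state x = (\<Sum>a\<in>{a. x a \<noteq> 0}. \<Sum>e\<in>basis (obj F a). \<Psi> a (bra (obj F a) e) (x a e))"
    unfolding ucp_state_def by (intro sum.cong refl b) (use A in auto)
  also have "\<dots> = (\<Sum>a\<in>A. \<Sum>e\<in>basis (obj F a). \<Psi> a (bra (obj F a) e) (x a e))"
    by (rule sum.mono_neutral_left[OF A(1,2)])
      (auto intro!: sum.neutral simp: O.dual_zero[OF ucp_in[OF O.bra_in[OF O.basis_in]]])
  finally show ?thesis .
qed

lemma ucp_state_linear: "clinear_on (qg_alg F Irr) UNIV ucp_state"
proof (rule clinear_onI)
  fix x y assume x: "x \<in> qg_alg F Irr" and y: "y \<in> qg_alg F Irr"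
  let ?A = "{a. x a \<noteq> 0} \<union> {a. y a \<noteq> 0}"
  have A: "finite ?A" "?A \<subseteq> Irr" using support_alg x y by auto
  have s: "{a. (x + y) a \<noteq> 0} \<subseteq> ?A" "{a. x a \<noteq> 0} \<subseteq> ?A" "{a. y a \<noteq> 0} \<subseteq> ?A" by auto
  note xy = complex_vector.subspace_add[OF subspace_qg_alg x y]
  show "ucp_state (x + y) = ucp_state x + ucp_state y"
    unfolding ucp_state_expand[OF xy A(1) s(1) A(2)] ucp_state_expand[OF x A(1) s(2) A(2)]
      ucp_state_expand[OF y A(1) s(3) A(2)] sum.distrib[symmetric]
  proof (intro sum.cong refl)
    fix a e assume a: "a \<in> ?A" and e: "e \<in> basis (obj F a)"
    hence ai: "a \<in> Irr" using A by auto
    show "\<Psi> a (bra (obj F a) e) ((x + y) a e) = \<Psi> a (bra (obj F a) e) (x a e) + \<Psi> a (bra (obj F a) e) (y a e)"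
      using O.dual_add[OF ucp_in[OF O.bra_in[OF O.basis_in[OF e]]] support_alg(3)[OF x ai] support_alg(3)[OF y ai]] by simp
  qed
next
  fix x z assume x: "x \<in> qg_alg F Irr"
  let ?A = "{a. x a \<noteq> 0}"
  have A: "finite ?A" "?A \<subseteq> Irr" using support_alg x by auto
  have s: "{a. (z *\<^sub>C x) a \<noteq> 0} \<subseteq> ?A" by (auto simp: scaleC_fun_apply[of z x])
  note zx = complex_vector.subspace_scale[OF subspace_qg_alg x]
  show "ucp_state (z *\<^sub>C x) = z *\<^sub>C ucp_state x"
    unfolding ucp_state_expand[OF zx A(1) s A(2)] ucp_state_expand[OF x A(1) subset_refl A(2)] complex_vector.scale_sum_right
  proof (intro sum.cong refl)
    fix a e assume a: "a \<in> ?A" and e: "e \<in> basis (obj F a)"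
    hence ai: "a \<in> Irr" using A by auto
    show "\<Psi> a (bra (obj F a) e) ((z *\<^sub>C x) a e) = z *\<^sub>C \<Psi> a (bra (obj F a) e) (x a e)"
      using O.dual_scale[OF ucp_in[OF O.bra_in[OF O.basis_in[OF e]]] support_alg(3)[OF x ai]] by (simp add: scaleC_fun_apply)
  qed
qed simp

text \<open>Naturality of \<open>\<Psi>\<close> extends the defining relation from simple objects to all objects, by completeness.\<close>

lemma ucp_state_coef:
  assumes f: "f \<in> dual (obj F c)" and v: "v \<in> hv c"
  shows "ucp_state (coef c f v) = \<Psi> c f v"
proof -
  have "ucp_state (coef c f v) = (\<Sum>a\<in>supp c. bilin_ext (obj F a) (\<Psi> a) (coef c f v a))"
    unfolding ucp_state_def
    by (rule sum.mono_neutral_left)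
      (use O.bilin_ext_sum[OF ucp_bilinear, of "{}"] in \<open>auto simp: finite_supp coef_support coef_outside_supp\<close>)
  also have "\<dots> = (\<Sum>a\<in>supp c. \<Sum>\<alpha>\<in>ONB C c a. \<Psi> c f (qdim C a *\<^sub>C mor F (\<alpha>\<^bold>*) (mor F \<alpha> v)))"
  proof (rule sum.cong[OF refl])
    fix a assume "a \<in> supp c"
    hence a: "a \<in> Irr" by (rule supp_Irr)
    have "coef c f v a = (\<Sum>\<alpha>\<in>ONB C c a. qdim C a *\<^sub>C elt (alg_map F a (\<alpha>\<^bold>*) f) (mor F \<alpha> v))"
      using a by (simp add: coef_def)
    hence "bilin_ext (obj F a) (\<Psi> a) (coef c f v a) = (\<Sum>\<alpha>\<in>ONB C c a. qdim C a *\<^sub>C \<Psi> a (alg_map F a (\<alpha>\<^bold>*) f) (mor F \<alpha> v))"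
      using O.bilin_ext_sum[OF ucp_bilinear[of a], of "ONB C c a" "\<lambda>\<alpha>. alg_map F a (\<alpha>\<^bold>*) f" "\<lambda>\<alpha>. mor F \<alpha> v" "\<lambda>_. qdim C a"]
        alg_map_in[OF dag_in[OF ONB_Irr[OF a]] f] mor_in[OF ONB_Irr[OF a] v] by simp
    also have "\<dots> = (\<Sum>\<alpha>\<in>ONB C c a. \<Psi> c f (qdim C a *\<^sub>C mor F (\<alpha>\<^bold>*) (mor F \<alpha> v)))"
    proof (rule sum.cong[OF refl])
      fix \<alpha> assume "\<alpha> \<in> ONB C c a"
      note al = ONB_Irr[OF a this]
      show "qdim C a *\<^sub>C \<Psi> a (alg_map F a (\<alpha>\<^bold>*) f) (mor F \<alpha> v) = \<Psi> c f (qdim C a *\<^sub>C mor F (\<alpha>\<^bold>*) (mor F \<alpha> v))"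
        unfolding ucp_natural[OF dag_in[OF al] f] alg_map_apply[OF mor_in[OF al v]]
          O.dual_scale[OF ucp_in[OF f] mor_in[OF dag_in[OF al] mor_in[OF al v]]] by simp
    qed
    finally show "bilin_ext (obj F a) (\<Psi> a) (coef c f v a) = (\<Sum>\<alpha>\<in>ONB C c a. \<Psi> c f (qdim C a *\<^sub>C mor F (\<alpha>\<^bold>*) (mor F \<alpha> v)))" .
  qed
  also have "\<dots> = \<Psi> c f (\<Sum>a\<in>supp c. \<Sum>\<alpha>\<in>ONB C c a. qdim C a *\<^sub>C mor F (\<alpha>\<^bold>*) (mor F \<alpha> v))"
    by (simp add: O.dual_sum[OF ucp_in[OF f]] O.sum_in O.scale_in mor_in[OF dag_in[OF ONB_Irr[OF supp_Irr]]] mor_in[OF ONB_Irr[OF supp_Irr]] v)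
  also have "\<dots> = \<Psi> c f v" unfolding completeness[OF v] ..
  finally show ?thesis .
qed

text \<open>Every element of the algebra is a single coefficient \<open>x\<close>, and then the value at \<open>x\<^sup># x\<close> is that of
  \<open>\<Psi>(f\<^sup>* f)\<close> at \<open>v\<^sup>\<sharp> \<otimes> v\<close>.\<close>

theorem ucp_state_state: "qg_state C F Irr ucp_state"
  unfolding qg_state_def
proof (intro conjI ballI ucp_state_linear)
  show "ucp_state (qg_one C F Irr) = 1"
    unfolding qg_one_coef ucp_state_coef[OF vacf_in vac_in] ucp_unit by simp
  fix x assume "x \<in> qg_alg F Irr"
  then obtain c f v where f: "f \<in> dual (obj F c)" and v: "v \<in> hv c" and x: "x = coef c f v"
    using qg_alg_coef by blast
  have "ucp_state (qg_mult C F Irr (qg_star C F Irr x) x) = \<Psi> (cj c \<boxtimes> c) (square c f) (lax F (cj c) c (sharp c v) v)"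
    unfolding x star_coef[OF f v] mult_coef[OF alg_star_in[OF f] sharp_in[OF v] f v]
    by (rule ucp_state_coef[OF square_in[OF f] lax_in[OF sharp_in[OF v] v]])
  thus "ucp_state (qg_mult C F Irr (qg_star C F Irr x) x) \<in> \<real>\<^sub>\<ge>\<^sub>0"
    using alg_positiveD(2)[OF ucp_positive[OF square_positive[OF f]] v] by simp
qed

end

section \<open>The correspondence of multipliers\<close>

definition transpose_multiplier :: "('o \<Rightarrow> 'h \<Rightarrow> 'h) \<Rightarrow> 'o \<Rightarrow> ('h \<Rightarrow> complex) \<Rightarrow> 'h \<Rightarrow> complex" where
  "transpose_multiplier m = (\<lambda>a f. if a \<in> Irr \<and> f \<in> dual (obj F a) then (\<lambda>v. if v \<in> hv a then f (m a v) else 0) else 0)"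

lemma transpose_state_multiplier:
  assumes "qg_state C F Irr \<phi>"
  shows "transpose_multiplier (state_multiplier F Irr \<phi>) = (\<lambda>a f. if a \<in> Irr \<and> f \<in> dual (obj F a) then state_map \<phi> a f else 0)"
  by (auto simp: transpose_multiplier_def fun_eq_iff state_map_def[OF assms] state_multiplier_spec[OF assms])

text \<open>The two constructions are mutually inverse on matrix coefficients.\<close>

lemma transpose_bij: "bij_betw transpose_multiplier (qg_ucp_multipliers C F Irr) (alg_ucp_multipliers C F Irr)"
  unfolding bij_betw_def
proof
  show "inj_on transpose_multiplier (qg_ucp_multipliers C F Irr)"
  proof (rule inj_onI)
    fix m m' assume "m \<in> qg_ucp_multipliers C F Irr" "m' \<in> qg_ucp_multipliers C F Irr"
      and eq: "transpose_multiplier m = transpose_multiplier m'"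
    then obtain \<phi> \<phi>' where m: "m = state_multiplier F Irr \<phi>" "qg_state C F Irr \<phi>"
      and m': "m' = state_multiplier F Irr \<phi>'" "qg_state C F Irr \<phi>'" by (auto simp: qg_ucp_multipliers_def)
    show "m = m'"
    proof (intro ext)
      fix a v
      show "m a v = m' a v"
      proof (cases "a \<in> Irr \<and> v \<in> hv a")
        case True
        show ?thesis
        proof (rule O.eq_if_dual_eq[of _ a])
          show "m a v \<in> hv a" "m' a v \<in> hv a"
            using state_multiplier_spec(1) m m' True by auto
          fix f assume "f \<in> dual (obj F a)"
          thus "f (m a v) = f (m' a v)"
            using fun_cong[OF fun_cong[OF fun_cong[OF eq, of a], of f], of v] True by (simp add: transpose_multiplier_def)
        qed
      next
        case False
        thus ?thesis using m(1) m'(1) by (auto simp: state_multiplier_def)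
      qed
    qed
  qed
  show "transpose_multiplier ` qg_ucp_multipliers C F Irr = alg_ucp_multipliers C F Irr"
  proof (intro equalityI subsetI)
    fix n assume "n \<in> transpose_multiplier ` qg_ucp_multipliers C F Irr"
    then obtain \<phi> where n: "n = transpose_multiplier (state_multiplier F Irr \<phi>)" and st: "qg_state C F Irr \<phi>"
      by (auto simp: qg_ucp_multipliers_def)
    show "n \<in> alg_ucp_multipliers C F Irr"
      unfolding alg_ucp_multipliers_def n transpose_state_multiplier[OF st] using state_map_ucp[OF st] by blast
  next
    fix n assume "n \<in> alg_ucp_multipliers C F Irr"
    then obtain \<Psi> where n: "n = (\<lambda>a f. if a \<in> Irr \<and> f \<in> dual (obj F a) then \<Psi> a f else 0)" and ucp: "ucp_map C F \<Psi>"
      by (auto simp: alg_ucp_multipliers_def)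
    note st = ucp_state_state[OF ucp]
    have "state_map (ucp_state \<Psi>) a f = \<Psi> a f" if f: "f \<in> dual (obj F a)" for a f
      by (rule O.dual_cong[OF state_map_in[OF st f] ucp_in[OF ucp f]])
        (simp add: state_map_apply[OF st] ucp_state_coef[OF ucp f])
    hence "n = transpose_multiplier (state_multiplier F Irr (ucp_state \<Psi>))"
      unfolding transpose_state_multiplier[OF st] n by (auto simp: fun_eq_iff)
    thus "n \<in> transpose_multiplier ` qg_ucp_multipliers C F Irr"
      using st by (auto simp: qg_ucp_multipliers_def)
  qed
qed

section \<open>The Hilbert spaces of the algebra object\<close>

text \<open>\<open>flat a\<close> identifies the space at \<open>a\<close> of the algebra object with the Hilbert space of the
  conjugate of \<open>a\<close>; it is the representing vector of the functional \<open>f\<^sup>*\<close>.\<close>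

definition flat :: "'o \<Rightarrow> ('h \<Rightarrow> complex) \<Rightarrow> 'h" where
  "flat a f = ket (obj F (cj a)) (alg_star C F a f)"

lemma flat_in: "f \<in> dual (obj F a) \<Longrightarrow> flat a f \<in> hv (cj a)"
  unfolding flat_def by (rule O.ket_in[OF alg_star_in])

lemma bra_flat: "f \<in> dual (obj F a) \<Longrightarrow> bra (obj F (cj a)) (flat a f) = alg_star C F a f"
  unfolding flat_def by (rule O.bra_ket[OF alg_star_in])

lemma ip_flat: "f \<in> dual (obj F a) \<Longrightarrow> \<xi> \<in> hv (cj a) \<Longrightarrow> ip (obj F (cj a)) (flat a f) \<xi> = hat_ev C F a \<xi> (ket (obj F a) f)"
  using O.ip_ket[OF alg_star_in] by (simp add: flat_def alg_star_evfun evfun_apply)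

lemma flat_surj: "\<xi> \<in> hv (cj a) \<Longrightarrow> \<exists>f\<in>dual (obj F a). flat a f = \<xi>"
proof -
  assume xi: "\<xi> \<in> hv (cj a)"
  obtain w where w: "w \<in> hv a" "bra (obj F (cj a)) \<xi> = evfun a w"
    using evfun_surj[OF O.bra_in[OF xi]] by blast
  have "flat a (bra (obj F a) w) = \<xi>"
    using w xi by (simp add: flat_def alg_star_evfun flip: w(2))
  thus ?thesis using O.bra_in[OF w(1)] by blast
qed

lemma L2_simps: "vecs (L2 C F a) = dual (obj F a)"
  "ip (L2 C F a) f g = alg_map F \<I> ((ev C a)\<^bold>*) (tens_fun C F (cj a) a (alg_star C F a f) g) (vac F)"
  by (simp_all add: L2_def)

text \<open>The inner product evaluates the product of \<open>f\<^sup>*\<close> and \<open>g\<close> on the vector of the adjoint evaluation, and this contracts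
  \<open>g\<close> to its image in the conjugate.\<close>

lemma ip_L2:
  assumes f: "f \<in> dual (obj F a)" and g: "g \<in> dual (obj F a)"
  shows "ip (L2 C F a) f g = ip (obj F (cj a)) (flat a f) (flat a g)"
proof -
  let ?x = "flat a f" and ?y = "ket (obj F a) g"
  note x = flat_in[OF f] and y = O.ket_in[OF g]
  have "tens_fun C F (cj a) a (alg_star C F a f) g = bra (obj F (cj a \<boxtimes> a)) (lax F (cj a) a ?x ?y)"
  proof (rule tensor_dual_eqI[OF tens_fun_spec(1)[OF alg_star_in[OF f] g] O.bra_in[OF lax_in[OF x y]]])
    fix \<xi> v assume xi: "\<xi> \<in> hv (cj a)" and v: "v \<in> hv a"
    have "alg_star C F a f \<xi> = ip (obj F (cj a)) ?x \<xi>" using bra_flat[OF f] O.bra_apply[OF xi] by metis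
    thus "tens_fun C F (cj a) a (alg_star C F a f) g (lax F (cj a) a \<xi> v) =
        bra (obj F (cj a \<boxtimes> a)) (lax F (cj a) a ?x ?y) (lax F (cj a) a \<xi> v)"
      unfolding tens_fun_spec(2)[OF alg_star_in[OF f] g xi v] O.bra_apply[OF lax_in[OF xi v]] lax_ip[OF x xi y v]
        O.ip_ket[OF g v] by (rule arg_cong)
  qed
  hence "ip (L2 C F a) f g = ip (obj F (cj a \<boxtimes> a)) (lax F (cj a) a ?x ?y) (evvec a)"
    by (simp add: L2_simps alg_map_apply O.bra_apply[OF evvec_in] flip: evvec_def)
  also have "\<dots> = cnj (hat_ev C F a ?x ?y)"
    using O.ip_cnj[OF evvec_in lax_in[OF x y]] ip_evvec[OF x y] by simp
  also have "\<dots> = ip (obj F (cj a)) ?x (flat a g)"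
    using ip_flat[OF g x] O.ip_cnj[OF flat_in[OF g] x] by simp
  finally show ?thesis .
qed

lemma flat_add: "f \<in> dual (obj F a) \<Longrightarrow> g \<in> dual (obj F a) \<Longrightarrow> flat a (f + g) = flat a f + flat a g"
  unfolding flat_def alg_star_evfun
  by (simp only: O.ket_add O.ket_in evfun_add evfun_in)

lemma flat_scale: "f \<in> dual (obj F a) \<Longrightarrow> flat a (z *\<^sub>C f) = z *\<^sub>C flat a f"
  unfolding flat_def alg_star_evfun
  by (simp only: O.ket_scale O.ket_in evfun_scale evfun_in complex_cnj_cnj)

lemma flat_eq_0: 
  assumes f: "f \<in> dual (obj F a)" and 0: "flat a f = 0"
  shows "f = 0"
proof -
  have "ket (obj F a) f = 0"
  proof (rule hat_ev_nondegenerate_right[OF O.ket_in[OF f] O.zero_in])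
    fix \<xi> assume xi: "\<xi> \<in> hv (cj a)"
    show "hat_ev C F a \<xi> (ket (obj F a) f) = hat_ev C F a \<xi> 0"
      using ip_flat[OF f xi] 0 O.ip_zero_left[OF xi] hat_ev_scale_right[OF xi O.zero_in, of 0] by simp
  qed
  hence "f = bra (obj F a) 0" using O.bra_ket[OF f] by simp
  also have "\<dots> = 0" by (auto simp: bra_def fun_eq_iff)
  finally show ?thesis .
qed

lemma L2_hilbert: "fd_hilbert_space (L2 C F a)"
proof
  show "fd_hilbert (L2 C F a)"
    unfolding fd_hilbert_def L2_simps(1)
  proof (intro conjI ballI)
    have "dual (obj F a) = complex_vector.span (bra (obj F a) ` basis (obj F a))"
    proof (intro equalityI subsetI)
      fix f assume "f \<in> dual (obj F a)"
      hence f: "f = (\<Sum>e\<in>basis (obj F a). f e *\<^sub>C bra (obj F a) e)" by (rule O.dual_basis_expand)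
      show "f \<in> complex_vector.span (bra (obj F a) ` basis (obj F a))"
        by (subst f) (intro complex_vector.span_sum complex_vector.span_scale complex_vector.span_base imageI)
    next
      fix f assume f: "f \<in> complex_vector.span (bra (obj F a) ` basis (obj F a))"
      have "complex_vector.span (bra (obj F a) ` basis (obj F a)) \<subseteq> dual (obj F a)"
        by (rule complex_vector.span_minimal[OF _ O.subspace_dual]) (auto intro: O.bra_in O.basis_in)
      thus "f \<in> dual (obj F a)" using f by blast
    qed
    thus "\<exists>B. finite B \<and> dual (obj F a) = complex_vector.span B" using O.finite_basis by blast
  next
    fix f assume f: "f \<in> dual (obj F a)"
    show "clinear_on (dual (obj F a)) UNIV (ip (L2 C F a) f)"
    proof (rule clinear_onI)
      fix g h assume g: "g \<in> dual (obj F a)" and h: "h \<in> dual (obj F a)"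
      show "ip (L2 C F a) f (g + h) = ip (L2 C F a) f g + ip (L2 C F a) f h"
        unfolding ip_L2[OF f g] ip_L2[OF f h] ip_L2[OF f complex_vector.subspace_add[OF O.subspace_dual g h]] flat_add[OF g h]
        by (rule O.ip_add_right[OF flat_in[OF f] flat_in[OF g] flat_in[OF h]])
    next
      fix g z assume g: "g \<in> dual (obj F a)"
      show "ip (L2 C F a) f (z *\<^sub>C g) = z *\<^sub>C ip (L2 C F a) f g"
        unfolding ip_L2[OF f g] ip_L2[OF f complex_vector.subspace_scale[OF O.subspace_dual g]] flat_scale[OF g] scaleC_complex
        by (rule O.ip_scale_right[OF flat_in[OF f] flat_in[OF g]])
    qed simp
    show "ip (L2 C F a) g f = cnj (ip (L2 C F a) f g)" if g: "g \<in> dual (obj F a)" for g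
      unfolding ip_L2[OF f g] ip_L2[OF g f] by (rule O.ip_cnj[OF flat_in[OF f] flat_in[OF g]])
    show "ip (L2 C F a) f f \<in> \<real>\<^sub>\<ge>\<^sub>0"
      unfolding ip_L2[OF f f] by (rule O.ip_self_nonneg[OF flat_in[OF f]])
    show "ip (L2 C F a) f f = 0 \<longrightarrow> f = 0"
      unfolding ip_L2[OF f f] using O.ip_self_eq_0[OF flat_in[OF f]] flat_eq_0[OF f] by blast
  qed
qed

section \<open>Conjugation as a permutation of the simple objects\<close>

lemma isomorphic_sym: "isomorphic C a b \<Longrightarrow> isomorphic C b a"
  unfolding isomorphic_def by blast

lemma isomorphic_trans:
  assumes "isomorphic C a b" "isomorphic C b c"
  shows "isomorphic C a c"
proof -
  obtain f g where f: "f \<in> Hom C a b" "g \<in> Hom C b a" "g \<cdot> f = \<one> a" "f \<cdot> g = \<one> b"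
    using assms(1) unfolding isomorphic_def by blast
  obtain h k where h: "h \<in> Hom C b c" "k \<in> Hom C c b" "k \<cdot> h = \<one> b" "h \<cdot> k = \<one> c"
    using assms(2) unfolding isomorphic_def by blast
  have "(g \<cdot> k) \<cdot> (h \<cdot> f) = g \<cdot> ((k \<cdot> h) \<cdot> f)"
    using comp_assoc[OF f(2) h(2) comp_in[OF h(1) f(1)]] comp_assoc[OF h(2,1) f(1)] by simp
  hence 1: "(g \<cdot> k) \<cdot> (h \<cdot> f) = \<one> a" using h f ident_left[OF f(1)] by simp
  have "(h \<cdot> f) \<cdot> (g \<cdot> k) = h \<cdot> ((f \<cdot> g) \<cdot> k)"
    using comp_assoc[OF h(1) f(1) comp_in[OF f(2) h(2)]] comp_assoc[OF f(1,2) h(2)] by simp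
  hence 2: "(h \<cdot> f) \<cdot> (g \<cdot> k) = \<one> c" using h f ident_left[OF h(2)] by simp
  show ?thesis
    unfolding isomorphic_def using 1 2 comp_in[OF h(1) f(1)] comp_in[OF f(2) h(2)] by blast
qed

lemma nonzero_isomorphic: "simple C a \<Longrightarrow> simple C b \<Longrightarrow> f \<in> Hom C a b \<Longrightarrow> f \<noteq> 0 \<Longrightarrow> isomorphic C a b"
  using schur unitary_isomorphic by blast

lemma isomorphic_nonzero:
  assumes "isomorphic C a b" "\<one> a \<noteq> 0"
  shows "\<exists>f\<in>Hom C a b. f \<noteq> 0"
  using assms comp_zero_right unfolding isomorphic_def by metis

text \<open>Nonzero morphisms between simple objects are isomorphisms, and mates of nonzero morphisms are nonzero.\<close>

lemma conj_isomorphic_iff: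
  assumes a: "simple C a" and b: "simple C b"
  shows "isomorphic C (cj a) (cj b) \<longleftrightarrow> isomorphic C b a"
proof
  assume "isomorphic C (cj a) (cj b)"
  then obtain \<beta> where \<beta>: "\<beta> \<in> Hom C (cj a) (cj b)" "\<beta> \<noteq> 0"
    using isomorphic_nonzero simple_ident[OF conj_simple[OF a]] by blast
  obtain \<alpha> where \<alpha>: "\<alpha> \<in> Hom C b a"
    "\<And>\<xi> w. \<xi> \<in> hv (cj a) \<Longrightarrow> w \<in> hv b \<Longrightarrow> hat_ev C F a \<xi> (mor F \<alpha> w) = hat_ev C F b (mor F \<beta> \<xi>) w"
    using unmate_exists[OF \<beta>(1)] by blast
  have "\<alpha> \<noteq> 0"
  proof
    assume 0: "\<alpha> = 0"
    have "\<beta> = 0"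
    proof (rule faithful[OF \<beta>(1)])
      fix \<xi> assume xi: "\<xi> \<in> hv (cj a)"
      show "mor F \<beta> \<xi> = 0"
      proof (rule hat_ev_nondegenerate_left[OF mor_in[OF \<beta>(1) xi] O.zero_in])
        fix w assume w: "w \<in> hv b"
        show "hat_ev C F b (mor F \<beta> \<xi>) w = hat_ev C F b 0 w"
          using \<alpha>(2)[OF xi w] 0 mor_zero[OF w] hat_ev_scale_right[OF xi O.zero_in, of 0] hat_ev_scale_left[OF w O.zero_in, of 0] by simp
      qed
    qed
    thus False using \<beta>(2) by simp
  qed
  thus "isomorphic C b a" by (rule nonzero_isomorphic[OF b a \<alpha>(1)])
next
  assume "isomorphic C b a"
  then obtain \<alpha> where \<alpha>: "\<alpha> \<in> Hom C b a" "\<alpha> \<noteq> 0"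
    using isomorphic_nonzero simple_ident[OF b] by blast
  obtain \<beta> where \<beta>: "\<beta> \<in> Hom C (cj a) (cj b)"
    "\<And>\<xi> w. \<xi> \<in> hv (cj a) \<Longrightarrow> w \<in> hv b \<Longrightarrow> hat_ev C F b (mor F \<beta> \<xi>) w = hat_ev C F a \<xi> (mor F \<alpha> w)"
    using mate_exists[OF \<alpha>(1)] by blast
  have "\<beta> \<noteq> 0"
  proof
    assume 0: "\<beta> = 0"
    have "\<alpha> = 0"
    proof (rule faithful[OF \<alpha>(1)])
      fix w assume w: "w \<in> hv b"
      show "mor F \<alpha> w = 0"
      proof (rule hat_ev_nondegenerate_right[OF mor_in[OF \<alpha>(1) w] O.zero_in])
        fix \<xi> assume xi: "\<xi> \<in> hv (cj a)"
        show "hat_ev C F a \<xi> (mor F \<alpha> w) = hat_ev C F a \<xi> 0"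
          using \<beta>(2)[OF xi w] 0 mor_zero[OF xi] hat_ev_scale_right[OF xi O.zero_in, of 0] hat_ev_scale_left[OF w O.zero_in, of 0] by simp
      qed
    qed
    thus False using \<alpha>(2) by simp
  qed
  thus "isomorphic C (cj a) (cj b)" by (rule nonzero_isomorphic[OF conj_simple[OF a] conj_simple[OF b] \<beta>(1)])
qed

text \<open>The adjoint of the coevaluation pairs \<open>r\<close> with its conjugate; bending this pairing gives a nonzero morphism
  into the double conjugate.\<close>

lemma double_conj_isomorphic:
  assumes r: "simple C r"
  shows "isomorphic C r (cj (cj r))"
proof -
  obtain \<rho> where \<rho>: "\<rho> \<in> Hom C r (cj (cj r))"
    "\<And>x \<xi>. x \<in> hv r \<Longrightarrow> \<xi> \<in> hv (cj r) \<Longrightarrow> hat_ev C F (cj r) (mor F \<rho> x) \<xi> = vacc (mor F ((coev C r)\<^bold>*) (lax F r (cj r) x \<xi>))"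
    using curry_conj[OF dag_in[OF coev_in]] by blast
  have "\<rho> \<noteq> 0"
  proof
    assume 0: "\<rho> = 0"
    obtain v where v: "v \<in> hv r" "ip (obj F r) v v = 1" using unit_vector[OF simple_ident[OF r]] by blast
    let ?s = "sharp r v"
    note s = sharp_in[OF v(1)]
    note vs = lax_in[OF v(1) s]
    have "ip (obj F (r \<boxtimes> cj r)) (copairing r) (lax F r (cj r) v ?s) = vacc (mor F ((coev C r)\<^bold>*) (lax F r (cj r) v ?s))"
      unfolding copairing_def by (rule mor_adj[OF coev_in vac_in vs])
    also have "\<dots> = 0"
      using \<rho>(2)[OF v(1) s] 0 mor_zero[OF v(1)] hat_ev_scale_left[OF s O.zero_in, of 0] by simp
    finally have "ip (obj F (cj r)) ?s ?s = 0"
      using ip_copairing[OF v(1) s] O.ip_cnj[OF copairing_in vs] by simp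
    hence "?s = 0" by (rule O.ip_self_eq_0[OF s])
    thus False using hat_ev_sharp[OF v(1,1)] v hat_ev_scale_left[OF v(1) O.zero_in, of 0] by simp
  qed
  thus ?thesis by (rule nonzero_isomorphic[OF r conj_simple[OF conj_simple[OF r]] \<rho>(1)])
qed

text \<open>The member of \<open>Irr\<close> isomorphic to the conjugate of \<open>a\<close>, which need not lie in \<open>Irr\<close> itself.\<close>

definition conj_rep :: "'o \<Rightarrow> 'o" where
  "conj_rep a = (SOME r. r \<in> Irr \<and> (\<exists>u. unitary_mor C (cj a) r u))"

lemma conj_rep:
  assumes "a \<in> Irr"
  shows "conj_rep a \<in> Irr" "\<exists>u. unitary_mor C (cj a) (conj_rep a) u"
proof -
  have "conj_rep a \<in> Irr \<and> (\<exists>u. unitary_mor C (cj a) (conj_rep a) u)"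
    unfolding conj_rep_def by (rule someI_ex) (use Irr_representative[OF conj_simple[OF Irr_simple[OF assms]]] in blast)
  thus "conj_rep a \<in> Irr" "\<exists>u. unitary_mor C (cj a) (conj_rep a) u" by auto
qed

lemma conj_rep_bij: "bij_betw conj_rep Irr Irr"
  unfolding bij_betw_def
proof
  have iso: "isomorphic C (cj a) (conj_rep a)" if "a \<in> Irr" for a
    using conj_rep(2)[OF that] unitary_isomorphic by blast
  show "inj_on conj_rep Irr"
  proof (rule inj_onI)
    fix a b assume a: "a \<in> Irr" and b: "b \<in> Irr" and eq: "conj_rep a = conj_rep b"
    have "isomorphic C (cj a) (cj b)"
      using isomorphic_trans[OF iso[OF a]] isomorphic_sym[OF iso[OF b]] eq by simp
    hence "isomorphic C b a" using conj_isomorphic_iff[OF Irr_simple[OF a] Irr_simple[OF b]] by simp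
    thus "a = b" using Irr_unique[OF Irr_simple[OF b] a b] isomorphic_refl by blast
  qed
  show "conj_rep ` Irr = Irr"
  proof (intro equalityI subsetI)
    fix r assume r: "r \<in> Irr"
    note rs = Irr_simple[OF r]
    define a where "a = conj_rep r"
    have a: "a \<in> Irr" unfolding a_def by (rule conj_rep(1)[OF r])
    have "isomorphic C (cj a) (cj (cj r))"
      using conj_isomorphic_iff[OF Irr_simple[OF a] conj_simple[OF rs]] iso[OF r] by (simp add: a_def)
    hence "isomorphic C (cj a) r" using isomorphic_trans isomorphic_sym[OF double_conj_isomorphic[OF rs]] by blast
    hence "conj_rep a = r"
      using Irr_unique[OF conj_simple[OF Irr_simple[OF a]] conj_rep(1)[OF a] r iso[OF a]] by blast
    thus "r \<in> conj_rep ` Irr" using a by blast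
  qed (use conj_rep(1) in blast)
qed

section \<open>Comparison of norms\<close>

text \<open>Since the ucp map of a state commutes with the involution, its block at \<open>a\<close> is the transpose of the
  block of the multiplier at the conjugate of \<open>a\<close>, up to the unitary \<open>flat\<close>.\<close>

lemma transpose_form:
  assumes st: "qg_state C F Irr \<phi>" and a: "a \<in> Irr" and u: "unitary_mor C (cj a) r u" and r: "r \<in> Irr"
    and f: "f \<in> dual (obj F a)" and g: "g \<in> dual (obj F a)"
  shows "ip (L2 C F a) f (transpose_multiplier (state_multiplier F Irr \<phi>) a g) =
    cnj (ip (obj F r) (mor F u (flat a g)) (state_multiplier F Irr \<phi> r (mor F u (flat a f))))"
proof -
  note u' = mor_unitary[OF u]
  let ?\<Psi>g = "state_map \<phi> a g" and ?x = "mor F u (flat a f)" and ?y = "mor F u (flat a g)"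
  note ff = flat_in[OF f] and fg = flat_in[OF g]
  note x = mor_in[OF u'(1) ff] and y = mor_in[OF u'(1) fg]
  note \<Psi>g = state_map_in[OF st g]
  note sg = alg_star_in[OF g]
  have "transpose_multiplier (state_multiplier F Irr \<phi>) a g = ?\<Psi>g"
    using a g by (simp add: transpose_state_multiplier[OF st])
  hence "ip (L2 C F a) f (transpose_multiplier (state_multiplier F Irr \<phi>) a g) = ip (obj F (cj a)) (flat a f) (flat a ?\<Psi>g)"
    using ip_L2[OF f \<Psi>g] by simp
  also have "\<dots> = cnj (alg_star C F a ?\<Psi>g (flat a f))"
    using O.ip_cnj[OF flat_in[OF \<Psi>g] ff] bra_flat[OF \<Psi>g] O.bra_apply[OF ff, of "flat a ?\<Psi>g"] by simp
  also have "alg_star C F a ?\<Psi>g (flat a f) = \<phi> (coef (cj a) (alg_star C F a g) (flat a f))"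
    using state_map_star[OF st g] state_map_apply[OF st ff] by metis
  also have "alg_star C F a g = alg_map F (cj a) u (alg_map F r (u\<^bold>*) (alg_star C F a g))"
    by (rule O.dual_cong[OF sg alg_map_in[OF u'(1) alg_map_in[OF dag_in[OF u'(1)] sg]]])
      (simp add: alg_map_apply mor_in[OF u'(1)] u'(2))
  also have "coef (cj a) \<dots> (flat a f) = coef r (alg_map F r (u\<^bold>*) (alg_star C F a g)) ?x"
    by (rule coef_natural[OF u'(1) alg_map_in[OF dag_in[OF u'(1)] sg] ff])
  also have "alg_map F r (u\<^bold>*) (alg_star C F a g) = bra (obj F r) ?y"
    using bra_mor[OF u'(1) fg] bra_flat[OF g] by simp
  also have "\<phi> (coef r (bra (obj F r) ?y) ?x) = ip (obj F r) ?y (state_multiplier F Irr \<phi> r ?x)"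
    using state_multiplier_spec[OF st r x] O.bra_in[OF y] by (metis O.bra_apply)
  finally show ?thesis .
qed

text \<open>The maps \<open>flat\<close> and a unitary onto the representative of the conjugate compose to a unitary, through which both
  blocks have transposed, conjugated matrices; subtracting the identity is compatible with this.\<close>

lemma transpose_bounds:
  assumes m: "m \<in> qg_ucp_multipliers C F Irr" and a: "a \<in> Irr" and k: "k \<ge> 0"
  shows "op_bound (L2 C F a) (transpose_multiplier m a) k \<longleftrightarrow> op_bound (obj F (conj_rep a)) (m (conj_rep a)) k"
    and "op_bound (L2 C F a) (dev (transpose_multiplier m a)) k \<longleftrightarrow> op_bound (obj F (conj_rep a)) (dev (m (conj_rep a))) k"
proof -
  obtain \<phi> where st: "qg_state C F Irr \<phi>" and m\<phi>: "m = state_multiplier F Irr \<phi>"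
    using m by (auto simp: qg_ucp_multipliers_def)
  define r where "r = conj_rep a"
  have r: "r \<in> Irr" unfolding r_def by (rule conj_rep(1)[OF a])
  obtain u where u: "unitary_mor C (cj a) r u" unfolding r_def using conj_rep(2)[OF a] by blast
  note u' = mor_unitary[OF u]
  interpret L: fd_hilbert_space "L2 C F a" by (rule L2_hilbert)
  define U where "U = (\<lambda>f. mor F u (flat a f))"
  have U_in: "U f \<in> hv r" if "f \<in> dual (obj F a)" for f
    unfolding U_def by (rule mor_in[OF u'(1) flat_in[OF that]])
  have U_image: "U ` vecs (L2 C F a) = hv r"
  proof (intro equalityI subsetI)
    fix y assume y: "y \<in> hv r"
    obtain f where f: "f \<in> dual (obj F a)" "flat a f = mor F (u\<^bold>*) y"
      using flat_surj[OF mor_in[OF dag_in[OF u'(1)] y]] by blast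
    have "U f = y" unfolding U_def f(2) by (rule u'(3)[OF y])
    thus "y \<in> U ` vecs (L2 C F a)" using f(1) L2_simps(1) by blast
  qed (use U_in L2_simps(1) in auto)
  have U_ip: "ip (L2 C F a) f g = ip (obj F r) (U f) (U g)" if f: "f \<in> vecs (L2 C F a)" and g: "g \<in> vecs (L2 C F a)" for f g
  proof -
    have f': "f \<in> dual (obj F a)" and g': "g \<in> dual (obj F a)" using f g by (auto simp: L2_simps)
    show ?thesis
      unfolding U_def ip_L2[OF f' g'] mor_adj[OF u'(1) flat_in[OF f'] mor_in[OF u'(1) flat_in[OF g']]] u'(2)[OF flat_in[OF g']] ..
  qed
  have mr: "m r x \<in> hv r" if "x \<in> hv r" for x
    unfolding m\<phi> by (rule state_multiplier_spec(1)[OF st r that])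
  have tm: "transpose_multiplier m a f \<in> vecs (L2 C F a)" if "f \<in> vecs (L2 C F a)" for f
    unfolding m\<phi> transpose_state_multiplier[OF st] using that a state_map_in[OF st] by (simp add: L2_simps)
  have form: "ip (L2 C F a) f (transpose_multiplier m a g) = cnj (ip (obj F r) (U g) (m r (U f)))"
    if "f \<in> vecs (L2 C F a)" "g \<in> vecs (L2 C F a)" for f g
    unfolding m\<phi> U_def using transpose_form[OF st a u r] that by (simp add: L2_simps)
  have form': "ip (L2 C F a) f (dev (transpose_multiplier m a) g) = cnj (ip (obj F r) (U g) (dev (m r) (U f)))"
    if f: "f \<in> vecs (L2 C F a)" and g: "g \<in> vecs (L2 C F a)" for f g
  proof -
    have Uf: "U f \<in> hv r" and Ug: "U g \<in> hv r" using U_in f g by (auto simp: L2_simps)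
    have "ip (L2 C F a) f (dev (transpose_multiplier m a) g) = ip (L2 C F a) f (transpose_multiplier m a g) - ip (L2 C F a) f g"
      by (rule L.ip_diff_right[OF f tm[OF g] g])
    also have "\<dots> = cnj (ip (obj F r) (U g) (m r (U f)) - ip (obj F r) (U g) (U f))"
      unfolding form[OF f g] U_ip[OF f g] using O.ip_cnj[OF Ug Uf] by simp
    also have "ip (obj F r) (U g) (m r (U f)) - ip (obj F r) (U g) (U f) = ip (obj F r) (U g) (dev (m r) (U f))"
      by (rule O.ip_diff_right[symmetric, OF Ug mr[OF Uf] Uf])
    finally show ?thesis .
  qed
  show "op_bound (L2 C F a) (transpose_multiplier m a) k \<longleftrightarrow> op_bound (obj F (conj_rep a)) (m (conj_rep a)) k"
    unfolding r_def[symmetric]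
    by (rule op_bound_transpose[OF O.fd_hilbert_space_axioms L2_hilbert k mr tm U_image U_ip form])
  show "op_bound (L2 C F a) (dev (transpose_multiplier m a)) k \<longleftrightarrow> op_bound (obj F (conj_rep a)) (dev (m (conj_rep a))) k"
    unfolding r_def[symmetric]
    by (rule op_bound_transpose[OF O.fd_hilbert_space_axioms L2_hilbert k O.diff_in[OF mr] L.diff_in[OF tm] U_image U_ip form'])
qed

lemma approximation_properties_iff:
  "qg_amenable C F Irr \<longleftrightarrow> alg_amenable C F Irr"
  "qg_haagerup C F Irr \<longleftrightarrow> alg_haagerup C F Irr"
  "qg_property_T C F Irr \<longleftrightarrow> alg_property_T C F Irr"
proof -
  have fam: "hilbert_family (obj F)" "hilbert_family (L2 C F)"
    by (rule hilbert_family.intro[OF O.fd_hilbert_space_axioms], rule hilbert_family.intro[OF L2_hilbert])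
  have S: "hilbert_family.contractive Irr (obj F) m" if m: "m \<in> qg_ucp_multipliers C F Irr" for m
    using m state_multiplier_linear state_multiplier_contraction
    by (auto simp: hilbert_family.contractive_def[OF fam(1)] qg_ucp_multipliers_def)
  have S': "clinear_on (vecs (L2 C F a)) (vecs (L2 C F a)) (m a)" if mem: "m \<in> alg_ucp_multipliers C F Irr" and a: "a \<in> Irr" for m a
  proof -
    obtain \<Psi> where m: "m = (\<lambda>a f. if a \<in> Irr \<and> f \<in> dual (obj F a) then \<Psi> a f else 0)" and ucp: "ucp_map C F \<Psi>"
      using mem by (auto simp: alg_ucp_multipliers_def)
    note lin = ucp_linear[OF ucp, of a]
    show ?thesis
      unfolding L2_simps m using a clinear_on_in[OF lin] clinear_on_add[OF lin] clinear_on_scale[OF lin]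
        complex_vector.subspace_add[OF O.subspace_dual, of _ a] complex_vector.subspace_scale[OF O.subspace_dual, of _ a]
      by (intro clinear_onI) simp_all
  qed
  note tr = multiplier_transfer[where I = Irr and V = "obj F" and V' = "L2 C F" and S = "qg_ucp_multipliers C F Irr"
      and S' = "alg_ucp_multipliers C F Irr" and T = transpose_multiplier and \<sigma> = conj_rep,
      OF fam _ _ transpose_bij conj_rep_bij]
  show "qg_amenable C F Irr \<longleftrightarrow> alg_amenable C F Irr"
    unfolding qg_amenable_def alg_amenable_def by (rule tr(1); rule S S' transpose_bounds; assumption)
  show "qg_haagerup C F Irr \<longleftrightarrow> alg_haagerup C F Irr"
    unfolding qg_haagerup_def alg_haagerup_def by (rule tr(2); rule S S' transpose_bounds; assumption)
  show "qg_property_T C F Irr \<longleftrightarrow> alg_property_T C F Irr"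
    unfolding qg_property_T_def alg_property_T_def by (rule tr(3); rule S S' transpose_bounds; assumption)
qed

end

theorem proposition5p41:
  fixes C :: "('o, 'm::complex_vector) tensor_category"
    and F :: "('o, 'm, 'h::complex_vector) fibre_functor"
    and Irr :: "'o set"
  assumes "discrete_quantum_group C F Irr"
  shows "(qg_amenable C F Irr \<longleftrightarrow> alg_amenable C F Irr) \<and>
         (qg_haagerup C F Irr \<longleftrightarrow> alg_haagerup C F Irr) \<and>
         (qg_property_T C F Irr \<longleftrightarrow> alg_property_T C F Irr)"
  using discrete_quantum_group.approximation_properties_iff[OF assms] by blast

end
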